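(* Let $s<-1$, let $f$ be a given function on $\mathbb{R}^2$, and let $(\Omega_R)_{R>0}$ be a one-parameter family of sets of the form $\Omega_R=\{(x,z)\in\mathbb{R}^2 : d(x,z)\le R\}$, where $d:\mathbb{R}^2\to\mathbb{R}$ is a convex and coercive function (so that the sets $\partial\Omega_R$ are level sets of $d$). Then there is at most one solution $u\in L^{2,s}(\mathbb{R}^2)$ of $$\Delta u + k^2 n(x)^2 u = f \quad\text{in } \mathbb{R}^2$$ that satisfies the radiation condition $$\sum_{l=0}^{M}\int_0^\infty\int_{\partial\Omega_R}\Big|\frac{\partial u_l}{\partial\nu}-i\beta_l u_l\Big|^2 d\ell\,dR<+\infty ,$$ where, for $l=1,\dots,M$, $$u_l(x,z)=e(x,\gamma_l)\,U(z,\gamma_l),\qquad U(z,\gamma_l)=\int_{-\infty}^{\infty}u(\xi,z)\,e(\xi,\gamma_l)\,d\xi,$$ and $u_0=u-\sum_{l=1}^M u_l$.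
   Context: Points of $\mathbb{R}^2$ are written $(x,z)$. Constants: $k>0$ (wavenumber), $h>0$, $n_{cl}>0$. The index of refraction is $n(x)=n_{co}(x)$ for $|x|\le h$ and $n(x)=n_{cl}$ for $|x|>h$, where $n_{co}$ is a bounded positive even function. Set $n_*=\max_{\mathbb{R}} n$, $d^2=k^2(n_*^2-n_{cl}^2)$ (this constant $d$ is unrelated to the function $d(x,z)$ defining $\Omega_R$), and $q(x)=k^2[n_*^2-n(x)^2]$. Guided modes: for $j\in\{s,a\}$ let $\phi_j(x,\lambda)$ be the solution of $v''+[\lambda-q(x)]v=0$ on $[-h,h]$ with $\phi_s(0,\lambda)=1,\ \phi_s'(0,\lambda)=0$ and $\phi_a(0,\lambda)=0,\ \phi_a'(0,\lambda)=\sqrt{\lambda}$ (prime $=d/dx$). Let $\lambda_m^j$, $m=1,\dots,M_j$, be the (finitely many) roots $\lambda\in(0,d^2)$ of $\sqrt{d^2-\lambda}\,\phi_j(h,\lambda)+\phi_j'(h,\lambda)=0$. For $\lambda=\lambda_m^j$ let $v_j(x,\lambda)$ equal $\phi_j(x,\lambda)$ for $|x|\le h$, $\phi_j(h,\lambda)e^{-\sqrt{d^2-\lambda}(x-h)}$ for $x>h$, and $\phi_j(-h,\lambda)e^{\sqrt{d^2-\lambda}(x+h)}$ for $x<-h$; this solves $v''+[\lambda-q]v=0$ on $\mathbb{R}$. Let $M=M_s+M_a$, let $\gamma_1,\dots,\gamma_M$ be all the $\lambda_m^j$ in increasing order, and set $e(x,\gamma_l)=v_j(x,\gamma_l)/\|v_j(\cdot,\gamma_l)\|_{L^2(\mathbb{R})}$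 for the corresponding $j$. Put $\beta_0=kn_{cl}$ and $\beta_l=\sqrt{k^2n_*^2-\gamma_l}$ for $l=1,\dots,M$. If $M=0$ there are no guided components and $u_0=u$. $L^{2,s}(\mathbb{R}^2)$ is the space of complex-valued measurable $u$ with $\int_{\mathbb{R}^2}|u|^2(1+x^2+z^2)^s\,dx\,dz<\infty$. $\nu$ is the outward unit normal to $\partial\Omega_R$ and $d\ell$ is arc length. Solutions are understood in the weak sense, with enough local regularity that the normal derivatives on $\partial\Omega_R$ make sense. *)

theory Defs
  imports "HOL-Analysis.Analysis"
begin

section \<open>Weighted and local function spaces on the plane\<close>

definition L2_weighted :: "real \<Rightarrow> (real \<times> real \<Rightarrow> complex) set" where
  "L2_weighted s = {u. u \<in> borel_measurable lebesgue \<and>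
     (\<integral>\<^sup>+ p. ennreal ((cmod (u p))\<^sup>2 * (1 + (fst p)\<^sup>2 + (snd p)\<^sup>2) powr s) \<partial>lebesgue) < \<infinity>}"

definition L1_loc :: "(real \<times> real \<Rightarrow> 'a::euclidean_space) \<Rightarrow> bool" where
  "L1_loc f \<longleftrightarrow> (\<forall>K. compact K \<longrightarrow> set_integrable lebesgue K f)"

definition L2_loc :: "(real \<times> real \<Rightarrow> 'a::euclidean_space) \<Rightarrow> bool" where
  "L2_loc f \<longleftrightarrow> f \<in> borel_measurable lebesgue \<and>
     (\<forall>K. compact K \<longrightarrow> set_integrable lebesgue K (\<lambda>p. (norm (f p))\<^sup>2))"

text \<open>\<open>\<phi>\<close> is a compactly supported \<open>C\<^sup>1\<close> function with gradient \<open>D\<close>.  For locally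
  integrable data, testing with \<open>C\<^sup>1\<close> or with \<open>C\<^sup>\<infinity>\<close> functions of compact support is the
  same, by mollification.\<close>

definition test_function ::
    "(real \<times> real \<Rightarrow> real) \<Rightarrow> (real \<times> real \<Rightarrow> real \<times> real) \<Rightarrow> bool" where
  "test_function \<phi> D \<longleftrightarrow>
     (\<forall>p. (\<phi> has_derivative (\<lambda>v. D p \<bullet> v)) (at p)) \<and>
     continuous_on UNIV D \<and> bounded {p. \<phi> p \<noteq> 0}"

text \<open>Gradients of complex-valued functions are pairs of complex numbers;
  this is the bilinear product of such a gradient with a real vector.\<close>

definition dot :: "real \<times> real \<Rightarrow> complex \<times> complex \<Rightarrow> complex" where
  "dot v g = of_real (fst v) * fst g + of_real (snd v) * snd g"

text \<open>\<open>w \<in> H\<^sup>1\<^sub>l\<^sub>o\<^sub>c\<close>, and \<open>G\<close> represents its weak gradient.\<close>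

definition H1_loc_gradient ::
    "(real \<times> real \<Rightarrow> complex) \<Rightarrow> (real \<times> real \<Rightarrow> complex \<times> complex) \<Rightarrow> bool" where
  "H1_loc_gradient w G \<longleftrightarrow> L2_loc w \<and> L2_loc G \<and>
     (\<forall>\<phi> D. test_function \<phi> D \<longrightarrow>
        (LINT p|lebesgue. w p * of_real (fst (D p))) = - (LINT p|lebesgue. fst (G p) * of_real (\<phi> p)) \<and>
        (LINT p|lebesgue. w p * of_real (snd (D p))) = - (LINT p|lebesgue. snd (G p) * of_real (\<phi> p)))"


section \<open>Level sets, normals, arc length\<close>

definition sublevel :: "(real \<times> real \<Rightarrow> real) \<Rightarrow> real \<Rightarrow> (real \<times> real) set" where
  "sublevel d R = {p. d p \<le> R}"

text \<open>For a convex body \<open>K\<close>, the outward unit normal at a boundary point is the unit vector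
  whose supporting half-plane contains \<open>K\<close>; it is unique at all boundary points outside a
  countable set of corners.\<close>

definition outward_unit_normal :: "(real \<times> real) set \<Rightarrow> real \<times> real \<Rightarrow> real \<times> real" where
  "outward_unit_normal K p = (THE \<nu>. norm \<nu> = 1 \<and> (\<forall>y\<in>K. \<nu> \<bullet> (y - p) \<le> 0))"

definition lipschitz_loops :: "(real \<times> real) set \<Rightarrow> (real \<Rightarrow> real \<times> real) set" where
  "lipschitz_loops C = {\<gamma>. simple_path \<gamma> \<and> pathfinish \<gamma> = pathstart \<gamma> \<and> path_image \<gamma> = C \<and>
     (\<exists>L. L-lipschitz_on {0..1} \<gamma>)}"

text \<open>The integral of \<open>g \<ge> 0\<close> with respect to arc length over a Lipschitz closed curve \<open>C\<close> is
  \<open>\<integral> g(\<gamma>(t)) |\<gamma>'(t)| dt\<close> for any Lipschitz parametrization \<open>\<gamma>\<close> of \<open>C\<close> that is injective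
  up to the common endpoint.  The value does not depend on \<open>\<gamma>\<close>, so the supremum below is just
  this common value.  The boundary of a compact convex set with nonempty interior always has
  such a parametrization; for a convex coercive \<open>d\<close> this covers every \<open>R > min d\<close>,
  and for \<open>R < min d\<close> the boundary is empty.\<close>

definition arclength_integral :: "(real \<times> real) set \<Rightarrow> (real \<times> real \<Rightarrow> ennreal) \<Rightarrow> ennreal" where
  "arclength_integral C g = (SUP \<gamma>\<in>lipschitz_loops C.
     \<integral>\<^sup>+ t\<in>{0..1}. g (\<gamma> t) * ennreal (norm (vector_derivative \<gamma> (at t within {0..1}))) \<partial>lebesgue)"


section \<open>The waveguide and its guided modes\<close>

datatype parity = Symmetric | Antisymmetric

locale waveguide =
  fixes k h n_cl :: real and n_co :: "real \<Rightarrow> real"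
  assumes k_pos: "0 < k"
    and h_pos: "0 < h"
    and n_cl_pos: "0 < n_cl"
    and n_co_measurable: "n_co \<in> borel_measurable (lebesgue_on {-h..h})"
    and n_co_bounded: "bounded (n_co ` {-h..h})"
    and n_co_pos: "\<And>x. \<bar>x\<bar> \<le> h \<Longrightarrow> 0 < n_co x"
    and n_co_even: "\<And>x. \<bar>x\<bar> \<le> h \<Longrightarrow> n_co (- x) = n_co x"
begin

definition n :: "real \<Rightarrow> real" where
  "n x = (if \<bar>x\<bar> \<le> h then n_co x else n_cl)"

text \<open>The least upper bound of \<open>n\<close>; it is the maximum whenever the maximum is attained.\<close>

definition n_max :: real where
  "n_max = Sup (range n)"

definition d_sq :: real where
  "d_sq = k\<^sup>2 * (n_max\<^sup>2 - n_cl\<^sup>2)"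

definition q :: "real \<Rightarrow> real" where
  "q x = k\<^sup>2 * (n_max\<^sup>2 - (n x)\<^sup>2)"

text \<open>\<open>v'' + (\<mu> - q) v = 0\<close> on \<open>[-h, h]\<close> with \<open>v(0) = a\<close>, \<open>v'(0) = b\<close>, and \<open>v' = v1\<close>.  As \<open>q\<close> is
  only bounded and measurable, the equation is understood in the sense of Caratheodory:
  \<open>v\<close> is \<open>C\<^sup>1\<close> and \<open>v'\<close> is an indefinite integral of \<open>(q - \<mu>) v\<close>.\<close>

definition cauchy_solution ::
    "real \<Rightarrow> real \<Rightarrow> real \<Rightarrow> (real \<Rightarrow> real) \<Rightarrow> (real \<Rightarrow> real) \<Rightarrow> bool" where
  "cauchy_solution \<mu> a b v v1 \<longleftrightarrow>
     v 0 = a \<and> v1 0 = b \<and>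
     (\<forall>x\<in>{-h..h}. (v has_real_derivative v1 x) (at x within {-h..h})) \<and>
     (\<forall>x y. - h \<le> x \<and> x \<le> y \<and> y \<le> h \<longrightarrow>
        ((\<lambda>t. (q t - \<mu>) * v t) has_integral (v1 y - v1 x)) {x..y})"

text \<open>The pair \<open>(\<phi>\<^sub>j(\<cdot>, \<mu>), \<phi>\<^sub>j'(\<cdot>, \<mu>))\<close>.  It exists and is unique on \<open>[-h, h]\<close>; only its
  values there are used.\<close>

definition \<phi>_pair :: "parity \<Rightarrow> real \<Rightarrow> (real \<Rightarrow> real) \<times> (real \<Rightarrow> real)" where
  "\<phi>_pair j \<mu> = (SOME P. case j of
       Symmetric \<Rightarrow> cauchy_solution \<mu> 1 0 (fst P) (snd P)
     | Antisymmetric \<Rightarrow> cauchy_solution \<mu> 0 (sqrt \<mu>) (fst P) (snd P))"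

definition \<phi> :: "parity \<Rightarrow> real \<Rightarrow> real \<Rightarrow> real" where
  "\<phi> j \<mu> x = fst (\<phi>_pair j \<mu>) x"

definition \<phi>' :: "parity \<Rightarrow> real \<Rightarrow> real \<Rightarrow> real" where
  "\<phi>' j \<mu> x = snd (\<phi>_pair j \<mu>) x"

definition roots :: "parity \<Rightarrow> real set" where
  "roots j = {\<mu>. 0 < \<mu> \<and> \<mu> < d_sq \<and> sqrt (d_sq - \<mu>) * \<phi> j \<mu> h + \<phi>' j \<mu> h = 0}"

definition v :: "parity \<Rightarrow> real \<Rightarrow> real \<Rightarrow> real" where
  "v j \<mu> x =
     (if \<bar>x\<bar> \<le> h then \<phi> j \<mu> x
      else if x > h then \<phi> j \<mu> h * exp (- sqrt (d_sq - \<mu>) * (x - h))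
      else \<phi> j \<mu> (- h) * exp (sqrt (d_sq - \<mu>) * (x + h)))"

definition M :: nat where
  "M = card (roots Symmetric) + card (roots Antisymmetric)"

text \<open>\<open>\<gamma> l\<close> is meaningful for \<open>1 \<le> l \<le> M\<close>.  The two root sets are finite, and they are disjoint
  because eigenvalues of the one-dimensional problem on the line are simple.\<close>

definition \<gamma> :: "nat \<Rightarrow> real" where
  "\<gamma> l = sort (sorted_list_of_set (roots Symmetric) @ sorted_list_of_set (roots Antisymmetric))
           ! (l - 1)"

definition mode_parity :: "nat \<Rightarrow> parity" where
  "mode_parity l = (if \<gamma> l \<in> roots Symmetric then Symmetric else Antisymmetric)"

definition e :: "nat \<Rightarrow> real \<Rightarrow> real" where
  "e l x = v (mode_parity l) (\<gamma> l) x /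
     sqrt (LINT \<xi>|lebesgue. (v (mode_parity l) (\<gamma> l) \<xi>)\<^sup>2)"

definition \<beta> :: "nat \<Rightarrow> real" where
  "\<beta> l = (if l = 0 then k * n_cl else sqrt (k\<^sup>2 * n_max\<^sup>2 - \<gamma> l))"


section \<open>The Helmholtz equation and the radiation condition\<close>

definition weak_solution ::
    "(real \<times> real \<Rightarrow> complex) \<Rightarrow> (real \<times> real \<Rightarrow> complex) \<Rightarrow> bool" where
  "weak_solution f u \<longleftrightarrow> L1_loc f \<and>
     (\<exists>G. H1_loc_gradient u G \<and>
       (\<forall>\<psi> D. test_function \<psi> D \<longrightarrow>
          - (LINT p|lebesgue. dot (D p) (G p))
          + (LINT p|lebesgue. of_real (k\<^sup>2 * (n (fst p))\<^sup>2) * u p * of_real (\<psi> p))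
          = (LINT p|lebesgue. f p * of_real (\<psi> p))))"

definition U :: "(real \<times> real \<Rightarrow> complex) \<Rightarrow> nat \<Rightarrow> real \<Rightarrow> complex" where
  "U u l z = (LINT \<xi>|lebesgue. u (\<xi>, z) * of_real (e l \<xi>))"

definition component :: "(real \<times> real \<Rightarrow> complex) \<Rightarrow> nat \<Rightarrow> real \<times> real \<Rightarrow> complex" where
  "component u l p =
     (if l = 0 then u p - (\<Sum>m = 1..M. of_real (e m (fst p)) * U u m (snd p))
      else of_real (e l (fst p)) * U u l (snd p))"

text \<open>The normal derivative of the component \<open>u\<^sub>l\<close> is formed with (a representative \<open>G l\<close> of) its
  weak gradient.  By the coarea formula a Lebesgue null set of the plane meets \<open>\<partial>\<Omega>\<^sub>R\<close> in a set
  of zero length for almost every \<open>R\<close>, so the double integral depends neither on the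
  representative \<open>G l\<close> nor on that of \<open>u\<close>.\<close>

definition radiation_condition ::
    "(real \<times> real \<Rightarrow> real) \<Rightarrow> (real \<times> real \<Rightarrow> complex) \<Rightarrow> bool" where
  "radiation_condition d u \<longleftrightarrow>
     (\<exists>G. (\<forall>l\<le>M. H1_loc_gradient (component u l) (G l)) \<and>
       (\<Sum>l = 0..M. \<integral>\<^sup>+ R\<in>{0<..}.
          arclength_integral (frontier (sublevel d R))
            (\<lambda>p. ennreal ((cmod (dot (outward_unit_normal (sublevel d R) p) (G l p)
                                 - \<i> * of_real (\<beta> l) * component u l p))\<^sup>2))
          \<partial>lebesgue) < \<infinity>)"

end

end

theory Submission
 imports Defs
begin

text \<open>The difference of two solutions solves the homogeneous equation, and so does each of its
  components: for \<open>l \<ge> 1\<close> because \<open>e(\<cdot>, \<gamma>\<^sub>l)\<close> is an eigenfunction in \<open>x\<close>. Expanding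
  \<open>|\<partial>\<^sub>\<nu>P - i\<beta>P|\<^sup>2\<close> for a component \<open>P\<close>, the cross term is the flux of \<open>Im (P\<^sup>* \<nabla>P)\<close>, which vanishes
  through every \<open>\<partial>\<Omega>\<^sub>R\<close> since this field is divergence free. By the coarea formula and because
  \<open>|\<nabla>d|\<close> is bounded below far out, the radiation condition puts every component, hence the whole
  difference, into \<open>L\<^sup>2(\<real>\<^sup>2)\<close>.

  A real solution \<open>a \<in> L\<^sup>2\<close> of \<open>\<Delta>a + V(x)a = 0\<close> vanishes: as \<open>V\<close> does not depend on \<open>z\<close>, the integral of
  \<open>a(x,z) a(x,z-t) P'(2z-t)\<close> does not depend on \<open>t\<close> for compactly supported \<open>P\<close>, and it tends to \<open>0\<close> as
  \<open>t \<rightarrow> \<infinity>\<close>; for \<open>t = 0\<close> this gives \<open>\<integral> a\<^sup>2 P'(2z) = 0\<close>.\<close>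


text \<open>\<open>u\<close> is only locally in H1 and \<open>n\<close> only bounded and measurable,
  so second derivatives stay on the test functions (\<open>vweak\<close>). An identity that formally
  multiplies the equation by a rough function comes from a mollifier in a second copy of the plane.
  For the autocorrelation, the equations for a(p) and a(q) are tested with one kernel in x - x', z +
  z', z - z' and subtracted; the potentials leave V(x) - V(x'), which is harmless as x' tends to x
  because multiplication by V keeps L2. Nothing makes the level curves of the convex
  \<open>d\<close> smooth: \<open>d\<close> is differentiable almost everywhere, its level curves
  are parametrised by the angle seen from a minimum point, and the coarea formula enters as an
  inequality that bounds an area integral by the integral over level curves. The flux is not
  evaluated on single curves; it is averaged over the levels with a Lipschitz cut-off of
  \<open>d\<close>. The radiation condition is quadratic and holds for \<open>u\<close> and
  \<open>w\<close> separately, so a difference inherits it up to a factor 2. The equation for the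
  component with index 0 follows by subtracting the guided ones from the difference.\<close>

abbreviation Borel :: "('a::topological_space \<Rightarrow> 'b::topological_space) set" where
 "Borel \<equiv> borel_measurable borel"

abbreviation Borel2 :: "('a::topological_space \<times> 'b::topological_space \<Rightarrow> 'c::topological_space) set" where
 "Borel2 \<equiv> borel_measurable (borel \<Otimes>\<^sub>M borel)"

abbreviation (input) "lborel2 \<equiv> lborel \<Otimes>\<^sub>M lborel"

abbreviation (input) "ind \<equiv> indicator"

abbreviation (input) "integr \<equiv> integrable lborel"

abbreviation (input) nn_lint :: "('a::euclidean_space \<Rightarrow> ennreal) \<Rightarrow> ennreal" (binder "NN " 10) where
 "nn_lint f \<equiv> nn_integral lborel f"

abbreviation (input) tends (infix "---->" 60) where
 "X ----> L \<equiv> (X \<longlonglongrightarrow> L)"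

abbreviation (input) gradient :: "('a::real_inner \<Rightarrow> real) \<Rightarrow> 'a \<Rightarrow> 'a \<Rightarrow> bool" where
 "gradient f g p \<equiv> (f has_derivative (\<lambda>v. g \<bullet> v)) (at p)"

abbreviation (input) scale (infixr "*R" 75) where
 "a *R x \<equiv> scaleR a x"

lemmas lint_cong = Bochner_Integration.integral_cong
 and lint_diff = Bochner_Integration.integral_diff
 and lint_add = Bochner_Integration.integral_add
 and lint_nonneg = Bochner_Integration.integral_nonneg
 and lint_sum = Bochner_Integration.integral_sum
 and integr_bound = Bochner_Integration.integrable_bound
 and integr_add = Bochner_Integration.integrable_add
 and integr_diff = Bochner_Integration.integrable_diff

type_synonym plane = "real \<times> real"

section \<open>Square integrable functions and translations\<close>

lemma lborel_shift:
 fixes f :: "'a::euclidean_space => real"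
 assumes [measurable]: "f : Borel"
 shows lint_shift: "(LBINT x. f (x + h)) = (LBINT x. f x)"
  and integr_shift: "integr (%x. f (x + h)) \<longleftrightarrow> integr f"
proof -
 have d: "distr lborel borel ((+) h) = (lborel :: 'a measure)" by (rule lborel_distr_plus)
 have "(LBINT x. f x) = integral\<^sup>L (distr lborel borel ((+) h)) f" by (simp add: d)
 also have "... = (LBINT x. f (h + x))" by (subst integral_distr) auto
 finally show "(LBINT x. f (x + h)) = (LBINT x. f x)" by (simp add: add.commute)
 have "integr f \<longleftrightarrow> integrable (distr lborel borel ((+) h)) f" by (simp add: d)
 also have "... \<longleftrightarrow> integr (%x. f (h + x))" by (subst integrable_distr_eq) auto
 finally show "integr (%x. f (x + h)) \<longleftrightarrow> integr f" by (simp add: add.commute)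
qed

lemma nn_lint_shift:
 fixes f :: "'a::euclidean_space => ennreal"
 assumes [measurable]: "f : Borel"
 shows "(NN x. f (x + h)) = (NN x. f x)"
proof -
 have "(NN x. f x) = integral\<^sup>N (distr lborel borel ((+) h)) f" by (simp add: lborel_distr_plus)
 also have "... = (NN x. f (h + x))" by (subst nn_integral_distr) auto
 finally show ?thesis by (simp add: add.commute)
qed

text \<open>A splitting through \<open>g\<close>: the error \<open>f - g\<close> occurs once shifted
  and once unshifted, with equal integrals by translation invariance, hence the factor 2.\<close>

lemma L1_modulus_approx:
 fixes f g :: "'a::euclidean_space => real"
 assumes "integr f" "integr g"
 shows "(LBINT x. abs (f (x + h) - f x)) <= 2 * (LBINT x. abs (f x - g x)) + (LBINT x. abs (g (x + h) - g x))"
proof -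
 have fh: "integr (%x. f (x + h))" "integr (%x. g (x + h))" using assms integr_shift[of f h] integr_shift[of g h]
   borel_measurable_integrable[OF assms(1)] borel_measurable_integrable[OF assms(2)] by auto
 have "(LBINT x. abs (f (x + h) - f x)) <=
  (LBINT x. abs (f (x + h) - g (x + h)) + abs (g (x + h) - g x) + abs (f x - g x))" by (rule integral_mono) (use fh assms in auto)
 also have "... = (LBINT x. abs (f (x + h) - g (x + h))) + (LBINT x. abs (g (x + h) - g x)) + (LBINT x. abs (f x - g x))" using fh assms by simp
 also have "(LBINT x. abs (f (x + h) - g (x + h))) = (LBINT x. abs (f x - g x))" using lint_shift[of "%x. abs (f x - g x)" h] assms[THEN borel_measurable_integrable] by simp
 finally show ?thesis by simp
qed

text \<open>The limit step of \<open>integrable_induct\<close>, whose domination by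
  \<open>2 * abs (f x)\<close> turns pointwise convergence into L1 convergence; a single
  \<open>s i\<close> close to \<open>f\<close> then carries the modulus over.\<close>

lemma L1_modulus_lim:
 fixes f :: "'a::euclidean_space => real"
 assumes f: "integr f" and s: "!!i::nat. integr (s i)"
  and lim: "!!x. (%i. s i x) ----> f x"
  and bound: "!!i x. abs (s i x) <= 2 * abs (f x)"
  and good: "!!i. ((%h. LBINT x. abs (s i (x + h) - s i x)) \<longlongrightarrow> 0) (at 0)"
 shows "((%h. LBINT x. abs (f (x + h) - f x)) \<longlongrightarrow> 0) (at 0)"
proof (rule tendstoI)
 fix e :: real assume "e > 0"
 have [measurable]: "f : Borel" "!!i. s i : Borel" using f[THEN borel_measurable_integrable] s[THEN borel_measurable_integrable] by auto
 have "(%i. LBINT x. abs (f x - s i x)) ----> (LBINT x::'a. 0)" proof (rule integral_dominated_convergence[where w="%x. 3 * abs (f x)"])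
  show "AE x in lborel. (%i. abs (f x - s i x)) ----> 0" using tendsto_rabs_zero[OF LIM_zero_iff[THEN iffD2, OF lim]] by (auto simp: abs_minus_commute)
  show "AE x in lborel. norm (abs (f x - s i x)) <= 3 * abs (f x)" for i using bound[of i] by (intro AE_I2) (smt (verit) real_norm_def)
 qed (use f s in auto)
 then have "eventually (%i. (LBINT x. abs (f x - s i x)) < e/4) sequentially" using \<open>e > 0\<close> by (intro order_tendstoD(2)) auto
 then obtain i where i: "(LBINT x. abs (f x - s i x)) < e/4" by (auto simp: eventually_sequentially)
 have "eventually (%h. (LBINT x. abs (s i (x + h) - s i x)) < e/4) (at 0)" using \<open>e > 0\<close> by (intro order_tendstoD(2)[OF good]) auto
 then show "eventually (%h. dist (LBINT x. abs (f (x + h) - f x)) 0 < e) (at 0)" proof eventually_elim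
  case (elim h)
  have "(LBINT x. abs (f (x + h) - f x)) >= 0" by simp
  then show ?case using L1_modulus_approx[OF f s[of i], of h] i elim \<open>e > 0\<close> unfolding dist_real_def by linarith
 qed
qed

text \<open>The absolute difference of the two indicators is twice its positive part minus the
  difference itself, and the difference integrates to 0 by translation invariance. So only points
  outside \<open>K\<close> count, and there the shifted indicator vanishes eventually because the
  complement of \<open>K\<close> is open.\<close>

lemma L1_modulus_compact:
 fixes K :: "'a::euclidean_space set"
 assumes K: "compact K"
 shows "((%h. LBINT x. abs (ind K (x + h) - ind K x :: real)) \<longlongrightarrow> 0) (at 0)" unfolding tendsto_at_iff_sequentially comp_def
proof safe
 fix X :: "nat => 'a" assume X0: "ALL i. X i : UNIV - {0}" and X: "X ----> 0"
 have [measurable]: "K : sets borel" using K by (simp add: borel_compact)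
 obtain B where B: "!!x. x : K ==> norm x <= B" using compact_imp_bounded[OF K] bounded_iff by blast
 obtain D where D: "!!i. norm (X i) <= D" using convergent_imp_Bseq[OF convergentI[OF X]] unfolding Bseq_def by blast
 have iK: "integr (ind K :: 'a => real)" using emeasure_compact_finite[OF K] by (simp add: integrable_indicator_iff)
 have iKh: "integr (%x. ind K (x + h) :: real)" for h using iK by (subst integr_shift) auto
 have "(%i. LBINT x. ind (-K) x * ind K (x + X i) :: real) ----> (LBINT x::'a. 0)" proof (rule integral_dominated_convergence[where w="ind (cball 0 (B + D))"])
  show "AE x in lborel. (%i. ind (- K) x * ind K (x + X i) :: real) ----> 0" proof (intro AE_I2)
   fix x
   show "(%i. ind (- K) x * ind K (x + X i) :: real) ----> 0" proof (cases "x : K")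
    case False
    have "(%i. x + X i) ----> x + 0" by (intro tendsto_intros X)
    then have "eventually (%i. x + X i : - K) sequentially" using False compact_imp_closed[OF K] by (intro topological_tendstoD) (auto simp: open_Compl)
    then have "eventually (%i. ind (- K) x * ind K (x + X i) = (0::real)) sequentially" by eventually_elim auto
    then show ?thesis by (rule tendsto_eventually)
   qed simp
  qed
  show "AE x in lborel. norm (ind (- K) x * ind K (x + X i) :: real) <= ind (cball 0 (B + D)) x" for i proof (intro AE_I2)
   fix x
   have "norm x <= B + D" if "x + X i : K" using B[OF that] D[of i] norm_triangle_ineq4[of "x + X i" "X i"] by simp
   then show "norm (ind (- K) x * ind K (x + X i) :: real) <= ind (cball 0 (B + D)) x" by (auto simp: indicator_def)
  qed
  show "integr (ind (cball 0 (B + D)) :: 'a => real)" using emeasure_bounded_finite[of "cball 0 (B + D) :: 'a set"] by (simp add: integrable_indicator_iff)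
 qed auto
 then have "(%i. 2 * (LBINT x. ind (-K) x * ind K (x + X i) :: real)) ----> 2 * 0" by (intro tendsto_intros) simp
 moreover have "(LBINT x. abs (ind K (x + h) - ind K x :: real))
   = 2 * (LBINT x. ind (-K) x * ind K (x + h) :: real)" for h proof -
  have i2: "integr (%x. ind (-K) x * ind K (x + h) :: real)" by (rule integr_bound[OF iKh[of h]]) (auto simp: indicator_def)
  have "(LBINT x. abs (ind K (x + h) - ind K x :: real))
   = (LBINT x. 2 * (ind (-K) x * ind K (x + h)) - (ind K (x + h) - ind K x) :: real)" by (rule lint_cong) (auto simp: indicator_def)
  also have "... = 2 * (LBINT x. ind (-K) x * ind K (x + h) :: real) -
    ((LBINT x. ind K (x + h)) - (LBINT x. ind K x))" using i2 iK iKh by simp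
  also have "(LBINT x. ind K (x + h)) = (LBINT x. (ind K x :: real))" by (rule lint_shift) auto
  finally show ?thesis by simp
 qed
 ultimately show "(%i. LBINT x. abs (ind K (x + X i) - ind K x :: real)) ----> 0" by simp
qed

lemma L1_modulus_of_dense:
 fixes f :: "'a::euclidean_space => real"
 assumes f: "integr f"
  and ap: "!!e. e > 0 ==> EX g. integr g & (LBINT x. abs (f x - g x)) < e &
    ((%h. LBINT x. abs (g (x + h) - g x)) \<longlongrightarrow> 0) (at 0)"
 shows "((%h. LBINT x. abs (f (x + h) - f x)) \<longlongrightarrow> 0) (at 0)"
proof (rule tendstoI)
 fix e :: real assume "e > 0"
 then obtain g where g: "integr g" "(LBINT x. abs (f x - g x)) < e / 4"
   "((%h. LBINT x. abs (g (x + h) - g x)) \<longlongrightarrow> 0) (at 0)" using ap[of "e/4"] by auto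
 have "eventually (%h. (LBINT x. abs (g (x + h) - g x)) < e/4) (at 0)" using \<open>e > 0\<close> by (intro order_tendstoD(2)[OF g(3)]) auto
 then show "eventually (%h. dist (LBINT x. abs (f (x + h) - f x)) 0 < e) (at 0)" proof eventually_elim
  case (elim h)
  have "(LBINT x. abs (f (x + h) - f x)) >= 0" by simp
  then show ?case using L1_modulus_approx[OF f g(1), of h] g(2) elim \<open>e > 0\<close> unfolding dist_real_def by linarith
 qed
qed

lemma L1_modulus_bounded_set:
 fixes A :: "'a::euclidean_space set"
 assumes A: "A : sets borel" "bounded A"
 shows "((%h. LBINT x. abs (ind A (x + h) - ind A x :: real)) \<longlongrightarrow> 0) (at 0)"
proof (rule L1_modulus_of_dense)
 have finA: "emeasure lborel A < \<infinity>" using emeasure_bounded_finite[OF A(2)] .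
 then show iA: "integr (ind A :: 'a => real)" using A by (simp add: integrable_indicator_iff)
 fix e :: real assume "e > 0"
 have "A : sets lebesgue" using A by simp
 from sets_lebesgue_inner_closed[OF this \<open>e > 0\<close>]
 obtain T where T: "closed T" "T \<subseteq> A" "A - T : lmeasurable" "emeasure lebesgue (A - T) < ennreal e" by blast
 have cT: "compact T" using T A(2) bounded_subset compact_eq_bounded_closed by blast
 have mT: "T : sets borel" using T(1) by simp
 have iT: "integr (ind T :: 'a => real)" using emeasure_compact_finite[OF cT] mT by (simp add: integrable_indicator_iff)
 have "(LBINT x. abs (ind A x - ind T x :: real)) = (LBINT x. ind (A - T) x)" by (rule lint_cong) (use T in \<open>auto simp: indicator_def\<close>)
 also have "... = measure lborel (A - T)" using A mT by simp
 also have "... < e" proof -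
  have "emeasure lborel (A - T) < ennreal e" using T(4) A mT by (simp add: emeasure_completion)
  then show ?thesis using \<open>e > 0\<close> unfolding measure_def by (metis enn2real_less_iff ennreal_less_top order_less_trans less_eq_real_def)
 qed
 finally show "EX g. integr g & (LBINT x. abs (ind A x - g x :: real)) < e &
    ((%h. LBINT x. abs (g (x + h) - g x)) \<longlongrightarrow> 0) (at 0)" using iT L1_modulus_compact[OF cT] by blast
qed

text \<open>Density in stages: compact sets, bounded Borel sets (inner regularity), Borel sets of
  finite measure (truncation by balls), integrable functions.\<close>

lemma L1_modulus:
 fixes f :: "'a::euclidean_space => real"
 assumes "integr f"
 shows "((%h. LBINT x. abs (f (x + h) - f x)) \<longlongrightarrow> 0) (at 0)" using assms
proof (induct f rule: integrable_induct)
 case (base A c)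
 have mA[measurable]: "A : sets borel" using base by simp
 have iA: "integr (ind A :: 'a => real)" using base by (simp add: integrable_indicator_iff)
 have "((%h. LBINT x. abs (ind A (x + h) - ind A x :: real)) \<longlongrightarrow> 0) (at 0)" proof (rule L1_modulus_lim[where s="%i. ind (A \<inter> cball 0 (real i))"])
  show "integr (ind (A \<inter> cball 0 (real i)) :: 'a => real)" for i by (rule integr_bound[OF iA])
    (use mA in \<open>auto simp: indicator_def intro!: borel_measurable_indicator\<close>)
  show "(%i. ind (A \<inter> cball 0 (real i)) x :: real) ----> ind A x" for x proof (rule tendsto_eventually)
   obtain n where "norm x <= real n" using real_arch_simple by blast
   then show "\<forall>\<^sub>F i in sequentially. ind (A \<inter> cball 0 (real i)) x = (ind A x :: real)" by (intro eventually_sequentiallyI[of n]) (auto simp: indicator_def)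
  qed
  show "((%h. LBINT x. abs (ind (A \<inter> cball 0 (real i)) (x + h) - ind (A \<inter> cball 0 (real i)) x :: real)) \<longlongrightarrow> 0) (at 0)" for i
   by (rule L1_modulus_bounded_set) auto
 qed (use iA in \<open>auto split: split_indicator\<close>)
 then have "((%h. abs c * (LBINT x. abs (ind A (x + h) - ind A x :: real))) \<longlongrightarrow> abs c * 0) (at 0)" by (intro tendsto_intros)
 moreover have "(LBINT x. abs (ind A (x + h) *R c - ind A x *R c))
   = abs c * (LBINT x. abs (ind A (x + h) - ind A x :: real))" for h unfolding integral_mult_right_zero[symmetric]
  by (rule lint_cong) (simp_all only: real_scaleR_def abs_mult[symmetric] right_diff_distrib mult.commute[of c])
 ultimately show ?case by simp
next
 case (add f g)
 have [measurable]: "f : Borel" "g : Borel" using add(1,3) by (auto dest: borel_measurable_integrable)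
 have sh: "integr (%x. f (x + h))" "integr (%x. g (x + h))" for h using add by (auto simp: integr_shift)
 show ?case proof (rule tendsto_sandwich[OF _ _ tendsto_const])
  show "((%h. (LBINT x. abs (f (x + h) - f x)) + (LBINT x. abs (g (x + h) - g x))) \<longlongrightarrow> 0) (at 0)" using tendsto_add[OF add(2,4)] by simp
  show "\<forall>\<^sub>F h in at 0. (LBINT x. abs ((f (x + h) + g (x + h)) - (f x + g x))) <=
    (LBINT x. abs (f (x + h) - f x)) + (LBINT x. abs (g (x + h) - g x))" proof (intro always_eventually allI)
   fix h
   have "(LBINT x. abs ((f (x + h) + g (x + h)) - (f x + g x))) <=
     (LBINT x. abs (f (x + h) - f x) + abs (g (x + h) - g x))" by (rule integral_mono) (use sh add in auto)
   also have "... = (LBINT x. abs (f (x + h) - f x)) + (LBINT x. abs (g (x + h) - g x))" using sh add by simp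
   finally show "(LBINT x. abs ((f (x + h) + g (x + h)) - (f x + g x))) <=
    (LBINT x. abs (f (x + h) - f x)) + (LBINT x. abs (g (x + h) - g x))" .
  qed
 qed auto
next
 case (lim f s)
 show ?case by (rule L1_modulus_lim[of f s]) (use lim in \<open>auto\<close>)
qed

text \<open>Borel rather than Lebesgue measurable: shifts, products and kernels in two variables
  then remain measurable on \<open>lborel2\<close>, where Fubini is applied. Complex Lebesgue data
  are replaced by Borel versions of their real and imaginary parts.\<close>

definition L2 :: "('a::euclidean_space => real) => bool" where
 "L2 f \<longleftrightarrow> f : Borel & integr (%x. (f x)^2)"

lemma L2_measurable [measurable_dest]: "L2 f ==> f : Borel" by (simp add: L2_def)

lemma L2_shift: "L2 f ==> L2 (%x. f (x + h))" using integr_shift[of "%x. (f x)^2" h] by (auto simp: L2_def)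

lemma L2_shift_minus: "L2 f ==> L2 (%x. f (x - h))" using L2_shift[of f "-h"] by simp

lemma L2_mult_bounded:
 assumes "L2 f" and [measurable]: "g : Borel" and "!!x. abs (g x) <= B"
 shows "L2 (%x. g x * f x)"
proof -
 have [measurable]: "f : Borel" using assms by (simp add: L2_def)
 have b: "(g x * f x)^2 <= B^2 * (f x)^2" for x unfolding power_mult_distrib using assms(3)[of x] abs_le_square_iff[of "g x" B] by (intro mult_right_mono) auto
 have "integr (%x. (g x * f x)^2)" proof (rule integr_bound[of _ "%x. B^2 * (f x)^2"])
  show "AE x in lborel. norm ((g x * f x)^2) <= norm (B^2 * (f x)^2)" using b by simp
 qed (use assms in \<open>auto simp: L2_def\<close>)
 then show ?thesis by (simp add: L2_def)
qed

lemma L2_add: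
 assumes "L2 f" "L2 g" shows "L2 (%x. f x + g x)"
proof -
 have [measurable]: "f : Borel" "g : Borel" using assms by (auto simp: L2_def)
 have "integr (%x. (f x + g x)^2)" proof (rule integr_bound[of _ "%x. 2 * (f x)^2 + 2 * (g x)^2"])
  show "AE x in lborel. norm ((f x + g x)^2) <= norm (2 * (f x)^2 + 2 * (g x)^2)" proof (intro AE_I2)
   fix x
   have "(f x + g x)^2 <= 2 * (f x)^2 + 2 * (g x)^2" using sum_squares_bound[of "f x" "g x"] by (simp add: power2_sum)
   then show "norm ((f x + g x)^2) <= norm (2 * (f x)^2 + 2 * (g x)^2)" unfolding real_norm_def abs_power2 by (rule order_trans[OF _ abs_ge_self])
  qed
 qed (use assms in \<open>auto simp: L2_def\<close>)
 then show ?thesis by (simp add: L2_def)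
qed

lemma L2_diff: "L2 f ==> L2 g ==> L2 (%x. f x - g x)" using L2_add[of f "%x. - g x"] by (simp add: L2_def)

lemma L2_mult_integr:
 assumes "L2 f" "L2 g" shows "integr (%x. f x * g x)"
proof -
 have [measurable]: "f : Borel" "g : Borel" using assms by (auto simp: L2_def)
 show ?thesis proof (rule integr_bound[of _ "%x. (f x)^2 + (g x)^2"])
  have "abs (f x * g x) <= (f x)^2 + (g x)^2" for x proof -
   have "2 * (abs (f x) * abs (g x)) <= (f x)^2 + (g x)^2" using sum_squares_bound[of "abs (f x)" "abs (g x)"] by simp
   moreover have "0 <= abs (f x) * abs (g x)" by simp
   ultimately show ?thesis unfolding abs_mult by linarith
  qed
  then show "AE x in lborel. norm (f x * g x) <= norm ((f x)^2 + (g x)^2)" by (simp add: order_trans[OF _ abs_ge_self])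
 qed (use assms in \<open>auto simp: L2_def\<close>)
qed

text \<open>The integral of \<open>(t * f x + g x)^2\<close> is a nonnegative quadratic polynomial
  in \<open>t\<close>. It is evaluated at its minimum \<open>- ?I / ?F\<close> or, if
  \<open>?F = 0\<close>, at the point where the remaining affine function would equal -1.\<close>

lemma L2_Cauchy_Schwarz:
 assumes "L2 f" "L2 g"
 shows "abs (LBINT x. f x * g x) <= sqrt (LBINT x. (f x)^2) * sqrt (LBINT x. (g x)^2)"
proof -
 let ?F = "LBINT x. (f x)^2" and ?G = "LBINT x. (g x)^2" and ?I = "LBINT x. f x * g x"
 have i: "integr (%x. (f x)^2)" "integr (%x. (g x)^2)" "integr (%x. f x * g x)" using assms L2_mult_integr by (auto simp: L2_def)
 have q: "0 <= t^2 * ?F + 2 * t * ?I + ?G" for t proof -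
  have "0 <= (LBINT x. (t * f x + g x)^2)" by simp
  also have "... = (LBINT x. t^2 * (f x)^2 + 2 * t * (f x * g x) + (g x)^2)" by (simp add: power2_sum power_mult_distrib algebra_simps)
  also have "... = t^2 * ?F + 2 * t * ?I + ?G" using i by simp
  finally show ?thesis .
 qed
 have FG: "?F >= 0" "?G >= 0" by simp_all
 have "?I^2 <= ?F * ?G" proof (cases "?F = 0")
  case True
  have "?I = 0" proof (rule ccontr)
   assume "?I ~= 0"
   then have "2 * (- (?G + 1) / (2 * ?I)) * ?I = - (?G + 1)" by (simp add: field_simps)
   then show False using q[of "- (?G + 1) / (2 * ?I)"] True by simp
  qed
  then show ?thesis using True by simp
 next
  case False
  then have "?F > 0" using FG by linarith
  have "0 <= (-?I/?F)^2 * ?F + 2 * (-?I/?F) * ?I + ?G" by (rule q)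
  also have "... = ?G - ?I^2 / ?F" using \<open>?F > 0\<close> by (simp add: field_simps power2_eq_square)
  finally show ?thesis using \<open>?F > 0\<close> by (simp add: field_simps)
 qed
 then have "sqrt (?I^2) <= sqrt (?F * ?G)" by (rule real_sqrt_le_mono)
 then show ?thesis by (simp add: real_sqrt_mult)
qed

text \<open>The signed square \<open>a * abs a\<close> maps L2 to L1, and this inequality brings the
  L1 modulus of continuity of the signed square back to an L2 modulus of the function. The factor 2
  pays for arguments of opposite sign.\<close>

lemma power2_diff_le_signed_squares: "(a - b)^2 <= 2 * abs (a * abs a - b * abs b)" for a b :: real
proof -
 have pos: "(a - b)^2 <= 2 * abs (a * abs a - b * abs b)" if "0 <= b" "b <= a" for a b :: real proof -
  have "(a - b) * (a - b) <= (a - b) * (a + b)" using that by (intro mult_left_mono) auto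
  then have "(a - b)^2 <= a^2 - b^2" by (simp add: power2_eq_square algebra_simps)
  moreover have "a * abs a - b * abs b = a^2 - b^2" using that by (simp add: power2_eq_square)
  ultimately show ?thesis by (metis abs_ge_self abs_ge_zero mult_2 order_trans le_add_same_cancel1)
 qed
 have opp: "(a - b)^2 <= 2 * abs (a * abs a - b * abs b)" if "0 <= a" "b <= 0" for a b :: real proof -
  have e: "a * abs a - b * abs b = a^2 + b^2" using that by (simp add: power2_eq_square)
  show ?thesis unfolding e using sum_squares_bound[of a "-b"] by (simp add: power2_diff)
 qed
 consider "0 <= b" "b <= a" | "0 <= a" "a <= b" | "0 <= a" "b <= 0" | "a <= 0" "0 <= b" |
  "a <= 0" "b <= a" | "b <= 0" "a <= b" by linarith
 then show ?thesis proof cases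
  case 1 then show ?thesis by (rule pos)
 next
  case 2 then show ?thesis using pos[OF 2] unfolding power2_commute[of a b] abs_minus_commute[of "a * abs a"] by simp
 next
  case 3 then show ?thesis by (rule opp)
 next
  case 4 then show ?thesis using opp[OF 4(2,1)] unfolding power2_commute[of a b] abs_minus_commute[of "a * abs a"] by simp
 next
  case 5
  then have "(- b - - a)^2 <= 2 * abs (- b * abs (- b) - - a * abs (- a))" by (intro pos) auto
  then show ?thesis by (simp add: abs_minus_commute)
 next
  case 6
  then have "(- a - - b)^2 <= 2 * abs (- a * abs (- a) - - b * abs (- b))" by (intro pos) auto
  then show ?thesis unfolding power2_commute[of a b] abs_minus_commute[of "a * abs a"] by simp
 qed
qed

lemma L2_modulus:
 assumes "L2 f"
 shows "((%h. LBINT x. (f (x + h) - f x)^2) \<longlongrightarrow> 0) (at 0)"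
proof -
 have [measurable]: "f : Borel" using assms by (simp add: L2_def)
 have i: "integr (%x. f x * abs (f x))" by (rule integr_bound[of _ "%x. (f x)^2"])
   (use assms in \<open>auto simp: L2_def abs_mult power2_eq_square\<close>)
 have sh: "integr (%x. f (x + h) * abs (f (x + h)))" for h using i integr_shift[of "%x. f x * abs (f x)" h] by simp
 have lim: "((%h. 2 * (LBINT x. abs (f (x + h) * abs (f (x + h)) - f x * abs (f x)))) \<longlongrightarrow> 2 * 0) (at 0)" by (intro tendsto_intros) (rule L1_modulus[OF i])
 have le: "(LBINT x. (f (x + h) - f x)^2) <= 2 * (LBINT x. abs (f (x + h) * abs (f (x + h)) - f x * abs (f x)))" for h proof -
  have "(LBINT x. (f (x + h) - f x)^2) <= (LBINT x. 2 * abs (f (x + h) * abs (f (x + h)) - f x * abs (f x)))" proof (rule integral_mono)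
   show "integr (%x. (f (x + h) - f x)^2)" using L2_diff[OF L2_shift[OF assms] assms] by (simp add: L2_def)
  qed (use i sh power2_diff_le_signed_squares in auto)
  then show ?thesis by simp
 qed
 show ?thesis by (rule tendsto_sandwich[OF _ _ tendsto_const lim[simplified mult_zero_right]])
   (simp_all add: le)
qed

text \<open>The change of the weight is handled by dominated convergence with the shift frozen at
  \<open>h0\<close>, the change of the shift by Cauchy-Schwarz and \<open>L2_modulus\<close>. The
  uniform bound \<open>B\<close> lets the weight vary with \<open>h\<close>.\<close>

lemma corr_tendsto:
 fixes f g :: "'a::euclidean_space => real" and W :: "'a => 'a => real"
 assumes f: "L2 f" and g: "L2 g" and W[measurable]: "!!h. W h : Borel"
  and B: "!!h p. abs (W h p) <= B" and lim: "!!p. ((%h. W h p) \<longlongrightarrow> W h0 p) (at h0)"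
 shows "((%h. LBINT p. f p * g (p - h) * W h p) \<longlongrightarrow> (LBINT p. f p * g (p - h0) * W h0 p)) (at h0)" unfolding tendsto_at_iff_sequentially comp_def
proof safe
 fix X :: "nat => 'a" assume X0: "ALL i. X i : UNIV - {h0}" and X: "X ----> h0"
 have [measurable]: "f : Borel" "g : Borel" using f g by (auto simp: L2_def)
 define F where "F = sqrt (LBINT x. (f x)^2)"
 have B0: "B >= 0" using B[of 0 0] by linarith
 have fW: "L2 (%p. W h p * f p)" for h by (rule L2_mult_bounded[OF f _ B]) simp
 have gd: "L2 (%p. g (p - h) - g (p - h0))" for h by (intro L2_diff L2_shift_minus g)
 have int1: "integr (%p. f p * g (p - h) * W h' p)" for h h' using L2_mult_integr[OF fW L2_shift_minus[OF g]] by (simp add: mult_ac)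
 have 1: "(%i. LBINT p. f p * g (p - h0) * W (X i) p) ----> (LBINT p. f p * g (p - h0) * W h0 p)" proof (rule integral_dominated_convergence[where w="%p. B * abs (f p * g (p - h0))"])
  have "(%i. W (X i) p) ----> W h0 p" for p using lim[of p, unfolded tendsto_at_iff_sequentially comp_def, rule_format, of X] X X0 by blast
  then show "AE p in lborel. (%i. f p * g (p - h0) * W (X i) p) ----> f p * g (p - h0) * W h0 p" by (intro AE_I2 tendsto_intros) auto
  show "AE x in lborel. norm (f x * g (x - h0) * W (X i) x) <= B * abs (f x * g (x - h0))" for i
   using mult_left_mono[OF B, of "abs (f _ * g (_ - h0))"] by (intro AE_I2) (simp add: abs_mult mult.commute[of B])
  show "integr (%p. B * abs (f p * g (p - h0)))" using L2_mult_integr[OF f L2_shift_minus[OF g]] by auto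
 qed auto
 have 2: "(%i. LBINT p. f p * (g (p - X i) - g (p - h0)) * W (X i) p) ----> 0" proof (rule tendsto_rabs_zero_cancel, rule tendsto_sandwich[OF _ _ tendsto_const])
  let ?D = "%h. LBINT p. (g (p - h) - g (p - h0))^2"
  have D: "?D h = (LBINT x. (g (x + (h0 - h)) - g x)^2)" for h using lint_shift[of "%x. (g (x + (h0 - h)) - g x)^2" "-h0"] by (simp add: algebra_simps)
  have "(%i. LBINT x. (g (x + (h0 - X i)) - g x)^2) ----> 0" proof -
   have "(%i. h0 - X i) ----> h0 - h0" by (intro tendsto_intros X)
   then have "(%i. h0 - X i) ----> 0" by simp
   moreover have "h0 - X i : UNIV - {0}" for i using X0 by auto
   ultimately show ?thesis by (rule L2_modulus[OF g, unfolded tendsto_at_iff_sequentially comp_def, rule_format, rotated])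
  qed
  then have "(%i. ?D (X i)) ----> 0" unfolding D .
  from tendsto_mult_left[OF tendsto_real_sqrt[OF this], of "B * F"]
  show "(%i. (B * F) * sqrt (?D (X i))) ----> 0" by simp
  show "\<forall>\<^sub>F i in sequentially. abs (LBINT p. f p * (g (p - X i) - g (p - h0)) * W (X i) p) <= (B * F) * sqrt (?D (X i))" proof (intro always_eventually allI)
   fix i
   have "abs (LBINT p. f p * (g (p - X i) - g (p - h0)) * W (X i) p)
     = abs (LBINT p. (W (X i) p * f p) * (g (p - X i) - g (p - h0)))" by (simp add: mult_ac)
   also have "... <= sqrt (LBINT p. (W (X i) p * f p)^2) * sqrt (?D (X i))" by (rule L2_Cauchy_Schwarz[OF fW gd])
   also have "sqrt (LBINT p. (W (X i) p * f p)^2) <= B * F" proof -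
    have "(LBINT p. (W (X i) p * f p)^2) <= (LBINT p. B^2 * (f p)^2)" proof (rule integral_mono)
     show "(W (X i) p * f p)^2 <= B^2 * (f p)^2" for p unfolding power_mult_distrib using B[of "X i" p] abs_le_square_iff[of "W (X i) p" B] by (intro mult_right_mono) auto
    qed (use fW[of "X i"] f in \<open>auto simp: L2_def\<close>)
    also have "... = (B * F)^2" unfolding F_def by (simp add: power_mult_distrib)
    finally have "sqrt (LBINT p. (W (X i) p * f p)^2) <= sqrt ((B * F)^2)" by (rule real_sqrt_le_mono)
    then show ?thesis using B0 by (simp add: F_def)
   qed
   finally show "abs (LBINT p. f p * (g (p - X i) - g (p - h0)) * W (X i) p) <= (B * F) * sqrt (?D (X i))" by (simp add: mult_right_mono)
  qed
 qed auto
 have "(%i. (LBINT p. f p * (g (p - X i) - g (p - h0)) * W (X i) p) + (LBINT p. f p * g (p - h0) * W (X i) p))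
   ----> 0 + (LBINT p. f p * g (p - h0) * W h0 p)" by (intro tendsto_intros 1 2)
 moreover have "(LBINT p. f p * (g (p - X i) - g (p - h0)) * W (X i) p) + (LBINT p. f p * g (p - h0) * W (X i) p)
   = (LBINT p. f p * g (p - X i) * W (X i) p)" for i proof -
  have "(LBINT p. f p * (g (p - X i) - g (p - h0)) * W (X i) p) =
    (LBINT p. f p * g (p - X i) * W (X i) p - f p * g (p - h0) * W (X i) p)" by (simp add: algebra_simps)
  also have "... = (LBINT p. f p * g (p - X i) * W (X i) p) - (LBINT p. f p * g (p - h0) * W (X i) p)" by (rule lint_diff[OF int1 int1])
  finally show ?thesis by simp
 qed
 ultimately show "(%i. LBINT p. f p * g (p - X i) * W (X i) p) ----> (LBINT p. f p * g (p - h0) * W h0 p)" by simp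
qed

text \<open>The limit of \<open>c\<close> at 0 ignores the value \<open>c 0\<close>, so the
  pointwise estimate is made off the null set {0}.\<close>

lemma approximate_identity:
 fixes c :: "'a::euclidean_space => real" and K :: "nat => 'a => real"
 assumes Kpos: "!!n h. 0 <= K n h" and Kint: "!!n. integr (K n)" "!!n. (LBINT h. K n h) = 1"
  and Ksupp: "!!n h. r n < norm h ==> K n h = 0" and r: "r ----> 0"
  and c[measurable]: "c : Borel" and cB: "!!h. abs (c h) <= B" and lim: "(c \<longlongrightarrow> c0) (at 0)"
 shows "(%n. LBINT h. K n h * c h) ----> c0"
proof (rule LIMSEQ_I)
 fix e :: real assume "e > 0"
 have [measurable]: "K n : Borel" for n using Kint(1)[of n] by (auto dest: borel_measurable_integrable)
 obtain d where d: "d > 0" "!!h. h ~= 0 ==> norm h < d ==> abs (c h - c0) < e / 2" using lim \<open>e > 0\<close> unfolding LIM_eq by (metis diff_zero half_gt_zero real_norm_def)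
 have "eventually (%n. r n < d) sequentially" using r d(1) by (rule order_tendstoD)
 then obtain N where N: "!!n. n >= N ==> r n < d" by (auto simp: eventually_sequentially)
 have iKc: "integr (%h. K n h * c h)" for n proof (rule integr_bound[of _ "%h. B * K n h"])
  have "B >= 0" using cB[of 0] by linarith
  then show "AE x in lborel. norm (K n x * c x) <= norm (B * K n x)" using mult_left_mono[OF cB Kpos] Kpos[of n] by (intro AE_I2) (simp add: abs_mult mult.commute[of B])
 qed (use Kint in auto)
 have "norm ((LBINT h. K n h * c h) - c0) < e" if "n >= N" for n proof -
  have iKc0: "integr (%h. K n h * (c h - c0))" using iKc[of n] Kint(1)[of n] by (simp add: right_diff_distrib)
  have "(LBINT h. K n h * c h) - c0 = (LBINT h. K n h * (c h - c0))" using iKc[of n] Kint(1)[of n] Kint(2)[of n] by (simp add: right_diff_distrib)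
  also have "norm ... <= (LBINT h. norm (K n h * (c h - c0)))" by (rule integral_norm_bound)
  also have "... <= (LBINT h. e / 2 * K n h)" proof (rule integral_mono_AE)
   show "AE h in lborel. norm (K n h * (c h - c0)) <= e / 2 * K n h" using AE_lborel_singleton[of 0] proof eventually_elim
    case (elim h)
    show ?case proof (cases "norm h <= r n")
     case True
     then have "abs (c h - c0) <= e / 2" using d(2)[of h] elim N[OF that] by simp
     then have "K n h * abs (c h - c0) <= K n h * (e / 2)" by (rule mult_left_mono) (rule Kpos)
     then show ?thesis using Kpos[of n h] by (simp add: abs_mult mult.commute)
    qed (use Ksupp in auto)
   qed
  qed (use iKc0 Kint(1) in auto)
  also have "... = e / 2" using Kint(2)[of n] by simp
  finally show ?thesis using \<open>e > 0\<close> by linarith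
 qed
 then show "EX no. ALL n>=no. norm ((LBINT h. K n h * c h) - c0) < e" by blast
qed

section \<open>Square integrable solutions vanish\<close>

definition C2c :: "(real => real) => (real => real) => (real => real) => bool" where
 "C2c a a1 a2 \<longleftrightarrow> (ALL x. (a has_real_derivative a1 x) (at x)) & (ALL x. (a1 has_real_derivative a2 x) (at x)) &
   continuous_on UNIV a2 & (EX r. ALL x. r < abs x --> a x = 0)"

lemma DERIV_zero_outside:
 assumes "!!x. (f has_real_derivative f' x) (at x)" "!!x. r < abs x ==> f x = 0" "r < abs x"
 shows "f' x = (0::real)"
proof -
 have "eventually (%y. r < abs y) (nhds x)" by (rule order_tendstoD(1)[OF _ assms(3)]) (intro tendsto_intros filterlim_ident)
 then have "eventually (%y. f y = 0) (nhds x)" by eventually_elim (rule assms(2))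
 then have "(f has_real_derivative 0) (at x)" by (subst DERIV_cong_ev[OF refl _ refl, of _ "%_. 0"]) auto
 then show ?thesis using assms(1) DERIV_unique by blast
qed

lemma C2c_supp:
 assumes "C2c a a1 a2"
 obtains r where "r > 0" "!!x. r < abs x ==> a x = 0" "!!x. r < abs x ==> a1 x = 0" "!!x. r < abs x ==> a2 x = 0"
proof -
 obtain r0 where r0: "!!x. r0 < abs x ==> a x = 0" using assms by (auto simp: C2c_def)
 define r where "r = max r0 1"
 have d: "!!x. (a has_real_derivative a1 x) (at x)" "!!x. (a1 has_real_derivative a2 x) (at x)" using assms by (auto simp: C2c_def)
 have r: "a x = 0" if "r < abs x" for x using r0 that by (auto simp: r_def)
 have r1: "a1 x = 0" if "r < abs x" for x using DERIV_zero_outside[OF d(1) r that] .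
 have r2: "a2 x = 0" if "r < abs x" for x using DERIV_zero_outside[OF d(2) r1 that] .
 show ?thesis using that[of r] r r1 r2 by (auto simp: r_def)
qed

lemma bounded_compact:
 fixes f :: "real => real"
 assumes "continuous_on UNIV f" "!!x. r < abs x ==> f x = 0"
 shows "EX B. ALL x. abs (f x) <= B"
proof -
 have "compact (f ` {-r..r})" by (intro compact_continuous_image continuous_on_subset[OF assms(1)]) auto
 then have "bounded (f ` {-r..r})" by (rule compact_imp_bounded)
 then obtain B where "ALL y:f ` {-r..r}. norm y <= B" unfolding bounded_iff by blast
 then have B: "abs (f x) <= B" if "x : {-r..r}" for x using that by auto
 have "abs (f x) <= max B 0" for x using B[of x] assms(2)[of x] by (cases "x : {-r..r}") auto
 then show ?thesis by blast
qed

lemma C2c_cont: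
 assumes "C2c a a1 a2"
 shows "continuous_on UNIV a" "continuous_on UNIV a1" "continuous_on UNIV a2" using assms by (auto simp: C2c_def continuous_on_eq_continuous_at intro: DERIV_isCont)

lemma C2c_measurable:
 assumes "C2c a a1 a2"
 shows "a : Borel" "a1 : Borel" "a2 : Borel" using C2c_cont[OF assms] by (auto intro: borel_measurable_continuous_onI)

lemma C2c_bounded:
 assumes "C2c a a1 a2"
 obtains B where "B >= 0" "!!x. abs (a x) <= B" "!!x. abs (a1 x) <= B" "!!x. abs (a2 x) <= B"
proof -
 obtain r where r: "!!x. r < abs x ==> a x = 0" "!!x. r < abs x ==> a1 x = 0" "!!x. r < abs x ==> a2 x = 0" by (rule C2c_supp[OF assms]) blast
 obtain B0 B1 B2 where B: "!!x. abs (a x) <= B0" "!!x. abs (a1 x) <= B1" "!!x. abs (a2 x) <= B2" using bounded_compact[OF C2c_cont(1)[OF assms], of r] r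
   bounded_compact[OF C2c_cont(2)[OF assms], of r]
   bounded_compact[OF C2c_cont(3)[OF assms], of r] by meson
 show ?thesis proof (rule that[of "max B0 (max B1 B2)"])
  show "0 <= max B0 (max B1 B2)" using B(1)[of 0] by linarith
  show "abs (a x) <= max B0 (max B1 B2)" "abs (a1 x) <= max B0 (max B1 B2)" "abs (a2 x) <= max B0 (max B1 B2)" for x using B[of x] by linarith+
 qed
qed

lemma C2c_mult:
 assumes a: "C2c a a1 a2" and b: "C2c b b1 b2"
 shows "C2c (%x. a x * b x) (%x. a1 x * b x + a x * b1 x) (%x. a2 x * b x + 2 * a1 x * b1 x + a x * b2 x)"
proof -
 have d: "!!x. (a has_real_derivative a1 x) (at x)" "!!x. (a1 has_real_derivative a2 x) (at x)"
   "!!x. (b has_real_derivative b1 x) (at x)" "!!x. (b1 has_real_derivative b2 x) (at x)" using assms by (auto simp: C2c_def)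
 obtain r where "!!x. r < abs x ==> a x = 0" using a by (auto simp: C2c_def)
 moreover have "((%x. a x * b x) has_real_derivative a1 x * b x + a x * b1 x) (at x)" for x by (rule derivative_eq_intros d refl)+ simp
 moreover have "((%x. a1 x * b x + a x * b1 x) has_real_derivative a2 x * b x + 2 * a1 x * b1 x + a x * b2 x) (at x)" for x by (rule derivative_eq_intros d refl)+ (simp add: algebra_simps)
 moreover have "continuous_on UNIV (%x. a2 x * b x + 2 * a1 x * b1 x + a x * b2 x)" by (intro continuous_intros C2c_cont[OF a] C2c_cont[OF b])
 ultimately show ?thesis unfolding C2c_def by auto
qed

lemma C2c_affine:
 assumes a: "C2c a a1 a2" and c: "c ~= 0"
 shows "C2c (%x. a (c * x + t)) (%x. c * a1 (c * x + t)) (%x. c^2 * a2 (c * x + t))"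
proof -
 have d: "!!x. (a has_real_derivative a1 x) (at x)" "!!x. (a1 has_real_derivative a2 x) (at x)" using assms by (auto simp: C2c_def)
 obtain r where r: "!!x. r < abs x ==> a x = 0" using a by (auto simp: C2c_def)
 have l: "((%x. c * x + t) has_real_derivative c) (at x)" for x by (auto intro!: derivative_eq_intros)
 have "((%x. a (c * x + t)) has_real_derivative c * a1 (c * x + t)) (at x)" for x by (rule DERIV_cong[OF DERIV_chain2[OF d(1) l]]) simp
 moreover have "((%x. c * a1 (c * x + t)) has_real_derivative (c^2) * a2 (c * x + t)) (at x)" for x
  by (rule DERIV_cong[OF DERIV_cmult[OF DERIV_chain2[OF d(2) l]]]) (simp add: power2_eq_square)
 moreover have "continuous_on UNIV (%x. c^2 * a2 (c * x + t))" by (intro continuous_intros continuous_on_compose2[OF C2c_cont(3)[OF a]]) auto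
 moreover have "a (c * x + t) = 0" if "(r + abs t) / abs c < abs x" for x proof (rule r)
  have "r + abs t < abs x * abs c" using that c by (simp add: divide_less_eq)
  then show "r < abs (c * x + t)" by (simp flip: abs_mult add: mult.commute)
 qed
 ultimately show ?thesis unfolding C2c_def by blast
qed

lemma C2c_cmult:
 assumes "C2c a a1 a2" shows "C2c (%x. k * a x) (%x. k * a1 x) (%x. k * a2 x)" using assms unfolding C2c_def by (auto intro!: derivative_eq_intros continuous_intros)

text \<open>The cube is the lowest integer power of the positive part of 1 - x^2 that has a
  continuous second derivative, which is the regularity asked by \<open>C2c\<close>.\<close>

definition bump :: "real => real" where "bump x = (max 0 (1 - x^2)) ^ 3"
definition bump1 :: "real => real" where "bump1 x = - 6 * x * (max 0 (1 - x^2)) ^ 2"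
definition bump2 :: "real => real" where "bump2 x = - 6 * (max 0 (1 - x^2)) ^ 2 + 24 * x^2 * max 0 (1 - x^2)"

lemma DERIV_max_0_power:
 fixes y :: real
 assumes "n >= 2"
 shows "((%y. max 0 y ^ n) has_real_derivative real n * max 0 y ^ (n - 1)) (at y)"
proof -
 consider "y > 0" | "y < 0" | "y = 0" by linarith
 then show ?thesis proof cases
  case 1
  have "((%y. y ^ n) has_real_derivative real n * y ^ (n - 1)) (at y)" by (auto intro!: derivative_eq_intros)
  moreover have "eventually (%y. max 0 y ^ n = y ^ n) (nhds y)" using 1 by (intro eventually_mono[OF eventually_nhds_in_open[of "{0<..}" y]]) auto
  ultimately show ?thesis using 1 by (subst DERIV_cong_ev[OF refl _ refl]) auto
 next
  case 2
  have "eventually (%y. max 0 y ^ n = 0) (nhds y)" using 2 assms by (intro eventually_mono[OF eventually_nhds_in_open[of "{..<0}" y]]) auto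
  then show ?thesis using 2 assms by (subst DERIV_cong_ev[OF refl _ refl, of _ "%_. 0"]) (auto simp: power_0_left)
 next
  case 3
  have "((%h. max 0 h ^ (n - 1)) \<longlongrightarrow> max 0 0 ^ (n - 1)) (at (0::real))" by (intro tendsto_intros)
  then have 1: "((%h::real. max 0 h ^ (n - 1)) \<longlongrightarrow> 0) (at 0)" by (rule tendsto_eq_rhs) (use assms in \<open>simp add: power_0_left\<close>)
  have "((%h::real. max 0 h ^ n / h) \<longlongrightarrow> 0) (at 0)" proof (rule Lim_transform_eventually[OF 1])
   have "max 0 h ^ (n - 1) = max 0 h ^ n / h" if "h ~= 0" for h :: real proof (cases "h > 0")
    case True then show ?thesis using assms by (simp add: power_eq_if max_def)
   next
    case False then show ?thesis using assms by (simp add: max_def power_0_left)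
   qed
   then show "\<forall>\<^sub>F h::real in at 0. max 0 h ^ (n - 1) = max 0 h ^ n / h" by (intro eventually_at_filter[THEN iffD2] always_eventually) auto
  qed
  then show ?thesis using 3 assms by (simp add: DERIV_def power_0_left)
 qed
qed

lemma bump_deriv: "(bump has_real_derivative bump1 x) (at x)" "(bump1 has_real_derivative bump2 x) (at x)"
proof -
 have l: "((%x::real. 1 - x^2) has_real_derivative - (2 * x)) (at x)" for x by (auto intro!: derivative_eq_intros)
 have 3: "((%x. max 0 (1 - x^2) ^ 3) has_real_derivative 3 * max 0 (1 - x^2) ^ 2 * - (2 * x)) (at x)" for x :: real using DERIV_chain2[OF DERIV_max_0_power[of 3 "1 - x^2"] l] by simp
 have 2: "((%x. max 0 (1 - x^2) ^ 2) has_real_derivative 2 * max 0 (1 - x^2) * - (2 * x)) (at x)" for x :: real using DERIV_chain2[OF DERIV_max_0_power[of 2 "1 - x^2"] l] by simp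
 show "(bump has_real_derivative bump1 x) (at x)" unfolding bump_def[abs_def] bump1_def by (rule DERIV_cong[OF 3]) simp
 show "(bump1 has_real_derivative bump2 x) (at x)" unfolding bump1_def[abs_def] bump2_def by (rule DERIV_cong[OF DERIV_mult[OF _ 2, where f="%x. - 6 * x" and Da="-6"]])
   (auto intro!: derivative_eq_intros simp: power2_eq_square algebra_simps)
qed

lemma bump_zero: "1 <= abs x ==> bump x = 0" using abs_le_square_iff[of 1 x] by (simp add: bump_def)

lemma bump_pos: "abs x < 1 ==> 0 < bump x" using abs_square_less_1[of x] by (simp add: bump_def)

lemma bump_C2c: "C2c bump bump1 bump2" unfolding C2c_def
proof (intro conjI allI bump_deriv)
 show "continuous_on UNIV bump2" unfolding bump2_def by (intro continuous_intros)
 show "EX r. ALL x. r < abs x --> bump x = 0" using bump_zero by (intro exI[of _ 1]) auto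
qed

lemma integr_compact:
 fixes f :: "'a::euclidean_space => real"
 assumes "f : Borel" "!!x. abs (f x) <= B" "!!x. r < norm x ==> f x = 0"
 shows "integr f"
proof (rule integr_bound[of _ "%x. B * ind (cball 0 r) x"])
 show "integr (%x::'a. B * ind (cball 0 r) x)" using emeasure_bounded_finite[of "cball 0 r :: 'a set"] by (intro integrable_mult_right) (simp add: integrable_indicator_iff)
 show "AE x in lborel. norm (f x) <= norm (B * ind (cball 0 r) x)" using assms(2,3) by (intro AE_I2) (auto simp: indicator_def not_le[symmetric] order_trans[OF _ abs_ge_self])
qed (use assms in auto)

lemma C2c_integrable:
 assumes "C2c a a1 a2"
 shows "integr a" "integr a1" "integr a2"
proof -
 obtain r where r: "!!x. r < abs x ==> a x = 0" "!!x. r < abs x ==> a1 x = 0" "!!x. r < abs x ==> a2 x = 0" by (rule C2c_supp[OF assms]) blast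
 obtain B where B: "!!x. abs (a x) <= B" "!!x. abs (a1 x) <= B" "!!x. abs (a2 x) <= B" by (rule C2c_bounded[OF assms]) blast
 show "integr a" "integr a1" "integr a2" using C2c_measurable[OF assms] B r by (auto intro!: integr_compact[of _ B r])
qed

lemma bump_integral_pos: "0 < (LBINT x. bump x)"
proof -
 have "(LBINT x. bump x) ~= 0" proof
  assume "(LBINT x. bump x) = 0"
  then have "AE x in lborel. bump x = 0" by (subst (asm) integral_nonneg_eq_0_iff_AE[OF C2c_integrable(1)[OF bump_C2c]]) (auto simp: bump_def)
  then have "AE x in lborel. x ~: {-1<..<1::real}" proof (rule AE_mp, intro AE_I2 impI)
   fix x assume "bump x = 0"
   then show "x ~: {-1<..<1}" using bump_pos[of x] by (cases "abs x < 1") (auto simp: abs_less_iff)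
  qed
  then have "emeasure lborel {x : space lborel. ~ (x ~: {-1<..<1::real})} = 0" by (subst (asm) AE_iff_measurable[OF _ refl]) auto
  moreover have "{x : space lborel. ~ (x ~: {-1<..<1::real})} = {-1<..<1}" by auto
  ultimately show False by simp
 qed
 moreover have "0 <= (LBINT x. bump x)" by (rule lint_nonneg) (simp add: bump_def)
 ultimately show ?thesis by linarith
qed

text \<open>The bump rescaled to unit mass on an interval of radius 1/(n+1). The added 0 makes the
  body a literal instance of \<open>C2c_affine\<close>.\<close>

definition ker :: "nat => real => real" where
 "ker n x = real (Suc n) / (LBINT x. bump x) * bump (real (Suc n) * x + 0)"
definition ker1 :: "nat => real => real" where
 "ker1 n x = real (Suc n) / (LBINT x. bump x) * (real (Suc n) * bump1 (real (Suc n) * x + 0))"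
definition ker2 :: "nat => real => real" where
 "ker2 n x = real (Suc n) / (LBINT x. bump x) * ((real (Suc n))^2 * bump2 (real (Suc n) * x + 0))"

lemma ker_C2c: "C2c (ker n) (ker1 n) (ker2 n)" unfolding ker_def[abs_def] ker1_def[abs_def] ker2_def[abs_def] by (intro C2c_cmult C2c_affine bump_C2c) simp

lemma ker_nonneg: "0 <= ker n x" unfolding ker_def using bump_integral_pos by (simp add: bump_def)

lemma ker_zero: "1 / real (Suc n) <= abs x ==> ker n x = 0"
proof -
 assume "1 / real (Suc n) <= abs x"
 then have "1 <= abs (real (Suc n) * x)" by (simp add: abs_mult divide_le_eq mult.commute)
 then show ?thesis by (simp add: ker_def bump_zero)
qed

lemma ker_pos: "abs x < 1 ==> 0 < ker 0 x" unfolding ker_def using bump_integral_pos bump_pos by simp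

lemma ker_integral: "(LBINT x. ker n x) = 1"
proof -
 have "(LBINT x. ker n x) = real (Suc n) / (LBINT x. bump x) * (LBINT x. bump (0 + real (Suc n) * x))" by (simp add: ker_def)
 also have "(LBINT x. bump x) = abs (real (Suc n)) *R (LBINT x. bump (0 + real (Suc n) * x))" by (rule lborel_integral_real_affine) simp
 finally show ?thesis using bump_integral_pos lborel_integral_real_affine[of "real (Suc n)" bump 0] by (auto simp: field_simps)
qed

lemma ker_approx:
 assumes "c : Borel" "!!h. abs (c h) <= B" "(c \<longlongrightarrow> c0) (at 0)"
 shows "(%n. LBINT h. ker n h * c h) ----> c0"
proof (rule approximate_identity[OF ker_nonneg C2c_integrable(1)[OF ker_C2c] ker_integral _ _ assms])
 show "ker n h = 0" if "1 / real (Suc n) < norm h" for n h using that ker_zero[of n h] by simp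
 show "(%n. 1 / real (Suc n)) ----> 0" using LIMSEQ_inverse_real_of_nat by (simp add: inverse_eq_divide)
qed

text \<open>Two translates of the kernel have equal mass, so the primitive of their difference is
  constant to the left and to the right with the same value 0. Such a primitive is an admissible
  test function; inserted as \<open>P\<close> or \<open>Q\<close> it compares an integral at
  \<open>c\<close> with the one at \<open>c + L\<close>, which is how constancy in a parameter is
  proved.\<close>

lemma C2c_ker_difference:
 fixes c L :: real
 obtains P P2 where "C2c P (%x. ker n (x - c) - ker n (x - (c + L))) P2"
proof -
 have "EX F. ALL x. - \<infinity> < ereal x --> ereal x < \<infinity> --> (F has_vector_derivative ker n x) (at x)" by (rule einterval_antiderivative)
   (use C2c_cont(1)[OF ker_C2c] in \<open>auto simp: continuous_on_eq_continuous_at\<close>)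
 then obtain F where F: "!!x. (F has_real_derivative ker n x) (at x)" by (auto simp: has_real_derivative_iff_has_vector_derivative)
 have const: "F x = F y" if "1 <= x & 1 <= y | x <= -1 & y <= -1" for x y proof -
  have "ker n t = 0" if "1 <= abs t" for t using that by (intro ker_zero order_trans[OF _ that]) (simp add: divide_le_eq)
  then have z: "(F has_real_derivative 0) (at t within S)" if "1 <= abs t" for t S using F[of t] that by (auto intro: has_field_derivative_at_within)
  have "convex {1::real..}" "convex {..-1::real}" by auto
  have "EX k. ALL x:{1..}. F x = k" by (rule has_field_derivative_zero_constant) (auto intro!: z)
  moreover have "EX k. ALL x:{..-1}. F x = k" by (rule has_field_derivative_zero_constant) (auto intro!: z)
  ultimately show ?thesis using that by force
 qed
 have "C2c (%x. F (x - c) - F (x - (c + L))) (%x. ker n (x - c) - ker n (x - (c + L)))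
    (%x. ker1 n (x - c) - ker1 n (x - (c + L)))" unfolding C2c_def proof (intro conjI allI)
  have s: "((%x. x - t) has_real_derivative 1) (at x)" for x t :: real by (auto intro!: derivative_eq_intros)
  fix x
  show "((%x. F (x - c) - F (x - (c + L))) has_real_derivative ker n (x - c) - ker n (x - (c + L))) (at x)" using DERIV_diff[OF DERIV_chain2[OF F s] DERIV_chain2[OF F s]] by simp
  have k: "(ker n has_real_derivative ker1 n x) (at x)" for x using ker_C2c[of n] by (simp add: C2c_def)
  show "((%x. ker n (x - c) - ker n (x - (c + L))) has_real_derivative ker1 n (x - c) - ker1 n (x - (c + L))) (at x)" using DERIV_diff[OF DERIV_chain2[OF k s] DERIV_chain2[OF k s]] by simp
 next
  show "continuous_on UNIV (%x. ker1 n (x - c) - ker1 n (x - (c + L)))" by (intro continuous_intros continuous_on_compose2[OF C2c_cont(2)[OF ker_C2c]]) auto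
  have "F (x - c) - F (x - (c + L)) = 0" if "1 + abs c + abs L < abs x" for x using const[of "x - c" "x - (c + L)"] that by (auto simp: abs_if split: if_splits)
  then show "EX r. ALL x. r < abs x --> F (x - c) - F (x - (c + L)) = 0" by blast
 qed
 then show ?thesis using that by blast
qed

section \<open>Double integrals with kernels supported near the diagonal, and the doubling of
  variables\<close>

lemma lborel_reflect:
 fixes f :: "'a::euclidean_space => real"
 assumes [measurable]: "f : Borel"
 shows "(LBINT x. f (t - x)) = (LBINT x. f x)"
proof -
 have "(\<Sum>j\<in>Basis. (- 1 * (x \<bullet> j)) *R j) = - x" for x :: 'a by (simp add: sum_negf euclidean_representation)
 then have e: "lborel = density (distr lborel borel (%x::'a. t - x)) (%_. 1)" using lborel_affine_euclidean[of "%_. -1" t] by simp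
 have "(LBINT x. f x) = integral\<^sup>L (density (distr lborel borel (%x::'a. t - x)) (%_. 1)) f" by (subst e[symmetric]) simp
 also have "... = integral\<^sup>L (distr lborel borel (%x::'a. t - x)) f" by (simp add: density_1)
 also have "... = (LBINT x. f (t - x))" by (subst integral_distr) auto
 finally show ?thesis by simp
qed

text \<open>The kernel is bounded and lives in a band around the diagonal. With abs (f g) <= f^2 +
  g^2, one variable integrates to the area of a ball of radius \<open>r\<close>, the same at every
  centre, and the integral of f^2 or g^2 remains. This justifies Fubini on two copies of the
  plane.\<close>

lemma L2_pair_integr:
 fixes f g :: "'a::euclidean_space => real"
 assumes f: "L2 f" and g: "L2 g" and K[measurable]: "(%(p, q). K p q) : Borel2"
  and b: "!!p q. abs (K p q) <= C * ind (cball p r) q"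
 shows "integrable lborel2 (%(p, q). f p * g q * K p q)"
proof -
 have [measurable]: "f : Borel" "g : Borel" using f g by (auto simp: L2_def)
 have [measurable]: "Measurable.pred (borel \<Otimes>\<^sub>M borel) (%x::'a\<times>'a. dist (fst x) (snd x) <= r)" by measurable
 define H where "H = (%(p, q). abs C * ((f p)^2 + (g q)^2) * ind {x::'a\<times>'a. dist (fst x) (snd x) <= r} (p, q))"
 have [measurable]: "H : Borel2" unfolding H_def by measurable
 have Hpos: "0 <= H x" for x by (auto simp: H_def split_beta)
 have fin: "emeasure lborel (cball p r) = emeasure lborel (cball (0::'a) r)" for p :: 'a proof (cases "r >= 0")
  case True then show ?thesis by (simp add: emeasure_cball)
 qed simp
 have finc: "emeasure lborel (cball (0::'a) r) < \<infinity>" using emeasure_bounded_finite[of "cball 0 r"] by simp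
 have fnn: "(NN p. ennreal (abs C * (u p)^2) * emeasure lborel (cball (0::'a) r)) < \<infinity>" if "L2 u" for u :: "'a => real" proof -
  have [measurable]: "u : Borel" using that by (auto simp: L2_def)
  have "(NN p. ennreal (abs C * (u p)^2)) < \<infinity>" proof -
   have "integr (%p. abs C * (u p)^2)" using that by (auto simp: L2_def)
   then show ?thesis unfolding integrable_iff_bounded by (simp add: abs_mult)
  qed
  then show ?thesis using finc by (subst nn_integral_multc) (auto simp: ennreal_mult_less_top)
 qed
 have iH: "integrable lborel2 H" proof (rule integrableI_nonneg)
  have "(\<integral>\<^sup>+ x. ennreal (H x) \<partial>lborel2) =
    (\<integral>\<^sup>+ x. ennreal (abs C * (f (fst x))^2) * ind {x::'a\<times>'a. dist (fst x) (snd x) <= r} x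
     + ennreal (abs C * (g (snd x))^2) * ind {x::'a\<times>'a. dist (fst x) (snd x) <= r} x \<partial>lborel2)" by (rule nn_integral_cong)
    (simp add: H_def split_beta distrib_left split: split_indicator)
  also have "... = (\<integral>\<^sup>+ x. ennreal (abs C * (f (fst x))^2) * ind {x::'a\<times>'a. dist (fst x) (snd x) <= r} x \<partial>lborel2)
     + (\<integral>\<^sup>+ x. ennreal (abs C * (g (snd x))^2) * ind {x::'a\<times>'a. dist (fst x) (snd x) <= r} x \<partial>lborel2)" by (rule nn_integral_add) auto
  also have "(\<integral>\<^sup>+ x. ennreal (abs C * (f (fst x))^2) * ind {x::'a\<times>'a. dist (fst x) (snd x) <= r} x \<partial>lborel2)
    = (NN p. \<integral>\<^sup>+ q. ennreal (abs C * (f p)^2) * ind (cball p r) q \<partial>lborel)" proof -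
   have "(\<integral>\<^sup>+ x. ennreal (abs C * (f (fst x))^2) * ind {x::'a\<times>'a. dist (fst x) (snd x) <= r} x \<partial>lborel2)
    = (NN p. \<integral>\<^sup>+ q. ennreal (abs C * (f (fst (p, q)))^2) * ind {x::'a\<times>'a. dist (fst x) (snd x) <= r} (p, q) \<partial>lborel)"
    by (rule lborel.nn_integral_fst[symmetric]) measurable
   also have "... = (NN p. \<integral>\<^sup>+ q. ennreal (abs C * (f p)^2) * ind (cball p r) q \<partial>lborel)" by (intro nn_integral_cong) (simp add: indicator_def)
   finally show ?thesis .
  qed
  also have "... = (NN p. ennreal (abs C * (f p)^2) * emeasure lborel (cball (0::'a) r))" by (intro nn_integral_cong, subst nn_integral_cmult_indicator, simp, subst fin, rule refl)
  also have "(\<integral>\<^sup>+ x. ennreal (abs C * (g (snd x))^2) * ind {x::'a\<times>'a. dist (fst x) (snd x) <= r} x \<partial>lborel2)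
    = (NN q. \<integral>\<^sup>+ p. ennreal (abs C * (g q)^2) * ind (cball q r) p \<partial>lborel)" proof -
   have "(\<integral>\<^sup>+ x. ennreal (abs C * (g (snd x))^2) * ind {x::'a\<times>'a. dist (fst x) (snd x) <= r} x \<partial>lborel2)
    = (NN q. \<integral>\<^sup>+ p. ennreal (abs C * (g (snd (p, q)))^2) * ind {x::'a\<times>'a. dist (fst x) (snd x) <= r} (p, q) \<partial>lborel)"
    by (rule lborel_pair.nn_integral_snd[symmetric]) measurable
   also have "... = (NN q. \<integral>\<^sup>+ p. ennreal (abs C * (g q)^2) * ind (cball q r) p \<partial>lborel)" by (intro nn_integral_cong) (simp add: indicator_def dist_commute)
   finally show ?thesis .
  qed
  also have "... = (NN p. ennreal (abs C * (g p)^2) * emeasure lborel (cball (0::'a) r))" by (intro nn_integral_cong, subst nn_integral_cmult_indicator, simp, subst fin, rule refl)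
  finally show "(\<integral>\<^sup>+ x. ennreal (H x) \<partial>lborel2) < \<infinity>" using fnn[OF f] fnn[OF g] by simp
 qed (auto simp: Hpos)
 show ?thesis proof (rule integr_bound[OF iH])
  show "AE x in lborel2. norm (case x of (p, q) => f p * g q * K p q) <= norm (H x)" proof (intro AE_I2, clarify)
   fix p q
   have 1: "abs (f p * g q) <= (f p)^2 + (g q)^2" proof -
    have "2 * (abs (f p) * abs (g q)) <= (f p)^2 + (g q)^2" using sum_squares_bound[of "abs (f p)" "abs (g q)"] by simp
    moreover have "0 <= abs (f p) * abs (g q)" by simp
    ultimately show ?thesis unfolding abs_mult by linarith
   qed
   have 2: "abs (K p q) <= abs C * ind (cball p r) q" using b[of p q] by (auto simp: indicator_def split: if_splits)
   have "abs (f p * g q) * abs (K p q) <= ((f p)^2 + (g q)^2) * (abs C * ind (cball p r) q)" by (rule mult_mono[OF 1 2]) auto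
   also have "... = H (p, q)" by (auto simp: H_def indicator_def)
   finally show "norm (f p * g q * K p q) <= norm (H (p, q))" using Hpos[of "(p, q)"] by (simp add: abs_mult)
  qed
 qed measurable
qed

text \<open>The same bound in the variables p and h = p - q, where the support condition concerns
  \<open>h\<close> alone; the integral of the shifted square does not depend on
  \<open>h\<close>.\<close>

lemma L2_pair_integr_shift:
 fixes f g :: "'a::euclidean_space => real"
 assumes f: "L2 f" and g: "L2 g" and K[measurable]: "(%(p, h). K p h) : Borel2"
  and b: "!!p h. abs (K p h) <= C * ind (cball 0 r) h"
 shows "integrable lborel2 (%(p, h). f p * g (p - h) * K p h)"
proof -
 have [measurable]: "f : Borel" "g : Borel" using f g by (auto simp: L2_def)
 define H where "H = (%(p, h). abs C * ((f p)^2 + (g (p - h))^2) * ind (cball (0::'a) r) h)"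
 have [measurable]: "(%x::'a\<times>'a. ind (cball 0 r) (snd x) :: real) : Borel2" by (rule measurable_compose[OF measurable_snd borel_measurable_indicator]) auto
 have [measurable]: "H : Borel2" unfolding H_def split_beta by measurable
 have Hpos: "0 <= H x" for x by (auto simp: H_def split_beta)
 have finc: "emeasure lborel (cball (0::'a) r) < \<infinity>" using emeasure_bounded_finite[of "cball 0 r"] by simp
 have fnn: "(NN p. ennreal (abs C * (u p)^2)) < \<infinity>" if "L2 u" for u :: "'a => real" proof -
  have "integr (%p. abs C * (u p)^2)" using that by (auto simp: L2_def)
  then show ?thesis unfolding integrable_iff_bounded by (simp add: abs_mult)
 qed
 have iH: "integrable lborel2 H" proof (rule integrableI_nonneg)
  have "(\<integral>\<^sup>+ x. ennreal (H x) \<partial>lborel2) = (NN h. \<integral>\<^sup>+ p. ennreal (H (p, h)) \<partial>lborel)"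
   by (rule lborel_pair.nn_integral_snd[symmetric]) measurable
  also have "... = (NN h. ((NN p. ennreal (abs C * (f p)^2)) + (NN p. ennreal (abs C * (g p)^2))) * ind (cball (0::'a) r) h)" proof (rule nn_integral_cong)
   fix h :: 'a
   have "(NN p. ennreal (H (p, h))) =
    (NN p. (ennreal (abs C * (f p)^2) + ennreal (abs C * (g (p + - h))^2)) * ind (cball (0::'a) r) h)" by (rule nn_integral_cong) (simp add: H_def distrib_left split: split_indicator)
   also have "... = ((NN p. ennreal (abs C * (f p)^2)) + (NN p. ennreal (abs C * (g (p + - h))^2))) * ind (cball (0::'a) r) h" by (subst nn_integral_multc) (auto simp: nn_integral_add)
   also have "(NN p. ennreal (abs C * (g (p + - h))^2)) = (NN p. ennreal (abs C * (g p)^2))" by (rule nn_lint_shift) auto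
   finally show "(NN p. ennreal (H (p, h))) =
    ((NN p. ennreal (abs C * (f p)^2)) + (NN p. ennreal (abs C * (g p)^2))) * ind (cball (0::'a) r) h" .
  qed
  also have "... = ((NN p. ennreal (abs C * (f p)^2)) + (NN p. ennreal (abs C * (g p)^2))) * emeasure lborel (cball (0::'a) r)" by (rule nn_integral_cmult_indicator) auto
  also have "... < \<infinity>" using fnn[OF f] fnn[OF g] finc by (simp add: ennreal_mult_less_top)
  finally show "(\<integral>\<^sup>+ x. ennreal (H x) \<partial>lborel2) < \<infinity>" .
 qed (auto simp: Hpos)
 show ?thesis proof (rule integr_bound[OF iH])
  show "AE x in lborel2. norm (case x of (p, h) => f p * g (p - h) * K p h) <= norm (H x)" proof (intro AE_I2, clarify)
   fix p h
   have 1: "abs (f p * g (p - h)) <= (f p)^2 + (g (p - h))^2" proof -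
    have "2 * (abs (f p) * abs (g (p - h))) <= (f p)^2 + (g (p - h))^2" using sum_squares_bound[of "abs (f p)" "abs (g (p - h))"] by simp
    moreover have "0 <= abs (f p) * abs (g (p - h))" by simp
    ultimately show ?thesis unfolding abs_mult by linarith
   qed
   have 2: "abs (K p h) <= abs C * ind (cball 0 r) h" using b[of p h] by (auto simp: indicator_def split: if_splits)
   have "abs (f p * g (p - h)) * abs (K p h) <= ((f p)^2 + (g (p - h))^2) * (abs C * ind (cball 0 r) h)" by (rule mult_mono[OF 1 2]) auto
   also have "... = H (p, h)" by (auto simp: H_def indicator_def)
   finally show "norm (f p * g (p - h) * K p h) <= norm (H (p, h))" using Hpos[of "(p, h)"] by (simp add: abs_mult)
  qed
 qed measurable
qed

lemma borel_fst_snd [measurable (raw)]: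
 fixes f :: "'c => 'a::euclidean_space \<times> 'b::euclidean_space"
 assumes "f : borel_measurable M"
 shows "(%x. fst (f x)) : borel_measurable M" "(%x. snd (f x)) : borel_measurable M" by (rule measurable_compose[OF assms borel_measurable_continuous_onI], intro continuous_intros)+

lemma C2c_shift: "C2c a a1 a2 ==> C2c (%x. a (x + t)) (%x. a1 (x + t)) (%x. a2 (x + t))" using C2c_affine[of a a1 a2 1 t] by simp

lemma C2c_shift_minus: "C2c a a1 a2 ==> C2c (%x. a (x - t)) (%x. a1 (x - t)) (%x. a2 (x - t))" using C2c_shift[of a a1 a2 "-t"] by simp

lemma C2c_reflect: "C2c a a1 a2 ==> C2c (%x. a (t - x)) (%x. - a1 (t - x)) (%x. a2 (t - x))" using C2c_affine[of a a1 a2 "-1" t] by simp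

lemma abs_mult3_le: "abs a <= A ==> abs b <= B ==> abs c <= C ==> abs (a * b * c) <= A * B * C" for a b c :: real unfolding abs_mult by (intro mult_mono) auto

lemma corr_integrable:
 assumes f: "L2 f" and g: "L2 g" and [measurable]: "W : Borel" and B: "!!p. abs (W p) <= B"
 shows "integr (%p. f p * g (p - h) * W p)" using L2_mult_integr[OF L2_mult_bounded[OF f, of W B] L2_shift_minus[OF g, of h]] B by (simp add: mult_ac)

lemma corr_bound:
 assumes f: "L2 f" and g: "L2 g" and [measurable]: "W : Borel" and B: "!!p. abs (W p) <= B"
 shows "abs (LBINT p. f p * g (p - h) * W p) <= B * ((LBINT p. (f p)^2) + (LBINT p. (g p)^2))"
proof -
 have [measurable]: "g : Borel" using g by (simp add: L2_def)
 have ig: "integr (%p. (g (p - h))^2)" "integr (%p. (f p)^2)" using L2_shift_minus[OF g, of h] f by (auto simp: L2_def)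
 have "abs (LBINT p. f p * g (p - h) * W p) <= (LBINT p. abs (f p * g (p - h) * W p))" by (rule integral_abs_bound)
 also have "... <= (LBINT p. B * ((f p)^2 + (g (p - h))^2))" proof (rule integral_mono)
  fix p
  have "2 * (abs (f p) * abs (g (p - h))) <= (f p)^2 + (g (p - h))^2" using sum_squares_bound[of "abs (f p)" "abs (g (p - h))"] by simp
  moreover have "0 <= abs (f p) * abs (g (p - h))" by simp
  ultimately have "abs (f p * g (p - h)) <= (f p)^2 + (g (p - h))^2" unfolding abs_mult by linarith
  then have "abs (W p) * abs (f p * g (p - h)) <= B * ((f p)^2 + (g (p - h))^2)" using B[of p] by (intro mult_mono) auto
  then show "abs (f p * g (p - h) * W p) <= B * ((f p)^2 + (g (p - h))^2)" by (simp add: abs_mult mult_ac)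
 qed (use ig corr_integrable[OF f g assms(3) B, of h] in auto)
 also have "... = B * ((LBINT p. (f p)^2) + (LBINT p. (g (p - h))^2))" using ig by simp
 also have "(LBINT p. (g (p - h))^2) = (LBINT p. (g p)^2)" using lint_shift[of "%p. (g p)^2" "-h"] by simp
 finally show ?thesis .
qed

lemma param_integral_Borel:
 fixes f :: "'a::euclidean_space => 'b::euclidean_space => real"
 assumes "(%(h, p). f h p) : Borel2"
 shows "(%h. LBINT p. f h p) : Borel"
proof (rule lborel.borel_measurable_lebesgue_integral)
 show "(%(h, p). f h p) : borel_measurable (borel \<Otimes>\<^sub>M lborel)"
  using assms measurable_cong_sets[OF sets_pair_measure_cong[OF refl sets_lborel] refl, of "borel :: 'a measure" "borel :: real measure"] by (simp add: split_beta)
qed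

text \<open>Doubling of variables. The equation for \<open>a\<close> in p = (x,z) and in q = (x',z')
  is tested with ker n (x - x') P (z + z') Q (z - z'). The x-derivatives of the kernel agree in both
  variables and cancel on subtraction; the second z- and z'-derivatives differ by 4 P' Q'; the
  potentials differ by V(x) - V(x'). Substituting q = p - h gives z + z' = 2z - t and z - z' = t for
  the second coordinate t of h, hence the arguments \<open>2 * snd p - snd h\<close>.\<close>

lemma corr_identity:
 fixes a :: "plane => real" and V :: "real => real"
 assumes a: "L2 a" and V[measurable]: "V : Borel" and VB: "!!x. abs (V x) <= BV"
  and eq: "!!al al1 al2 \<beta> \<beta>1 \<beta>2. C2c al al1 al2 ==> C2c \<beta> \<beta>1 \<beta>2 ==>
   (LBINT p. a p * (al2 (fst p) * \<beta> (snd p) + al (fst p) * \<beta>2 (snd p) + V (fst p) * al (fst p) * \<beta> (snd p))) = 0"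
  and P: "C2c P P1 P2" and Q: "C2c Q Q1 Q2"
 shows "(LBINT h. ker n (fst h) * (4 * Q1 (snd h) * (LBINT p. a p * a (p - h) * P1 (2 * snd p - snd h))
   + Q (snd h) * (LBINT p. a p * a (p - h) * ((V (fst p) - V (fst p - fst h)) * P (2 * snd p - snd h))))) = 0" proof -
 let ?c = "%h p. a p * a (p - h) * P1 (2 * snd p - snd h)" and ?e = "%h p. a p * a (p - h) * ((V (fst p) - V (fst p - fst h)) * P (2 * snd p - snd h))"
 have [measurable]: "a : Borel" using a by (simp add: L2_def)
 note [measurable] = C2c_measurable[OF P] C2c_measurable[OF Q] C2c_measurable[OF ker_C2c[of n]]
 obtain BP where BP: "BP >= 0" "!!x. abs (P x) <= BP" "!!x. abs (P1 x) <= BP" "!!x. abs (P2 x) <= BP" by (rule C2c_bounded[OF P]) blast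
 obtain BQ where BQ: "BQ >= 0" "!!x. abs (Q x) <= BQ" "!!x. abs (Q1 x) <= BQ" "!!x. abs (Q2 x) <= BQ" by (rule C2c_bounded[OF Q]) blast
 obtain Bk where Bk: "Bk >= 0" "!!x. abs (ker n x) <= Bk" "!!x. abs (ker2 n x) <= Bk" by (rule C2c_bounded[OF ker_C2c[of n]]) blast
 obtain rQ where rQ: "!!x. rQ < abs x ==> Q x = 0" "!!x. rQ < abs x ==> Q1 x = 0" "!!x. rQ < abs x ==> Q2 x = 0" by (rule C2c_supp[OF Q]) blast
 obtain rk where rk: "!!x. rk < abs x ==> ker n x = 0" "!!x. rk < abs x ==> ker2 n x = 0" by (rule C2c_supp[OF ker_C2c[of n]]) blast
 have BV0: "BV >= 0" using VB[of 0] by linarith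
 define k where "k p p' = ker n (fst p - fst p')" for p p' :: "plane"
 define k2 where "k2 p p' = ker2 n (fst p - fst p')" for p p' :: "plane"
 define s where "s p p' = snd p + snd p'" for p p' :: "plane"
 define t where "t p p' = snd p - snd p'" for p p' :: "plane"
 \<comment> \<open>\<open>K 2 W1\<close> is Laplacian plus V in p applied to the test kernel, and
   \<open>K (- 2) W2\<close> is the same in q. The parameter \<open>sg\<close> is the coefficient of
   P' Q': it changes sign because Q depends on z - z' while P depends on z + z'.\<close>
 define K where "K sg W p p' = k2 p p' * P (s p p') * Q (t p p') + k p p' * P2 (s p p') * Q (t p p') + sg * (k p p' * P1 (s p p') * Q1 (t p p'))
   + k p p' * P (s p p') * Q2 (t p p') + W p p' * (k p p' * P (s p p') * Q (t p p'))" for sg W p p'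
 define C where "C = Bk * BP * BQ + Bk * BP * BQ + 2 * (Bk * BP * BQ) + Bk * BP * BQ + BV * (Bk * BP * BQ)"
 have Kb: "abs (K sg W p p') <= C * ind (cball p (abs rk + abs rQ)) p'" if "abs sg <= 2" "!!p p'. abs (W p p') <= BV" for sg W p p' proof (cases "dist p p' <= abs rk + abs rQ")
  case True
  have m: "abs (k2 p p' * P (s p p') * Q (t p p')) <= Bk * BP * BQ" "abs (k p p' * P2 (s p p') * Q (t p p')) <= Bk * BP * BQ"
    "abs (k p p' * P1 (s p p') * Q1 (t p p')) <= Bk * BP * BQ" "abs (k p p' * P (s p p') * Q2 (t p p')) <= Bk * BP * BQ"
    "abs (k p p' * P (s p p') * Q (t p p')) <= Bk * BP * BQ" unfolding k_def k2_def by (intro abs_mult3_le Bk BP BQ)+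
  have "abs (sg * (k p p' * P1 (s p p') * Q1 (t p p'))) <= 2 * (Bk * BP * BQ)" unfolding abs_mult[of sg] using that(1) m(3) by (intro mult_mono) auto
  moreover have "abs (W p p' * (k p p' * P (s p p') * Q (t p p'))) <= BV * (Bk * BP * BQ)" unfolding abs_mult[of "W p p'"] using that(2)[of p p'] m(5) BV0 by (intro mult_mono) auto
  ultimately have "abs (K sg W p p') <= C" unfolding K_def C_def using m(1,2,4) by linarith
  then show ?thesis using True by (simp add: indicator_def)
 next
  case False
  have "dist p p' <= abs (fst p - fst p') + abs (snd p - snd p')" unfolding dist_prod_def dist_real_def using sqrt_sum_squares_le_sum_abs by simp
  then consider "rk < abs (fst p - fst p')" | "rQ < abs (snd p - snd p')" using False by linarith
  then have "K sg W p p' = 0" by cases (simp_all add: K_def k_def k2_def t_def rk rQ)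
  moreover have "C >= 0" unfolding C_def using Bk BP BQ BV0 by simp
  ultimately show ?thesis by simp
 qed
 have Km: "(%(p, p'). K sg W p p') : Borel2"
  if [measurable]: "(%(p, p'). W p p') : Borel2" for sg W unfolding K_def k_def k2_def s_def t_def by measurable
 define W1 where "W1 p p' = V (fst p)" for p p' :: "plane"
 define W2 where "W2 p p' = V (fst p')" for p p' :: "plane"
 have W1m: "(%(p, p'). W1 p p') : Borel2" unfolding W1_def by measurable
 have W2m: "(%(p, p'). W2 p p') : Borel2" unfolding W2_def by measurable
 have i1: "integrable lborel2 (%(p, q). a p * a q * K 2 W1 p q)" by (rule L2_pair_integr[OF a a Km[OF W1m] Kb]) (auto simp: W1_def VB)
 have i2: "integrable lborel2 (%(p, q). a p * a q * K (- 2) W2 p q)" by (rule L2_pair_integr[OF a a Km[OF W2m] Kb]) (auto simp: W2_def VB)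
 have z1: "(LBINT p. a p * a q * K 2 W1 p q) = 0" for q proof -
  have c1: "C2c (%x. ker n (x - fst q)) (%x. ker1 n (x - fst q)) (%x. ker2 n (x - fst q))" by (rule C2c_shift_minus[OF ker_C2c])
  have c2: "C2c (%z. P (z + snd q) * Q (z - snd q)) (%z. P1 (z + snd q) * Q (z - snd q) + P (z + snd q) * Q1 (z - snd q))
   (%z. P2 (z + snd q) * Q (z - snd q) + 2 * P1 (z + snd q) * Q1 (z - snd q) + P (z + snd q) * Q2 (z - snd q))" by (rule C2c_mult[OF C2c_shift[OF P] C2c_shift_minus[OF Q]])
  have "(LBINT p. a p * a q * K 2 W1 p q) = (LBINT p. a q * (a p * (ker2 n (fst p - fst q) * (P (snd p + snd q) * Q (snd p - snd q)) +
    ker n (fst p - fst q) * (P2 (snd p + snd q) * Q (snd p - snd q) + 2 * P1 (snd p + snd q) * Q1 (snd p - snd q) + P (snd p + snd q) * Q2 (snd p - snd q))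
    + V (fst p) * ker n (fst p - fst q) * (P (snd p + snd q) * Q (snd p - snd q)))))" by (rule lint_cong) (auto simp: K_def k_def k2_def s_def t_def W1_def algebra_simps)
  also have "... = 0" by (subst integral_mult_right_zero) (simp add: eq[OF c1 c2])
  finally show ?thesis .
 qed
 have z2: "(LBINT q. a p * a q * K (- 2) W2 p q) = 0" for p proof -
  have c1: "C2c (%x. ker n (fst p - x)) (%x. - ker1 n (fst p - x)) (%x. ker2 n (fst p - x))" by (rule C2c_reflect[OF ker_C2c])
  have "C2c (%z. P (z + snd p) * Q (snd p - z)) (%z. P1 (z + snd p) * Q (snd p - z) + P (z + snd p) * - Q1 (snd p - z))
   (%z. P2 (z + snd p) * Q (snd p - z) + 2 * P1 (z + snd p) * - Q1 (snd p - z) + P (z + snd p) * Q2 (snd p - z))" by (rule C2c_mult[OF C2c_shift[OF P] C2c_reflect[OF Q]])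
  note c2 = this
  have "(LBINT q. a p * a q * K (- 2) W2 p q) = (LBINT q. a p * (a q * (ker2 n (fst p - fst q) * (P (snd q + snd p) * Q (snd p - snd q)) +
    ker n (fst p - fst q) * (P2 (snd q + snd p) * Q (snd p - snd q) + 2 * P1 (snd q + snd p) * - Q1 (snd p - snd q) + P (snd q + snd p) * Q2 (snd p - snd q))
    + V (fst q) * ker n (fst p - fst q) * (P (snd q + snd p) * Q (snd p - snd q)))))" by (rule lint_cong) (auto simp: K_def k_def k2_def s_def t_def W2_def algebra_simps)
  also have "... = 0" unfolding integral_mult_right_zero using eq[OF c1 c2] by simp
  finally show ?thesis .
 qed
 define D where "D p h = ker n (fst h) * (4 * Q1 (snd h) * P1 (2 * snd p - snd h) + Q (snd h) * ((V (fst p) - V (fst p - fst h)) * P (2 * snd p - snd h)))"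
  for p h :: "plane"
 \<comment> \<open>All terms without a mixed derivative cancel; the mixed terms add up to 4 and the
   potentials leave their difference.\<close>
 have KD: "K 2 W1 p (p - h) - K (- 2) W2 p (p - h) = D p h" for p h by (simp add: K_def k_def k2_def s_def t_def W1_def W2_def D_def algebra_simps)
 have Db: "abs (D p h) <= (C + C) * ind (cball 0 (abs rk + abs rQ)) h" for p h proof -
  have k: "abs (K 2 W1 p (p - h)) <= C * ind (cball p (abs rk + abs rQ)) (p - h)"
    "abs (K (- 2) W2 p (p - h)) <= C * ind (cball p (abs rk + abs rQ)) (p - h)" by (rule Kb; auto simp: W1_def W2_def VB)+
  have e: "ind (cball p (abs rk + abs rQ)) (p - h) = (ind (cball 0 (abs rk + abs rQ)) h :: real)" by (auto simp: indicator_def dist_norm)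
  show ?thesis using k unfolding KD[symmetric] distrib_right e by linarith
 qed
 have Dm: "(%(p, h). D p h) : Borel2" unfolding D_def by measurable
 have iD: "integrable lborel2 (%(p, h). a p * a (p - h) * D p h)" by (rule L2_pair_integr_shift[OF a a Dm Db])
 define I where "I = (%(p, q). a p * a q * K 2 W1 p q - a p * a q * K (- 2) W2 p q)"
 have iI: "integrable lborel2 I" using integr_diff[OF i1 i2] by (simp add: I_def case_prod_unfold)
 have [measurable]: "I : Borel2" using borel_measurable_integrable[OF iI] by simp
 have "(LINT x|lborel2. I x) = (LINT x|lborel2. (%(p, q). a p * a q * K 2 W1 p q) x)
   - (LINT x|lborel2. (%(p, q). a p * a q * K (- 2) W2 p q) x)" using lint_diff[OF i1 i2] by (simp add: I_def case_prod_unfold)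
 also have "(LINT x|lborel2. (%(p, q). a p * a q * K 2 W1 p q) x) = (LBINT q. LBINT p. a p * a q * K 2 W1 p q)" using lborel_pair.integral_snd[OF i1] by simp
 also have "(LINT x|lborel2. (%(p, q). a p * a q * K (- 2) W2 p q) x) = (LBINT p. LBINT q. a p * a q * K (- 2) W2 p q)" using lborel_pair.integral_fst[OF i2] by simp
 finally have "(LINT x|lborel2. I x) = 0" by (simp add: z1 z2)
 then have "0 = (LBINT p. LBINT q. I (p, q))" using lborel_pair.integral_fst'[OF iI] by simp
 also have "... = (LBINT p. LBINT h. a p * a (p - h) * D p h)" proof (rule lint_cong[OF refl])
  fix p
  have "(LBINT q. I (p, q)) = (LBINT h. I (p, p - h))" by (rule lborel_reflect[symmetric]) measurable
  also have "... = (LBINT h. a p * a (p - h) * D p h)" by (rule lint_cong) (simp_all add: I_def KD[symmetric] right_diff_distrib)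
  finally show "(LBINT q. I (p, q)) = (LBINT h. a p * a (p - h) * D p h)" .
 qed
 also have "... = (LBINT h. LBINT p. a p * a (p - h) * D p h)" using lborel_pair.Fubini_integral[OF iD] by simp
 also have "... = (LBINT h. ker n (fst h) * (4 * Q1 (snd h) * (LBINT p. ?c h p)
   + Q (snd h) * (LBINT p. ?e h p)))" proof (rule lint_cong[OF refl])
  fix h
  have j1: "integr (%p. ?c h p)" by (rule corr_integrable[OF a a _ BP(3)]) measurable
  have j2: "integr (%p. ?e h p)" proof (rule corr_integrable[OF a a])
   fix p :: "plane"
   have "abs (V (fst p) - V (fst p - fst h)) <= 2 * BV" using VB[of "fst p"] VB[of "fst p - fst h"] by linarith
   then show "abs ((V (fst p) - V (fst p - fst h)) * P (2 * snd p - snd h)) <= 2 * BV * BP" unfolding abs_mult using BP BV0 by (intro mult_mono) auto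
  qed measurable
  have "(LBINT p. a p * a (p - h) * D p h) = (LBINT p. ker n (fst h) * (4 * Q1 (snd h)) * (?c h p)
    + ker n (fst h) * Q (snd h) * (?e h p))" by (rule lint_cong) (simp_all add: D_def algebra_simps)
  also have "... = ker n (fst h) * (4 * Q1 (snd h)) * (LBINT p. ?c h p)
    + ker n (fst h) * Q (snd h) * (LBINT p. ?e h p)" using j1 j2 by simp
  finally show "(LBINT p. a p * a (p - h) * D p h) = ker n (fst h) * (4 * Q1 (snd h) * (LBINT p. ?c h p)
   + Q (snd h) * (LBINT p. ?e h p))" by (simp add: algebra_simps)
 qed
 finally show ?thesis by simp
qed

text \<open>\<open>CC h\<close> is the autocorrelation for a plane shift and \<open>EE h\<close> the
  commutator with the potential. Letting the x-part of the shift tend to 0 in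
  \<open>corr_identity\<close> removes \<open>EE\<close>, and what remains says that
  \<open>CC (0, t)\<close> has zero weak derivative in t. Being continuous it is constant, and it
  decays for large shifts.\<close>

lemma autocorrelation_zero:
 fixes a :: "plane => real" and V :: "real => real"
 assumes a: "L2 a" and V[measurable]: "V : Borel" and VB: "!!x. abs (V x) <= BV"
  and eq: "!!al al1 al2 \<beta> \<beta>1 \<beta>2. C2c al al1 al2 ==> C2c \<beta> \<beta>1 \<beta>2 ==>
   (LBINT p. a p * (al2 (fst p) * \<beta> (snd p) + al (fst p) * \<beta>2 (snd p) + V (fst p) * al (fst p) * \<beta> (snd p))) = 0"
  and P: "C2c P P1 P2"
 shows "(LBINT p. (a p)^2 * P1 (2 * snd p)) = 0"
proof -
 have [measurable]: "a : Borel" using a by (simp add: L2_def)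
 note [measurable] = C2c_measurable[OF P] C2c_measurable[OF ker_C2c]
 obtain BP where BP: "BP >= 0" "!!x. abs (P x) <= BP" "!!x. abs (P1 x) <= BP" by (rule C2c_bounded[OF P]) blast
 have BV0: "BV >= 0" using VB[of 0] by linarith
 define CC where "CC h = (LBINT p. a p * a (p - h) * P1 (2 * snd p - snd h))" for h
 define EE where "EE h = (LBINT p. a p * a (p - h) * ((V (fst p) - V (fst p - fst h)) * P (2 * snd p - snd h)))" for h
 have [measurable]: "CC : Borel" unfolding CC_def by (rule param_integral_Borel) measurable
 have [measurable]: "EE : Borel" unfolding EE_def by (rule param_integral_Borel) measurable
 define N where "N = (LBINT p. (a p)^2) + (LBINT p. (a p)^2)"
 have N0: "N >= 0" unfolding N_def by simp
 have CCb: "abs (CC h) <= BP * N" for h unfolding CC_def N_def by (rule corr_bound[OF a a _ BP(3)]) measurable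
 have EEb: "abs (EE h) <= 2 * BV * BP * N" for h unfolding EE_def N_def proof (rule corr_bound[OF a a])
  fix p :: "plane"
  have "abs (V (fst p) - V (fst p - fst h)) <= 2 * BV" using VB[of "fst p"] VB[of "fst p - fst h"] by linarith
  then show "abs ((V (fst p) - V (fst p - fst h)) * P (2 * snd p - snd h)) <= 2 * BV * BP" unfolding abs_mult using BP BV0 by (intro mult_mono) auto
 qed measurable
 have contP: "isCont (%h. F (2 * snd p - snd h)) h0" if "continuous_on UNIV F" for F :: "real => real" and p h0 :: "plane"
  using that by (intro isCont_o2[where f="%h. 2 * snd p - snd h" and g=F] continuous_intros) (auto simp: continuous_on_eq_continuous_at)
 have CCc: "isCont CC h0" for h0 unfolding isCont_def CC_def by (rule corr_tendsto[OF a a _ BP(3)]) (use contP[OF C2c_cont(2)[OF P]] in \<open>auto simp: isCont_def\<close>)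
 have Va: "L2 (%p. V (fst p) * a p)" by (rule L2_mult_bounded[OF a _ VB]) measurable
 have EEc: "isCont EE h0" for h0 proof -
  \<comment> \<open>\<open>V\<close> may be discontinuous, so V(x) - V(x - s) need not become small
    pointwise. Written as two correlations, of \<open>V a\<close> with \<open>a\<close> and of
    \<open>a\<close> with \<open>V a\<close>, the term is continuous in the shift because
    \<open>V a\<close> is again in L2.\<close>
  have e1: "EE h = (LBINT p. (V (fst p) * a p) * a (p - h) * P (2 * snd p - snd h)) -
    (LBINT p. a p * (V (fst (p - h)) * a (p - h)) * P (2 * snd p - snd h))" for h proof -
   have "integr (%p. (V (fst p) * a p) * a (p - h) * P (2 * snd p - snd h))" by (rule corr_integrable[OF Va a _ BP(2)]) measurable
   moreover have "integr (%p. a p * (V (fst (p - h)) * a (p - h)) * P (2 * snd p - snd h))" using corr_integrable[OF a Va _ BP(2), of "%p. 2 * snd p - snd h" h] by simp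
   ultimately show ?thesis unfolding EE_def by (subst lint_diff[symmetric]) (auto intro!: lint_cong simp: algebra_simps)
  qed
  have e2: "isCont (%h. LBINT p. (V (fst p) * a p) * a (p - h) * P (2 * snd p - snd h)) h0"
   unfolding isCont_def by (rule corr_tendsto[OF Va a _ BP(2)]) (use contP[OF C2c_cont(1)[OF P]] in \<open>auto simp: isCont_def\<close>)
  have e3: "isCont (%h. LBINT p. a p * (V (fst (p - h)) * a (p - h)) * P (2 * snd p - snd h)) h0"
   unfolding isCont_def by (rule corr_tendsto[OF a Va _ BP(2)]) (use contP[OF C2c_cont(1)[OF P]] in \<open>auto simp: isCont_def\<close>)
  show ?thesis unfolding ext[of EE, OF e1] by (rule isCont_diff[OF e2 e3])
 qed
 have EE0: "EE (0, t) = 0" for t by (simp add: EE_def)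
 \<comment> \<open>Integrating \<open>corr_identity\<close> first over the z-shift leaves a bounded
   function of the x-shift with a limit at 0; \<open>ker n\<close> concentrates there, and the
   potential part of that limit is \<open>EE (0, t) = 0\<close>.\<close>
 have R: "(LBINT t. Q1 t * CC (0, t)) = 0" if Q: "C2c Q Q1 Q2" for Q Q1 Q2 proof -
  note [measurable] = C2c_measurable[OF Q]
  obtain BQ where BQ: "BQ >= 0" "!!x. abs (Q x) <= BQ" "!!x. abs (Q1 x) <= BQ" by (rule C2c_bounded[OF Q]) blast
  obtain rQ where rQ: "!!x. rQ < abs x ==> Q x = 0" "!!x. rQ < abs x ==> Q1 x = 0" by (rule C2c_supp[OF Q]) blast
  define G where "G s t = 4 * Q1 t * CC (s, t) + Q t * EE (s, t)" for s t
  have [measurable]: "(%(s, t). G s t) : Borel2" proof -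
   have [measurable]: "(%x::real\<times>real. CC x) : Borel2" "(%x::real\<times>real. EE x) : Borel2" by (simp_all add: borel_prod)
   show ?thesis unfolding G_def by measurable
  qed
  define BG where "BG = 4 * BQ * (BP * N) + BQ * (2 * BV * BP * N)"
  have Gb: "\<bar>G s t\<bar> <= BG * ind {-\<bar>rQ\<bar>..\<bar>rQ\<bar>} t" for s t proof (cases "abs t <= abs rQ")
   case True
   have "abs (4 * Q1 t * CC (s, t)) <= 4 * BQ * (BP * N)" unfolding abs_mult using BQ CCb by (intro mult_mono) auto
   moreover have "abs (Q t * EE (s, t)) <= BQ * (2 * BV * BP * N)" unfolding abs_mult using BQ EEb by (intro mult_mono) auto
   ultimately have "abs (G s t) <= BG" unfolding G_def BG_def by linarith
   then show ?thesis using True by (simp add: indicator_def abs_le_iff)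
  next
   case False
   then have "G s t = 0" using rQ[of t] by (simp add: G_def)
   moreover have "BG >= 0" unfolding BG_def using BQ BP BV0 N0 by simp
   ultimately show ?thesis by simp
  qed
  have BG0: "BG >= 0" using Gb[of 0 0] by (simp add: indicator_def)
  have iB: "integr (%t. BG * ind {-\<bar>rQ\<bar>..\<bar>rQ\<bar>} t)" by (intro integrable_mult_right) (simp add: integrable_indicator_iff)
  have Gi: "integr (G s)" for s proof (rule integr_bound[OF iB])
   show "AE t in lborel. norm (G s t) <= norm (BG * ind {-\<bar>rQ\<bar>..\<bar>rQ\<bar>} t)" using Gb BG0 by (intro AE_I2) (simp add: abs_mult)
  qed measurable
  define c where "c s = (LBINT t. G s t)" for s
  have [measurable]: "c : Borel" unfolding c_def by measurable
  have cb: "\<bar>c s\<bar> <= (LBINT t. BG * ind {-\<bar>rQ\<bar>..\<bar>rQ\<bar>} t)" for s proof -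
   have "abs (c s) <= (LBINT t. abs (G s t))" unfolding c_def by (rule integral_abs_bound)
   also have "... <= (LBINT t. BG * ind {-\<bar>rQ\<bar>..\<bar>rQ\<bar>} t)" by (rule integral_mono) (use Gi iB Gb in auto)
   finally show ?thesis .
  qed
  have clim: "(c \<longlongrightarrow> (LBINT t. G 0 t)) (at 0)" unfolding tendsto_at_iff_sequentially comp_def proof safe
   fix X :: "nat => real" assume X: "X ----> 0"
   show "(%i. c (X i)) ----> (LBINT t. G 0 t)" unfolding c_def proof (rule integral_dominated_convergence[OF _ _ iB])
    show "AE t in lborel. (%i. G (X i) t) ----> G 0 t" proof (intro AE_I2)
     fix t :: real
     have "(%i. (X i, t)) ----> (0, t)" by (intro tendsto_intros X)
     then have "(%i. CC (X i, t)) ----> CC (0, t)" "(%i. EE (X i, t)) ----> EE (0, t)" by (rule isCont_tendsto_compose[OF CCc], rule isCont_tendsto_compose[OF EEc])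
     then show "(%i. G (X i) t) ----> G 0 t" unfolding G_def by (intro tendsto_intros)
    qed
    show "AE t in lborel. norm (G (X i) t) <= BG * ind {-\<bar>rQ\<bar>..\<bar>rQ\<bar>} t" for i using Gb by simp
   qed measurable
  qed
  have "(%n. LBINT s. ker n s * c s) ----> (LBINT t. G 0 t)" by (rule ker_approx[OF _ cb clim]) measurable
  moreover have "(LBINT s. ker n s * c s) = 0" for n proof -
   obtain Bk where Bk: "Bk >= 0" "!!x. abs (ker n x) <= Bk" by (rule C2c_bounded[OF ker_C2c[of n]]) blast
   obtain rk where rk: "!!x. rk < abs x ==> ker n x = 0" by (rule C2c_supp[OF ker_C2c[of n]]) blast
   have int: "integrable lborel2 (%(s, t). ker n s * G s t)" unfolding lborel_prod proof (rule integr_compact[where B="Bk * BG" and r="abs rk + abs rQ"])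
    have "(%(s, t). ker n s * G s t) : Borel2" by measurable
    then show "(%(s, t). ker n s * G s t) : Borel" by (simp add: borel_prod)
    show "abs (case x of (s, t) => ker n s * G s t) <= Bk * BG" for x proof (cases x)
     case (Pair s t)
     have "abs (G s t) <= BG" using Gb[of s t] BG0 by (cases "- abs rQ <= t & t <= abs rQ") (auto simp: indicator_def)
     then show ?thesis using Pair Bk BG0 by (auto simp: abs_mult intro!: mult_mono)
    qed
    show "(case x of (s, t) => ker n s * G s t) = 0" if "abs rk + abs rQ < norm x" for x proof (cases x)
     case (Pair s t)
     have "norm x <= abs s + abs t" using sqrt_sum_squares_le_sum_abs by (simp add: Pair norm_prod_def)
     then consider "rk < abs s" | "rQ < abs t" using \<open>\<bar>rk\<bar> + \<bar>rQ\<bar> < norm x\<close> by linarith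
     then show ?thesis by cases (simp_all add: Pair rk rQ G_def)
    qed
   qed
   have "(LBINT s. ker n s * c s) = (LBINT s. LBINT t. ker n s * G s t)" by (simp add: c_def)
   also have "... = (LINT x|lborel2. (%(s, t). ker n s * G s t) x)" using lborel_pair.integral_fst[OF int] by simp
   also have "... = (LBINT h. ker n (fst h) * (4 * Q1 (snd h) * CC h + Q (snd h) * EE h))" unfolding lborel_prod by (simp add: split_beta G_def)
   also have "... = 0" unfolding CC_def EE_def by (rule corr_identity[OF a V VB eq P Q])
   finally show ?thesis .
  qed
  ultimately have "(%n::nat. 0) ----> (LBINT t. G 0 t)" by simp
  then have "(LBINT t. G 0 t) = 0" by (simp add: LIMSEQ_const_iff)
  then show ?thesis by (simp add: G_def EE0 mult.assoc)
 qed
 define c where "c t = CC (0, t)" for t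
 have [measurable]: "c : Borel" proof -
  have [measurable]: "(%x::real\<times>real. CC x) : Borel2" by (simp add: borel_prod)
  show ?thesis unfolding c_def by measurable
 qed
 have cc: "isCont c t" for t unfolding c_def by (rule isCont_o2[where f="%t. (0, t)" and g=CC]) (auto intro!: continuous_intros CCc)
 have cB: "abs (c t) <= BP * N" for t by (simp add: c_def CCb)
 \<comment> \<open>With Q' equal to the difference of two translated kernels, \<open>R\<close> says
   that the mollified \<open>c\<close> takes the same value at 0 and at \<open>L\<close>; the
   kernels then shrink to the points.\<close>
 have cL: "c 0 = c L" for L proof -
  have l1: "(%m. LBINT t. ker m t * c t) ----> c 0" by (rule ker_approx[OF _ cB]) (use cc[of 0] in \<open>auto simp: isCont_def\<close>)
  have l2: "(%m. LBINT t. ker m t * c (t + L)) ----> c L" proof (rule ker_approx[OF _ cB])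
   have "isCont (%t. c (t + L)) 0" by (rule isCont_o2[where f="%t. t + L" and g=c]) (auto intro!: continuous_intros cc)
   then show "((%t. c (t + L)) \<longlongrightarrow> c L) (at 0)" by (simp add: isCont_def)
  qed measurable
  have "(LBINT t. ker m t * c t) = (LBINT t. ker m t * c (t + L))" for m proof -
   obtain Q Q2 where Q: "C2c Q (%x. ker m (x - 0) - ker m (x - (0 + L))) Q2" by (rule C2c_ker_difference)
   have i: "integr (%t. ker m t * d t)" if [measurable]: "d : Borel" and "!!t. abs (d t) <= BP * N" for d proof (rule integr_bound[of _ "%t. BP * N * ker m t"])
    show "AE t in lborel. norm (ker m t * d t) <= norm (BP * N * ker m t)" using mult_left_mono[OF that(2) ker_nonneg[of m]] BP N0 ker_nonneg[of m]
     by (intro AE_I2) (simp add: abs_mult mult.commute)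
   qed (use C2c_integrable(1)[OF ker_C2c[of m]] in auto)
   have i1: "integr (%t. ker m t * c t)" by (rule i) (use cB in auto)
   have i2: "integr (%t. ker m t * c (t + L))" by (rule i) (use cB in auto)
   have i2': "integr (%t. ker m (t - L) * c t)" using i2 integr_shift[of "%t. ker m (t - L) * c t" L] by simp
   have "0 = (LBINT t. (ker m (t - 0) - ker m (t - (0 + L))) * c t)" using R[OF Q] by (simp add: c_def)
   also have "... = (LBINT t. ker m t * c t) - (LBINT t. ker m (t - L) * c t)" using i1 i2' by (simp add: left_diff_distrib)
   also have "(LBINT t. ker m (t - L) * c t) = (LBINT t. ker m t * c (t + L))" using lint_shift[of "%t. ker m (t - L) * c t" L] by simp
   finally show ?thesis by simp
  qed
  then show ?thesis using l1 l2 LIMSEQ_unique by simp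
 qed
 \<comment> \<open>For a shift by j the weight P'(2z - j) lives near z = j/2, so by Cauchy-Schwarz
   only the part of \<open>a\<close> on a strip that escapes to infinity contributes.\<close>
 have "(%j. c (real j)) ----> 0" proof (rule tendsto_rabs_zero_cancel, rule tendsto_sandwich[OF _ _ tendsto_const])
  define I where "I j = (LBINT p. (P1 (2 * snd p - real j) * a p)^2)" for j
  have "I ----> (LBINT p::real\<times>real. 0)" unfolding I_def proof (rule integral_dominated_convergence[where w="%p. BP^2 * (a p)^2"])
   obtain rP where rP: "!!x. rP < abs x ==> P1 x = 0" by (rule C2c_supp[OF P]) blast
   show "AE p in lborel. (%j. (P1 (2 * snd p - real j) * a p)^2) ----> 0" proof (intro AE_I2 tendsto_eventually)
    fix p :: "plane"
    obtain j0 where j0: "abs rP + abs (2 * snd p) + 1 <= real j0" using real_arch_simple by blast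
    show "eventually (%j. (P1 (2 * snd p - real j) * a p)^2 = 0) sequentially" proof (rule eventually_sequentiallyI[of j0])
     fix j assume "j0 <= j"
     then have "real j0 <= real j" by simp
     then have "rP < abs (2 * snd p - real j)" using j0 by linarith
     then show "(P1 (2 * snd p - real j) * a p)^2 = 0" by (simp add: rP)
    qed
   qed
   show "AE p in lborel. norm ((P1 (2 * snd p - real j) * a p)^2) <= BP^2 * (a p)^2" for j proof (intro AE_I2)
    fix p
    show "norm ((P1 (2 * snd p - real j) * a p)^2) <= BP^2 * (a p)^2" using BP(3)[of "2 * snd p - real j"] BP(1) abs_le_square_iff[of "P1 (2 * snd p - real j)" BP]
     by (simp add: power_mult_distrib mult_right_mono)
   qed
   show "integr (%p. BP^2 * (a p)^2)" using a by (simp add: L2_def)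
  qed measurable
  then have "I ----> 0" by simp
  from tendsto_mult_left[OF tendsto_real_sqrt[OF this], of "sqrt (LBINT p. (a p)^2)"]
  show "(%j. sqrt (LBINT p. (a p)^2) * sqrt (I j)) ----> 0" by simp
  show "\<forall>\<^sub>F j in sequentially. abs (c (real j)) <= sqrt (LBINT p. (a p)^2) * sqrt (I j)" proof (intro always_eventually allI)
   fix j
   have "abs (c (real j)) = abs (LBINT p. (P1 (2 * snd p - real j) * a p) * a (p - (0, real j)))" by (simp add: c_def CC_def mult_ac)
   also have "... <= sqrt (I j) * sqrt (LBINT p. (a (p - (0, real j)))^2)" unfolding I_def by (rule L2_Cauchy_Schwarz[OF L2_mult_bounded[OF a _ BP(3)] L2_shift_minus[OF a]]) measurable
   also have "(LBINT p. (a (p - (0, real j)))^2) = (LBINT p. (a p)^2)" proof -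
    have "(%p. (a p)^2) : Borel" by measurable
    from lint_shift[OF this, of "- (0, real j)"] show ?thesis by (simp only: diff_conv_add_uminus)
   qed
   finally show "abs (c (real j)) <= sqrt (LBINT p. (a p)^2) * sqrt (I j)" by (simp add: mult.commute)
  qed
 qed simp
 moreover have "(%j. c (real j)) = (%j. c 0)" by (rule ext) (rule cL[symmetric])
 ultimately have "c 0 = 0" by (simp add: LIMSEQ_const_iff)
 then show ?thesis by (simp add: c_def CC_def power2_eq_square zero_prod_def[symmetric])
qed

text \<open>Choosing P' as the difference of two translated kernels in
  \<open>autocorrelation_zero\<close> shows that the integral of a^2 weighted by
  \<open>ker 0 (2 * snd p - c)\<close> is the same for all c. It tends to 0 as c grows, so it
  vanishes, and the weight is nonnegative.\<close>

theorem L2_solution_zero: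
 fixes a :: "plane => real" and V :: "real => real"
 assumes a: "L2 a" and V: "V : Borel" and VB: "!!x. abs (V x) <= BV"
  and eq: "!!al al1 al2 \<beta> \<beta>1 \<beta>2. C2c al al1 al2 ==> C2c \<beta> \<beta>1 \<beta>2 ==>
   (LBINT p. a p * (al2 (fst p) * \<beta> (snd p) + al (fst p) * \<beta>2 (snd p) + V (fst p) * al (fst p) * \<beta> (snd p))) = 0"
 shows "AE p in lborel. a p = 0"
proof -
 have [measurable]: "a : Borel" using a by (simp add: L2_def)
 note [measurable] = C2c_measurable[OF ker_C2c]
 obtain Bk where Bk: "Bk >= 0" "!!x. abs (ker 0 x) <= Bk" by (rule C2c_bounded[OF ker_C2c[of 0]]) blast
 have i: "integr (%p. (a p)^2 * ker 0 (2 * snd p - c))" for c proof (rule integr_bound[of _ "%p. Bk * (a p)^2"])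
  show "AE p in lborel. norm ((a p)^2 * ker 0 (2 * snd p - c)) <= norm (Bk * (a p)^2)" proof (intro AE_I2)
   fix p show "norm ((a p)^2 * ker 0 (2 * snd p - c)) <= norm (Bk * (a p)^2)" using mult_left_mono[OF Bk(2)[of "2 * snd p - c"] zero_le_power2[of "a p"]] Bk(1)
    by (simp add: abs_mult mult.commute[of Bk])
  qed
 qed (use a in \<open>auto simp: L2_def\<close>)
 have z: "(LBINT p. (a p)^2 * ker 0 (2 * snd p - c)) = 0" for c proof -
  have e: "(LBINT p. (a p)^2 * ker 0 (2 * snd p - c)) = (LBINT p. (a p)^2 * ker 0 (2 * snd p - (c + L)))" for L proof -
   obtain P P2 where P: "C2c P (%x. ker 0 (x - c) - ker 0 (x - (c + L))) P2" by (rule C2c_ker_difference)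
   have "0 = (LBINT p. (a p)^2 * (ker 0 (2 * snd p - c) - ker 0 (2 * snd p - (c + L))))" using autocorrelation_zero[OF a V VB eq P] by simp
   also have "... = (LBINT p. (a p)^2 * ker 0 (2 * snd p - c)) - (LBINT p. (a p)^2 * ker 0 (2 * snd p - (c + L)))" unfolding right_diff_distrib by (rule lint_diff[OF i i])
   finally show ?thesis by simp
  qed
  have "(%j. LBINT p. (a p)^2 * ker 0 (2 * snd p - (c + real j))) ----> (LBINT p::real\<times>real. 0)" proof (rule integral_dominated_convergence[where w="%p. Bk * (a p)^2"])
   show "AE p in lborel. (%j. (a p)^2 * ker 0 (2 * snd p - (c + real j))) ----> 0" proof (intro AE_I2 tendsto_eventually)
    fix p :: "plane"
    obtain j0 where j0: "abs c + abs (2 * snd p) + 1 <= real j0" using real_arch_simple by blast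
    show "eventually (%j. (a p)^2 * ker 0 (2 * snd p - (c + real j)) = 0) sequentially" proof (rule eventually_sequentiallyI[of j0])
     fix j assume "j0 <= j"
     then have "real j0 <= real j" by simp
     then have "1 <= abs (2 * snd p - (c + real j))" using j0 by linarith
     then show "(a p)^2 * ker 0 (2 * snd p - (c + real j)) = 0" by (simp add: ker_zero)
    qed
   qed
   show "AE p in lborel. norm ((a p)^2 * ker 0 (2 * snd p - (c + real j))) <= Bk * (a p)^2" for j proof (intro AE_I2)
    fix p show "norm ((a p)^2 * ker 0 (2 * snd p - (c + real j))) <= Bk * (a p)^2" using mult_left_mono[OF Bk(2)[of "2 * snd p - (c + real j)"] zero_le_power2[of "a p"]]
     by (simp add: abs_mult mult.commute[of Bk])
   qed
  qed (use a in \<open>auto simp: L2_def\<close>)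
  then show ?thesis unfolding e[symmetric] by (simp add: LIMSEQ_const_iff)
 qed
 have "AE p in lborel. (a p)^2 * ker 0 (2 * snd p - c) = 0" for c using z[of c] integral_nonneg_eq_0_iff_AE[OF i[of c]] ker_nonneg by auto
 \<comment> \<open>Countably many centres suffice: 2z is at distance less than 1 from its floor, and
   \<open>ker 0\<close> is positive there.\<close>
 then have "AE p in lborel. ALL c::int. (a p)^2 * ker 0 (2 * snd p - of_int c) = 0" by (subst AE_all_countable) auto
 then show ?thesis proof (rule AE_mp, intro AE_I2 impI)
  fix p :: "plane" assume *: "ALL c::int. (a p)^2 * ker 0 (2 * snd p - of_int c) = 0"
  have "abs (2 * snd p - of_int \<lfloor>2 * snd p\<rfloor>) < 1" by linarith
  from ker_pos[OF this] * show "a p = 0" by (metis less_irrefl mult_eq_0_iff zero_eq_power2)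
 qed
qed

section \<open>Differentiability of convex functions\<close>

lemma C2c_second_difference:
 assumes "C2c a a1 a2" "!!x. abs (a2 x) <= B" "t > 0"
 shows "abs (a (x - t) + a (x + t) - 2 * a x) <= 2 * B * t^2"
proof -
 have d: "!!x. (a has_real_derivative a1 x) (at x)" "!!x. (a1 has_real_derivative a2 x) (at x)" using assms by (auto simp: C2c_def)
 obtain u where u: "x < u" "u < x + t" "a (x + t) - a x = (x + t - x) * a1 u" using MVT2[of x "x + t" a a1] d assms(3) by auto
 obtain w where w: "x - t < w" "w < x" "a x - a (x - t) = (x - (x - t)) * a1 w" using MVT2[of "x - t" x a a1] d assms(3) by auto
 obtain y where y: "w < y" "y < u" "a1 u - a1 w = (u - w) * a2 y" using MVT2[of w u a1 a2] d u w by auto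
 have "a (x - t) + a (x + t) - 2 * a x = t * (a1 u - a1 w)" using u(3) w(3) by (simp add: algebra_simps)
 also have "... = t * ((u - w) * a2 y)" using y(3) by simp
 also have "abs ... <= t * ((2 * t) * B)" unfolding abs_mult using assms(2)[of y] assms(3) u w by (intro mult_mono) auto
 finally show ?thesis by (simp add: power2_eq_square mult_ac)
qed

lemma convex_second_difference_nonneg:
 fixes d :: "'a::real_vector => real"
 assumes "convex_on UNIV d"
 shows "0 <= d (p + v) + d (p - v) - 2 * d p"
proof -
 have "d ((1 - 1/2) *R (p + v) + (1/2) *R (p - v)) <= (1 - 1/2) * d (p + v) + (1/2) * d (p - v)" by (rule convex_onD[OF assms]) auto
 moreover have "(1 - 1/2) *R (p + v) + (1/2) *R (p - v) = p" by (simp add: scaleR_add_right scaleR_diff_right flip: scaleR_left_distrib)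
 ultimately show ?thesis by simp
qed

text \<open>Differentiability in one direction, in the form of small symmetric second differences.
  Against a smooth weight \<open>z\<close>, translation invariance moves the second difference from
  \<open>d\<close> to \<open>z\<close>, where it is of order t^2. Since convexity makes the second
  differences of \<open>d\<close> nonnegative, their quotients by t tend to 0 in L1 against
  \<open>z\<close>, hence almost everywhere along a subsequence of t = 1/(n+1).\<close>

lemma convex_second_difference_AE:
 fixes d :: "plane => real"
 assumes d: "convex_on UNIV d" and e: "e = (1, 0) | e = (0, 1)"
 shows "AE p in lborel. ALL ep>0. EX t>0. d (p + t *R e) + d (p - t *R e) - 2 * d p <= ep * t"
proof -
 have contd: "continuous_on UNIV d" by (rule convex_on_continuous[OF open_UNIV d])
 have [measurable]: "d : Borel" using contd by (rule borel_measurable_continuous_onI)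
 define de where "de n p = real (Suc n) * (d (p + (1 / real (Suc n)) *R e) + d (p - (1 / real (Suc n)) *R e) - 2 * d p)" for n p
 define b where "b k x = bump (1 / real (Suc k) * x + 0)" for k x
 have *: "AE p in lborel. b k (fst p) * b k (snd p) ~= 0 --> (ALL ep>0. EX t>0. d (p + t *R e) + d (p - t *R e) - 2 * d p <= ep * t)" for k proof -
  obtain b1 b2 where b: "C2c (b k) b1 b2" proof -
   have "1 / real (Suc k) ~= 0" by simp
   from C2c_affine[OF bump_C2c this, of 0] show ?thesis using that unfolding b_def[abs_def] by blast
  qed
  note [measurable] = C2c_measurable(1)[OF b]
  obtain B where B: "B >= 0" "!!x. abs (b k x) <= B" "!!x. abs (b2 x) <= B" by (rule C2c_bounded[OF b]) blast
  obtain r where r: "r > 0" "!!x. r < abs x ==> b k x = 0" by (rule C2c_supp[OF b]) blast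
  define z where "z p = b k (fst p) * b k (snd p)" for p
  have [measurable]: "z : Borel" unfolding z_def[abs_def] by (intro borel_measurable_continuous_onI continuous_intros continuous_on_compose2[OF C2c_cont(1)[OF b]]) auto
  have zpos: "z p >= 0" for p by (simp add: z_def b_def bump_def)
  have z0: "z p = 0" if "2 * r < norm p" for p proof -
   have "norm p <= abs (fst p) + abs (snd p)" using sqrt_sum_squares_le_sum_abs by (cases p) (simp add: norm_prod_def)
   then have "r < abs (fst p) | r < abs (snd p)" using that by linarith
   then show ?thesis using r by (auto simp: z_def)
  qed
  have zB: "abs (z p) <= B * B" for p unfolding z_def abs_mult by (intro mult_mono B) (use B in auto)
  obtain D where D: "!!p. norm p <= 2 * r + 2 ==> abs (d p) <= D" "D >= 0" proof -
   have "compact (d ` cball 0 (2 * r + 2))" by (intro compact_continuous_image continuous_on_subset[OF contd]) auto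
   then have "bounded (d ` cball 0 (2 * r + 2))" by (rule compact_imp_bounded)
   then obtain D where "ALL y:d ` cball 0 (2 * r + 2). norm y <= D" unfolding bounded_iff by blast
   then have "abs (d p) <= max D 0" if "norm p <= 2 * r + 2" for p using that by force
   then show ?thesis using that[of "max D 0"] by simp
  qed
  have ne: "norm e = 1" using e by (auto simp: norm_prod_def)
  have int: "integr (%p. z (p + v) * d (p + w))" if "norm v <= 1" "norm w <= 1" for v w proof (rule integr_compact[where B="B * B * D" and r="2 * r + 1"])
   show "abs (z (p + v) * d (p + w)) <= B * B * D" for p proof (cases "norm p <= 2 * r + 1")
    case True
    then have "norm (p + w) <= 2 * r + 2" using norm_triangle_ineq[of p w] that by linarith
    then show ?thesis unfolding abs_mult using zB D B by (intro mult_mono) auto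
   next
    case False
    then have "2 * r < norm (p + v)" using norm_diff_ineq[of p v] that by linarith
    then show ?thesis using z0 B D by simp
   qed
   show "z (p + v) * d (p + w) = 0" if "2 * r + 1 < norm p" for p using z0[of "p + v"] norm_diff_ineq[of p v] that \<open>norm v <= 1\<close> by simp
  qed measurable
  have de0: "0 <= de n p" for n p unfolding de_def using convex_second_difference_nonneg[OF d] by (intro mult_nonneg_nonneg) auto
  have [measurable]: "de n : Borel" for n unfolding de_def by measurable
  define C where "C = 2 * B * B * D * measure lborel (cball (0::real\<times>real) (2 * r + 1))"
  have bound: "(LBINT p. z p * de n p) <= C * (1 / real (Suc n))" and intz: "integr (%p. z p * de n p)" for n proof -
   define t where "t = 1 / real (Suc n)"
   have t: "t > 0" "t <= 1" "real (Suc n) = 1 / t" by (auto simp: t_def)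
   have nt: "norm (t *R e) <= 1" "norm (- (t *R e)) <= 1" using t ne by auto
   have ii: "integr (%p. z p * d (p + t *R e))" "integr (%p. z p * d (p - t *R e))" "integr (%p. z p * d p)"
     "integr (%p. z (p + t *R e) * d p)" "integr (%p. z (p - t *R e) * d p)"
    using int[of 0 "t *R e"] int[of 0 "- (t *R e)"] int[of 0 0] int[of "t *R e" 0] int[of "- (t *R e)" 0] nt by auto
   have ez: "(%p. z p * de n p) = (%p. real (Suc n) * (z p * d (p + t *R e) + z p * d (p - t *R e) - 2 * (z p * d p)))" by (rule ext) (simp add: de_def t_def algebra_simps)
   show "integr (%p. z p * de n p)" unfolding ez using ii by (intro integrable_mult_right) auto
   have "(LBINT p. z p * de n p) = real (Suc n) * ((LBINT p. z p * d (p + t *R e)) + (LBINT p. z p * d (p - t *R e)) - 2 * (LBINT p. z p * d p))" unfolding ez using ii by simp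
   also have "(LBINT p. z p * d (p + t *R e)) = (LBINT p. z (p - t *R e) * d p)" using lint_shift[of "%p. z (p - t *R e) * d p" "t *R e"] by simp
   also have "(LBINT p. z p * d (p - t *R e)) = (LBINT p. z (p + t *R e) * d p)" using lint_shift[of "%p. z (p + t *R e) * d p" "- (t *R e)"] by simp
   also have "(LBINT p. z (p - t *R e) * d p) + (LBINT p. z (p + t *R e) * d p) - 2 * (LBINT p. z p * d p)
    = (LBINT p. (z (p - t *R e) + z (p + t *R e) - 2 * z p) * d p)" proof -
    have "(LBINT p. (z (p - t *R e) + z (p + t *R e) - 2 * z p) * d p)
     = (LBINT p. z (p - t *R e) * d p + z (p + t *R e) * d p - 2 * (z p * d p))" by (rule lint_cong) (simp_all add: algebra_simps)
    also have "... = (LBINT p. z (p - t *R e) * d p) + (LBINT p. z (p + t *R e) * d p) - 2 * (LBINT p. z p * d p)" using ii by simp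
    finally show ?thesis by simp
   qed
   finally have e1: "(LBINT p. z p * de n p) = real (Suc n) * (LBINT p. (z (p - t *R e) + z (p + t *R e) - 2 * z p) * d p)" .
   have "(LBINT p. (z (p - t *R e) + z (p + t *R e) - 2 * z p) * d p) <= (LBINT p::real\<times>real. (2 * B * t^2 * B * D) * ind (cball 0 (2 * r + 1)) p)" proof (rule integral_mono)
    have "integr (%p. z (p - t *R e) * d p + z (p + t *R e) * d p - 2 * (z p * d p))" using ii by (intro integr_diff integr_add integrable_mult_right) auto
    then show "integr (%p. (z (p - t *R e) + z (p + t *R e) - 2 * z p) * d p)" by (simp add: algebra_simps)
    show "integr (%p::real\<times>real. (2 * B * t^2 * B * D) * ind (cball 0 (2 * r + 1)) p)" using emeasure_bounded_finite[of "cball 0 (2 * r + 1) :: (real\<times>real) set"]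
     by (intro integrable_mult_right) (simp add: integrable_indicator_iff)
    fix p
    show "(z (p - t *R e) + z (p + t *R e) - 2 * z p) * d p <= (2 * B * t^2 * B * D) * ind (cball 0 (2 * r + 1)) p" proof (cases "norm p <= 2 * r + 1")
     case False
     have "2 * r < norm (p + t *R e)" "2 * r < norm (p - t *R e)" "2 * r < norm p" using False norm_diff_ineq[of p "t *R e"] norm_triangle_ineq2[of p "t *R e"] nt by linarith+
     then show ?thesis using z0 False by simp
    next
     case True
     have "abs (z (p - t *R e) + z (p + t *R e) - 2 * z p) <= 2 * B * t^2 * B" proof -
      consider "e = (1, 0)" | "e = (0, 1)" using e by blast
      then show ?thesis proof cases
       case 1
       have "z (p - t *R e) + z (p + t *R e) - 2 * z p = (b k (fst p - t) + b k (fst p + t) - 2 * b k (fst p)) * b k (snd p)" by (simp add: z_def 1 algebra_simps)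
       also have "abs ... <= (2 * B * t^2) * B" unfolding abs_mult[of "b k (fst p - t) + b k (fst p + t) - 2 * b k (fst p)"]
        using C2c_second_difference[OF b B(3) t(1), of "fst p"] B by (intro mult_mono) auto
       finally show ?thesis .
      next
       case 2
       have "z (p - t *R e) + z (p + t *R e) - 2 * z p = (b k (snd p - t) + b k (snd p + t) - 2 * b k (snd p)) * b k (fst p)" by (simp add: z_def 2 algebra_simps)
       also have "abs ... <= (2 * B * t^2) * B" unfolding abs_mult[of "b k (snd p - t) + b k (snd p + t) - 2 * b k (snd p)"]
        using C2c_second_difference[OF b B(3) t(1), of "snd p"] B by (intro mult_mono) auto
       finally show ?thesis .
      qed
     qed
     moreover have "abs (d p) <= D" using D True by simp
     ultimately have "abs (z (p - t *R e) + z (p + t *R e) - 2 * z p) * abs (d p) <= (2 * B * t^2 * B) * D" using B by (intro mult_mono) auto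
     then show ?thesis using True abs_ge_self[of "(z (p - t *R e) + z (p + t *R e) - 2 * z p) * d p"] by (simp add: abs_mult)
    qed
   qed
   also have "... = t^2 * C" by (simp add: C_def mult_ac)
   finally have "(LBINT p. z p * de n p) <= real (Suc n) * (t^2 * C)" unfolding e1 by (intro mult_left_mono) simp_all
   also have "... = C * (1 / real (Suc n))" unfolding t_def by (simp add: power2_eq_square)
   finally show "(LBINT p. z p * de n p) <= C * (1 / real (Suc n))" .
  qed
  have "(%n. LBINT p. norm (z p * de n p)) ----> 0" proof (rule tendsto_sandwich[OF _ _ tendsto_const])
   have "(%n. 1 / real (Suc n)) ----> 0" using LIMSEQ_inverse_real_of_nat by (simp add: inverse_eq_divide)
   from tendsto_mult_left[OF this, of C] show "(%n. C * (1 / real (Suc n))) ----> 0" by simp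
   show "\<forall>\<^sub>F n in sequentially. (LBINT p. norm (z p * de n p)) <= C * (1 / real (Suc n))" using bound zpos de0 by simp
  qed simp
  \<comment> \<open>A subsequence is enough because the claim asks for one \<open>t\<close> for each
    \<open>ep\<close>.\<close>
  from tendsto_L1_AE_subseq[OF intz this] obtain s where s: "AE p in lborel. (%n. z p * de (s n) p) ----> 0" by blast
  then show ?thesis proof (rule AE_mp, intro AE_I2 impI allI)
   fix p ep assume l: "(%n. z p * de (s n) p) ----> 0" and nz: "b k (fst p) * b k (snd p) ~= 0" and "(0::real) < ep"
   have zp: "z p > 0" using zpos[of p] nz unfolding z_def by linarith
   then have "0 < z p * ep" using \<open>0 < ep\<close> by simp
   then have "eventually (%n. z p * de (s n) p < z p * ep) sequentially" by (rule order_tendstoD(2)[OF l])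
   then obtain n where "z p * de (s n) p < z p * ep" by (auto simp: eventually_sequentially)
   then have n: "de (s n) p < ep" using zp by simp
   show "EX t>0. d (p + t *R e) + d (p - t *R e) - 2 * d p <= ep * t" proof (intro exI conjI)
    show "0 < 1 / real (Suc (s n))" by simp
    show "d (p + (1 / real (Suc (s n))) *R e) + d (p - (1 / real (Suc (s n))) *R e) - 2 * d p <= ep * (1 / real (Suc (s n)))" using n unfolding de_def by (simp add: field_simps)
   qed
  qed
 qed
 then have "AE p in lborel. ALL k. b k (fst p) * b k (snd p) ~= 0 --> (ALL ep>0. EX t>0. d (p + t *R e) + d (p - t *R e) - 2 * d p <= ep * t)" by (subst AE_all_countable) auto
 then show ?thesis proof (rule AE_mp, intro AE_I2 impI)
  fix p :: "plane"
  assume *: "ALL k. b k (fst p) * b k (snd p) ~= 0 --> (ALL ep>0. EX t>0. d (p + t *R e) + d (p - t *R e) - 2 * d p <= ep * t)"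
  obtain k where k: "abs (fst p) + abs (snd p) < real k" using reals_Archimedean2 by blast
  have bp: "b k x > 0" if "abs x < real k" for x unfolding b_def using that by (intro bump_pos) (simp add: abs_mult divide_less_eq)
  have "b k (fst p) > 0" "b k (snd p) > 0" using k by (intro bp; linarith)+
  then show "ALL ep>0. EX t>0. d (p + t *R e) + d (p - t *R e) - 2 * d p <= ep * t" using * by (metis less_irrefl mult_eq_0_iff)
 qed
qed

text \<open>By convexity the right difference quotients decrease to \<open>c\<close> as t decreases
  to 0, and every left quotient lies below \<open>c\<close>. A single \<open>t0\<close> at which the
  second difference is at most \<open>ep * t0\<close> squeezes both quotients to within
  \<open>ep\<close> of \<open>c\<close>, and monotonicity extends this to all smaller
  \<open>t\<close>.\<close>

lemma convex_directional_derivative: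
 fixes d :: "'a::real_vector => real"
 assumes d: "convex_on UNIV d" and sd: "!!ep. ep > 0 ==> EX t>0. d (p + t *R e) + d (p - t *R e) - 2 * d p <= ep * t"
 shows "EX c. ALL ep>0. EX t0>0. ALL t. abs t <= t0 --> abs (d (p + t *R e) - d p - c * t) <= ep * abs t"
proof -
 define f where "f t = d (p + t *R e) - d p" for t
 have scale: "f (l * t) <= l * f t" if "0 <= l" "l <= 1" for l t proof -
  have "d ((1 - l) *R p + l *R (p + t *R e)) <= (1 - l) * d p + l * d (p + t *R e)" by (rule convex_onD[OF d]) (use that in auto)
  moreover have "(1 - l) *R p + l *R (p + t *R e) = p + (l * t) *R e" by (simp add: algebra_simps)
  ultimately show ?thesis by (simp add: f_def algebra_simps)
 qed
 have mono: "f s / s <= f t / t" "f (- s) / s <= f (- t) / t" if "0 < s" "s <= t" for s t proof -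
  have "f (s / t * t) <= s / t * f t" "f (s / t * (- t)) <= s / t * f (- t)" by (rule scale; use that in simp)+
  then show "f s / s <= f t / t" "f (- s) / s <= f (- t) / t" using that by (auto simp: field_simps)
 qed
 have opp: "- (f (- s) / s) <= f t / t" if "0 < s" "0 < t" for s t proof -
  have "d ((1 - s / (s + t)) *R (p + (- s) *R e) + (s / (s + t)) *R (p + t *R e)) <=
    (1 - s / (s + t)) * d (p + (- s) *R e) + (s / (s + t)) * d (p + t *R e)" by (rule convex_onD[OF d]) (use that in auto)
  moreover have "(1 - s / (s + t)) *R (p + (- s) *R e) + (s / (s + t)) *R (p + t *R e) =
    p + (- ((1 - s / (s + t)) * s) + s / (s + t) * t) *R e" by (simp add: algebra_simps)
  moreover have "- ((1 - s / (s + t)) * s) + s / (s + t) * t = 0" using that by (simp add: field_simps)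
  ultimately have "d p <= (1 - s / (s + t)) * d (p + (- s) *R e) + (s / (s + t)) * d (p + t *R e)" by simp
  moreover have alg: "(1 - l) * (A - C) + l * (B - C) = (1 - l) * A + l * B - C" for l A B C :: real by (simp add: algebra_simps)
  have "(1 - s / (s + t)) * f (- s) + (s / (s + t)) * f t = (1 - s / (s + t)) * d (p + (- s) *R e) + (s / (s + t)) * d (p + t *R e) - d p" unfolding f_def by (rule alg)
  ultimately have "0 <= (1 - s / (s + t)) * f (- s) + (s / (s + t)) * f t" by linarith
  also have "... = (t * f (- s) + s * f t) / (s + t)" proof -
   have "1 - s / (s + t) = t / (s + t)" using that by (simp add: field_simps)
   then show ?thesis by (simp add: add_divide_distrib)
  qed
  finally have "0 <= t * f (- s) + s * f t" using that by (simp add: zero_le_divide_iff)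
  then show ?thesis using that by (simp add: field_simps)
 qed
 define c where "c = (INF t\<in>{0<..}. f t / t)"
 have bdd: "bdd_below ((%t. f t / t) ` {0<..})" by (rule bdd_belowI[of _ "- (f (- 1) / 1)"]) (use opp[of 1] in auto)
 have cu: "c <= f t / t" if "t > 0" for t unfolding c_def by (rule cINF_lower[OF bdd]) (use that in auto)
 have cl: "- (f (- s) / s) <= c" if "s > 0" for s unfolding c_def by (rule cINF_greatest) (use that opp in auto)
 show ?thesis proof (rule exI[of _ c], intro allI impI)
  fix ep :: real assume "ep > 0"
  from sd[OF this] obtain t0 where t0: "t0 > 0" "f t0 + f (- t0) <= ep * t0" by (auto simp: f_def)
  then have t0': "f t0 / t0 + f (- t0) / t0 <= ep" by (simp add: field_simps)
  show "EX t0>0. ALL t. abs t <= t0 --> abs (d (p + t *R e) - d p - c * t) <= ep * abs t" proof (intro exI[of _ t0] conjI allI impI t0(1))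
   fix t assume "abs t <= t0"
   consider "t > 0" | "t = 0" | "t < 0" by linarith
   then show "abs (d (p + t *R e) - d p - c * t) <= ep * abs t" proof cases
    case 1
    have "0 <= f t / t - c" "f t / t - c <= ep" using cu[OF 1] mono(1)[of t t0] cl[OF t0(1)] t0' 1 \<open>\<bar>t\<bar> <= t0\<close> by linarith+
    then have "abs (f t - c * t) <= ep * t" using 1 by (simp add: field_simps)
    then show ?thesis using 1 by (simp add: f_def)
   next
    case 3
    define s where "s = - t"
    have s: "s > 0" "s <= t0" using 3 \<open>\<bar>t\<bar> <= t0\<close> by (auto simp: s_def)
    have "0 <= f (- s) / s + c" "f (- s) / s + c <= ep" using cl[OF s(1)] mono(2)[OF s] cu[OF t0(1)] t0' by linarith+
    then have "abs (f (- s) + c * s) <= ep * s" using s by (simp add: field_simps)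
    then show ?thesis using 3 by (simp add: f_def s_def)
   qed simp
  qed
 qed
qed

text \<open>For convex functions partial derivatives give full differentiability. The remainder
  \<open>k\<close> is convex: \<open>k v\<close> is at most the mean of \<open>k\<close> at the
  doubled coordinate vectors, which bounds it above by \<open>ep * norm v\<close>, and
  \<open>- k (- v) <= k v\<close> turns this into a lower bound.\<close>

lemma convex_differentiable_plane:
 fixes d :: "plane => real"
 assumes d: "convex_on UNIV d"
  and 1: "!!ep. ep > 0 ==> EX t>0. d (p + t *R (1, 0)) + d (p - t *R (1, 0)) - 2 * d p <= ep * t"
  and 2: "!!ep. ep > 0 ==> EX t>0. d (p + t *R (0, 1)) + d (p - t *R (0, 1)) - 2 * d p <= ep * t"
 shows "EX g. gradient d g p"
proof -
 obtain c1 where c1: "!!ep. ep > 0 ==> EX t0>0. ALL t. abs t <= t0 --> abs (d (p + t *R (1, 0)) - d p - c1 * t) <= ep * abs t" using convex_directional_derivative[OF d 1] by blast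
 obtain c2 where c2: "!!ep. ep > 0 ==> EX t0>0. ALL t. abs t <= t0 --> abs (d (p + t *R (0, 1)) - d p - c2 * t) <= ep * abs t" using convex_directional_derivative[OF d 2] by blast
 define k where "k v = d (p + v) - d p - (c1, c2) \<bullet> v" for v
 have kneg: "- k (- v) <= k v" for v using convex_second_difference_nonneg[OF d, of p v] by (simp add: k_def inner_minus_right)
 have kmid: "k v <= (k (2 * fst v, 0) + k (0, 2 * snd v)) / 2" for v proof -
  have "d ((1 - 1/2) *R (p + (2 * fst v, 0)) + (1/2) *R (p + (0, 2 * snd v))) <=
    (1 - 1/2) * d (p + (2 * fst v, 0)) + (1/2) * d (p + (0, 2 * snd v))" by (rule convex_onD[OF d]) auto
  moreover have "(1 - 1/2) *R (p + (2 * fst v, 0)) + (1/2) *R (p + (0, 2 * snd v)) = p + v" by (cases p; cases v) (simp add: field_simps)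
  ultimately show ?thesis by (cases v) (simp add: k_def field_simps)
 qed
 have "gradient d (c1, c2) p" unfolding has_derivative_at_alt proof (intro conjI allI impI)
  show "bounded_linear ((\<bullet>) (c1, c2))" by (rule bounded_linear_inner_right)
  fix ep :: real assume "ep > 0"
  then have "ep / 2 > 0" by simp
  obtain t1 where t1: "t1 > 0" "!!t. abs t <= t1 ==> abs (d (p + t *R (1, 0)) - d p - c1 * t) <= ep / 2 * abs t" using c1[OF \<open>ep / 2 > 0\<close>] by blast
  obtain t2 where t2: "t2 > 0" "!!t. abs t <= t2 ==> abs (d (p + t *R (0, 1)) - d p - c2 * t) <= ep / 2 * abs t" using c2[OF \<open>ep / 2 > 0\<close>] by blast
  have ub: "k v <= ep * norm v" if "norm v < min t1 t2 / 2" for v proof -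
   have n: "abs (fst v) <= norm v" "abs (snd v) <= norm v" using norm_fst_le[of "fst v" "snd v"] norm_snd_le[of "snd v" "fst v"] by simp_all
   have "k (2 * fst v, 0) <= ep / 2 * abs (2 * fst v)" proof -
    have "abs (2 * fst v) <= t1" using n that by auto
    from abs_le_D1[OF t1(2)[OF this]] show ?thesis by (simp add: k_def)
   qed
   moreover have "k (0, 2 * snd v) <= ep / 2 * abs (2 * snd v)" proof -
    have "abs (2 * snd v) <= t2" using n that by auto
    from abs_le_D1[OF t2(2)[OF this]] show ?thesis by (simp add: k_def)
   qed
   moreover have "ep * abs (fst v) <= ep * norm v" "ep * abs (snd v) <= ep * norm v" using n \<open>ep > 0\<close> by auto
   ultimately show ?thesis using kmid[of v] by (simp add: abs_mult)
  qed
  show "EX de>0. ALL y. norm (y - p) < de --> norm (d y - d p - (c1, c2) \<bullet> (y - p)) <= ep * norm (y - p)" proof (intro exI[of _ "min t1 t2 / 2"] conjI allI impI)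
   show "0 < min t1 t2 / 2" using t1 t2 by simp
   fix y assume y: "norm (y - p) < min t1 t2 / 2"
   have "d y - d p - (c1, c2) \<bullet> (y - p) = k (y - p)" by (simp add: k_def)
   moreover have "abs (k (y - p)) <= ep * norm (y - p)" using ub[of "y - p"] ub[of "- (y - p)"] kneg[of "y - p"] y by (simp add: norm_minus_commute)
   ultimately show "norm (d y - d p - (c1, c2) \<bullet> (y - p)) <= ep * norm (y - p)" by simp
  qed
 qed
 then show ?thesis by blast
qed

text \<open>Limits of difference quotients along 1/(n+1), so that Borel measurability is immediate;
  where \<open>d\<close> is not differentiable the value is whatever \<open>lim\<close> returns, and
  it is used at differentiability points.\<close>

definition grad :: "(plane => real) => plane => plane" where
 "grad d p = (lim (%n. real (Suc n) * (d (p + (1 / real (Suc n)) *R (1, 0)) - d p)),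
        lim (%n. real (Suc n) * (d (p + (1 / real (Suc n)) *R (0, 1)) - d p)))"

lemma difference_quotient_LIMSEQ:
 fixes d :: "'a::real_normed_vector => real"
 assumes "(d has_derivative D) (at p)"
 shows "(%n. real (Suc n) * (d (p + (1 / real (Suc n)) *R v) - d p)) ----> D v"
proof -
 have "((%t. p + t *R v) has_derivative (%t. t *R v)) (at 0)" by (auto intro!: derivative_eq_intros)
 moreover have "(d has_derivative D) (at (p + 0 *R v))" using assms by simp
 ultimately have "((%t. d (p + t *R v)) has_derivative (%t. D (t *R v))) (at 0)" by (rule has_derivative_compose)
 moreover have "(%t. D (t *R v)) = (*) (D v)" using linear_simps(5)[OF has_derivative_bounded_linear[OF assms]] by (auto simp: mult.commute)
 ultimately have "((%t. d (p + t *R v)) has_real_derivative D v) (at 0)" by (simp add: has_field_derivative_def)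
 then have "((%h. (d (p + h *R v) - d p) / h) \<longlongrightarrow> D v) (at 0)" by (simp add: DERIV_def)
 moreover have "(%n. 1 / real (Suc n)) ----> 0" using LIMSEQ_inverse_real_of_nat by (simp add: inverse_eq_divide)
 moreover have "1 / real (Suc n) : UNIV - {0}" for n by simp
 ultimately have "(%n. (d (p + (1 / real (Suc n)) *R v) - d p) / (1 / real (Suc n))) ----> D v" unfolding tendsto_at_iff_sequentially comp_def by meson
 then show ?thesis by (simp add: mult.commute)
qed

lemma grad_eq:
 assumes "gradient d g p"
 shows "grad d p = g"
proof -
 note l = difference_quotient_LIMSEQ[OF assms, THEN limI]
 show ?thesis unfolding grad_def l[of "(1, 0)"] l[of "(0, 1)"] by (cases g) simp
qed

lemma grad_measurable:
 assumes "continuous_on UNIV d"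
 shows "(%p. fst (grad d p)) : Borel" "(%p. snd (grad d p)) : Borel"
proof -
 have [measurable]: "d : Borel" using assms by (rule borel_measurable_continuous_onI)
 show "(%p. fst (grad d p)) : Borel" "(%p. snd (grad d p)) : Borel" unfolding grad_def fst_conv snd_conv by (intro borel_measurable_lim_metric; measurable)+
qed

theorem convex_AE_differentiable:
 assumes "convex_on UNIV d"
 shows "AE p in lborel. gradient d (grad d p) p" using convex_second_difference_AE[OF assms, of "(1, 0)", simplified] convex_second_difference_AE[OF assms, of "(0, 1)", simplified]
proof eventually_elim
 case (elim p)
 have "EX g. gradient d g p" by (rule convex_differentiable_plane[OF assms]) (use elim in auto)
 then show ?case using grad_eq by metis
qed

section \<open>A coarea inequality for convex functions\<close>

lemma nn_lint_substitution:
 fixes g g' :: "real => real" and F :: "real => ennreal"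
 assumes S[measurable]: "S : sets borel" and T[measurable]: "g ` S : sets borel"
  and g[measurable]: "g : Borel" and g'[measurable]: "g' : Borel"
  and der: "!!x. x : S ==> (g has_field_derivative g' x) (at x within S)"
  and inj: "inj_on g S" and F: "F : Borel"
 shows "(NN x. ind S x * ennreal (abs (g' x)) * F (g x)) = (NN y. ind (g ` S) y * F y)"
proof -
 define mu where "mu = distr (density lborel (%x. ind S x * ennreal (abs (g' x)))) borel g"
 define \<nu> where "\<nu> = density lborel (ind (g ` S) :: real => ennreal)"
 have s: "sets mu = sets borel" "sets \<nu> = sets borel" by (auto simp: mu_def \<nu>_def)
 have bdd: "emeasure mu A = emeasure \<nu> A" if [measurable]: "A : sets borel" and "bounded A" for A proof -
  have "emeasure lborel (A \<inter> g ` S) < \<infinity>" by (rule emeasure_bounded_finite) (use \<open>bounded A\<close> in \<open>auto intro: bounded_subset\<close>)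
  then have iA: "integr (ind (A \<inter> g ` S) :: real => real)" by (simp add: integrable_indicator_iff)
  then have "integrable lebesgue (ind (A \<inter> g ` S) :: real => real)" by (subst integrable_completion) auto
  then have ai: "(ind A :: real => real) absolutely_integrable_on (g ` S)" proof -
   have "(%x. ind (g ` S) x *R (ind A x :: real)) = ind (A \<inter> g ` S)" by (rule ext) (simp split: split_indicator)
   then show ?thesis using \<open>integrable lebesgue (ind (A \<inter> g ` S) :: real => real)\<close> unfolding set_integrable_def by simp
  qed
  have m: "integral (g ` S) (ind A :: real => real) = measure lborel (A \<inter> g ` S)" proof -
   have "integral (g ` S) (ind A :: real => real) = integral UNIV (ind (A \<inter> g ` S) :: real => real)"
    by (subst integral_restrict_UNIV[symmetric], rule arg_cong[where f="integral UNIV"], rule ext) (simp split: split_indicator)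
   also have "... = (LBINT x. ind (A \<inter> g ` S) x)" by (rule integral_lborel[OF iA])
   finally show ?thesis by simp
  qed
  have *: "(%x. abs (g' x) * ind A (g x)) absolutely_integrable_on S &
   integral S (%x. abs (g' x) * ind A (g x)) = measure lborel (A \<inter> g ` S)"
   using has_absolute_integral_change_of_variables_1'[of S g g' "ind A" "measure lborel (A \<inter> g ` S)"] S der inj ai m by auto
  define f where "f x = ind S x * (abs (g' x) * ind A (g x))" for x
  have [measurable]: "f : Borel" unfolding f_def by measurable
  have if1: "integrable lebesgue f" using * by (simp add: set_integrable_def f_def[abs_def])
  then have if2: "integr f" by (subst (asm) integrable_completion) auto
  have "integral S (%x. abs (g' x) * ind A (g x)) = integral UNIV f" by (subst integral_restrict_UNIV[symmetric], rule arg_cong[where f="integral UNIV"], rule ext) (simp add: f_def)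
  also have "... = (LBINT x. f x)" by (rule integral_lborel[OF if2])
  finally have "integral S (%x. abs (g' x) * ind A (g x)) = (LBINT x. f x)" .
  from trans[OF sym[OF this] conjunct2[OF *]] have e: "(LBINT x. f x) = measure lborel (A \<inter> g ` S)" .
  have "(NN x. ennreal (f x)) = ennreal (measure lborel (A \<inter> g ` S))" proof -
   have "0 <= f x" for x by (simp add: f_def)
   then have "(NN x. ennreal (f x)) = ennreal (LBINT x. f x)" by (intro nn_integral_eq_integral[OF if2]) simp
   then show ?thesis using e by simp
  qed
  also have "... = emeasure lborel (A \<inter> g ` S)" using \<open>emeasure lborel (A \<inter> g ` S) < \<infinity>\<close> by (simp add: emeasure_eq_ennreal_measure)
  finally have "(NN x. ennreal (f x)) = emeasure lborel (A \<inter> g ` S)" .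
  moreover have "emeasure mu A = (NN x. ennreal (f x))" proof -
   have [measurable]: "g -` A : sets borel" using measurable_sets[OF g that(1)] by simp
   have "emeasure mu A = (NN x. ind S x * ennreal (abs (g' x)) * ind (g -` A \<inter> space borel) x)"
    unfolding mu_def by (subst emeasure_distr, simp, simp, subst emeasure_density) simp_all
   also have "... = (NN x. ennreal (f x))" by (intro nn_integral_cong) (simp add: f_def split: split_indicator)
   finally show ?thesis .
  qed
  moreover have "emeasure \<nu> A = emeasure lborel (A \<inter> g ` S)" proof -
   have "emeasure \<nu> A = (NN x. ind (A \<inter> g ` S) x)" unfolding \<nu>_def by (subst emeasure_density, simp, simp, intro nn_integral_cong) (simp split: split_indicator)
   then show ?thesis by simp
  qed
  ultimately show ?thesis by simp
 qed
 have "mu = \<nu>" proof (rule measure_eqI)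
  show "sets mu = sets \<nu>" using s by simp
  fix A assume "A : sets mu"
  then have [measurable]: "A : sets borel" using s by simp
  define B where "B n = A \<inter> {- real n .. real n}" for n
  have B[measurable]: "B n : sets borel" for n unfolding B_def by measurable
  have inc: "incseq B" unfolding B_def by (rule incseq_SucI) auto
  have U: "(\<Union>n. B n) = A" proof -
   have "EX n. x : {- real n .. real n}" for x proof -
    obtain n where "abs x <= real n" using real_arch_simple by blast
    then show ?thesis by (intro exI[of _ n]) auto
   qed
   then show ?thesis by (auto simp: B_def)
  qed
  have "emeasure mu A = (SUP n. emeasure mu (B n))" using SUP_emeasure_incseq[of B mu] inc U B s by (auto simp: image_subset_iff)
  also have "... = (SUP n. emeasure \<nu> (B n))" by (intro SUP_cong refl bdd B) (auto simp: B_def intro: bounded_subset[OF bounded_closed_interval])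
  also have "... = emeasure \<nu> A" using SUP_emeasure_incseq[of B \<nu>] inc U B s by (auto simp: image_subset_iff)
  finally show "emeasure mu A = emeasure \<nu> A" .
 qed
 then have "(\<integral>\<^sup>+y. F y \<partial>mu) = (\<integral>\<^sup>+y. F y \<partial>\<nu>)" by simp
 moreover have "(\<integral>\<^sup>+y. F y \<partial>mu) = (NN x. ind S x * ennreal (abs (g' x)) * F (g x))"
  unfolding mu_def using F by (subst nn_integral_distr, simp, simp, subst nn_integral_density) auto
 moreover have "(\<integral>\<^sup>+y. F y \<partial>\<nu>) = (NN y. ind (g ` S) y * F y)" unfolding \<nu>_def using F by (subst nn_integral_density) auto
 ultimately show ?thesis by simp
qed

section \<open>Polar coordinates for nonnegative functions\<close>

lemma nn_integral_plane:
 fixes F :: "plane => ennreal"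
 assumes [measurable]: "F : Borel"
 shows "(NN p. F p) = (NN x. \<integral>\<^sup>+z. F (x, z) \<partial>lborel)"
proof -
 have "F : borel_measurable lborel2" by (simp add: lborel_prod)
 from lborel.nn_integral_fst[OF this] show ?thesis by (simp add: lborel_prod)
qed

text \<open>Two substitutions in one variable: z = x tan th at fixed x, and x = rh cos th at fixed
  th. The factors x / (cos th)^2 and cos th multiply to rh.\<close>

lemma polar_half_plane:
 fixes F :: "plane => ennreal"
 assumes F[measurable]: "F : Borel"
 shows "(NN p. ind {p. 0 < fst p} p * F p) =
  (NN th. ind {-pi/2<..<pi/2} th * (NN rh. ind {0<..} rh * (ennreal rh * F (rh * cos th, rh * sin th))))" proof -
 let ?S = "{-pi/2<..<pi/2::real}"
 have [measurable]: "(%x::real\<times>real. F x) : Borel2" by (simp add: borel_prod)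
 have [measurable]: "{p::real\<times>real. 0 < fst p} : sets borel" by (intro borel_open open_Collect_less continuous_intros)
 have [measurable]: "tan : borel_measurable (borel :: real measure)" unfolding tan_def[abs_def] by measurable
 have cospos: "cos th > 0" if "th : ?S" for th using that cos_gt_zero_pi[of th] by auto
 have "(NN p. ind {p. 0 < fst p} p * F p) = (NN x. \<integral>\<^sup>+z. ind {p. 0 < fst p} (x, z) * F (x, z) \<partial>lborel)" by (rule nn_integral_plane) measurable
 also have "... = (NN x. ind {0<..} x * (NN th. ind ?S th * (ennreal (abs (x * inverse ((cos th)^2))) * F (x, x * tan th))))" proof (rule nn_integral_cong)
  fix x :: real
  show "(NN z. ind {p. 0 < fst p} (x, z) * F (x, z)) = ind {0<..} x * (NN th. ind ?S th * (ennreal (abs (x * inverse ((cos th)^2))) * F (x, x * tan th)))" proof (cases "x > 0")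
   case True
   have img: "(%th. x * tan th) ` ?S = UNIV" proof -
    have "y : (%th. x * tan th) ` ?S" for y by (rule image_eqI[of _ _ "arctan (y / x)"]) (use True arctan_lbound arctan_ubound in \<open>auto simp: tan_arctan\<close>)
    then show ?thesis by blast
   qed
   have der: "((%th. x * tan th) has_field_derivative x * inverse ((cos th)^2)) (at th within ?S)" if "th : ?S" for th using cospos[OF that] by (auto intro!: derivative_eq_intros)
   have inj: "inj_on (%th. x * tan th) ?S" proof (rule inj_onI)
    fix a b assume ab: "a : ?S" "b : ?S" "x * tan a = x * tan b"
    then have "tan a = tan b" using True by simp
    moreover have "arctan (tan a) = a" "arctan (tan b) = b" by (rule arctan_tan; use ab in simp)+
    ultimately show "a = b" by metis
   qed
   have Fx: "(%z. F (x, z)) : Borel" by measurable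
   have "(NN z. F (x, z)) = (NN y. ind ((%th. x * tan th) ` ?S) y * F (x, y))" unfolding img by simp
   also have "... = (NN th. ind ?S th * ennreal (abs (x * inverse ((cos th)^2))) * F (x, x * tan th))" proof -
    have i: "(%th. x * tan th) ` ?S : sets borel" unfolding img by simp
    show ?thesis by (rule nn_lint_substitution[symmetric, OF _ i _ _ der inj Fx]) measurable
   qed
   finally show ?thesis using True by (simp add: mult.assoc)
  qed simp
 qed
 also have "... = (NN x. (NN th. ind {0<..} x * (ind ?S th * (ennreal (abs (x * inverse ((cos th)^2))) * F (x, x * tan th)))))"
  by (intro nn_integral_cong nn_integral_cmult[symmetric]) measurable
 also have "... = (NN th. (NN x. ind {0<..} x * (ind ?S th * (ennreal (abs (x * inverse ((cos th)^2))) * F (x, x * tan th)))))" by (rule lborel_pair.Fubini') measurable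
 also have "... = (NN th. ind ?S th * (NN rh. ind {0<..} rh * (ennreal rh * F (rh * cos th, rh * sin th))))" proof (rule nn_integral_cong)
  fix th :: real
  show "(NN x. ind {0<..} x * (ind ?S th * (ennreal (abs (x * inverse ((cos th)^2))) * F (x, x * tan th))))
   = ind ?S th * (NN rh. ind {0<..} rh * (ennreal rh * F (rh * cos th, rh * sin th)))" proof (cases "th : ?S")
   case True
   note c = cospos[OF True]
   have "(NN x. ind {0<..} x * (ennreal (abs (x * inverse ((cos th)^2))) * F (x, x * tan th)))
    = ennreal (abs (cos th)) * (NN rh. ind {0<..} (0 + cos th * rh) * (ennreal (abs ((0 + cos th * rh) * inverse ((cos th)^2))) * F (0 + cos th * rh, (0 + cos th * rh) * tan th)))"
    by (rule nn_integral_real_affine) (use c in \<open>auto\<close>)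
   also have "... = (NN rh. ennreal (abs (cos th)) * (ind {0<..} (0 + cos th * rh) * (ennreal (abs ((0 + cos th * rh) * inverse ((cos th)^2))) * F (0 + cos th * rh, (0 + cos th * rh) * tan th))))"
    by (rule nn_integral_cmult[symmetric]) measurable
   also have "... = (NN rh. ind {0<..} rh * (ennreal rh * F (rh * cos th, rh * sin th)))" proof (rule nn_integral_cong)
    fix rh :: real
    show "ennreal (abs (cos th)) * (ind {0<..} (0 + cos th * rh) * (ennreal (abs ((0 + cos th * rh) * inverse ((cos th)^2))) * F (0 + cos th * rh, (0 + cos th * rh) * tan th)))
     = ind {0<..} rh * (ennreal rh * F (rh * cos th, rh * sin th))" proof (cases "rh > 0")
     case True
     have "ennreal (abs (cos th)) * ennreal (abs ((0 + cos th * rh) * inverse ((cos th)^2))) = ennreal (abs (cos th) * abs ((0 + cos th * rh) * inverse ((cos th)^2)))"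
      by (rule ennreal_mult[symmetric]) auto
     also have "abs (cos th) * abs ((0 + cos th * rh) * inverse ((cos th)^2)) = rh" using c True by (simp add: abs_mult power2_eq_square field_simps)
     finally have e: "ennreal (abs (cos th)) * ennreal (abs ((0 + cos th * rh) * inverse ((cos th)^2))) = ennreal rh" .
     have p: "(0 + cos th * rh, (0 + cos th * rh) * tan th) = (rh * cos th, rh * sin th)" using c by (simp add: tan_def)
     have i: "ind {0<..} (0 + cos th * rh) = (1::ennreal)" using c True by simp
     show ?thesis unfolding p i mult_1_left mult.assoc[symmetric] e using True by simp
    next
     case False
     then have "~ 0 < cos th * rh" using c by (simp add: zero_less_mult_iff)
     then show ?thesis using False by simp
    qed
   qed
   finally show ?thesis using True by simp
  qed simp
 qed
 finally show ?thesis .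
qed

lemma nn_integral_lborel_reflect:
 fixes f :: "'a::euclidean_space => ennreal"
 assumes [measurable]: "f : Borel"
 shows "(NN x. f (- x)) = (NN x. f x)"
proof -
 have "(\<Sum>j\<in>Basis. (- 1 * (x \<bullet> j)) *R j) = - x" for x :: 'a by (simp add: sum_negf euclidean_representation)
 then have e: "lborel = density (distr lborel borel (%x::'a. - x)) (%_. 1)" using lborel_affine_euclidean[of "%_. -1" "0 :: 'a"] by (simp add: sum_negf euclidean_representation)
 have "(NN x. f x) = integral\<^sup>N (density (distr lborel borel (%x::'a. - x)) (%_. 1)) f" by (subst e[symmetric]) simp
 also have "... = integral\<^sup>N (distr lborel borel (%x::'a. - x)) f" by (simp add: density_1)
 also have "... = (NN x. f (- x))" by (subst nn_integral_distr) auto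
 finally show ?thesis by simp
qed

lemma polar_coordinates:
 fixes F :: "plane => ennreal"
 assumes F[measurable]: "F : Borel"
 shows "(NN p. F p) =
  (NN th. ind {-pi/2<..<pi/2} th * (NN rh. ind {0<..} rh * (ennreal rh * F (rh * cos th, rh * sin th))))
  + (NN th. ind {pi/2<..<3*pi/2} th * (NN rh. ind {0<..} rh * (ennreal rh * F (rh * cos th, rh * sin th))))" proof -
 have [measurable]: "(%x::real\<times>real. F x) : Borel2" by (simp add: borel_prod)
 have [measurable]: "{p::real\<times>real. 0 < fst p} : sets borel" "{p::real\<times>real. fst p < 0} : sets borel" by (intro borel_open open_Collect_less continuous_intros)+
 have ae: "AE p in lborel. fst (p::real\<times>real) ~= 0" proof -
  have "emeasure lborel {p::real\<times>real. fst p = 0} = 0" proof -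
   have [measurable]: "{p::real\<times>real. fst p = 0} : sets borel" by (intro borel_closed closed_Collect_eq continuous_intros)
   have "emeasure lborel {p::real\<times>real. fst p = 0} = (NN p. ind {p::real\<times>real. fst p = 0} p)" by simp
   also have "... = (NN x. \<integral>\<^sup>+z. ind {p::real\<times>real. fst p = 0} (x, z) \<partial>lborel)" by (rule nn_integral_plane) measurable
   also have "... = (NN x. ind {0::real} x * \<infinity>)" by (intro nn_integral_cong) (auto simp: indicator_def)
   also have "... = 0" by (subst nn_integral_multc) auto
   finally show ?thesis .
  qed
  then show ?thesis by (intro AE_I[of _ _ "{p. fst p = 0}"]) (auto intro!: borel_closed closed_Collect_eq continuous_intros)
 qed
 have "(NN p. F p) = (NN p. ind {p. 0 < fst p} p * F p + ind {p. fst p < 0} p * F p)" by (rule nn_integral_cong_AE) (use ae in eventually_elim, auto simp: indicator_def)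
 also have "... = (NN p. ind {p. 0 < fst p} p * F p) + (NN p. ind {p. fst p < 0} p * F p)" by (rule nn_integral_add) measurable
 also have "(NN p. ind {p. fst p < 0} p * F p) = (NN p. ind {p. fst p < 0} (- p) * F (- p))" by (rule nn_integral_lborel_reflect[symmetric]) measurable
 also have "... = (NN p. ind {p. 0 < fst p} p * F (- p))" by (rule nn_integral_cong) (auto simp: indicator_def)
 also have "... = (NN th. ind {-pi/2<..<pi/2} th * (NN rh. ind {0<..} rh * (ennreal rh * F (- (rh * cos th, rh * sin th)))))" by (rule polar_half_plane) measurable
 \<comment> \<open>The reflection p to -p, which brought the left half plane to the right one, is a
   rotation by pi; shifting the angle restores the original argument of \<open>F\<close>.\<close>
 also have "... = (NN th. ind {-pi/2<..<pi/2} (th + - pi) * (NN rh. ind {0<..} rh * (ennreal rh * F (- (rh * cos (th + - pi), rh * sin (th + - pi))))))"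
  by (rule nn_lint_shift[symmetric]) measurable
 also have "... = (NN th. ind {pi/2<..<3*pi/2} th * (NN rh. ind {0<..} rh * (ennreal rh * F (rh * cos th, rh * sin th))))" by (rule nn_integral_cong) (auto simp: indicator_def)
 finally show ?thesis using polar_half_plane[OF F] by simp
qed

definition dir :: "real => plane" where "dir th = (cos th, sin th)"
definition dir' :: "real => plane" where "dir' th = (- sin th, cos th)"

lemma norm_dir [simp]: "norm (dir th) = 1" by (simp add: dir_def norm_prod_def)

lemma norm_dir_diff: "norm (dir a - dir b) <= 2 * abs (a - b)"
proof -
 have s: "abs (sin ((a - b) / 2)) <= abs (a - b) / 2" "abs (sin ((b - a) / 2)) <= abs (a - b) / 2"
  using abs_sin_x_le_abs_x[of "(a - b) / 2"] abs_sin_x_le_abs_x[of "(b - a) / 2"] by (simp_all add: abs_minus_commute)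
 have "abs (cos a - cos b) <= 2 * (1 * (abs (a - b) / 2))" unfolding cos_diff_cos abs_mult mult.assoc using s by (intro mult_mono) (auto simp: abs_mult)
 moreover have "abs (sin a - sin b) <= 2 * (abs (a - b) / 2 * 1)" unfolding sin_diff_sin abs_mult mult.assoc using s by (intro mult_mono) (auto simp: abs_mult)
 moreover have "norm (dir a - dir b) <= abs (cos a - cos b) + abs (sin a - sin b)" using sqrt_sum_squares_le_sum_abs by (simp add: dir_def norm_prod_def)
 ultimately show ?thesis by simp
qed

lemma inner_dir_squares: "(g \<bullet> dir th)^2 + (g \<bullet> dir' th)^2 = (norm g)^2"
proof -
 have alg: "(a * c + b * s)^2 + (- a * s + b * c)^2 = (a^2 + b^2) * (c^2 + s^2)" for a b c s :: real by algebra
 have "(g \<bullet> dir th)^2 + (g \<bullet> dir' th)^2 = ((fst g)^2 + (snd g)^2) * ((cos th)^2 + (sin th)^2)" unfolding alg[symmetric] by (cases g) (simp add: dir_def dir'_def)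
 also have "... = (norm g)^2" by (cases g) (simp add: norm_prod_def)
 finally show ?thesis .
qed

lemma subgradient:
 fixes d :: "'a::real_inner => real"
 assumes d: "convex_on UNIV d" and g: "gradient d g p"
 shows "g \<bullet> (y - p) <= d y - d p"
proof (rule LIMSEQ_le_const2[OF difference_quotient_LIMSEQ[OF g]], intro exI allI impI)
 fix n :: nat
 define t where "t = 1 / real (Suc n)"
 have "d ((1 - t) *R p + t *R y) <= (1 - t) * d p + t * d y" by (rule convex_onD[OF d]) (auto simp: t_def)
 moreover have "(1 - t) *R p + t *R y = p + t *R (y - p)" by (simp add: algebra_simps)
 moreover have "(1 - t) * d p + t * d y = d p + t * (d y - d p)" by (simp add: algebra_simps)
 ultimately have "d (p + t *R (y - p)) - d p <= t * (d y - d p)" by simp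
 then have "real (Suc n) * (d (p + t *R (y - p)) - d p) <= real (Suc n) * (t * (d y - d p))" by (rule mult_left_mono) simp
 then show "real (Suc n) * (d (p + (1 / real (Suc n)) *R (y - p)) - d p) <= d y - d p" by (simp add: t_def)
qed

text \<open>Every direction \<open>v\<close> with negative product with the gradient enters the
  sublevel set, so each supporting unit vector \<open>\<nu>\<close> satisfies
  \<open>\<nu> \<bullet> v <= 0\<close> for these \<open>v\<close>. Testing with vectors in the span
  of \<open>\<nu>\<close> and the normalised gradient forces the two to coincide, which settles the
  definite description in \<open>outward_unit_normal\<close>.\<close>

lemma normal_unique:
 fixes d :: "plane => real"
 assumes d: "convex_on UNIV d" and g: "gradient d g p" and g0: "g ~= 0"
 shows "outward_unit_normal (sublevel d (d p)) p = g /\<^sub>R norm g" unfolding outward_unit_normal_def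
proof (rule the_equality)
 show "norm (g /\<^sub>R norm g) = 1 & (ALL y:sublevel d (d p). (g /\<^sub>R norm g) \<bullet> (y - p) <= 0)" proof (intro conjI ballI)
  fix y assume "y : sublevel d (d p)"
  then have "g \<bullet> (y - p) <= 0" using subgradient[OF d g, of y] by (simp add: sublevel_def)
  then show "(g /\<^sub>R norm g) \<bullet> (y - p) <= 0" by (simp add: mult_nonneg_nonpos)
 qed (use g0 in simp)
 fix \<nu> assume \<nu>: "norm \<nu> = 1 & (ALL y:sublevel d (d p). \<nu> \<bullet> (y - p) <= 0)"
 define u where "u = g /\<^sub>R norm g"
 have u1: "u \<bullet> u = 1" using g0 by (simp add: u_def dot_square_norm power2_eq_square)
 have \<nu>1: "\<nu> \<bullet> \<nu> = 1" using \<nu> by (simp add: dot_square_norm)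
 have neg: "\<nu> \<bullet> v <= 0" if "u \<bullet> v < 0" for v proof -
  have "g \<bullet> v < 0" using that g0 by (simp add: u_def mult_less_0_iff zero_less_mult_iff)
  then have "eventually (%n. real (Suc n) * (d (p + (1 / real (Suc n)) *R v) - d p) < 0) sequentially" by (rule order_tendstoD(2)[OF difference_quotient_LIMSEQ[OF g]])
  then obtain n where "real (Suc n) * (d (p + (1 / real (Suc n)) *R v) - d p) < 0" by (auto simp: eventually_sequentially)
  then have "d (p + (1 / real (Suc n)) *R v) < d p" by (simp add: mult_less_0_iff)
  then have "p + (1 / real (Suc n)) *R v : sublevel d (d p)" by (simp add: sublevel_def)
  then have "\<nu> \<bullet> ((p + (1 / real (Suc n)) *R v) - p) <= 0" using \<nu> by blast
  then have "1 / real (Suc n) * (\<nu> \<bullet> v) <= 0" by simp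
  moreover have "1 / real (Suc n) > 0" by simp
  ultimately show ?thesis by (meson mult_pos_pos not_le)
 qed
 define s where "s = \<nu> \<bullet> u"
 have us: "u \<bullet> \<nu> = s" by (simp add: s_def inner_commute)
 \<comment> \<open>The test direction is the component of \<open>\<nu>\<close> orthogonal to
   \<open>u\<close>, tilted by \<open>ep\<close> against \<open>u\<close> so that its product with
   \<open>u\<close> is strictly negative.\<close>
 have e: "1 - s^2 <= ep * s" if "ep > 0" for ep proof -
  have "u \<bullet> (\<nu> - (s + ep) *R u) < 0" using that by (simp add: inner_diff_right u1 us)
  from neg[OF this] show ?thesis by (simp add: inner_diff_right \<nu>1 s_def[symmetric] power2_eq_square algebra_simps)
 qed
 have "s^2 >= 1" proof (rule ccontr)
  assume "~ s^2 >= 1"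
  then have "1 - s^2 > 0" by simp
  have "abs s <= 1" using Cauchy_Schwarz_ineq2[of \<nu> u] \<nu> u1 by (simp add: s_def norm_eq_sqrt_inner)
  then have "(1 - s^2) / 2 * s <= (1 - s^2) / 2 * 1" using \<open>1 - s\<^sup>2 > 0\<close> by (intro mult_left_mono) auto
  with e[OF half_gt_zero[OF \<open>1 - s\<^sup>2 > 0\<close>]] have "1 - s^2 <= (1 - s^2) / 2 * 1" by (rule order_trans)
  then show False using \<open>1 - s\<^sup>2 > 0\<close> by simp
 qed
 have "s > 0" proof (rule ccontr)
  assume "~ s > 0"
  have "u \<bullet> (- u) < 0" by (simp add: u1)
  from neg[OF this] have "s >= 0" by (simp add: s_def)
  then show False using \<open>~ s > 0\<close> \<open>s\<^sup>2 >= 1\<close> by simp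
 qed
 then have "s >= 1" using \<open>s\<^sup>2 >= 1\<close> abs_le_square_iff[of 1 s] by simp
 then have "(\<nu> - u) \<bullet> (\<nu> - u) <= 0" by (simp add: inner_diff_left inner_diff_right \<nu>1 u1 us s_def[symmetric])
 then have "\<nu> - u = 0" using inner_ge_zero[of "\<nu> - u"] by (metis antisym inner_eq_zero_iff)
 then show "\<nu> = g /\<^sub>R norm g" by (simp add: u_def)
qed

section \<open>Level curves of a convex coercive function as polar graphs around a minimum
  point\<close>

locale convex_well =
 fixes d :: "plane => real" and p0 :: "plane"
 assumes convex: "convex_on UNIV d" and coercive: "filterlim d at_top at_infinity"
  and minimum: "!!p. d p0 <= d p"
begin

lemma cont: "continuous_on UNIV d" by (rule convex_on_continuous[OF open_UNIV convex])

lemma d_measurable [measurable]: "d : Borel" using cont by (rule borel_measurable_continuous_onI)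

lemma far: obtains B where "B > 0" "!!p. B <= norm (p - p0) ==> R <= d p"
proof -
 have "eventually (%p. R <= d p) at_infinity" using coercive by (simp add: filterlim_at_top)
 then obtain b where b: "!!p. b <= norm p ==> R <= d p" by (auto simp: eventually_at_infinity)
 show ?thesis proof (rule that[of "abs b + norm p0 + 1"])
  show "R <= d p" if "abs b + norm p0 + 1 <= norm (p - p0)" for p using that norm_triangle_ineq4[of p p0] by (intro b) linarith
 qed (simp add: add_nonneg_pos)
qed

lemma near:
 assumes "d p0 < R" obtains a where "a > 0" "!!p. norm (p - p0) <= a ==> d p <= R"
proof -
 have "isCont d p0" using cont continuous_on_eq_continuous_at[OF open_UNIV, of d] by blast
 then have "eventually (%p. d p < R) (nhds p0)" using assms by (metis isCont_def order_tendstoD(2) tendsto_at_iff_tendsto_nhds)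
 then obtain a where a: "a > 0" "!!p. dist p p0 < a ==> d p < R" by (auto simp: eventually_nhds_metric)
 show ?thesis proof (rule that[of "a / 2"])
  show "d p <= R" if "norm (p - p0) <= a / 2" for p using a(2)[of p] a(1) that by (simp add: dist_norm)
 qed (use a in simp)
qed

text \<open>Convexity alone gives a weak inequality; strictness comes from the positive weight on
  \<open>p0\<close>, whose value lies strictly below that at the far point.\<close>

lemma ray_less:
 assumes "0 <= a" "a < b" "d p0 < d (p0 + b *R v)"
 shows "d (p0 + a *R v) < d (p0 + b *R v)"
proof -
 have e: "(1 - a / b) *R p0 + (a / b) *R (p0 + b *R v) = p0 + a *R v" using assms by (simp add: algebra_simps)
 have "d ((1 - a / b) *R p0 + (a / b) *R (p0 + b *R v)) <= (1 - a / b) * d p0 + (a / b) * d (p0 + b *R v)" by (rule convex_onD[OF convex]) (use assms in auto)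
 then have "d (p0 + a *R v) <= (1 - a / b) * d p0 + (a / b) * d (p0 + b *R v)" unfolding e .
 moreover have "(1 - a / b) * d p0 < (1 - a / b) * d (p0 + b *R v)" using assms by (intro mult_strict_left_mono) auto
 moreover have "(1 - a / b) * d (p0 + b *R v) + (a / b) * d (p0 + b *R v) = d (p0 + b *R v)" by (simp add: algebra_simps)
 ultimately show ?thesis by linarith
qed

lemma ray_less':
 assumes "0 <= a" "a < b" "d p0 < d (p0 + a *R v)"
 shows "d (p0 + a *R v) < d (p0 + b *R v)"
proof (cases "d p0 < d (p0 + b *R v)")
 case True then show ?thesis by (rule ray_less[OF assms(1,2)])
next
 case False
 then have eq: "d (p0 + b *R v) = d p0" using minimum[of "p0 + b *R v"] by linarith
 have "d ((1 - a / b) *R p0 + (a / b) *R (p0 + b *R v)) <= (1 - a / b) * d p0 + (a / b) * d (p0 + b *R v)" by (rule convex_onD[OF convex]) (use assms in auto)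
 moreover have "(1 - a / b) *R p0 + (a / b) *R (p0 + b *R v) = p0 + a *R v" using assms by (simp add: algebra_simps)
 moreover have "(1 - a / b) * d p0 + (a / b) * d p0 = d p0" by (simp add: algebra_simps)
 ultimately show ?thesis using eq assms(3) by simp
qed

text \<open>The radial function of the sublevel set seen from \<open>p0\<close>. For R above the
  minimum the chosen radius exists by the intermediate value theorem and is unique by strict growth
  along rays.\<close>

definition rad :: "real => real => real" where
 "rad R th = (SOME rh. 0 < rh & d (p0 + rh *R dir th) = R)"

lemma rad:
 assumes "d p0 < R" shows rad_pos: "0 < rad R th" and d_rad: "d (p0 + rad R th *R dir th) = R"
proof -
 obtain B where B: "B > 0" "!!p. B <= norm (p - p0) ==> R <= d p" by (rule far[of R]) blast
 have "EX rh. 0 <= rh & rh <= B & d (p0 + rh *R dir th) = R" proof (rule IVT')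
  show "d (p0 + 0 *R dir th) <= R" using assms by simp
  show "R <= d (p0 + B *R dir th)" using B by simp
  show "continuous_on {0..B} (%rh. d (p0 + rh *R dir th))" by (rule continuous_on_compose2[OF cont]) (auto intro!: continuous_intros)
 qed (use B in simp)
 then obtain rh where "0 <= rh" "d (p0 + rh *R dir th) = R" by blast
 moreover then have "rh ~= 0" using assms by auto
 ultimately have "0 < rh & d (p0 + rh *R dir th) = R" by auto
 then have "0 < rad R th & d (p0 + rad R th *R dir th) = R" unfolding rad_def by (rule someI)
 then show "0 < rad R th" "d (p0 + rad R th *R dir th) = R" by auto
qed

text \<open>This turns statements about the chosen radius into statements about \<open>d\<close>;
  both the bound on \<open>rad\<close> and the measurability of \<open>radm\<close> are read off
  from it.\<close>

lemma rad_le_iff: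
 assumes "d p0 < R" "0 <= c" shows "rad R th <= c \<longleftrightarrow> R <= d (p0 + c *R dir th)"
proof
 assume "rad R th <= c"
 then show "R <= d (p0 + c *R dir th)" using ray_less'[of "rad R th" c "dir th"] rad[OF assms(1), of th] assms by (cases "rad R th = c") auto
next
 assume R: "R <= d (p0 + c *R dir th)"
 show "rad R th <= c" proof (rule ccontr)
  assume "~ rad R th <= c"
  then have "d (p0 + c *R dir th) < d (p0 + rad R th *R dir th)" by (intro ray_less) (use assms rad[OF assms(1), of th] in auto)
  then show False using R rad[OF assms(1), of th] by simp
 qed
qed

lemma rad_unique:
 assumes "0 < rh" "d p0 < d (p0 + rh *R dir th)" shows "rad (d (p0 + rh *R dir th)) th = rh"
proof (rule antisym)
 show "rad (d (p0 + rh *R dir th)) th <= rh" using assms by (subst rad_le_iff) auto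
 show "rh <= rad (d (p0 + rh *R dir th)) th" proof (rule ccontr)
  assume "~ rh <= rad (d (p0 + rh *R dir th)) th"
  then have "d (p0 + rad (d (p0 + rh *R dir th)) th *R dir th) < d (p0 + rh *R dir th)" using rad_pos[OF assms(2), of th] assms by (intro ray_less) auto
  then show False using d_rad[OF assms(2), of th] by simp
 qed
qed

text \<open>The convex hull of the boundary point at angle \<open>th\<close> and the disc of radius
  \<open>a\<close> around \<open>p0\<close> lies in the sublevel set, and it meets the ray at angle
  \<open>th'\<close> at least as far out as \<open>l * r\<close>. So the radius cannot drop faster
  than this cone allows, with \<open>B\<close> bounding the radius.\<close>

lemma rad_Lipschitz_aux:
 assumes R: "d p0 < R" and a: "a > 0" "!!p. norm (p - p0) <= a ==> d p <= R"
  and B: "B > 0" "!!p. B <= norm (p - p0) ==> R <= d p"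
 shows "rad R th <= B" "rad R th - rad R th' <= B^2 / a * norm (dir th - dir th')"
proof -
 show rB: "rad R th <= B" using R B by (subst rad_le_iff) auto
 define r where "r = rad R th"
 define de where "de = norm (dir th - dir th')"
 have r: "r > 0" "r <= B" "d (p0 + r *R dir th) = R" using rad[OF R, of th] rB by (auto simp: r_def)
 show "rad R th - rad R th' <= B^2 / a * norm (dir th - dir th')" proof (cases "de = 0")
  case True
  then have "dir th = dir th'" by (simp add: de_def)
  then have "rad R th = rad R th'" by (simp add: rad_def)
  then show ?thesis using a B by simp
 next
  case False
  then have de: "de > 0" by (simp add: de_def)
  define l where "l = a / (a + r * de)"
  have ar: "a + r * de > 0" "r * de > 0" using a r de by (auto intro: add_pos_pos)
  have l: "0 < l" "l < 1" "1 - l = r * de / (a + r * de)" using a ar by (auto simp: l_def field_simps)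
  \<comment> \<open>A point on the rim of the disc, in the direction from \<open>dir th\<close> to
    \<open>dir th'\<close>; the weight \<open>l\<close> is chosen so that the combination with the
    boundary point loses its \<open>dir th\<close> part and lands on the ray
    \<open>th'\<close>.\<close>
  define v where "v = (a / de) *R (dir th' - dir th)"
  have nv: "norm v = a" using de a by (simp add: v_def de_def norm_minus_commute)
  have "(1 - l) *R v = (l * r) *R (dir th' - dir th)" proof -
   have "(1 - l) * (a / de) = r * de / (a + r * de) * (a / de)" by (simp only: l(3))
   also have "... = l * r" using de by (simp add: l_def)
   finally have "(1 - l) * (a / de) = l * r" .
   then show ?thesis by (simp add: v_def)
  qed
  then have q: "(1 - l) *R (p0 + v) + l *R (p0 + r *R dir th) = p0 + (l * r) *R dir th'" proof -
   have "(1 - l) *R (p0 + v) + l *R (p0 + r *R dir th) = p0 + ((1 - l) *R v + (l * r) *R dir th)" by (simp add: algebra_simps)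
   also have "(1 - l) *R v + (l * r) *R dir th = (l * r) *R dir th'" using \<open>(1 - l) *R v = (l * r) *R (dir th' - dir th)\<close> by (simp add: scaleR_diff_right)
   finally show ?thesis .
  qed
  have "d ((1 - l) *R (p0 + v) + l *R (p0 + r *R dir th)) <= (1 - l) * d (p0 + v) + l * d (p0 + r *R dir th)" by (rule convex_onD[OF convex]) (use l in auto)
  also have "... <= (1 - l) * R + l * R" using l a(2)[of "p0 + v"] nv r by (intro add_mono mult_left_mono) auto
  also have "... = R" by (simp add: algebra_simps)
  finally have "d (p0 + (l * r) *R dir th') <= R" unfolding q .
  have "l * r <= rad R th'" proof (rule ccontr)
   assume "~ l * r <= rad R th'"
   then have "d (p0 + rad R th' *R dir th') < d (p0 + (l * r) *R dir th')" using rad[OF R, of th'] R by (intro ray_less') auto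
   then show False using \<open>d (p0 + (l * r) *R dir th') <= R\<close> d_rad[OF R, of th'] by simp
  qed
  then have "r - rad R th' <= (1 - l) * r" by (simp add: algebra_simps)
  also have "... = r * (r * de) / (a + r * de)" by (simp add: l(3))
  also have "... <= r * (r * de) / a" using a ar r by (intro divide_left_mono) auto
  also have "... <= B * (B * de) / a" using a r B de by (intro divide_right_mono mult_mono) auto
  finally show ?thesis by (simp add: r_def de_def power2_eq_square)
 qed
qed

definition crv :: "real => real => plane" where
 "crv R th = p0 + rad R th *R dir th"

lemma crv_Lipschitz:
 assumes R: "d p0 < R"
 obtains L where "L > 0" "!!th th'. norm (crv R th - crv R th') <= L * abs (th - th')" "!!th th'. abs (rad R th - rad R th') <= L * abs (th - th')"
proof -
 obtain a where a: "a > 0" "!!p. norm (p - p0) <= a ==> d p <= R" using near[OF R] by blast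
 obtain B where B: "B > 0" "!!p. B <= norm (p - p0) ==> R <= d p" using far by blast
 note aux = rad_Lipschitz_aux[OF R a B]
 have 1: "abs (rad R th - rad R th') <= B^2 / a * norm (dir th - dir th')" for th th' using aux(2)[of th th'] aux(2)[of th' th] by (simp add: norm_minus_commute abs_le_iff)
 have 2: "abs (rad R th - rad R th') <= B^2 / a * (2 * abs (th - th'))" for th th' by (rule order_trans[OF 1 mult_left_mono[OF norm_dir_diff]]) (use a in simp)
 have 3: "norm (crv R th - crv R th') <= B^2 / a * (2 * abs (th - th')) + B * (2 * abs (th - th'))" for th th' proof -
  have "crv R th - crv R th' = (rad R th - rad R th') *R dir th + rad R th' *R (dir th - dir th')" by (simp add: crv_def algebra_simps)
  also have "norm ... <= abs (rad R th - rad R th') + rad R th' * norm (dir th - dir th')" by (rule order_trans[OF norm_triangle_ineq]) (use rad_pos[OF R, of th'] in simp)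
  also have "... <= B^2 / a * (2 * abs (th - th')) + B * (2 * abs (th - th'))" using 2[of th th'] aux(1)[of th'] norm_dir_diff[of th th'] B(1) by (intro add_mono mult_mono) auto
  finally show ?thesis .
 qed
 show ?thesis proof (rule that[of "2 * B^2 / a + 2 * B"])
  show "0 < 2 * B^2 / a + 2 * B" using a B by (intro add_pos_pos) auto
  show "norm (crv R th - crv R th') <= (2 * B^2 / a + 2 * B) * abs (th - th')" for th th' using 3[of th th'] by (simp add: algebra_simps)
  have "0 <= 2 * B * abs (th - th')" for th th' using B(1) by simp
  moreover have "abs (rad R th - rad R th') <= 2 * B^2 / a * abs (th - th')" for th th' using 2[of th th'] by (simp add: mult_ac)
  ultimately show "abs (rad R th - rad R th') <= (2 * B^2 / a + 2 * B) * abs (th - th')" for th th' unfolding distrib_right by (rule add_increasing2)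
 qed
qed

lemma d_crv: "d p0 < R ==> d (crv R th) = R" by (simp add: crv_def d_rad)

lemma gradient_pos:
 assumes "gradient d g (p0 + rh *R v)" "0 < rh" "d p0 < d (p0 + rh *R v)"
 shows "0 < g \<bullet> v"
proof -
 have "g \<bullet> (p0 - (p0 + rh *R v)) <= d p0 - d (p0 + rh *R v)" by (rule subgradient[OF convex assms(1)])
 then have "0 < rh * (g \<bullet> v)" using assms(3) by simp
 then show ?thesis using assms(2) by (simp add: zero_less_mult_iff)
qed

text \<open>Implicit differentiation of the equation that the curve stays on its level, although
  nothing is known beforehand about differentiability of \<open>rad\<close>: the Lipschitz bound for
  \<open>crv\<close> replaces it, and the increment quotient of \<open>rad\<close> is solved for
  before the limit is taken. The denominator is positive by \<open>gradient_pos\<close>.\<close>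

lemma rad_derivative:
 assumes R: "d p0 < R" and g: "gradient d g (crv R th)"
 shows "(rad R has_real_derivative - (rad R th * (g \<bullet> dir' th)) / (g \<bullet> dir th)) (at th)"
proof -
 obtain L where L: "L > 0" "!!th th'. norm (crv R th - crv R th') <= L * abs (th - th')" by (rule crv_Lipschitz[OF R]) blast
 have gpos: "0 < g \<bullet> dir th" using gradient_pos[of g "rad R th" "dir th"] g rad[OF R, of th] R by (simp add: crv_def)
 \<comment> \<open>The increment of \<open>d\<close> along the curve is 0, so differentiability of
   \<open>d\<close> leaves g times the increment of the curve as o of that increment, which is o(h)
   by the Lipschitz bound.\<close>
 have A: "((%h. g \<bullet> (crv R (th + h) - crv R th) / h) \<longlongrightarrow> 0) (at 0)" proof (rule LIM_I)
  fix ep :: real assume "ep > 0"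
  then have "ep / (2 * L) > 0" using L by simp
  then obtain de where de: "de > 0" "!!y. norm (y - crv R th) < de ==> abs (d y - d (crv R th) - g \<bullet> (y - crv R th)) <= ep / (2 * L) * norm (y - crv R th)"
   using g unfolding has_derivative_at_alt by (metis real_norm_def)
  show "EX s>0. ALL h. h ~= 0 & norm (h - 0) < s --> norm (g \<bullet> (crv R (th + h) - crv R th) / h - 0) < ep" proof (intro exI[of _ "de / L"] conjI allI impI)
   show "0 < de / L" using de L by simp
   fix h :: real assume h: "h ~= 0 & norm (h - 0) < de / L"
   have n: "norm (crv R (th + h) - crv R th) <= L * abs h" using L(2)[of "th + h" th] by simp
   also have "L * abs h < de" using h L by (simp add: field_simps)
   finally have "abs (g \<bullet> (crv R (th + h) - crv R th)) <= ep / (2 * L) * norm (crv R (th + h) - crv R th)" using de(2)[of "crv R (th + h)"] by (simp add: d_crv[OF R])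
   also have "... <= ep / (2 * L) * (L * abs h)" using n \<open>ep / (2 * L) > 0\<close> by (intro mult_left_mono) auto
   also have "... = ep / 2 * abs h" using L by simp
   finally have "abs (g \<bullet> (crv R (th + h) - crv R th)) / abs h <= ep / 2" using h by (simp add: field_simps)
   then show "norm (g \<bullet> (crv R (th + h) - crv R th) / h - 0) < ep" using \<open>ep > 0\<close> by (simp only: diff_zero real_norm_def abs_divide)
  qed
 qed
 have gd: "g \<bullet> dir t = fst g * cos t + snd g * sin t" "g \<bullet> dir' t = - fst g * sin t + snd g * cos t" for t by (cases g; simp add: dir_def dir'_def)+
 have "((%t. g \<bullet> dir t) has_real_derivative g \<bullet> dir' th) (at th)" unfolding gd by (auto intro!: derivative_eq_intros)
 then have D: "((%h. (g \<bullet> dir (th + h) - g \<bullet> dir th) / h) \<longlongrightarrow> g \<bullet> dir' th) (at 0)" by (simp add: DERIV_def)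
 have "isCont (%t. g \<bullet> dir t) th" using \<open>((%t. g \<bullet> dir t) has_real_derivative g \<bullet> dir' th) (at th)\<close> by (rule DERIV_isCont)
 then have C: "((%h. g \<bullet> dir (th + h)) \<longlongrightarrow> g \<bullet> dir th) (at 0)" by (simp add: isCont_iff)
 have T: "((%h. (g \<bullet> (crv R (th + h) - crv R th) / h - rad R th * ((g \<bullet> dir (th + h) - g \<bullet> dir th) / h)) / (g \<bullet> dir (th + h))) \<longlongrightarrow>
   (0 - rad R th * (g \<bullet> dir' th)) / (g \<bullet> dir th)) (at 0)" by (intro tendsto_divide tendsto_diff tendsto_mult A C D tendsto_const) (use gpos in simp)
 have ev: "eventually (%h. (g \<bullet> (crv R (th + h) - crv R th) / h - rad R th * ((g \<bullet> dir (th + h) - g \<bullet> dir th) / h)) / (g \<bullet> dir (th + h))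
   = (rad R (th + h) - rad R th) / h) (at 0)" using order_tendstoD(1)[OF C gpos] proof eventually_elim
  case (elim h)
  have "g \<bullet> (crv R (th + h) - crv R th) = (rad R (th + h) - rad R th) * (g \<bullet> dir (th + h)) + rad R th * (g \<bullet> dir (th + h) - g \<bullet> dir th)"
   by (simp add: crv_def inner_diff_right inner_add_right algebra_simps)
  then have "g \<bullet> (crv R (th + h) - crv R th) / h - rad R th * ((g \<bullet> dir (th + h) - g \<bullet> dir th) / h)
    = (rad R (th + h) - rad R th) / h * (g \<bullet> dir (th + h))" by (simp add: add_divide_distrib)
  then show ?case using elim by simp
 qed
 have "((%h. (rad R (th + h) - rad R th) / h) \<longlongrightarrow> (0 - rad R th * (g \<bullet> dir' th)) / (g \<bullet> dir th)) (at 0)" by (rule Lim_transform_eventually[OF T ev])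
 then show ?thesis by (simp add: DERIV_def)
qed

text \<open>The speed squared is rad'^2 + rad^2. With the value of rad' from
  \<open>rad_derivative\<close> this is rad^2 times the sum of the squared radial and angular parts
  of \<open>g\<close>, divided by the squared radial part.\<close>

lemma crv_derivative:
 assumes R: "d p0 < R" and g: "gradient d g (crv R th)"
 obtains c' where "(crv R has_vector_derivative c') (at th)" "norm c' = norm g * rad R th / (g \<bullet> dir th)"
proof -
 have gpos: "0 < g \<bullet> dir th" using gradient_pos[of g "rad R th" "dir th"] g rad[OF R, of th] R by (simp add: crv_def)
 define r' where "r' = - (rad R th * (g \<bullet> dir' th)) / (g \<bullet> dir th)"
 have r: "(rad R has_vector_derivative r') (at th)" using rad_derivative[OF assms] by (simp add: r'_def has_real_derivative_iff_has_vector_derivative)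
 have dd: "(dir has_vector_derivative dir' th) (at th)" unfolding dir_def[abs_def] dir'_def
  by (intro has_vector_derivative_Pair) (auto intro!: derivative_eq_intros simp: has_real_derivative_iff_has_vector_derivative[symmetric])
 define c' where "c' = r' *R dir th + rad R th *R dir' th"
 have "(crv R has_vector_derivative c') (at th)" unfolding crv_def[abs_def] c'_def by (rule has_vector_derivative_eq_rhs[OF has_vector_derivative_add[OF has_vector_derivative_const
     has_vector_derivative_scaleR[OF rad_derivative[OF assms] dd]]]) (simp add: r'_def)
 moreover have "norm c' = norm g * rad R th / (g \<bullet> dir th)" proof -
  have alg: "(r * c - q * s)^2 + (r * s + q * c)^2 = (r^2 + q^2) * (c^2 + s^2)" for r q c s :: real by algebra
  have "c' = (r' * cos th - rad R th * sin th, r' * sin th + rad R th * cos th)" by (simp add: c'_def dir_def dir'_def)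
  then have "(norm c')^2 = (r' * cos th - rad R th * sin th)^2 + (r' * sin th + rad R th * cos th)^2" by (simp add: norm_prod_def)
  then have "(norm c')^2 = (r'^2 + (rad R th)^2) * ((cos th)^2 + (sin th)^2)" unfolding alg .
  also have "... = (rad R th)^2 * ((g \<bullet> dir th)^2 + (g \<bullet> dir' th)^2) / (g \<bullet> dir th)^2" using gpos by (simp add: r'_def power_divide power_mult_distrib field_simps)
  also have "... = (norm g * rad R th / (g \<bullet> dir th))^2" by (simp add: inner_dir_squares power_divide power_mult_distrib mult.commute)
  finally show ?thesis using gpos rad_pos[OF R, of th] by (simp add: power2_eq_iff_nonneg)
 qed
 ultimately show ?thesis by (rule that)
qed

text \<open>Above the minimum \<open>d\<close> grows strictly along rays from \<open>p0\<close>, so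
  a point with \<open>d p = R\<close> has points outside the sublevel set in every
  neighbourhood.\<close>

lemma frontier_sublevel:
 assumes R: "d p0 < R" shows "frontier (sublevel d R) = {p. d p = R}"
proof -
 have cl: "closed (sublevel d R)" unfolding sublevel_def by (intro closed_Collect_le cont continuous_on_const)
 have i: "interior (sublevel d R) = {p. d p < R}" proof (rule interior_unique)
  show "{p. d p < R} \<subseteq> sublevel d R" by (auto simp: sublevel_def)
  show "open {p. d p < R}" by (intro open_Collect_less cont continuous_on_const)
  fix T assume T: "T \<subseteq> sublevel d R" "open T"
  show "T \<subseteq> {p. d p < R}" proof
   fix p assume "p : T"
   then obtain e where e: "e > 0" "ball p e \<subseteq> T" using T openE by blast
   have "d p ~= R" proof
    assume dp: "d p = R"
    then have np: "p ~= p0" using R by auto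
    define et where "et = e / (2 * norm (p - p0))"
    have et: "et > 0" using e np by (simp add: et_def)
    have "dist p (p + et *R (p - p0)) = e / 2" using np e by (simp add: dist_norm et_def)
    then have "d (p + et *R (p - p0)) <= R" using e T by (auto simp: sublevel_def subset_eq)
    moreover have "d (p0 + 1 *R (p - p0)) < d (p0 + (1 + et) *R (p - p0))" by (rule ray_less') (use et dp R in auto)
    moreover have "p0 + (1 + et) *R (p - p0) = p + et *R (p - p0)" by (simp add: algebra_simps)
    ultimately show False using dp by simp
   qed
   then show "p : {p. d p < R}" using T \<open>p : T\<close> by (auto simp: sublevel_def)
  qed
 qed
 show ?thesis unfolding frontier_def closure_closed[OF cl] i by (auto simp: sublevel_def)
qed

text \<open>Starting at the angle -pi/2 lets one turn cover exactly the two angular intervals of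
  \<open>polar_coordinates\<close>, up to their end points.\<close>

definition loop :: "real => real => plane" where
 "loop R t = crv R (2 * pi * t + - (pi / 2))"

lemma loop_lipschitz_loops:
 assumes R: "d p0 < R" shows "loop R : lipschitz_loops (frontier (sublevel d R))"
proof -
 obtain L where L: "L > 0" "!!th th'. norm (crv R th - crv R th') <= L * abs (th - th')" by (rule crv_Lipschitz[OF R]) blast
 have lip: "(L * (2 * pi))-lipschitz_on S (loop R)" for S proof (rule lipschitz_onI)
  fix x y
  have "abs ((2 * pi * x + - (pi / 2)) - (2 * pi * y + - (pi / 2))) = 2 * pi * abs (x - y)" by (simp add: abs_mult flip: right_diff_distrib)
  then show "dist (loop R x) (loop R y) <= (L * (2 * pi)) * dist x y" using L(2)[of "2 * pi * x + - (pi / 2)" "2 * pi * y + - (pi / 2)"] by (simp add: loop_def dist_norm mult.assoc)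
 qed (use L in simp)
 have inj: "x - y : \<int>" if "loop R x = loop R y" for x y proof -
  define a b where "a = 2 * pi * x + - (pi / 2)" and "b = 2 * pi * y + - (pi / 2)"
  have e: "rad R a *R dir a = rad R b *R dir b" using that by (simp add: loop_def crv_def a_def b_def)
  then have "norm (rad R a *R dir a) = norm (rad R b *R dir b)" by simp
  then have "rad R a = rad R b" using rad_pos[OF R, of a] rad_pos[OF R, of b] by simp
  then have "dir a = dir b" using e rad_pos[OF R, of a] by simp
  then have "sin a = sin b & cos a = cos b" by (simp add: dir_def)
  then obtain n :: int where "a = b + 2 * pi * n" using sin_cos_eq_iff by blast
  then have "2 * pi * (x - y) = 2 * pi * n" by (simp add: a_def b_def algebra_simps)
  then show ?thesis by simp
 qed
 have "simple_path (loop R)" unfolding simple_path_def loop_free_def path_def proof (intro conjI ballI impI)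
  show "continuous_on {0..1} (loop R)" using lip by (rule lipschitz_on_continuous_on)
  fix x y :: real assume xy: "x : {0..1}" "y : {0..1}" "loop R x = loop R y"
  then obtain n :: int where n: "x - y = of_int n" using inj[OF xy(3)] by (auto elim: Ints_cases)
  then have "abs (real_of_int n) <= 1" using xy by auto
  then have "abs n <= 1" by linarith
  then have "n = 0 | n = 1 | n = -1" by linarith
  then show "x = y | x = 0 & y = 1 | x = 1 & y = 0" using n xy by auto
 qed
 moreover have "pathfinish (loop R) = pathstart (loop R)" proof -
  have "dir (2 * pi * 1 + - (pi / 2)) = dir (2 * pi * 0 + - (pi / 2))" proof -
   have e: "2 * pi * 1 + - (pi / 2) = - (pi / 2) + 2 * pi" by simp
   show ?thesis unfolding dir_def e sin_periodic cos_periodic by simp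
  qed
  then show ?thesis unfolding pathfinish_def pathstart_def loop_def crv_def rad_def by simp
 qed
 moreover have "path_image (loop R) = {p. d p = R}" proof
  show "path_image (loop R) \<subseteq> {p. d p = R}" by (auto simp: path_image_def loop_def d_crv[OF R])
  show "{p. d p = R} \<subseteq> path_image (loop R)" proof
   fix p assume "p : {p. d p = R}"
   then obtain x z where p_eq: "p = (x, z)" and dp: "d (x, z) = R" by (cases p) auto
   define rh where "rh = norm ((x, z) - p0)"
   have "(x, z) ~= p0" using dp R by auto
   then have rh: "rh > 0" by (simp add: rh_def)
   define a b where "a = (x - fst p0) / rh" and "b = (z - snd p0) / rh"
   have "rh^2 = (x - fst p0)^2 + (z - snd p0)^2" by (cases p0) (simp add: rh_def norm_prod_def)
   moreover have "(- b)^2 + a^2 = ((x - fst p0)^2 + (z - snd p0)^2) / rh^2" by (simp add: a_def b_def power_divide add_divide_distrib)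
   ultimately have "(- b)^2 + a^2 = rh^2 / rh^2" by (simp only:)
   also have "... = 1" using rh by simp
   finally have "(- b)^2 + a^2 = 1" .
   \<comment> \<open>The library angle is measured for the rotated pair (-b, a), which accounts for
     the shift by pi/2 in \<open>loop\<close>.\<close>
   from sincos_total_2pi[OF this] obtain \<tau> where \<tau>: "0 <= \<tau>" "\<tau> < 2 * pi" "- b = cos \<tau>" "a = sin \<tau>" by blast
   have dd: "dir (\<tau> + - (pi / 2)) = (a, b)" proof -
    have "cos (\<tau> - pi / 2) = a" "sin (\<tau> - pi / 2) = b" using \<tau> by (simp_all add: cos_diff sin_diff)
    then show ?thesis by (simp add: dir_def)
   qed
   have p: "p0 + rh *R dir (\<tau> + - (pi / 2)) = (x, z)" unfolding dd using rh by (cases p0) (simp add: a_def b_def)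
   have "rad R (\<tau> + - (pi / 2)) = rh" using rad_unique[OF rh, of "\<tau> + - (pi / 2)"] p dp R by simp
   then have "loop R (\<tau> / (2 * pi)) = (x, z)" using p by (simp add: loop_def crv_def)
   moreover have "\<tau> / (2 * pi) : {0..1}" using \<tau> by simp
   ultimately show "p : path_image (loop R)" unfolding path_image_def p_eq by (metis imageI)
  qed
 qed
 ultimately show ?thesis using lip frontier_sublevel[OF R] by (auto simp: lipschitz_loops_def)
qed

text \<open>The radius as one total function of (R, th), set to 0 at and below the minimum level, so
  that joint measurability can be stated for Fubini.\<close>

definition radm :: "plane => real" where
 "radm x = (if d p0 < fst x then rad (fst x) (snd x) else 0)"

lemma dir_measurable [measurable]: "dir : Borel" unfolding dir_def[abs_def] by (intro borel_measurable_continuous_onI continuous_intros)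

lemma radm_measurable [measurable]: "radm : Borel"
proof (subst borel_measurable_iff_le, rule allI)
 fix c :: real
 show "{x : space borel. radm x <= c} : sets borel" proof (cases "0 <= c")
  case True
  have "{x : space borel. radm x <= c} = {x. fst x <= d p0} \<union> {x. fst x <= d (p0 + c *R dir (snd x))}" proof (intro set_eqI iffI)
   fix x assume "x : {x : space borel. radm x <= c}"
   then show "x : {x. fst x <= d p0} \<union> {x. fst x <= d (p0 + c *R dir (snd x))}" using rad_le_iff[of "fst x" c "snd x"] True by (auto simp: radm_def split: if_splits)
  next
   fix x assume "x : {x. fst x <= d p0} \<union> {x. fst x <= d (p0 + c *R dir (snd x))}"
   then show "x : {x : space borel. radm x <= c}" using rad_le_iff[of "fst x" c "snd x"] True by (auto simp: radm_def)
  qed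
  moreover have "continuous_on UNIV (%x::real\<times>real. d (p0 + c *R dir (snd x)))" unfolding dir_def by (rule continuous_on_compose2[OF cont]) (auto intro!: continuous_intros)
  then have "closed {x::real\<times>real. fst x <= d (p0 + c *R dir (snd x))}" "closed {x::real\<times>real. fst x <= d p0}" by (intro closed_Collect_le continuous_intros; assumption?)+
  ultimately show ?thesis by auto
 next
  case False
  have "radm x >= 0" for x using rad_pos[of "fst x" "snd x"] by (auto simp: radm_def less_imp_le)
  then have "~ radm x <= c" for x using False by (meson order_trans)
  then have "{x : space borel. radm x <= c} = {}" by blast
  then show ?thesis by (simp only: sets.empty_sets)
 qed
qed

text \<open>In polar coordinates around \<open>p0\<close> the substitution R = d along each ray has
  derivative g . dir, so |g| rh drh becomes |g| rh / (g . dir) dR, and by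
  \<open>crv_derivative\<close> this factor is the speed of the level curve in the angle. The
  resulting integral over one level is that of \<open>loop\<close>, hence at most the supremum in
  \<open>arclength_integral\<close>. \<open>E\<close> carries the points of differentiability; the
  minorant \<open>F\<close> is Borel, while no measurability is asserted of
  \<open>F'\<close>.\<close>

theorem coarea_inequality:
 fixes F F' :: "plane => ennreal"
 assumes E[measurable]: "E : sets borel" and g: "!!p. p : E ==> gradient d (grad d p) p"
  and F[measurable]: "F : Borel" and FF': "!!p. p : E ==> F p <= F' p" and R0: "d p0 <= R0"
 shows "(NN p. ind {p : E. R0 < d p} p * (ennreal (norm (grad d p)) * F p))
  <= (NN R. ind {R0<..} R * arclength_integral (frontier (sublevel d R)) F')" proof -
 define G where "G = grad d"
 have [measurable]: "G : Borel" proof -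
  have "(%p. (fst (G p), snd (G p))) : Borel" unfolding G_def by (intro borel_measurable_Pair grad_measurable[OF cont])
  then show ?thesis by simp
 qed
 define Ph where "Ph p = ind {p : E. R0 < d p} p * (ennreal (norm (G p)) * F p)" for p
 have [measurable]: "Ph : Borel" unfolding Ph_def by measurable
 define cm where "cm x = p0 + radm x *R dir (snd x)" for x
 have cmm: "cm : Borel" unfolding cm_def by measurable
 have cmR: "cm (R, th) = crv R th" if "d p0 < R" for R th using that by (simp add: cm_def crv_def radm_def)
 \<comment> \<open>\<open>F\<close> times the speed of the curve of level \<open>fst x\<close> at
   angle \<open>snd x\<close>, cut off where the point of the curve leaves \<open>E\<close>.\<close>
 define H where "H x = ind E (cm x) * (ennreal (norm (G (cm x))) * F (cm x) * ennreal (radm x / (G (cm x) \<bullet> dir (snd x))))" for x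
 have Hm: "H : Borel" unfolding H_def using cmm by measurable
 have [measurable]: "(%x::real\<times>real. H x) : Borel2" using Hm by (simp add: borel_prod)
 have ray: "(NN rh. ind {0<..} rh * (ennreal rh * Ph (p0 + rh *R dir th))) <= (NN R. ind {R0<..} R * H (R, th))" for th proof -
  define f where "f rh = d (p0 + rh *R dir th)" for rh
  define f' where "f' rh = G (p0 + rh *R dir th) \<bullet> dir th" for rh
  define S where "S = {rh. 0 < rh & p0 + rh *R dir th : E & R0 < f rh}"
  have [measurable]: "f : Borel" "f' : Borel" unfolding f_def f'_def by measurable
  have [measurable]: "S : sets borel" unfolding S_def by measurable
  have Sf: "rad (f rh) th = rh" "d p0 < f rh" "crv (f rh) th = p0 + rh *R dir th" if "rh : S" for rh proof -
   show 1: "d p0 < f rh" using that R0 by (simp add: S_def)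
   show "rad (f rh) th = rh" using rad_unique[of rh th] 1 that by (simp add: S_def f_def)
   then show "crv (f rh) th = p0 + rh *R dir th" by (simp add: crv_def)
  qed
  have img: "f ` S = {R. R0 < R & cm (R, th) : E}" proof (intro set_eqI iffI)
   fix R assume "R : f ` S"
   then obtain rh where "rh : S" "R = f rh" by blast
   then show "R : {R. R0 < R & cm (R, th) : E}" using Sf[of rh] by (simp add: cmR) (simp add: S_def)
  next
   fix R assume R: "R : {R. R0 < R & cm (R, th) : E}"
   then have m: "d p0 < R" using R0 by simp
   have "f (rad R th) = R" using d_rad[OF m] by (simp add: f_def)
   moreover have "rad R th : S" using R rad[OF m, of th] by (simp add: S_def f_def cmR[OF m] crv_def)
   ultimately show "R : f ` S" by (metis imageI)
  qed
  have [measurable]: "(%R. cm (R, th)) : Borel" by (rule measurable_compose[OF _ cmm]) measurable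
  have imgm: "f ` S : sets borel" unfolding img by measurable
  have der: "(f has_field_derivative f' rh) (at rh within S)" if "rh : S" for rh proof -
   have "gradient d (G (p0 + rh *R dir th)) (p0 + rh *R dir th)" using that g by (simp add: S_def G_def)
   moreover have "((%rh. p0 + rh *R dir th) has_derivative (%t. t *R dir th)) (at rh)" by (auto intro!: derivative_eq_intros)
   ultimately have "(f has_derivative (%t. G (p0 + rh *R dir th) \<bullet> (t *R dir th))) (at rh)" unfolding f_def by (rule has_derivative_compose[rotated])
   then have "(f has_field_derivative f' rh) (at rh)" by (simp add: has_field_derivative_def f'_def mult.commute[of _ "G (p0 + rh *R dir th) \<bullet> dir th"])
   then show ?thesis by (rule has_field_derivative_at_within)
  qed
  have f'pos: "0 < f' rh" if "rh : S" for rh unfolding f'_def by (rule gradient_pos[of _ rh]) (use that g Sf(2)[OF that] in \<open>auto simp: S_def G_def f_def\<close>)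
  have inj: "inj_on f S" by (rule inj_on_inverseI[of _ "%R. rad R th"]) (rule Sf(1))
  have Hr: "(%R. H (R, th)) : Borel" by measurable
  have "(NN rh. ind {0<..} rh * (ennreal rh * Ph (p0 + rh *R dir th)))
   = (NN rh. ind S rh * ennreal (abs (f' rh)) * H (f rh, th))" proof (rule nn_integral_cong)
   fix rh :: real
   show "ind {0<..} rh * (ennreal rh * Ph (p0 + rh *R dir th)) = ind S rh * ennreal (abs (f' rh)) * H (f rh, th)" proof (cases "rh : S")
    case True
    have rr: "radm (f rh, th) = rh" using Sf[OF True] by (simp add: radm_def)
    have cc: "cm (f rh, th) = p0 + rh *R dir th" using Sf[OF True] by (simp add: cmR)
    have "ennreal (abs (f' rh)) * ennreal (rh / f' rh) = ennreal (abs (f' rh) * (rh / f' rh))" using True f'pos[OF True] by (intro ennreal_mult[symmetric]) (auto simp: S_def)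
    also have "abs (f' rh) * (rh / f' rh) = rh" using f'pos[OF True] by simp
    finally have e: "ennreal (abs (f' rh)) * ennreal (rh / f' rh) = ennreal rh" .
    have "ind S rh * ennreal (abs (f' rh)) * H (f rh, th) = (ennreal (abs (f' rh)) * ennreal (rh / f' rh)) * (ennreal (norm (G (p0 + rh *R dir th))) * F (p0 + rh *R dir th))"
     using True by (simp add: H_def cc rr f'_def S_def mult_ac)
    also have "... = ind {0<..} rh * (ennreal rh * Ph (p0 + rh *R dir th))" unfolding e using True by (simp add: Ph_def S_def f_def)
    finally show ?thesis by simp
   qed (auto simp: Ph_def S_def f_def indicator_def)
  qed
  also have "... = (NN R. ind (f ` S) R * H (R, th))" by (rule nn_lint_substitution[OF _ imgm _ _ der inj Hr]) measurable
  also have "... <= (NN R. ind {R0<..} R * H (R, th))" by (rule nn_integral_mono) (auto simp: img indicator_def)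
  finally show ?thesis .
 qed
 define S1 S2 where "S1 = {-pi/2<..<pi/2}" and "S2 = {pi/2<..<3*pi/2}"
 have [measurable]: "S1 : sets borel" "S2 : sets borel" by (auto simp: S1_def S2_def)
 have fub: "(NN th. ind S th * (NN rh. ind {0<..} rh * (ennreal rh * Ph (p0 + (rh * cos th, rh * sin th)))))
   <= (NN R. ind {R0<..} R * (NN th. ind S th * H (R, th)))" if [measurable]: "S : sets borel" for S proof -
  have "(NN th. ind S th * (NN rh. ind {0<..} rh * (ennreal rh * Ph (p0 + (rh * cos th, rh * sin th)))))
   <= (NN th. ind S th * (NN R. ind {R0<..} R * H (R, th)))" proof (rule nn_integral_mono)
   fix th show "ind S th * (NN rh. ind {0<..} rh * (ennreal rh * Ph (p0 + (rh * cos th, rh * sin th))))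
    <= ind S th * (NN R. ind {R0<..} R * H (R, th))" using mult_left_mono[OF ray[of th], of "ind S th"] by (simp add: dir_def)
  qed
  also have "... = (NN th. (NN R. ind S th * (ind {R0<..} R * H (R, th))))" by (intro nn_integral_cong nn_integral_cmult[symmetric]) measurable
  also have "... = (NN R. (NN th. ind S th * (ind {R0<..} R * H (R, th))))" by (rule lborel_pair.Fubini') measurable
  also have "... = (NN R. ind {R0<..} R * (NN th. ind S th * H (R, th)))" proof (rule nn_integral_cong)
   fix R
   have "(NN th. ind S th * (ind {R0<..} R * H (R, th))) = (NN th. ind {R0<..} R * (ind S th * H (R, th)))" by (simp add: mult_ac)
   also have "... = ind {R0<..} R * (NN th. ind S th * H (R, th))" by (rule nn_integral_cmult) measurable
   finally show "(NN th. ind S th * (ind {R0<..} R * H (R, th))) = ind {R0<..} R * (NN th. ind S th * H (R, th))" .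
  qed
  finally show ?thesis .
 qed
 \<comment> \<open>The linear change of angle th = 2 pi t - pi/2 contributes the factor 2 pi, which
   is also the factor between the derivatives of \<open>loop\<close> and of
   \<open>crv\<close>.\<close>
 have arc: "(NN th. ind S1 th * H (R, th)) + (NN th. ind S2 th * H (R, th)) <= arclength_integral (frontier (sublevel d R)) F'"
  if "R0 < R" for R proof -
  have m: "d p0 < R" using that R0 by simp
  have "(NN th. ind S1 th * H (R, th)) + (NN th. ind S2 th * H (R, th))
    = (NN th. ind S1 th * H (R, th) + ind S2 th * H (R, th))" by (rule nn_integral_add[symmetric]) measurable
  also have "... = (NN th. ind (S1 \<union> S2) th * H (R, th))" by (rule nn_integral_cong) (auto simp: S1_def S2_def indicator_def)
  also have "... = ennreal (abs (2 * pi)) * (NN t. ind (S1 \<union> S2) (- (pi / 2) + 2 * pi * t) * H (R, - (pi / 2) + 2 * pi * t))" proof (rule nn_integral_real_affine)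
   have [measurable]: "S1 \<union> S2 : sets borel" by (rule sets.Un) measurable
   have [measurable]: "(%th. H (R, th)) : Borel" by measurable
   show "(%th. ind (S1 \<union> S2) th * H (R, th)) : Borel" by measurable
  qed simp
  also have "... = (NN t. ennreal (abs (2 * pi)) * (ind (S1 \<union> S2) (- (pi / 2) + 2 * pi * t) * H (R, - (pi / 2) + 2 * pi * t)))" by (rule nn_integral_cmult[symmetric]) measurable
  also have "... <= (NN t. F' (loop R t) * ennreal (norm (vector_derivative (loop R) (at t within {0..1}))) * ind {0..1} t)" proof (rule nn_integral_mono)
   fix t :: real
   define th where "th = - (pi / 2) + 2 * pi * t"
   show "ennreal (abs (2 * pi)) * (ind (S1 \<union> S2) (- (pi / 2) + 2 * pi * t) * H (R, - (pi / 2) + 2 * pi * t)) <= F' (loop R t) * ennreal (norm (vector_derivative (loop R) (at t within {0..1}))) * ind {0..1} t"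
   proof (cases "th : S1 \<union> S2 & crv R th : E")
    case False
    then have "ind (S1 \<union> S2) th * H (R, th) = 0" by (auto simp: H_def cmR[OF m] indicator_def)
    then show ?thesis unfolding th_def by (simp only: mult_zero_right zero_le)
   next
    case True
    have t: "0 <= t" "t <= 1" proof -
     have "0 <= 2 * pi * t" "2 * pi * t <= 2 * pi * 1" using True by (auto simp: th_def S1_def S2_def)
     then have "2 * pi * 0 <= 2 * pi * t" by simp
     moreover have "0 < 2 * pi" by simp
     ultimately show "0 <= t" by (simp only: mult_le_cancel_left_pos)
     show "t <= 1" using \<open>2 * pi * t <= 2 * pi * 1\<close> \<open>0 < 2 * pi\<close> by (simp only: mult_le_cancel_left_pos)
    qed
    have lt: "loop R t = crv R th" by (simp add: loop_def th_def)
    have gd: "gradient d (G (crv R th)) (crv R th)" using g True by (simp add: G_def)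
    from crv_derivative[OF m gd] obtain c' where c': "(crv R has_vector_derivative c') (at th)"
     "norm c' = norm (G (crv R th)) * rad R th / (G (crv R th) \<bullet> dir th)" .
    have "((%t. 2 * pi * t + - (pi / 2)) has_vector_derivative (2 * pi)) (at t)" by (auto intro!: derivative_eq_intros simp: has_real_derivative_iff_has_vector_derivative[symmetric])
    moreover have "(crv R has_vector_derivative c') (at (2 * pi * t + - (pi / 2)))" using c'(1) by (simp add: th_def add.commute)
    ultimately have "(crv R \<circ> (%t. 2 * pi * t + - (pi / 2)) has_vector_derivative (2 * pi) *R c') (at t)" by (rule vector_diff_chain_at)
    then have "(loop R has_vector_derivative (2 * pi) *R c') (at t)" by (simp add: loop_def[abs_def] comp_def)
    then have vd: "vector_derivative (loop R) (at t within {0..1}) = (2 * pi) *R c'" by (rule vector_derivative_at_within_ivl) (use t in auto)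
    have gp: "0 < G (crv R th) \<bullet> dir th" using gradient_pos[of "G (crv R th)" "rad R th" "dir th"] gd rad[OF m, of th] m by (simp add: crv_def)
    have rm: "radm (R, th) = rad R th" using m by (simp add: radm_def)
    have n: "ennreal (norm ((2 * pi) *R c')) = ennreal (abs (2 * pi)) * (ennreal (norm (G (crv R th))) * ennreal (rad R th / (G (crv R th) \<bullet> dir th)))"
     using gp rad_pos[OF m, of th] by (subst ennreal_mult[symmetric], simp, simp, subst ennreal_mult[symmetric], simp, simp) (simp add: c'(2))
    have "ennreal (abs (2 * pi)) * (ind (S1 \<union> S2) th * H (R, th)) = F (crv R th) * ennreal (norm ((2 * pi) *R c'))"
     unfolding n using True by (simp add: H_def cmR[OF m] rm mult_ac)
    also have "... <= F' (loop R t) * ennreal (norm (vector_derivative (loop R) (at t within {0..1}))) * ind {0..1} t"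
     using FF'[of "crv R th"] True t by (simp add: vd lt mult_right_mono)
    finally show ?thesis by (simp add: th_def)
   qed
  qed
  also have "... = (\<integral>\<^sup>+t\<in>{0..1}. F' (loop R t) * ennreal (norm (vector_derivative (loop R) (at t within {0..1}))) \<partial>lebesgue)"
   by (simp add: nn_integral_completion)
  also have "... <= arclength_integral (frontier (sublevel d R)) F'" unfolding arclength_integral_def by (rule SUP_upper[OF loop_lipschitz_loops[OF m]])
  finally show ?thesis .
 qed
 have "(NN p. ind {p : E. R0 < d p} p * (ennreal (norm (grad d p)) * F p)) = (NN p. Ph p)" by (simp add: Ph_def G_def)
 also have "... = (NN p. Ph (p0 + p))" using nn_lint_shift[of Ph p0] by (simp add: add.commute)
 also have "... = (NN th. ind S1 th * (NN rh. ind {0<..} rh * (ennreal rh * Ph (p0 + (rh * cos th, rh * sin th)))))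
   + (NN th. ind S2 th * (NN rh. ind {0<..} rh * (ennreal rh * Ph (p0 + (rh * cos th, rh * sin th)))))" unfolding S1_def S2_def by (rule polar_coordinates) measurable
 also have "... <= (NN R. ind {R0<..} R * (NN th. ind S1 th * H (R, th)))
   + (NN R. ind {R0<..} R * (NN th. ind S2 th * H (R, th)))" by (intro add_mono fub) measurable
 also have "... = (NN R. ind {R0<..} R * (NN th. ind S1 th * H (R, th)) + ind {R0<..} R * (NN th. ind S2 th * H (R, th)))" by (rule nn_integral_add[symmetric]) measurable
 also have "... <= (NN R. ind {R0<..} R * arclength_integral (frontier (sublevel d R)) F')" by (rule nn_integral_mono) (use arc in \<open>auto simp: indicator_def\<close>)
 finally show ?thesis .
qed

end

lemma convex_well_exists:
 assumes "convex_on UNIV d" "filterlim d at_top at_infinity"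
 shows "EX p0. convex_well d p0"
proof -
 have cont: "continuous_on UNIV d" by (rule convex_on_continuous[OF open_UNIV assms(1)])
 have "eventually (%p. d 0 <= d p) at_infinity" using assms(2) by (simp add: filterlim_at_top)
 then obtain b where b: "!!p. b <= norm p ==> d 0 <= d p" by (auto simp: eventually_at_infinity)
 have "EX x:cball 0 (abs b). ALL y:cball 0 (abs b). d x <= d y" by (rule continuous_attains_inf) (auto intro: continuous_on_subset[OF cont])
 then obtain p0 where p0: "!!y. y : cball 0 (abs b) ==> d p0 <= d y" by blast
 have "d p0 <= d p" for p proof (cases "norm p <= abs b")
  case True then show ?thesis using p0[of p] by simp
 next
  case False
  then have "d 0 <= d p" by (intro b) linarith
  then show ?thesis using p0[of 0] by simp
 qed
 then have "convex_well d p0" using assms by unfold_locales auto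
 then show ?thesis by blast
qed

section \<open>Weak gradients and Green's identity\<close>

lemma test_continuous:
 assumes "test_function \<phi> D"
 shows "continuous_on UNIV \<phi>" "continuous_on UNIV D" using assms by (auto simp: test_function_def continuous_on_eq_continuous_at intro: has_derivative_continuous)

lemma test_support:
 assumes "test_function \<phi> D"
 obtains r where "r > 0" "!!p. r < norm p ==> \<phi> p = 0" "!!p. r < norm p ==> D p = 0"
proof -
 have "bounded {p. \<phi> p ~= 0}" using assms by (simp add: test_function_def)
 then obtain b where "ALL p:{p. \<phi> p ~= 0}. norm p <= b" unfolding bounded_iff by blast
 then have b: "\<phi> p = 0" if "b < norm p" for p using that by (metis (mono_tags) mem_Collect_eq not_less)
 have "D p = 0" if "abs b + 1 < norm p" for p proof -
  have "eventually (%y. y : {y. b < norm y}) (nhds p)" using that by (intro eventually_nhds_in_open open_Collect_less continuous_intros) auto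
  then have ev: "eventually (%y. \<phi> y = 0) (nhds p)" by eventually_elim (use b in simp)
  have "gradient \<phi> (D p) p" using assms unfolding test_function_def by blast
  then have "gradient (%_. 0) (D p) p" by (rule has_derivative_transform_eventually[where s=UNIV]) (use ev b that in \<open>auto simp: eventually_at_filter elim: eventually_mono\<close>)
  then have "(%v. D p \<bullet> v) = (%_. 0)" using has_derivative_unique has_derivative_const by blast
  then have "D p \<bullet> D p = 0" by metis
  then show ?thesis by simp
 qed
 then show ?thesis using b by (intro that[of "abs b + 1"]) auto
qed

lemma test_bounded:
 assumes "test_function \<phi> D"
 obtains B where "B >= 0" "!!p. abs (\<phi> p) <= B" "!!p. norm (D p) <= B" "!!p. abs (fst (D p)) <= B" "!!p. abs (snd (D p)) <= B"
proof -
 obtain r where r: "!!p. r < norm p ==> \<phi> p = 0" "!!p. r < norm p ==> D p = 0" by (rule test_support[OF assms]) blast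
 have "compact (\<phi> ` cball 0 r)" "compact (D ` cball 0 r)" by (intro compact_continuous_image continuous_on_subset[OF test_continuous(1)[OF assms]]
    continuous_on_subset[OF test_continuous(2)[OF assms]]; simp)+
 then have "bounded (\<phi> ` cball 0 r)" "bounded (D ` cball 0 r)" by (auto intro: compact_imp_bounded)
 then obtain B1 B2 where B: "ALL y:\<phi> ` cball 0 r. norm y <= B1" "ALL y:D ` cball 0 r. norm y <= B2" unfolding bounded_iff by blast
 define B where "B = max 0 (max B1 B2)"
 have b: "abs (\<phi> p) <= B" "norm (D p) <= B" for p using B r[of p] by (cases "norm p <= r"; force simp: B_def)+
 show ?thesis proof (rule that[of B])
  show "abs (fst (D p)) <= B" "abs (snd (D p)) <= B" for p using b(2)[of p] norm_fst_le[of "fst (D p)" "snd (D p)"] norm_snd_le[of "snd (D p)" "fst (D p)"] by auto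
 qed (use b in \<open>auto simp: B_def\<close>)
qed

lemma test_measurable:
 assumes "test_function \<phi> D"
 shows "\<phi> : Borel" "D : Borel"
  "(%p. fst (D p)) : Borel" "(%p. snd (D p)) : Borel" using test_continuous[OF assms] by (auto intro!: borel_measurable_continuous_onI continuous_intros)

lemma test_function_mult:
 assumes "test_function \<phi> D" "test_function ps D'"
 shows "test_function (%p. \<phi> p * ps p) (%p. \<phi> p *R D' p + ps p *R D p)" unfolding test_function_def
proof (intro conjI allI)
 fix p
 have "gradient \<phi> (D p) p" "gradient ps (D' p) p" using assms unfolding test_function_def by blast+
 from has_derivative_mult[OF this]
 show "gradient (%p. \<phi> p * ps p) (\<phi> p *R D' p + ps p *R D p) p" by (simp add: inner_add_left mult.commute)
next
 show "continuous_on UNIV (%p. \<phi> p *R D' p + ps p *R D p)" by (intro continuous_intros test_continuous[OF assms(1)] test_continuous[OF assms(2)])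
 show "bounded {p. \<phi> p * ps p ~= 0}" using assms(1) by (auto simp: test_function_def intro: bounded_subset)
qed

lemma test_function_add:
 assumes "test_function \<phi> D" "test_function ps D'"
 shows "test_function (%p. \<phi> p + ps p) (%p. D p + D' p)" unfolding test_function_def
proof (intro conjI allI)
 fix p
 have "gradient \<phi> (D p) p" "gradient ps (D' p) p" using assms unfolding test_function_def by blast+
 from has_derivative_add[OF this]
 show "gradient (%p. \<phi> p + ps p) (D p + D' p) p" by (simp add: inner_add_left)
next
 show "continuous_on UNIV (%p. D p + D' p)" by (intro continuous_intros test_continuous[OF assms(1)] test_continuous[OF assms(2)])
 have "bounded ({p. \<phi> p ~= 0} \<union> {p. ps p ~= 0})" using assms by (auto simp: test_function_def)
 then show "bounded {p. \<phi> p + ps p ~= 0}" by (rule bounded_subset) auto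
qed

lemma test_function_prod:
 assumes a: "C2c al al1 al2" and b: "C2c \<beta> \<beta>1 \<beta>2"
 shows "test_function (%p. al (fst p) * \<beta> (snd p)) (%p. (al1 (fst p) * \<beta> (snd p), al (fst p) * \<beta>1 (snd p)))"
  "test_function (%p. al1 (fst p) * \<beta> (snd p)) (%p. (al2 (fst p) * \<beta> (snd p), al1 (fst p) * \<beta>1 (snd p)))"
  "test_function (%p. al (fst p) * \<beta>1 (snd p)) (%p. (al1 (fst p) * \<beta>1 (snd p), al (fst p) * \<beta>2 (snd p)))" proof -
 obtain r where r: "!!x. r < abs x ==> al x = 0" "!!x. r < abs x ==> al1 x = 0" by (rule C2c_supp[OF a]) blast
 obtain s where s: "!!x. s < abs x ==> \<beta> x = 0" "!!x. s < abs x ==> \<beta>1 x = 0" by (rule C2c_supp[OF b]) blast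
 have *: "test_function (%p. f (fst p) * g (snd p)) (%p. (f1 (fst p) * g (snd p), f (fst p) * g1 (snd p)))"
  if f: "!!x. (f has_real_derivative f1 x) (at x)" "continuous_on UNIV f1" "!!x. r < abs x ==> f x = 0"
   and g: "!!x. (g has_real_derivative g1 x) (at x)" "continuous_on UNIV g1" "!!x. s < abs x ==> g x = 0" for f f1 g g1 unfolding test_function_def
 proof (intro conjI allI)
  fix p :: "plane"
  have cf: "continuous_on UNIV f" "continuous_on UNIV g" using f(1) g(1) by (auto simp: continuous_on_eq_continuous_at intro: DERIV_isCont)
  have 1: "((%p. f (fst p)) has_derivative (%v. fst v * f1 (fst p))) (at p)"
   by (rule has_derivative_eq_rhs[OF has_derivative_compose[OF has_derivative_fst[OF has_derivative_ident] f(1)[THEN has_field_derivative_imp_has_derivative]]])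
    (auto simp: mult.commute)
  have 2: "((%p. g (snd p)) has_derivative (%v. snd v * g1 (snd p))) (at p)"
   by (rule has_derivative_eq_rhs[OF has_derivative_compose[OF has_derivative_snd[OF has_derivative_ident] g(1)[THEN has_field_derivative_imp_has_derivative]]])
    (auto simp: mult.commute)
  show "gradient (%p. f (fst p) * g (snd p)) (f1 (fst p) * g (snd p), f (fst p) * g1 (snd p)) p"
   by (rule has_derivative_eq_rhs[OF has_derivative_mult[OF 1 2]]) (auto simp: inner_prod_def algebra_simps)
  show "continuous_on UNIV (%p. (f1 (fst p) * g (snd p), f (fst p) * g1 (snd p)))" by (intro continuous_intros continuous_on_compose2[OF f(2)] continuous_on_compose2[OF g(2)]
     continuous_on_compose2[OF cf(1)] continuous_on_compose2[OF cf(2)]) auto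
  have "norm p <= abs r + abs s" if "f (fst p) * g (snd p) ~= 0" for p proof -
   have "abs (fst p) <= r" "abs (snd p) <= s" using that f(3)[of "fst p"] g(3)[of "snd p"] by (auto simp: not_less[symmetric])
   moreover have "norm p <= abs (fst p) + abs (snd p)" using sqrt_sum_squares_le_sum_abs by (cases p) (simp add: norm_prod_def)
   ultimately show ?thesis by linarith
  qed
  then show "bounded {p. f (fst p) * g (snd p) ~= 0}" unfolding bounded_iff by blast
 qed
 have a': "!!x. (al has_real_derivative al1 x) (at x)" "!!x. (al1 has_real_derivative al2 x) (at x)" using a by (auto simp: C2c_def)
 have b': "!!x. (\<beta> has_real_derivative \<beta>1 x) (at x)" "!!x. (\<beta>1 has_real_derivative \<beta>2 x) (at x)" using b by (auto simp: C2c_def)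
 show "test_function (%p. al (fst p) * \<beta> (snd p)) (%p. (al1 (fst p) * \<beta> (snd p), al (fst p) * \<beta>1 (snd p)))"
  by (rule *) (use a' b' C2c_cont[OF a] C2c_cont[OF b] r s in auto)
 show "test_function (%p. al1 (fst p) * \<beta> (snd p)) (%p. (al2 (fst p) * \<beta> (snd p), al1 (fst p) * \<beta>1 (snd p)))"
  by (rule *) (use a' b' C2c_cont[OF a] C2c_cont[OF b] r s in auto)
 show "test_function (%p. al (fst p) * \<beta>1 (snd p)) (%p. (al1 (fst p) * \<beta>1 (snd p), al (fst p) * \<beta>2 (snd p)))"
  by (rule *) (use a' b' C2c_cont[OF a] C2c_cont[OF b] r s in auto)
qed

text \<open>\<open>D1\<close> and \<open>D2\<close> are the gradients of the two partial
  derivatives, so \<open>fst (D1 p) + snd (D2 p)\<close> is the Laplacian of \<open>ps\<close>, and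
  each step of an integration by parts is an instance of the weak gradient.\<close>

definition C2c_plane :: "(plane => real) => (plane => plane) => (plane => plane) => (plane => plane) => bool" where
 "C2c_plane ps D D1 D2 \<longleftrightarrow> test_function ps D & test_function (%p. fst (D p)) D1 & test_function (%p. snd (D p)) D2"

lemma C2c_plane_prod:
 assumes a: "C2c al al1 al2" and b: "C2c \<beta> \<beta>1 \<beta>2"
 shows "C2c_plane (%p. al (fst p) * \<beta> (snd p)) (%p. (al1 (fst p) * \<beta> (snd p), al (fst p) * \<beta>1 (snd p)))
  (%p. (al2 (fst p) * \<beta> (snd p), al1 (fst p) * \<beta>1 (snd p))) (%p. (al1 (fst p) * \<beta>1 (snd p), al (fst p) * \<beta>2 (snd p)))"
 using test_function_prod[OF assms] by (simp add: C2c_plane_def)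

lemma C2c_plane_mult:
 assumes a: "C2c_plane ps D D1 D2" and b: "C2c_plane et E E1 E2"
 shows "EX F1 F2. C2c_plane (%p. ps p * et p) (%p. ps p *R E p + et p *R D p) F1 F2"
proof -
 note t = a[unfolded C2c_plane_def] b[unfolded C2c_plane_def]
 have "test_function (%p. ps p * et p) (%p. ps p *R E p + et p *R D p)" using t by (intro test_function_mult) auto
 moreover have "EX F1. test_function (%p. ps p * fst (E p) + et p * fst (D p)) F1" using t test_function_add[OF test_function_mult test_function_mult] by blast
 moreover have "EX F2. test_function (%p. ps p * snd (E p) + et p * snd (D p)) F2" using t test_function_add[OF test_function_mult test_function_mult] by blast
 ultimately show ?thesis by (auto simp: C2c_plane_def)
qed

definition L2l :: "(plane => real) => bool" where
 "L2l a \<longleftrightarrow> a : Borel & (ALL r. L2 (%p. ind (cball 0 r) p * a p))"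

lemma L2l_cut: "L2l a ==> L2 (%p. ind (cball 0 r) p * a p)" by (simp add: L2l_def)

lemma L2l_mult:
 assumes a: "L2l a" and [measurable]: "f : Borel" and "!!p. abs (f p) <= B" "!!p. r < norm p ==> f p = 0"
 shows "L2 (%p. f p * a p)"
proof -
 have "L2 (%p. f p * (ind (cball 0 r) p * a p))" by (rule L2_mult_bounded[OF L2l_cut[OF a]]) (use assms in auto)
 moreover have "(%p. f p * (ind (cball 0 r) p * a p)) = (%p. f p * a p)" using assms(4) by (auto simp: indicator_def fun_eq_iff not_le)
 ultimately show ?thesis by simp
qed

lemma L2_integrable_compact:
 assumes "L2 a" "!!p. r < norm p ==> a p = 0"
 shows "integr a"
proof -
 have "L2 (ind (cball 0 r) :: 'a => real)" proof -
  have "(%x. (ind (cball 0 r) x)^2) = (ind (cball 0 r) :: 'a => real)" by (auto simp: indicator_def fun_eq_iff)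
  then show ?thesis unfolding L2_def using emeasure_bounded_finite[of "cball 0 r :: 'a set"]
   borel_measurable_indicator[OF borel_closed[OF closed_cball[of "0 :: 'a" r]]] by simp
 qed
 from L2_mult_integr[OF this assms(1)] have "integr (%p. ind (cball 0 r) p * a p)" .
 moreover have "(%p. ind (cball 0 r) p * a p) = a" using assms(2) by (auto simp: indicator_def fun_eq_iff not_le)
 ultimately show ?thesis by simp
qed

lemma L2l_integrable:
 assumes a: "L2l a" and [measurable]: "f : Borel" and "!!p. abs (f p) <= B" "!!p. r < norm p ==> f p = 0"
 shows "integr (%p. a p * f p)"
proof -
 have "integr (%p. f p * a p)" by (rule L2_integrable_compact[where r=r, OF L2l_mult[OF assms]]) (use assms(4) in auto)
 then show ?thesis by (simp add: mult.commute)
qed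

lemma L2l_test_integr:
 assumes a: "L2l a" and t: "test_function \<phi> D"
 shows "integr (%p. a p * \<phi> p)" "integr (%p. a p * fst (D p))" "integr (%p. a p * snd (D p))"
proof -
 obtain r where r: "!!p. r < norm p ==> \<phi> p = 0" "!!p. r < norm p ==> D p = 0" by (rule test_support[OF t]) blast
 obtain B where B: "!!p. abs (\<phi> p) <= B" "!!p. abs (fst (D p)) <= B" "!!p. abs (snd (D p)) <= B" by (rule test_bounded[OF t]) blast
 show "integr (%p. a p * \<phi> p)" by (rule L2l_integrable[OF a test_measurable(1)[OF t] B(1) r(1)])
 show "integr (%p. a p * fst (D p))" by (rule L2l_integrable[OF a test_measurable(3)[OF t] B(2), where r=r]) (simp add: r)
 show "integr (%p. a p * snd (D p))" by (rule L2l_integrable[OF a test_measurable(4)[OF t] B(3), where r=r]) (simp add: r)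
qed

definition wgrad :: "(plane => real) => (plane => real) => (plane => real) => bool" where
 "wgrad a A1 A2 \<longleftrightarrow> L2l a & L2l A1 & L2l A2 & (ALL \<phi> D. test_function \<phi> D -->
   (LBINT p. a p * fst (D p)) = - (LBINT p. A1 p * \<phi> p) & (LBINT p. a p * snd (D p)) = - (LBINT p. A2 p * \<phi> p))"

abbreviation (input) "schr V ps D1 D2 p \<equiv> (fst (D1 p) + snd (D2 p) + V (fst p) * ps p)"

text \<open>The equation with all derivatives on the test function. It makes sense for a function
  without a known gradient, such as a component e(x) U(z), and it can be tested by products of
  functions of x and z.\<close>

definition vweak :: "(real => real) => (plane => real) => bool" where
 "vweak V a \<longleftrightarrow> (ALL ps D D1 D2. C2c_plane ps D D1 D2 -->
   (LBINT p. a p * schr V ps D1 D2 p) = 0)"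

lemma vweak_gradient_form:
 assumes g: "wgrad a A1 A2" and v: "vweak V a" and [measurable]: "V : Borel" and VB: "!!x. abs (V x) <= BV"
  and t: "C2c_plane ps D D1 D2"
 shows "(LBINT p. A1 p * fst (D p) + A2 p * snd (D p) - V (fst p) * a p * ps p) = 0"
proof -
 have L: "L2l a" "L2l A1" "L2l A2" using g by (auto simp: wgrad_def)
 have t0: "test_function ps D" and t1: "test_function (%p. fst (D p)) D1" and t2: "test_function (%p. snd (D p)) D2" using t by (auto simp: C2c_plane_def)
 note [measurable] = test_measurable[OF t0]
 obtain r where r: "!!p. r < norm p ==> ps p = 0" by (rule test_support[OF t0]) blast
 obtain B where B: "B >= 0" "!!p. abs (ps p) <= B" by (rule test_bounded[OF t0]) blast
 have BV: "BV >= 0" using VB[of 0] by linarith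
 have iV: "integr (%p. a p * (V (fst p) * ps p))" proof (rule L2l_integrable[OF L(1)])
  show "abs (V (fst p) * ps p) <= BV * B" for p unfolding abs_mult by (intro mult_mono VB B BV) auto
  show "V (fst p) * ps p = 0" if "r < norm p" for p using r that by simp
 qed measurable
 note i = L2l_test_integr(2)[OF L(1) t1] L2l_test_integr(3)[OF L(1) t2] iV
   L2l_test_integr(1)[OF L(2) t1] L2l_test_integr(1)[OF L(3) t2]
 have iV': "integr (%p. V (fst p) * a p * ps p)" using iV by (simp add: mult_ac)
 have "0 = (LBINT p. a p * fst (D1 p) + a p * snd (D2 p) + a p * (V (fst p) * ps p))" using v t by (simp add: vweak_def distrib_left)
 also have "... = (LBINT p. a p * fst (D1 p)) + (LBINT p. a p * snd (D2 p)) + (LBINT p. a p * (V (fst p) * ps p))" using i by simp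
 also have "(LBINT p. a p * fst (D1 p)) = - (LBINT p. A1 p * fst (D p))" using g t1 by (simp add: wgrad_def)
 also have "(LBINT p. a p * snd (D2 p)) = - (LBINT p. A2 p * snd (D p))" using g t2 by (simp add: wgrad_def)
 finally have "(LBINT p. A1 p * fst (D p)) + (LBINT p. A2 p * snd (D p)) - (LBINT p. V (fst p) * a p * ps p) = 0" by (simp add: mult_ac)
 then show ?thesis using i iV' by simp
qed

section \<open>Mollifiers on the plane and Green's identity\<close>

definition ker2d :: "nat => plane => real" where "ker2d n h = ker n (fst h) * ker n (snd h)"
definition ker2d_1 :: "nat => plane => real" where "ker2d_1 n h = ker1 n (fst h) * ker n (snd h)"
definition ker2d_2 :: "nat => plane => real" where "ker2d_2 n h = ker n (fst h) * ker1 n (snd h)"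

lemma ker2d_measurable [measurable]:
 "ker2d n : Borel" "ker2d_1 n : Borel" "ker2d_2 n : Borel" proof -
 note [measurable] = C2c_measurable[OF ker_C2c]
 show "ker2d n : Borel" "ker2d_1 n : Borel" "ker2d_2 n : Borel" unfolding ker2d_def[abs_def] ker2d_1_def[abs_def] ker2d_2_def[abs_def] by measurable
qed

lemma ker1_zero: "1 / real (Suc n) < abs x ==> ker1 n x = 0"
proof (rule DERIV_zero_outside[where f="ker n" and f'="ker1 n" and r="1 / real (Suc n)"])
 show "(ker n has_real_derivative ker1 n x) (at x)" for x using ker_C2c[of n] by (simp add: C2c_def)
qed (auto intro: ker_zero)

lemma ker2d_zero:
 assumes "2 / real (Suc n) < norm h" shows "ker2d n h = 0" "ker2d_1 n h = 0" "ker2d_2 n h = 0"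
proof -
 have "norm h <= abs (fst h) + abs (snd h)" using sqrt_sum_squares_le_sum_abs by (cases h) (simp add: norm_prod_def)
 then have "1 / real (Suc n) < abs (fst h) | 1 / real (Suc n) < abs (snd h)" using assms by (simp add: add_divide_distrib[symmetric]) linarith
 then show "ker2d n h = 0" "ker2d_1 n h = 0" "ker2d_2 n h = 0" by (auto simp: ker2d_def ker2d_1_def ker2d_2_def intro: ker_zero ker1_zero)
qed

lemma ker2d_bound: obtains B where "B >= 0" "!!h. abs (ker2d n h) <= B" "!!h. abs (ker2d_1 n h) <= B" "!!h. abs (ker2d_2 n h) <= B"
proof -
 obtain B where B: "B >= 0" "!!x. abs (ker n x) <= B" "!!x. abs (ker1 n x) <= B" by (rule C2c_bounded[OF ker_C2c[of n]]) blast
 show ?thesis proof (rule that[of "B * B"])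
  show "abs (ker2d n h) <= B * B" "abs (ker2d_1 n h) <= B * B" "abs (ker2d_2 n h) <= B * B" for h unfolding ker2d_def ker2d_1_def ker2d_2_def abs_mult by (intro mult_mono B; simp)+
 qed simp
qed

lemma ker2d_nonneg: "0 <= ker2d n h" by (simp add: ker2d_def ker_nonneg)

lemma ker2d_integrable: "integr (ker2d n)" "integr (ker2d_1 n)" "integr (ker2d_2 n)"
proof -
 obtain B where B: "!!h. abs (ker2d n h) <= B" "!!h. abs (ker2d_1 n h) <= B" "!!h. abs (ker2d_2 n h) <= B" by (rule ker2d_bound) blast
 show "integr (ker2d n)" by (rule integr_compact[OF ker2d_measurable(1) B(1) ker2d_zero(1)])
 show "integr (ker2d_1 n)" by (rule integr_compact[OF ker2d_measurable(2) B(2) ker2d_zero(2)])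
 show "integr (ker2d_2 n)" by (rule integr_compact[OF ker2d_measurable(3) B(3) ker2d_zero(3)])
qed

lemma integral_plane:
 fixes f :: "plane => real"
 assumes "integr f" shows "(LBINT p. f p) = (LBINT x. LBINT z. f (x, z))"
proof -
 have "integrable lborel2 f" using assms by (simp add: lborel_prod)
 from lborel_pair.integral_fst'[OF this] show ?thesis by (simp add: lborel_prod)
qed

lemma ker2d_integral: "(LBINT h. ker2d n h) = 1" by (subst integral_plane[OF ker2d_integrable(1)]) (simp add: ker2d_def ker_integral)

lemma ker2d_test:
 "C2c_plane (%p. ker2d n (p - q)) (%p. (ker2d_1 n (p - q), ker2d_2 n (p - q)))
   (%p. (ker2 n (fst p - fst q) * ker n (snd p - snd q), ker1 n (fst p - fst q) * ker1 n (snd p - snd q)))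
   (%p. (ker1 n (fst p - fst q) * ker1 n (snd p - snd q), ker n (fst p - fst q) * ker2 n (snd p - snd q)))"
 using C2c_plane_prod[OF C2c_shift_minus[OF ker_C2c, of n "fst q"] C2c_shift_minus[OF ker_C2c, of n "snd q"]] by (simp add: ker2d_def ker2d_1_def ker2d_2_def)

lemma ker2d_test_reflect: "test_function (%q. ker2d n (p - q)) (%q. (- ker2d_1 n (p - q), - ker2d_2 n (p - q)))"
 using test_function_prod(1)[OF C2c_reflect[OF ker_C2c, of n "fst p"] C2c_reflect[OF ker_C2c, of n "snd p"]] by (simp add: ker2d_def ker2d_1_def ker2d_2_def)

lemma ker2d_pair_integr:
 assumes "L2 f" "L2 g"
 shows "integrable lborel2 (%(p, q). f p * g q * ker2d n (p - q))"
  "integrable lborel2 (%(p, q). f p * g q * ker2d_1 n (p - q))"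
  "integrable lborel2 (%(p, q). f p * g q * ker2d_2 n (p - q))" proof -
 obtain B where B: "B >= 0" "!!h. abs (ker2d n h) <= B" "!!h. abs (ker2d_1 n h) <= B" "!!h. abs (ker2d_2 n h) <= B" by (rule ker2d_bound[of n]) blast
 have b: "abs (k (p - q)) <= B * ind (cball p (2 / real (Suc n))) q"
  if "!!h. abs (k h) <= B" "!!h. 2 / real (Suc n) < norm h ==> k h = 0" for k :: "plane => real" and p q
  using that(1)[of "p - q"] that(2)[of "p - q"] by (cases "2 / real (Suc n) < norm (p - q)") (auto simp: indicator_def dist_norm)
 show "integrable lborel2 (%(p, q). f p * g q * ker2d n (p - q))" by (rule L2_pair_integr[OF assms _ b[OF B(2) ker2d_zero(1)]]) measurable
 show "integrable lborel2 (%(p, q). f p * g q * ker2d_1 n (p - q))" by (rule L2_pair_integr[OF assms _ b[OF B(3) ker2d_zero(2)]]) measurable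
 show "integrable lborel2 (%(p, q). f p * g q * ker2d_2 n (p - q))" by (rule L2_pair_integr[OF assms _ b[OF B(4) ker2d_zero(3)]]) measurable
qed

text \<open>In the variables p and h = p - q the double integral averages the continuous correlation
  of \<open>f\<close> and \<open>g\<close> against an approximate identity, and its value at h = 0
  is the integral of the product.\<close>

lemma ker2d_corr_limit:
 assumes f: "L2 f" and g: "L2 g"
 shows "(%n. LBINT p. LBINT q. f p * g q * ker2d n (p - q)) ----> (LBINT p. f p * g p)"
proof -
 have [measurable]: "f : Borel" "g : Borel" using f g by (auto simp: L2_def)
 define c where "c h = (LBINT p. f p * g (p - h) * 1)" for h
 have cm: "c : Borel" unfolding c_def by (rule param_integral_Borel) measurable
 have cb: "abs (c h) <= 1 * ((LBINT p. (f p)^2) + (LBINT p. (g p)^2))" for h unfolding c_def by (rule corr_bound[OF f g]) auto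
 have cl: "(c \<longlongrightarrow> (LBINT p. f p * g p)) (at 0)" using corr_tendsto[OF f g, of "%_ _. 1" 1 0] by (simp add: c_def[abs_def])
 have "(%n. LBINT h. ker2d n h * c h) ----> (LBINT p. f p * g p)" proof (rule approximate_identity[OF ker2d_nonneg ker2d_integrable(1) ker2d_integral _ _ cm cb cl])
  show "ker2d n h = 0" if "2 / real (Suc n) < norm h" for n h by (rule ker2d_zero[OF that])
  have "(%n. 2 * inverse (real (Suc n))) ----> 2 * 0" by (intro tendsto_mult LIMSEQ_inverse_real_of_nat tendsto_const)
  then show "(%n. 2 / real (Suc n)) ----> 0" by (simp add: divide_inverse)
 qed
 moreover have "(LBINT h. ker2d n h * c h) = (LBINT p. LBINT q. f p * g q * ker2d n (p - q))" for n proof -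
  obtain B where B: "!!h. abs (ker2d n h) <= B" by (rule ker2d_bound) blast
  have b: "abs (ker2d n h) <= B * ind (cball 0 (2 / real (Suc n))) h" for h using B[of h] ker2d_zero(1)[of n h] by (cases "2 / real (Suc n) < norm h") (auto simp: indicator_def)
  have i: "integrable lborel2 (%(p, h). f p * g (p - h) * ker2d n h)" by (rule L2_pair_integr_shift[OF f g _ b]) measurable
  have "(LBINT p. LBINT q. f p * g q * ker2d n (p - q)) = (LBINT p. LBINT h. f p * g (p - h) * ker2d n h)" proof (rule lint_cong[OF refl])
   fix p
   have "(LBINT h. f p * g (p - h) * ker2d n (p - (p - h))) = (LBINT q. f p * g q * ker2d n (p - q))" by (rule lborel_reflect) measurable
   then show "(LBINT q. f p * g q * ker2d n (p - q)) = (LBINT h. f p * g (p - h) * ker2d n h)" by simp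
  qed
  also have "... = (LBINT h. LBINT p. f p * g (p - h) * ker2d n h)" using lborel_pair.Fubini_integral[OF i] by simp
  also have "... = (LBINT h. ker2d n h * c h)" by (rule lint_cong[OF refl]) (simp add: c_def mult.commute)
  finally show ?thesis by simp
 qed
 ultimately show ?thesis by simp
qed

text \<open>Formally the equation of \<open>a\<close> tested with \<open>ps * b\<close>, which is
  not twice differentiable. Instead \<open>ps * ker2d n (p - q)\<close> is used as a test function
  in p, the result is multiplied by b(q) and integrated over q. Where a derivative falls on the
  kernel it is moved to \<open>b\<close> through the weak gradient of \<open>b\<close>; then n tends
  to infinity.\<close>

lemma energy_identity:
 assumes a: "wgrad a A1 A2" and va: "vweak V a" and b: "wgrad b B1 B2"
  and V[measurable]: "V : Borel" and VB: "!!x. abs (V x) <= BV" and t: "C2c_plane ps D D1 D2"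
 shows "(LBINT p. (A1 p * fst (D p) + A2 p * snd (D p)) * b p + ps p * (A1 p * B1 p + A2 p * B2 p) - V (fst p) * ps p * a p * b p) = 0"
proof -
 have La: "L2l a" "L2l A1" "L2l A2" and Lb: "L2l b" "L2l B1" "L2l B2" using a b by (auto simp: wgrad_def)
 have [measurable]: "a : Borel" "A1 : Borel" "A2 : Borel"
   "b : Borel" "B1 : Borel" "B2 : Borel" using La Lb by (auto simp: L2l_def)
 have t0: "test_function ps D" using t by (simp add: C2c_plane_def)
 note [measurable] = test_measurable[OF t0]
 obtain r where r: "!!p. r < norm p ==> ps p = 0" "!!p. r < norm p ==> D p = 0" by (rule test_support[OF t0]) blast
 obtain B where B: "B >= 0" "!!p. abs (ps p) <= B" "!!p. abs (fst (D p)) <= B" "!!p. abs (snd (D p)) <= B" by (rule test_bounded[OF t0]) blast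
 have BV: "BV >= 0" using VB[of 0] by linarith
 \<comment> \<open>\<open>b\<close> and its gradient are only locally square integrable. The kernels
   reach at most distance 2, so the cut at r + 2 is invisible for p in the support of
   \<open>ps\<close>.\<close>
 define T where "T g p = ind (cball 0 (r + 2)) p * g p" for g :: "plane => real" and p
 have LT: "L2 (T b)" "L2 (T B1)" "L2 (T B2)" unfolding T_def using Lb by (auto intro: L2l_cut)
 have L: "L2 (%p. fst (D p) * A1 p)" "L2 (%p. snd (D p) * A2 p)" "L2 (%p. ps p * A1 p)" "L2 (%p. ps p * A2 p)" by (intro L2l_mult[where r=r and B=B] La; use B r in auto)+
 have LV: "L2 (%p. V (fst p) * ps p * a p)" proof (rule L2l_mult[where r=r and B="BV * B", OF La(1)])
  show "abs (V (fst p) * ps p) <= BV * B" for p unfolding abs_mult by (intro mult_mono VB B BV) auto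
 qed (use r in auto)
 have near: "T g q * k (p - q) = g q * k (p - q)"
  if "norm p <= r" "!!h. 2 / real (Suc n) < norm h ==> k h = 0" for p q n and g k :: "plane => real" proof (cases "norm q <= r + 2")
  case False
  then have "2 < norm (p - q)" using that(1) norm_triangle_ineq2[of q p] by (simp add: norm_minus_commute)
  moreover have "2 / real (Suc n) <= 2" by (simp add: divide_le_eq)
  ultimately show ?thesis using that(2)[of "p - q"] by simp
 qed (simp add: T_def)
 have pz: "ps p = 0 & D p = 0" if "~ norm p <= r" for p using r that by simp
 define I where "I f g n = (LBINT p. LBINT q. f p * g q * ker2d n (p - q))" for f g :: "plane => real" and n
 have key: "I (%p. fst (D p) * A1 p) (T b) n + I (%p. snd (D p) * A2 p) (T b) n + I (%p. ps p * A1 p) (T B1) n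
   + I (%p. ps p * A2 p) (T B2) n - I (%p. V (fst p) * ps p * a p) (T b) n = 0" for n proof -
  \<comment> \<open>As a function of q the kernel \<open>ker2d n (p - q)\<close> is a test function
    with gradient minus its p-gradient; this cancels the minus sign of the weak derivative.\<close>
  have G: "(LBINT q. T b q * ker2d_1 n (p - q)) = (LBINT q. T B1 q * ker2d n (p - q))"
    "(LBINT q. T b q * ker2d_2 n (p - q)) = (LBINT q. T B2 q * ker2d n (p - q))" if "norm p <= r" for p proof -
   have nr: "T g q * ker2d n (p - q) = g q * ker2d n (p - q)" "T g q * ker2d_1 n (p - q) = g q * ker2d_1 n (p - q)"
    "T g q * ker2d_2 n (p - q) = g q * ker2d_2 n (p - q)" for g q by (rule near[OF that], erule ker2d_zero)+
   have "(LBINT q. b q * fst (- ker2d_1 n (p - q), - ker2d_2 n (p - q))) = - (LBINT q. B1 q * ker2d n (p - q))"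
    "(LBINT q. b q * snd (- ker2d_1 n (p - q), - ker2d_2 n (p - q))) = - (LBINT q. B2 q * ker2d n (p - q))" using b ker2d_test_reflect[of n p] unfolding wgrad_def by blast+
   then show "(LBINT q. T b q * ker2d_1 n (p - q)) = (LBINT q. T B1 q * ker2d n (p - q))"
    "(LBINT q. T b q * ker2d_2 n (p - q)) = (LBINT q. T B2 q * ker2d n (p - q))" unfolding nr by simp_all
  qed
  have G1: "I (%p. ps p * A1 p) (T B1) n = (LBINT p. LBINT q. ps p * A1 p * T b q * ker2d_1 n (p - q))" unfolding I_def proof (rule lint_cong[OF refl])
   fix p show "(LBINT q. ps p * A1 p * T B1 q * ker2d n (p - q)) = (LBINT q. ps p * A1 p * T b q * ker2d_1 n (p - q))"
    using G(1)[of p] pz[of p] by (cases "norm p <= r") (simp_all add: mult.assoc)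
  qed
  have G2: "I (%p. ps p * A2 p) (T B2) n = (LBINT p. LBINT q. ps p * A2 p * T b q * ker2d_2 n (p - q))" unfolding I_def proof (rule lint_cong[OF refl])
   fix p show "(LBINT q. ps p * A2 p * T B2 q * ker2d n (p - q)) = (LBINT q. ps p * A2 p * T b q * ker2d_2 n (p - q))"
    using G(2)[of p] pz[of p] by (cases "norm p <= r") (simp_all add: mult.assoc)
  qed
  define J where "J = (%(p, q). (fst (D p) * A1 p) * T b q * ker2d n (p - q) + (snd (D p) * A2 p) * T b q * ker2d n (p - q)
    + (ps p * A1 p) * T b q * ker2d_1 n (p - q) + (ps p * A2 p) * T b q * ker2d_2 n (p - q) - (V (fst p) * ps p * a p) * T b q * ker2d n (p - q))"
  note i = ker2d_pair_integr(1)[OF L(1) LT(1), of n] ker2d_pair_integr(1)[OF L(2) LT(1), of n]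
    ker2d_pair_integr(2)[OF L(3) LT(1), of n] ker2d_pair_integr(3)[OF L(4) LT(1), of n] ker2d_pair_integr(1)[OF LV LT(1), of n]
  have Je: "J = (%x. (%(p, q). fst (D p) * A1 p * T b q * ker2d n (p - q)) x + (%(p, q). snd (D p) * A2 p * T b q * ker2d n (p - q)) x
    + (%(p, q). ps p * A1 p * T b q * ker2d_1 n (p - q)) x + (%(p, q). ps p * A2 p * T b q * ker2d_2 n (p - q)) x - (%(p, q). V (fst p) * ps p * a p * T b q * ker2d n (p - q)) x)"
   by (auto simp: J_def fun_eq_iff)
  have iJ: "integrable lborel2 J" unfolding Je by (intro integr_add integr_diff i)
  have "(LINT x|lborel2. J x) = I (%p. fst (D p) * A1 p) (T b) n + I (%p. snd (D p) * A2 p) (T b) n + I (%p. ps p * A1 p) (T B1) n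
   + I (%p. ps p * A2 p) (T B2) n - I (%p. V (fst p) * ps p * a p) (T b) n" proof -
   have "(LINT x|lborel2. J x) = (LINT x|lborel2. (%(p, q). fst (D p) * A1 p * T b q * ker2d n (p - q)) x) + (LINT x|lborel2. (%(p, q). snd (D p) * A2 p * T b q * ker2d n (p - q)) x)
    + (LINT x|lborel2. (%(p, q). ps p * A1 p * T b q * ker2d_1 n (p - q)) x) + (LINT x|lborel2. (%(p, q). ps p * A2 p * T b q * ker2d_2 n (p - q)) x) - (LINT x|lborel2. (%(p, q). V (fst p) * ps p * a p * T b q * ker2d n (p - q)) x)"
    unfolding Je by (subst lint_diff lint_add, (intro integr_add i), (intro integr_add i))+ (rule refl)
   then show ?thesis using i[THEN lborel_pair.integral_fst] unfolding G1 G2 by (simp add: I_def)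
  qed
  moreover have "(LINT x|lborel2. J x) = (LBINT q. LBINT p. J (p, q))" using lborel_pair.integral_snd[of "%p q. J (p, q)"] iJ by simp
  moreover have "(LBINT p. J (p, q)) = 0" for q proof -
   obtain F1 F2 where "C2c_plane (%p. ps p * ker2d n (p - q)) (%p. ps p *R (ker2d_1 n (p - q), ker2d_2 n (p - q)) + ker2d n (p - q) *R D p) F1 F2"
    using C2c_plane_mult[OF t ker2d_test[of n q]] by blast
   from vweak_gradient_form[OF a va V VB this]
   have z: "(LBINT p. A1 p * fst (ps p *R (ker2d_1 n (p - q), ker2d_2 n (p - q)) + ker2d n (p - q) *R D p) +
     A2 p * snd (ps p *R (ker2d_1 n (p - q), ker2d_2 n (p - q)) + ker2d n (p - q) *R D p) - V (fst p) * a p * (ps p * ker2d n (p - q))) = 0" .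
   have "(LBINT p. J (p, q)) = (LBINT p. T b q * (A1 p * fst (ps p *R (ker2d_1 n (p - q), ker2d_2 n (p - q)) + ker2d n (p - q) *R D p) +
     A2 p * snd (ps p *R (ker2d_1 n (p - q), ker2d_2 n (p - q)) + ker2d n (p - q) *R D p) - V (fst p) * a p * (ps p * ker2d n (p - q))))"
    by (rule lint_cong[OF refl]) (simp add: J_def algebra_simps)
   also have "... = 0" unfolding integral_mult_right_zero z by simp
   finally show ?thesis .
  qed
  ultimately show ?thesis by simp
 qed
 have "(%n. I (%p. fst (D p) * A1 p) (T b) n + I (%p. snd (D p) * A2 p) (T b) n + I (%p. ps p * A1 p) (T B1) n
   + I (%p. ps p * A2 p) (T B2) n - I (%p. V (fst p) * ps p * a p) (T b) n) ---->
   (LBINT p. fst (D p) * A1 p * T b p) + (LBINT p. snd (D p) * A2 p * T b p) + (LBINT p. ps p * A1 p * T B1 p)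
   + (LBINT p. ps p * A2 p * T B2 p) - (LBINT p. V (fst p) * ps p * a p * T b p)" unfolding I_def by (intro tendsto_add tendsto_diff ker2d_corr_limit L LT LV)
 then have "(LBINT p. fst (D p) * A1 p * T b p) + (LBINT p. snd (D p) * A2 p * T b p) + (LBINT p. ps p * A1 p * T B1 p)
   + (LBINT p. ps p * A2 p * T B2 p) - (LBINT p. V (fst p) * ps p * a p * T b p) = 0" unfolding key by (simp add: LIMSEQ_const_iff)
 moreover have "(LBINT p. (A1 p * fst (D p) + A2 p * snd (D p)) * b p + ps p * (A1 p * B1 p + A2 p * B2 p) - V (fst p) * ps p * a p * b p)
  = (LBINT p. fst (D p) * A1 p * T b p + snd (D p) * A2 p * T b p + ps p * A1 p * T B1 p + ps p * A2 p * T B2 p - V (fst p) * ps p * a p * T b p)" proof (rule lint_cong[OF refl])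
  fix p
  show "(A1 p * fst (D p) + A2 p * snd (D p)) * b p + ps p * (A1 p * B1 p + A2 p * B2 p) - V (fst p) * ps p * a p * b p
   = fst (D p) * A1 p * T b p + snd (D p) * A2 p * T b p + ps p * A1 p * T B1 p + ps p * A2 p * T B2 p - V (fst p) * ps p * a p * T b p" proof (cases "norm p <= r")
   case True
   then have "T g p = g p" for g by (simp add: T_def)
   then show ?thesis by (simp add: algebra_simps)
  qed (use pz[of p] in simp)
 qed
 moreover have "... = (LBINT p. fst (D p) * A1 p * T b p) + (LBINT p. snd (D p) * A2 p * T b p) + (LBINT p. ps p * A1 p * T B1 p)
   + (LBINT p. ps p * A2 p * T B2 p) - (LBINT p. V (fst p) * ps p * a p * T b p)" using L2_mult_integr[OF L(1) LT(1)] L2_mult_integr[OF L(2) LT(1)] L2_mult_integr[OF L(3) LT(2)]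
   L2_mult_integr[OF L(4) LT(3)] L2_mult_integr[OF LV LT(1)] by simp
 ultimately show ?thesis by simp
qed

lemma L2l_prod_integr:
 assumes a: "L2l a" and b: "L2l b" and [measurable]: "f : Borel" and B: "!!p. abs (f p) <= B" and r: "!!p. r < norm p ==> f p = 0"
 shows "integr (%p. f p * a p * b p)"
proof -
 have "integr (%p. (f p * a p) * (ind (cball 0 r) p * b p))" by (rule L2_mult_integr[OF L2l_mult[OF a _ B r] L2l_cut[OF b]]) measurable
 moreover have "(%p. (f p * a p) * (ind (cball 0 r) p * b p)) = (%p. f p * a p * b p)" using r by (auto simp: fun_eq_iff indicator_def not_le)
 ultimately show ?thesis by simp
qed

text \<open>Exchanging \<open>a\<close> and \<open>b\<close> in \<open>energy_identity\<close> and
  subtracting removes the potential and the products of gradients; the field b grad a - a grad b is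
  weakly divergence free.\<close>

lemma flux_identity_C2:
 assumes a: "wgrad a A1 A2" and va: "vweak V a" and b: "wgrad b B1 B2" and vb: "vweak V b"
  and V[measurable]: "V : Borel" and VB: "!!x. abs (V x) <= BV" and t: "C2c_plane ps D D1 D2"
 shows "(LBINT p. fst (D p) * (A1 p * b p - B1 p * a p) + snd (D p) * (A2 p * b p - B2 p * a p)) = 0"
proof -
 have La: "L2l a" "L2l A1" "L2l A2" and Lb: "L2l b" "L2l B1" "L2l B2" using a b by (auto simp: wgrad_def)
 have t0: "test_function ps D" using t by (simp add: C2c_plane_def)
 note [measurable] = test_measurable[OF t0]
 obtain r where r: "!!p. r < norm p ==> ps p = 0" "!!p. r < norm p ==> D p = 0" by (rule test_support[OF t0]) blast
 obtain B where B: "B >= 0" "!!p. abs (ps p) <= B" "!!p. abs (fst (D p)) <= B" "!!p. abs (snd (D p)) <= B" by (rule test_bounded[OF t0]) blast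
 have BV: "BV >= 0" using VB[of 0] by linarith
 have r': "fst (D p) = 0" "snd (D p) = 0" if "r < norm p" for p using r(2)[OF that] by auto
 note i1 = L2l_prod_integr[OF _ _ test_measurable(3)[OF t0] B(3) r'(1)]
 note i2 = L2l_prod_integr[OF _ _ test_measurable(4)[OF t0] B(4) r'(2)]
 note i3 = L2l_prod_integr[OF _ _ test_measurable(1)[OF t0] B(2) r(1)]
 have i4: "integr (%p. (V (fst p) * ps p) * a p * b p)" proof (rule L2l_prod_integr[OF La(1) Lb(1)])
  show "abs (V (fst p) * ps p) <= BV * B" for p unfolding abs_mult by (intro mult_mono VB B BV) auto
  show "V (fst p) * ps p = 0" if "r < norm p" for p using r that by simp
 qed measurable
 have ia: "integr (%p. (A1 p * fst (D p) + A2 p * snd (D p)) * b p + ps p * (A1 p * B1 p + A2 p * B2 p) - V (fst p) * ps p * a p * b p)" proof -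
  have "integr (%p. fst (D p) * A1 p * b p + snd (D p) * A2 p * b p + (ps p * A1 p * B1 p + ps p * A2 p * B2 p) - (V (fst p) * ps p) * a p * b p)"
   by (intro integr_add integr_diff i1 i2 i3 i4 La Lb)
  then show ?thesis by (simp add: algebra_simps)
 qed
 have ib: "integr (%p. (B1 p * fst (D p) + B2 p * snd (D p)) * a p + ps p * (B1 p * A1 p + B2 p * A2 p) - V (fst p) * ps p * b p * a p)" proof -
  have "integr (%p. fst (D p) * B1 p * a p + snd (D p) * B2 p * a p + (ps p * A1 p * B1 p + ps p * A2 p * B2 p) - (V (fst p) * ps p) * a p * b p)"
   by (intro integr_add integr_diff i1 i2 i3 i4 La Lb)
  then show ?thesis by (simp add: algebra_simps)
 qed
 have "0 = (LBINT p. (A1 p * fst (D p) + A2 p * snd (D p)) * b p + ps p * (A1 p * B1 p + A2 p * B2 p) - V (fst p) * ps p * a p * b p)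
   - (LBINT p. (B1 p * fst (D p) + B2 p * snd (D p)) * a p + ps p * (B1 p * A1 p + B2 p * A2 p) - V (fst p) * ps p * b p * a p)"
  using energy_identity[OF a va b V VB t] energy_identity[OF b vb a V VB t] by simp
 also have "... = (LBINT p. ((A1 p * fst (D p) + A2 p * snd (D p)) * b p + ps p * (A1 p * B1 p + A2 p * B2 p) - V (fst p) * ps p * a p * b p)
   - ((B1 p * fst (D p) + B2 p * snd (D p)) * a p + ps p * (B1 p * A1 p + B2 p * A2 p) - V (fst p) * ps p * b p * a p))" by (rule lint_diff[OF ia ib, symmetric])
 also have "... = (LBINT p. fst (D p) * (A1 p * b p - B1 p * a p) + snd (D p) * (A2 p * b p - B2 p * a p))" by (rule lint_cong[OF refl]) (simp add: algebra_simps)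
 finally show ?thesis by simp
qed

section \<open>Components along a bound state\<close>

text \<open>Integrability against every exponential weight in x on each horizontal strip. It is the
  form in which the weighted L2 condition enters: bound states decay exponentially, so their
  pairings with such a function on almost every horizontal line converge.\<close>

definition expint :: "(plane => real) => bool" where
 "expint u \<longleftrightarrow> u : Borel &
   (ALL c>0. ALL Z. integr (%p. ind {-Z..Z} (snd p) * exp (- (c * abs (fst p))) * u p))"

lemma expint_diff:
 assumes "expint u" "expint w" shows "expint (%p. u p - w p)" unfolding expint_def
proof (intro conjI allI impI)
 show "(%p. u p - w p) : Borel" using assms by (auto simp: expint_def)
 fix c Z :: real assume "c > 0"
 then show "integr (%p. ind {-Z..Z} (snd p) * exp (- (c * abs (fst p))) * (u p - w p))" using assms unfolding expint_def right_diff_distrib by (intro integr_diff) blast+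
qed

lemma expint_integrable:
 assumes u: "expint u" and c: "c > 0" and [measurable]: "f : Borel"
  and f: "!!p. abs (f p) <= C * exp (- (c * abs (fst p)))" and z: "!!p. Z < abs (snd p) ==> f p = 0"
 shows "integr (%p. u p * f p)"
proof (rule integr_bound)
 have [measurable]: "u : Borel" using u by (simp add: expint_def)
 show "integr (%p. C * (ind {-Z..Z} (snd p) * exp (- (c * abs (fst p))) * u p))" using u c by (intro integrable_mult_right) (auto simp: expint_def)
 show "(%p. u p * f p) : borel_measurable lborel" by measurable
 have C0: "C >= 0" using f[of 0] by (auto intro: order_trans[OF abs_ge_zero])
 show "AE p in lborel. norm (u p * f p) <= norm (C * (ind {-Z..Z} (snd p) * exp (- (c * abs (fst p))) * u p))" proof (intro AE_I2)
  fix p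
  show "norm (u p * f p) <= norm (C * (ind {-Z..Z} (snd p) * exp (- (c * abs (fst p))) * u p))" proof (cases "abs (snd p) <= Z")
   case True
   then have "ind {-Z..Z} (snd p) = (1::real)" by (auto simp: indicator_def abs_le_iff)
   moreover have "abs (u p) * abs (f p) <= abs (u p) * (C * exp (- (c * abs (fst p))))" by (intro mult_left_mono f) simp
   ultimately show ?thesis using C0 by (simp add: abs_mult mult_ac)
  qed (use z[of p] in simp)
 qed
qed

lemma exp_abs_integrable:
 assumes "c > 0" shows "integr (%x::real. exp (- (c * abs x)))"
proof -
 define g where "g x = ind {0..} x * exp (- c * x)" for x :: real
 have [measurable]: "g : Borel" unfolding g_def by measurable
 have "(%x. exp (- c * x)) absolutely_integrable_on {0..}" by (rule nonnegative_absolutely_integrable_1[OF integrable_on_exp_minus_to_infinity[OF assms]]) simp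
 then have "integrable lebesgue g" by (simp add: set_integrable_def g_def[abs_def])
 then have g: "integr g" by (subst (asm) integrable_completion) auto
 have "integr (%x. g (0 + (- 1) * x))" by (rule lborel_integrable_real_affine[OF g]) simp
 then have g': "integr (%x. g (- x))" by simp
 show ?thesis proof (rule integr_bound[OF integr_add[OF g g']])
  show "AE x in lborel. norm (exp (- (c * abs x))) <= norm (g x + g (- x))" proof (intro AE_I2)
   fix x :: real
   show "norm (exp (- (c * abs x))) <= norm (g x + g (- x))" by (cases "x = 0"; cases "x > 0") (auto simp: g_def indicator_def abs_if)
  qed
 qed measurable
qed

lemma AE_fst_lborel:
 assumes "AE x in lborel. P (x::real)" shows "AE p in lborel. P (fst (p :: plane))"
proof -
 from AE_E[OF assms] obtain N where N: "{x : space lborel. ~ P x} \<subseteq> N" "emeasure lborel N = 0" "N : sets lborel" by blast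
 have "emeasure lborel2 (N \<times> (UNIV :: real set)) = emeasure lborel N * emeasure lborel (UNIV :: real set)" by (rule lborel.emeasure_pair_measure_Times) (use N in auto)
 then have z: "emeasure lborel (N \<times> (UNIV :: real set)) = 0" using N by (simp add: lborel_prod)
 have "N \<times> (UNIV :: real set) : sets lborel2" using N by (intro pair_measureI) auto
 then have m: "N \<times> (UNIV :: real set) : sets lborel" unfolding lborel_prod .
 show ?thesis by (rule AE_I[OF _ z m]) (use N in auto)
qed

lemma AE_snd_lborel:
 assumes "AE x in lborel. P (x::real)" shows "AE p in lborel. P (snd (p :: plane))"
proof -
 from AE_E[OF assms] obtain N where N: "{x : space lborel. ~ P x} \<subseteq> N" "emeasure lborel N = 0" "N : sets lborel" by blast
 have "emeasure lborel2 ((UNIV :: real set) \<times> N) = emeasure lborel (UNIV :: real set) * emeasure lborel N" by (rule lborel.emeasure_pair_measure_Times) (use N in auto)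
 then have z: "emeasure lborel ((UNIV :: real set) \<times> N) = 0" using N by (simp add: lborel_prod)
 have "(UNIV :: real set) \<times> N : sets lborel2" using N by (intro pair_measureI) auto
 then have m: "(UNIV :: real set) \<times> N : sets lborel" unfolding lborel_prod .
 show ?thesis by (rule AE_I[OF _ z m]) (use N in auto)
qed

lemma integral_plane_snd:
 fixes f :: "plane => real"
 assumes "integr f" shows "(LBINT p. f p) = (LBINT z. LBINT x. f (x, z))"
proof -
 have i: "integrable lborel2 (%(x, z). f (x, z))" using assms by (simp add: lborel_prod)
 from lborel_pair.integral_snd[OF i] show ?thesis by (simp add: lborel_prod)
qed

lemma test_function_slice:
 assumes "test_function \<phi> D"
 shows "((%x. \<phi> (x, z)) has_real_derivative fst (D (x, z))) (at x)" "((%z. \<phi> (x, z)) has_real_derivative snd (D (x, z))) (at z)"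
proof -
 have d: "gradient \<phi> (D (x, z)) (x, z)" using assms unfolding test_function_def by blast
 have "((%x. (x, z)) has_derivative (%h. (h, 0))) (at x)" by (auto intro!: derivative_eq_intros)
 from has_derivative_compose[OF this d] show "((%x. \<phi> (x, z)) has_real_derivative fst (D (x, z))) (at x)" by (simp add: has_field_derivative_def inner_prod_def mult_commute_abs)
 have "((%z. (x, z)) has_derivative (%h. (0, h))) (at z)" by (auto intro!: derivative_eq_intros)
 from has_derivative_compose[OF this d] show "((%z. \<phi> (x, z)) has_real_derivative snd (D (x, z))) (at z)" by (simp add: has_field_derivative_def inner_prod_def mult_commute_abs)
qed

lemma norm_Pair_ge: "abs x <= norm (x, z)" "abs z <= norm (x, z)" for x z :: real using norm_fst_le[of x z] norm_snd_le[of z x] by simp_all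

lemma C2c_plane_slice:
 assumes "C2c_plane ps D D1 D2"
 shows "C2c (%x. ps (x, z)) (%x. fst (D (x, z))) (%x. fst (D1 (x, z)))"
proof -
 have t: "test_function ps D" "test_function (%p. fst (D p)) D1" using assms by (auto simp: C2c_plane_def)
 obtain r where r: "!!p. r < norm p ==> ps p = 0" by (rule test_support[OF t(1)]) blast
 have "ps (x, z) = 0" if "r < abs x" for x using r[of "(x, z)"] norm_Pair_ge(1)[of x z] that by linarith
 moreover have "continuous_on UNIV (%x. fst (D1 (x, z)))" by (intro continuous_on_fst continuous_on_compose2[OF test_continuous(2)[OF t(2)]] continuous_intros) auto
 ultimately show ?thesis using test_function_slice(1)[OF t(1)] test_function_slice(1)[OF t(2)] unfolding C2c_def by blast
qed

lemma slice_integral: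
 fixes e :: "real => real" and \<phi> :: "plane => real"
 assumes e: "continuous_on UNIV e" and \<phi>: "continuous_on UNIV \<phi>" and r: "!!p. r < norm p ==> \<phi> p = 0"
 shows "(LBINT x. e x * \<phi> (x, z)) = integral (cbox (- r) r) (%x. e x * \<phi> (x, z))"
  "integr (%x. e x * \<phi> (x, z))" "continuous_on UNIV (%z. LBINT x. e x * \<phi> (x, z))" proof -
 have c: "continuous_on UNIV (%x. e x * \<phi> (x, z))" for z by (intro continuous_intros e continuous_on_compose2[OF \<phi>]) auto
 have z: "e x * \<phi> (x, z) = 0" if "r < abs x" for x z using r[of "(x, z)"] norm_Pair_ge(1)[of x z] that by simp
 have i: "integr (%x. e x * \<phi> (x, z))" for z proof -
  have "EX B. ALL x. abs (e x * \<phi> (x, z)) <= B" by (rule bounded_compact[OF c]) (erule z)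
  then obtain B where B: "!!x. abs (e x * \<phi> (x, z)) <= B" by auto
  show ?thesis by (rule integr_compact[OF borel_measurable_continuous_onI[OF c] B]) (rule z, simp)
 qed
 have eq: "(LBINT x. e x * \<phi> (x, z)) = integral (cbox (- r) r) (%x. e x * \<phi> (x, z))" for z proof -
  have "(LBINT x. e x * \<phi> (x, z)) = integral UNIV (%x. e x * \<phi> (x, z))" by (rule integral_lborel[OF i, symmetric])
  also have "... = integral UNIV (%x. if x : cbox (- r) r then e x * \<phi> (x, z) else 0)" proof (intro arg_cong[where f="integral UNIV"] ext)
   fix x show "e x * \<phi> (x, z) = (if x : cbox (- r) r then e x * \<phi> (x, z) else 0)" using z[of x z] by (cases "r < abs x") (auto simp: abs_le_iff not_less)
  qed
  finally show ?thesis unfolding integral_restrict_UNIV .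
 qed
 show "(LBINT x. e x * \<phi> (x, z)) = integral (cbox (- r) r) (%x. e x * \<phi> (x, z))" by (rule eq)
 show "integr (%x. e x * \<phi> (x, z))" by (rule i)
 show "continuous_on UNIV (%z. LBINT x. e x * \<phi> (x, z))" unfolding eq proof (rule integral_continuous_on_param)
  show "continuous_on (UNIV \<times> cbox (- r) r) (%(z, x). e x * \<phi> (x, z))"
   unfolding split_beta by (intro continuous_intros continuous_on_compose2[OF e] continuous_on_compose2[OF \<phi>]) auto
 qed
qed

lemma slice_integral_deriv:
 assumes e: "continuous_on UNIV e" and t: "test_function \<phi> D"
 shows "((%z. LBINT x. e x * \<phi> (x, z)) has_real_derivative (LBINT x. e x * snd (D (x, z)))) (at z)"
proof -
 obtain r where r: "!!p. r < norm p ==> \<phi> p = 0" "!!p. r < norm p ==> D p = 0" by (rule test_support[OF t]) blast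
 have c1: "continuous_on UNIV (%p. snd (D p))" by (intro continuous_intros test_continuous(2)[OF t])
 have e1: "(LBINT x. e x * \<phi> (x, z)) = integral (cbox (- r) r) (%x. e x * \<phi> (x, z))" for z by (rule slice_integral(1)[OF e test_continuous(1)[OF t] r(1)])
 have e2: "(LBINT x. e x * snd (D (x, z))) = integral (cbox (- r) r) (%x. e x * snd (D (x, z)))" for z by (rule slice_integral(1)[OF e c1]) (simp add: r)
 have "((%z. integral (cbox (- r) r) (%x. e x * \<phi> (x, z))) has_real_derivative integral (cbox (- r) r) (%x. e x * snd (D (x, z)))) (at z within UNIV)"
 proof (rule leibniz_rule_field_derivative[where f="%z x. e x * \<phi> (x, z)" and fx="%z x. e x * snd (D (x, z))"])
  show "((%z. e x * \<phi> (x, z)) has_real_derivative e x * snd (D (x, z))) (at z within UNIV)" for x z by (simp only: DERIV_cmult[OF test_function_slice(2)[OF t]])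
  show "(%x. e x * \<phi> (x, z)) integrable_on cbox (- r) r" for z
   by (intro integrable_continuous continuous_intros continuous_on_subset[OF e] continuous_on_compose2[OF test_continuous(1)[OF t]]) auto
  show "continuous_on (UNIV \<times> cbox (- r) r) (%(z, x). e x * snd (D (x, z)))"
   unfolding case_prod_unfold by (intro continuous_intros continuous_on_compose2[OF e] continuous_on_compose2[OF test_continuous(2)[OF t]]) auto
 qed auto
 then show ?thesis unfolding e1 e2 by simp
qed

section \<open>Mollification in the transversal variable x\<close>

definition conv :: "(real => real) => nat => real => real" where
 "conv f n x = (LBINT y. f y * ker n (x - y))"

lemma conv_reflect:
 assumes [measurable]: "f : Borel"
 shows "conv f n x = (LBINT t. ker n t * f (x - t))"
proof -
 note [measurable] = C2c_measurable[OF ker_C2c]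
 have "(LBINT t. (%y. f y * ker n (x - y)) (x - t)) = (LBINT y. f y * ker n (x - y))" by (rule lborel_reflect) measurable
 then show ?thesis by (simp add: conv_def mult.commute)
qed

lemma conv_tendsto:
 assumes f: "continuous_on UNIV f" "!!x. abs (f x) <= B"
 shows "(%n. conv f n x) ----> f x"
proof -
 have m[measurable]: "f : Borel" using f(1) by (rule borel_measurable_continuous_onI)
 have "isCont (%t. f (x - t)) 0" using f(1) by (intro isCont_o2[where f="%t. x - t" and g=f] continuous_intros) (simp add: continuous_on_eq_continuous_at)
 then have "((%t. f (x - t)) \<longlongrightarrow> f x) (at 0)" by (simp add: isCont_def)
 then show ?thesis unfolding conv_reflect[OF m] by (intro ker_approx[where B=B]) (use f in auto)
qed

text \<open>The L1 error of the mollification is at most the average of the L1 modulus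
  \<open>c\<close> of \<open>f\<close> against \<open>ker n\<close>, and \<open>c\<close> tends to 0
  at 0. Neither boundedness nor continuity of \<open>f\<close> is involved, which suits a
  discontinuous potential.\<close>

lemma conv_L1:
 assumes f: "integr f"
 shows "integr (%x. conv f n x)" "(%n. LBINT x. abs (conv f n x - f x)) ----> 0"
proof -
 note [measurable] = C2c_measurable[OF ker_C2c]
 have m[measurable]: "f : Borel" using f by auto
 define c where "c t = (LBINT x. abs (f (x + - t) - f x))" for t
 have sh: "integr (%x. f (x + t))" for t using f by (simp add: integr_shift)
 have sh': "integr (%x. f (x - t))" for t using sh[of "- t"] by simp
 have c0: "(c \<longlongrightarrow> 0) (at 0)" unfolding tendsto_at_iff_sequentially comp_def c_def proof safe
  fix X :: "nat => real" assume X: "ALL i. X i : UNIV - {0}" "X ----> 0"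
  have 1: "- X i : UNIV - {0}" for i using X by auto
  have 2: "(%i. - X i) ----> 0" using tendsto_minus[OF X(2)] by simp
  show "(%i. LBINT x. abs (f (x + - X i) - f x)) ----> 0" by (rule L1_modulus[OF f, unfolded tendsto_at_iff_sequentially comp_def, rule_format, OF 1 2])
 qed
 have cb: "abs (c t) <= 2 * (LBINT x. abs (f x))" for t proof -
  have "c t <= (LBINT x. abs (f (x + - t)) + abs (f x))" unfolding c_def using sh' f by (intro integral_mono) auto
  also have "... = (LBINT x. abs (f (x + - t))) + (LBINT x. abs (f x))" using sh' f by (intro lint_add) auto
  also have "(LBINT x. abs (f (x + - t))) = (LBINT x. abs (f x))" by (rule lint_shift) measurable
  finally have "c t <= 2 * (LBINT x. abs (f x))" by simp
  moreover have "c t >= 0" by (simp add: c_def)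
  ultimately show ?thesis by simp
 qed
 have cm: "c : Borel" unfolding c_def by (rule param_integral_Borel) measurable
 have lim: "(%n. LBINT t. ker n t * c t) ----> 0" by (rule ker_approx[OF cm cb c0])
 have ik: "integr (ker n)" for n by (rule C2c_integrable(1)[OF ker_C2c])
 have int: "integrable lborel2 (%(t, x). ker n t * (f (x + - t) - f x))" for n proof (rule lborel_pair.Fubini_integrable)
  show "(%(t, x). ker n t * (f (x + - t) - f x)) : borel_measurable lborel2" by measurable
  have "(%t. LBINT x. norm (case (t, x) of (t, x) => ker n t * (f (x + - t) - f x))) = (%t. ker n t * c t)" by (rule ext) (simp add: c_def abs_mult ker_nonneg)
  moreover have "integr (%t. ker n t * c t)" proof (rule integr_bound[of _ "%t. 2 * (LBINT x. abs (f x)) * ker n t"])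
   show "AE t in lborel. norm (ker n t * c t) <= norm (2 * (LBINT x. abs (f x)) * ker n t)" proof (intro AE_I2)
    fix t
    have "ker n t * abs (c t) <= ker n t * (2 * (LBINT x. abs (f x)))" by (intro mult_left_mono cb ker_nonneg)
    then show "norm (ker n t * c t) <= norm (2 * (LBINT x. abs (f x)) * ker n t)" using ker_nonneg[of n t] by (simp add: abs_mult mult_ac)
   qed
  qed (use ik cm in auto)
  ultimately show "integr (%t. LBINT x. norm (case (t, x) of (t, x) => ker n t * (f (x + - t) - f x)))" by simp
  show "AE t in lborel. integr (%x. case (t, x) of (t, x) => ker n t * (f (x + - t) - f x))" using sh' f by (intro AE_I2) auto
 qed
 have cf: "AE x in lborel. conv f n x - f x = (LBINT t. ker n t * (f (x + - t) - f x))" for n proof -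
  have "AE x in lborel. integr (%t. ker n t * (f (x + - t) - f x))" using lborel_pair.AE_integrable_snd[OF int[of n]] by simp
  then show ?thesis proof eventually_elim
   case (elim x)
   have k: "integr (%t. ker n t * f x)" using ik by simp
   have "integr (%t. ker n t * (f (x + - t) - f x) + ker n t * f x)" by (rule integr_add[OF elim k])
   then have i: "integr (%t. ker n t * f (x - t))" by (simp add: algebra_simps)
   have "(LBINT t. ker n t * (f (x + - t) - f x)) = (LBINT t. ker n t * f (x - t)) - (LBINT t. ker n t * f x)" using lint_diff[OF i k] by (simp add: right_diff_distrib)
   then show ?case by (simp add: conv_reflect ker_integral)
  qed
 qed
 have cmn: "(%x. conv f n x) : Borel" for n unfolding conv_def by (rule param_integral_Borel) measurable
 have id: "integr (%x. LBINT t. ker n t * (f (x + - t) - f x))" for n using lborel_pair.integrable_snd[OF int[of n]] by simp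
 have icd: "integr (%x. conv f n x - f x)" for n by (rule integrable_cong_AE_imp[OF id]) (use cf[of n] cmn in \<open>auto intro: AE_symmetric\<close>)
 have "integr (%x. (conv f n x - f x) + f x)" for n by (rule integr_add[OF icd f])
 then show "integr (%x. conv f n x)" for n by simp
 show "(%n. LBINT x. abs (conv f n x - f x)) ----> 0" proof (rule tendsto_sandwich[OF _ _ tendsto_const lim])
  show "\<forall>\<^sub>F n in sequentially. (LBINT x. abs (conv f n x - f x)) <= (LBINT t. ker n t * c t)" proof (intro always_eventually allI)
   fix n
   have int': "integrable lborel2 (%(t, x). abs (ker n t * (f (x + - t) - f x)))" using integrable_abs[OF int[of n]] by (simp add: case_prod_unfold)
   have "(LBINT x. abs (conv f n x - f x)) = (LBINT x. abs (LBINT t. ker n t * (f (x + - t) - f x)))" by (rule integral_cong_AE) (use cf[of n] icd[of n] id[of n] in \<open>auto\<close>)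
   also have "... <= (LBINT x. LBINT t. abs (ker n t * (f (x + - t) - f x)))" using id[of n] lborel_pair.integrable_snd[OF int'] by (intro integral_mono integral_abs_bound) auto
   also have "... = (LBINT t. LBINT x. abs (ker n t * (f (x + - t) - f x)))" using lborel_pair.Fubini_integral[OF int'] by simp
   also have "... = (LBINT t. ker n t * c t)" by (rule lint_cong[OF refl]) (simp add: c_def abs_mult ker_nonneg)
   finally show "(LBINT x. abs (conv f n x - f x)) <= (LBINT t. ker n t * c t)" .
  qed
 qed simp
qed

text \<open>The kernel has radius at most 1, over which the exponential weight changes by at most
  the factor exp c. The bound is uniform in n and serves as a dominating function.\<close>

lemma conv_exp_bound:
 assumes [measurable]: "f : Borel" and f: "!!x. abs (f x) <= C * exp (- (c * abs x))" and "c > 0"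
 shows "abs (conv f n x) <= C * exp c * exp (- (c * abs x))"
proof -
 note [measurable] = C2c_measurable[OF ker_C2c]
 have C0: "C >= 0" using f[of 0] by (auto intro: order_trans[OF abs_ge_zero])
 have b: "abs (ker n t * f (x - t)) <= (C * exp c * exp (- (c * abs x))) * ker n t" for t proof (cases "1 <= abs t")
  case True
  have "1 / real (Suc n) <= 1" by simp
  then have "ker n t = 0" using True by (intro ker_zero) linarith
  then show ?thesis by simp
 next
  case False
  then have "abs x <= 1 + abs (x - t)" by linarith
  then have "c * abs x <= c * (1 + abs (x - t))" using \<open>c > 0\<close> by (intro mult_left_mono) auto
  then have "- (c * abs (x - t)) <= c + - (c * abs x)" by (simp add: distrib_left)
  then have "exp (- (c * abs (x - t))) <= exp c * exp (- (c * abs x))" by (simp flip: exp_add)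
  then have "abs (f (x - t)) <= C * (exp c * exp (- (c * abs x)))" by (intro order_trans[OF f] mult_left_mono C0)
  then have "ker n t * abs (f (x - t)) <= ker n t * (C * (exp c * exp (- (c * abs x))))" by (intro mult_left_mono ker_nonneg)
  then show ?thesis using ker_nonneg[of n t] by (simp add: abs_mult mult_ac)
 qed
 have ik: "integr (%t. (C * exp c * exp (- (c * abs x))) * ker n t)" using C2c_integrable(1)[OF ker_C2c] by simp
 have i: "integr (%t. ker n t * f (x - t))" proof (rule integr_bound[OF ik])
  show "AE t in lborel. norm (ker n t * f (x - t)) <= norm ((C * exp c * exp (- (c * abs x))) * ker n t)" using b by (auto intro!: AE_I2 intro: order_trans[OF _ abs_ge_self])
 qed measurable
 have "abs (conv f n x) <= (LBINT t. abs (ker n t * f (x - t)))" unfolding conv_reflect[OF assms(1)] by (rule integral_abs_bound)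
 also have "... <= (LBINT t. (C * exp c * exp (- (c * abs x))) * ker n t)" by (rule integral_mono) (use i ik b in auto)
 also have "... = C * exp c * exp (- (c * abs x))" by (simp add: ker_integral)
 finally show ?thesis .
qed

text \<open>\<open>e\<close> is a bound state of the operator \<open>d\<^sup>2/dx\<^sup>2 + V\<close> with eigenvalue \<open>b2\<close>, in the very weak sense.\<close>

locale bound_state =
 fixes V e :: "real => real" and BV C c b2 :: real
 assumes V_measurable [measurable]: "V : Borel" and V_bound: "!!x. abs (V x) <= BV"
  and e_cont: "continuous_on UNIV e" and c_pos: "c > 0" and e_bound: "!!x. abs (e x) <= C * exp (- (c * abs x))"
  and e_eq: "!!al al1 al2. C2c al al1 al2 ==> (LBINT x. e x * (al2 x + (V x - b2) * al x)) = 0"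
begin

lemma e_measurable [measurable]: "e : Borel" using e_cont by (rule borel_measurable_continuous_onI)

lemma C_nonneg: "C >= 0" using e_bound[of 0] by (auto intro: order_trans[OF abs_ge_zero])

lemma BV_nonneg: "BV >= 0" using V_bound[of 0] by linarith

lemma e_bound_C: "abs (e x) <= C"
proof -
 have "C * exp (- (c * abs x)) <= C * 1" using c_pos by (intro mult_left_mono C_nonneg) simp
 then show ?thesis using e_bound[of x] by simp
qed

text \<open>In the sense of distributions this is \<open>- e''\<close>; it decays like
  \<open>e\<close> but may jump with \<open>V\<close>.\<close>

definition f :: "real => real" where "f x = (V x - b2) * e x"

lemma f_measurable [measurable]: "f : Borel" unfolding f_def by measurable

lemma f_bound: "abs (f x) <= ((BV + abs b2) * C) * exp (- (c * abs x))"
proof -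
 have "abs (V x - b2) * abs (e x) <= (BV + abs b2) * (C * exp (- (c * abs x)))" using V_bound[of x] BV_nonneg e_bound[of x] by (intro mult_mono) auto
 then show ?thesis by (simp add: f_def abs_mult mult.assoc)
qed

lemma f_integrable: "integr f"
proof (rule integr_bound)
 show "integr (%x. ((BV + abs b2) * C) * exp (- (c * abs x)))" using exp_abs_integrable[OF c_pos] by simp
 show "AE x in lborel. norm (f x) <= norm (((BV + abs b2) * C) * exp (- (c * abs x)))" using f_bound by (auto intro!: AE_I2 intro: order_trans[OF _ abs_ge_self])
qed measurable

text \<open>The eigenvalue equation tested with a reflected kernel: the second derivative of the
  mollified \<open>e\<close> is minus the mollified \<open>f\<close>, although \<open>e\<close>
  itself has no classical second derivative.\<close>

lemma ker2_pairing: "(LBINT y. e y * ker2 n (x - y)) = - conv f n x"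
proof -
 note [measurable] = C2c_measurable[OF ker_C2c]
 obtain B where B: "!!x. abs (ker n x) <= B" "!!x. abs (ker2 n x) <= B" by (rule C2c_bounded[OF ker_C2c[of n]]) blast
 have ie: "integr e" proof (rule integr_bound)
  show "integr (%x. C * exp (- (c * abs x)))" using exp_abs_integrable[OF c_pos] by simp
  show "AE x in lborel. norm (e x) <= norm (C * exp (- (c * abs x)))" using e_bound by (auto intro!: AE_I2 intro: order_trans[OF _ abs_ge_self])
 qed measurable
 have ib: "integr (%y. g y * k (x - y))" if "integr g" "!!t. abs (k t) <= B" "k : Borel" for g k :: "real => real" proof (rule integr_bound[of _ "%y. B * g y"])
  show "integr (%y. B * g y)" using that by simp
  show "(%y. g y * k (x - y)) : borel_measurable lborel" using that by measurable
  show "AE y in lborel. norm (g y * k (x - y)) <= norm (B * g y)" proof (intro AE_I2)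
   fix y
   have "abs (g y) * abs (k (x - y)) <= abs (g y) * B" by (intro mult_left_mono that) simp
   then show "norm (g y * k (x - y)) <= norm (B * g y)" using B(1)[of 0] by (simp add: abs_mult mult.commute)
  qed
 qed
 have i1: "integr (%y. e y * ker2 n (x - y))" by (rule ib[OF ie B(2)]) measurable
 have i2: "integr (%y. f y * ker n (x - y))" by (rule ib[OF f_integrable B(1)]) measurable
 have "0 = (LBINT y. e y * (ker2 n (x - y) + (V y - b2) * ker n (x - y)))" using e_eq[OF C2c_reflect[OF ker_C2c]] by simp
 also have "... = (LBINT y. e y * ker2 n (x - y) + f y * ker n (x - y))" by (rule lint_cong) (simp_all add: f_def algebra_simps)
 also have "... = (LBINT y. e y * ker2 n (x - y)) + conv f n x" unfolding conv_def using i1 i2 by simp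
 finally show ?thesis by simp
qed

text \<open>The equation of \<open>u\<close> should be tested with e(x) g(z), but \<open>e\<close>
  has neither compact support nor two continuous derivatives. Testing with ker n (x - y) g(z),
  multiplying by e(y) and integrating over y replaces \<open>e\<close> by its mollification; in the
  limit the eigenvalue equation turns the x-part into \<open>b2\<close>. The outcome is the weak
  form of U'' + b2 U = 0 for the coefficient U of \<open>u\<close> along \<open>e\<close>.\<close>

lemma separated_pairing:
 assumes u: "expint u" and eq: "!!al al1 al2 \<beta> \<beta>1 \<beta>2. C2c al al1 al2 ==> C2c \<beta> \<beta>1 \<beta>2 ==>
   (LBINT p. u p * (al2 (fst p) * \<beta> (snd p) + al (fst p) * \<beta>2 (snd p) + V (fst p) * al (fst p) * \<beta> (snd p))) = 0"
  and g: "C2c g g1 g2"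
 shows "(LBINT p. u p * (e (fst p) * (g2 (snd p) + b2 * g (snd p)))) = 0"
proof -
 note [measurable] = C2c_measurable[OF ker_C2c] C2c_measurable[OF g]
 have [measurable]: "u : Borel" using u by (simp add: expint_def)
 obtain Bg where Bg: "Bg >= 0" "!!x. abs (g x) <= Bg" "!!x. abs (g2 x) <= Bg" by (rule C2c_bounded[OF g]) blast
 obtain Z where Z: "!!z. Z < abs z ==> g z = 0" "!!z. Z < abs z ==> g2 z = 0" by (rule C2c_supp[OF g]) blast
 let ?H = "%n p. g2 (snd p) * conv e n (fst p) + g (snd p) * (V (fst p) * conv e n (fst p) - conv f n (fst p))"
 have approx: "(LBINT p. u p * ?H n p) = 0" for n proof -
  obtain B where B: "B >= 0" "!!x. abs (ker n x) <= B" "!!x. abs (ker2 n x) <= B" by (rule C2c_bounded[OF ker_C2c[of n]]) blast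
  obtain r where r: "r > 0" "!!x. r < abs x ==> ker n x = 0" "!!x. r < abs x ==> ker2 n x = 0" by (rule C2c_supp[OF ker_C2c[of n]]) blast
  define k where "k p y = ker2 n (fst p - y) * g (snd p) + ker n (fst p - y) * g2 (snd p) + V (fst p) * ker n (fst p - y) * g (snd p)" for p :: "plane" and y
  define Ck where "Ck = B * Bg + B * Bg + BV * B * Bg"
  have kb: "abs (k p y) <= Ck" for p y proof -
   have "abs (ker2 n (fst p - y) * g (snd p)) <= B * Bg" "abs (ker n (fst p - y) * g2 (snd p)) <= B * Bg" unfolding abs_mult by (intro mult_mono B Bg; simp)+
   moreover have "abs (V (fst p) * ker n (fst p - y) * g (snd p)) <= BV * B * Bg" by (intro abs_mult3_le V_bound B Bg)
   ultimately show ?thesis unfolding k_def Ck_def by linarith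
  qed
  have kz: "k p y = 0" if "r < abs (fst p - y) | Z < abs (snd p)" for p y using that r Z by (auto simp: k_def)
  have Ck0: "Ck >= 0" using kb[of 0 0] by (auto intro: order_trans[OF abs_ge_zero])
  \<comment> \<open>On the support of the kernel abs (x - y) <= r, so the decay of \<open>e\<close>
    in y is traded for decay in x at the price of exp (c r); this makes the double integral converge
    under \<open>expint\<close>.\<close>
  define D where "D = C * exp (c * r) * Ck"
  have ub: "abs (e y * k p y) <= D * (ind {-Z..Z} (snd p) * exp (- (c * abs (fst p)))) * ind {fst p - r..fst p + r} y" for p y proof (cases "r < abs (fst p - y) | Z < abs (snd p)")
   case True then show ?thesis using kz[OF True] C_nonneg Ck0 by (simp add: D_def)
  next
   case False
   then have i: "ind {-Z..Z} (snd p) = (1::real)" "ind {fst p - r..fst p + r} y = (1::real)" by (auto simp: indicator_def abs_le_iff not_less)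
   have "c * abs (fst p) <= c * (r + abs y)" using False c_pos by (intro mult_left_mono) auto
   then have "- (c * abs y) <= c * r + - (c * abs (fst p))" by (simp add: distrib_left)
   then have "exp (- (c * abs y)) <= exp (c * r) * exp (- (c * abs (fst p)))" by (simp flip: exp_add)
   then have "abs (e y) <= C * (exp (c * r) * exp (- (c * abs (fst p))))" by (intro order_trans[OF e_bound] mult_left_mono C_nonneg)
   then have "abs (e y) * abs (k p y) <= (C * (exp (c * r) * exp (- (c * abs (fst p))))) * Ck" using kb[of p y] C_nonneg by (intro mult_mono) auto
   then show ?thesis by (simp add: i D_def abs_mult mult_ac)
  qed
  have km: "(%(p, y). k p y) : Borel2" unfolding k_def by measurable
  note [measurable] = km
  define U where "U p = abs (u p) * (D * (ind {-Z..Z} (snd p) * exp (- (c * abs (fst p)))) * (2 * r))" for p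
  have iU: "integr U" proof -
   have "integr (%p. (D * 2 * r) * abs (ind {-Z..Z} (snd p) * exp (- (c * abs (fst p))) * u p))" using u c_pos by (intro integrable_mult_right integrable_abs) (auto simp: expint_def)
   then show ?thesis by (rule back_subst[of "integr"]) (auto simp: U_def fun_eq_iff abs_mult mult_ac)
  qed
  have iy: "integr (%y. ind {a - r..a + r} y :: real)" for a :: real by (simp add: integrable_indicator_iff emeasure_lborel_Icc_eq)
  have iek: "integr (%y. e y * k p y)" for p proof (rule integr_bound[OF integrable_mult_right[OF iy]])
   show "AE y in lborel. norm (e y * k p y) <= norm ((D * (ind {-Z..Z} (snd p) * exp (- (c * abs (fst p))))) * ind {fst p - r..fst p + r} y)"
    using ub[of _ p] by (auto intro!: AE_I2 intro: order_trans[OF _ abs_ge_self])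
  qed measurable
  have int: "integrable lborel2 (%(p, y). u p * (e y * k p y))" proof (rule lborel_pair.Fubini_integrable)
   show "(%(p, y). u p * (e y * k p y)) : borel_measurable lborel2" using km by (simp add: measurable_cong_sets[OF sets_pair_measure_cong[OF sets_lborel sets_lborel] refl] split_beta)
   show "AE p in lborel. integr (%y. case (p, y) of (p, y) => u p * (e y * k p y))" using iek by auto
   show "integr (%p. LBINT y. norm (case (p, y) of (p, y) => u p * (e y * k p y)))" proof (rule integr_bound[OF iU])
    show "(%p. LBINT y. norm (case (p, y) of (p, y) => u p * (e y * k p y))) : borel_measurable lborel" unfolding measurable_lborel2 by (rule param_integral_Borel) measurable
    show "AE p in lborel. norm (LBINT y. norm (case (p, y) of (p, y) => u p * (e y * k p y))) <= norm (U p)" proof (intro AE_I2)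
     fix p
     have "(LBINT y. norm (u p * (e y * k p y))) = abs (u p) * (LBINT y. abs (e y * k p y))" by (simp add: abs_mult)
     also have "(LBINT y. abs (e y * k p y)) <= (LBINT y. (D * (ind {-Z..Z} (snd p) * exp (- (c * abs (fst p))))) * ind {fst p - r..fst p + r} y)"
      using ub[of _ p] iek[of p] iy by (intro integral_mono) auto
     also have "... = (D * (ind {-Z..Z} (snd p) * exp (- (c * abs (fst p))))) * (2 * r)" using r(1) by simp
     finally have "(LBINT y. norm (u p * (e y * k p y))) <= U p" unfolding U_def by (simp add: mult_left_mono)
     moreover have "0 <= (LBINT y. norm (u p * (e y * k p y)))" by simp
     ultimately show "norm (LBINT y. norm (case (p, y) of (p, y) => u p * (e y * k p y))) <= norm (U p)" by simp
    qed
   qed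
  qed
  have inner: "(LBINT y. e y * k p y) = ?H n p" for p proof -
   have b: "integr (%y. e y * h (fst p - y))" if "!!x. abs (h x) <= B" "!!x. r < abs x ==> h x = 0" "h : Borel" for h :: "real => real" proof (rule integr_compact[of _ "C * B" "abs (fst p) + r"])
    show "(%y. e y * h (fst p - y)) : Borel" using that(3) by measurable
    show "abs (e y * h (fst p - y)) <= C * B" for y unfolding abs_mult by (intro mult_mono e_bound_C that C_nonneg) simp
    show "e y * h (fst p - y) = 0" if "abs (fst p) + r < norm y" for y using that \<open>!!x. r < \<bar>x\<bar> ==> h x = 0\<close>[of "fst p - y"] by simp
   qed
   have i: "integr (%y. e y * ker2 n (fst p - y))" "integr (%y. e y * ker n (fst p - y))" by (rule b; use B r in measurable)+
   have "(LBINT y. e y * k p y) = (LBINT y. g (snd p) * (e y * ker2 n (fst p - y)) + (g2 (snd p) + V (fst p) * g (snd p)) * (e y * ker n (fst p - y)))"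
    by (rule lint_cong) (simp_all add: k_def algebra_simps)
   also have "... = g (snd p) * (LBINT y. e y * ker2 n (fst p - y)) + (g2 (snd p) + V (fst p) * g (snd p)) * conv e n (fst p)" unfolding conv_def using i by simp
   finally show ?thesis unfolding ker2_pairing by (simp add: algebra_simps)
  qed
  have "(LBINT p. u p * ?H n p) = (LBINT p. LBINT y. u p * (e y * k p y))" by (simp add: inner)
  also have "... = (LBINT y. LBINT p. u p * (e y * k p y))" using lborel_pair.Fubini_integral[OF int] by simp
  also have "... = 0" proof -
   have "(LBINT p. u p * (e y * k p y)) = 0" for y proof -
    have "(LBINT p. u p * (e y * k p y)) = (LBINT p. e y * (u p * (ker2 n (fst p - y) * g (snd p) + ker n (fst p - y) * g2 (snd p) + V (fst p) * ker n (fst p - y) * g (snd p))))"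
     by (rule lint_cong) (simp_all add: k_def mult_ac)
    also have "... = 0" unfolding integral_mult_right_zero using eq[OF C2c_shift_minus[OF ker_C2c, of n y] g] by simp
    finally show ?thesis .
   qed
   then show ?thesis by simp
  qed
  finally show ?thesis .
 qed
 \<comment> \<open>\<open>f\<close> is only integrable, so its mollifications converge in L1 and a
   subsequence is taken for almost every x; those of the continuous \<open>e\<close> converge
   everywhere.\<close>
 obtain s where s: "strict_mono s" "AE x in lborel. (%n. conv f (s n) x - f x) ----> 0" proof -
  have "integr (%x. conv f n x - f x)" for n using conv_L1(1)[OF f_integrable] f_integrable by simp
  from tendsto_L1_AE_subseq[of lborel "%n x. conv f n x - f x", OF this] conv_L1(2)[OF f_integrable]
  obtain s where "strict_mono s" "AE x in lborel. (%n. conv f (s n) x - f x) ----> 0" by auto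
  then show ?thesis by (rule that)
 qed
 have "(%n. LBINT p. u p * ?H (s n) p)
  ----> (LBINT p. u p * (g2 (snd p) * e (fst p) + g (snd p) * (V (fst p) * e (fst p) - f (fst p))))" proof (rule integral_dominated_convergence)
  define E where "E = Bg * (C * exp c) + Bg * (BV * (C * exp c) + (BV + abs b2) * C * exp c)"
  show "integr (%p. E * abs (ind {-Z..Z} (snd p) * exp (- (c * abs (fst p))) * u p))" using u c_pos by (intro integrable_mult_right integrable_abs) (auto simp: expint_def)
  have cmn: "(%x. conv h n x) : Borel" if [measurable]: "h : Borel" for h n unfolding conv_def by (rule param_integral_Borel) measurable
  note [measurable] = cmn[OF e_measurable] cmn[OF f_measurable]
  show "(%p. u p * ?H (s n) p) : borel_measurable lborel" for n by measurable
  show "(%p. u p * (g2 (snd p) * e (fst p) + g (snd p) * (V (fst p) * e (fst p) - f (fst p)))) : borel_measurable lborel" by measurable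
  have "AE p in (lborel :: plane measure). (%n. conv f (s n) (fst p) - f (fst p)) ----> 0" by (rule AE_fst_lborel[OF s(2)])
  then show "AE p in lborel. (%n. u p * ?H (s n) p)
    ----> u p * (g2 (snd p) * e (fst p) + g (snd p) * (V (fst p) * e (fst p) - f (fst p)))" proof eventually_elim
   case (elim p)
   have "(%n. conv f (s n) (fst p)) ----> f (fst p)" using elim by (rule LIM_zero_cancel)
   moreover have "(%n. conv e (s n) (fst p)) ----> e (fst p)" using LIMSEQ_subseq_LIMSEQ[OF conv_tendsto[OF e_cont e_bound_C] s(1)] by (simp add: comp_def)
   ultimately show ?case by (intro tendsto_mult tendsto_add tendsto_diff tendsto_const)
  qed
  show "AE p in lborel. norm (u p * ?H (s n) p)
    <= E * abs (ind {-Z..Z} (snd p) * exp (- (c * abs (fst p))) * u p)" for n proof (intro AE_I2)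
   fix p :: "plane"
   let ?x = "fst p" and ?z = "snd p"
   let ?ex = "exp (- (c * abs (?x)))"
   show "norm (u p * (g2 ?z * conv e (s n) ?x + g ?z * (V ?x * conv e (s n) ?x - conv f (s n) ?x))) <= E * abs (ind {-Z..Z} ?z * ?ex * u p)" proof (cases "abs (?z) <= Z")
    case True
    then have i: "ind {-Z..Z} ?z = (1::real)" by (auto simp: indicator_def abs_le_iff)
    have ce: "abs (conv e (s n) ?x) <= C * exp c * ?ex" by (rule conv_exp_bound[OF e_measurable e_bound c_pos])
    have cf: "abs (conv f (s n) ?x) <= (BV + abs b2) * C * exp c * ?ex" by (rule conv_exp_bound[OF f_measurable f_bound c_pos])
    have 1: "abs (g2 ?z * conv e (s n) ?x) <= Bg * (C * exp c * ?ex)" unfolding abs_mult by (intro mult_mono Bg ce) simp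
    have "abs (V ?x * conv e (s n) ?x) <= BV * (C * exp c * ?ex)" unfolding abs_mult by (intro mult_mono V_bound ce BV_nonneg) simp
    then have "abs (V ?x * conv e (s n) ?x - conv f (s n) ?x) <= BV * (C * exp c * ?ex) + (BV + abs b2) * C * exp c * ?ex" using cf by linarith
    then have 2: "abs (g ?z * (V ?x * conv e (s n) ?x - conv f (s n) ?x)) <= Bg * (BV * (C * exp c * ?ex) + (BV + abs b2) * C * exp c * ?ex)"
     unfolding abs_mult[of "g ?z"] by (intro mult_mono Bg) auto
    have "abs (g2 ?z * conv e (s n) ?x + g ?z * (V ?x * conv e (s n) ?x - conv f (s n) ?x)) <= E * ?ex"
     using 1 2 unfolding E_def by (simp add: distrib_right distrib_left mult_ac) linarith
    then have "abs (u p) * abs (g2 ?z * conv e (s n) ?x + g ?z * (V ?x * conv e (s n) ?x - conv f (s n) ?x)) <= abs (u p) * (E * ?ex)" by (intro mult_left_mono) auto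
    then show ?thesis by (simp add: i abs_mult mult_ac)
   next
    case False
    then have "ind {-Z..Z} ?z = (0::real)" by (auto simp: indicator_def abs_le_iff)
    then show ?thesis using False Z[of ?z] by simp
   qed
  qed
 qed
 then have "(LBINT p. u p * (g2 (snd p) * e (fst p) + g (snd p) * (V (fst p) * e (fst p) - f (fst p)))) = 0" unfolding approx by (simp add: LIMSEQ_const_iff)
 moreover have "g2 z * e x + g z * (V x * e x - f x) = e x * (g2 z + b2 * g z)" for x z by (simp add: f_def algebra_simps)
 ultimately show ?thesis by simp
qed

lemma moment_C2c:
 assumes "C2c_plane ps D D1 D2"
 shows "C2c (%z. LBINT x. e x * ps (x, z)) (%z. LBINT x. e x * snd (D (x, z))) (%z. LBINT x. e x * snd (D2 (x, z)))"
proof -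
 have t: "test_function ps D" "test_function (%p. snd (D p)) D2" using assms by (auto simp: C2c_plane_def)
 obtain r where r: "!!p. r < norm p ==> ps p = 0" by (rule test_support[OF t(1)]) blast
 obtain r2 where r2: "!!p. r2 < norm p ==> D2 p = 0" by (rule test_support[OF t(2)]) blast
 have "(LBINT x. e x * ps (x, z)) = 0" if "r < abs z" for z proof -
  have "ps (x, z) = 0" for x using r[of "(x, z)"] norm_Pair_ge(2)[of z x] that by linarith
  then show ?thesis by simp
 qed
 moreover have "continuous_on UNIV (%z. LBINT x. e x * snd (D2 (x, z)))" by (rule slice_integral(3)[OF e_cont, where \<phi>="%p. snd (D2 p)" and r=r2])
   (use r2 in \<open>auto intro!: continuous_intros test_continuous(2)[OF t(2)]\<close>)
 ultimately show ?thesis using slice_integral_deriv[OF e_cont t(1)] slice_integral_deriv[OF e_cont t(2)] unfolding C2c_def by blast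
qed

text \<open>For w = e(x) U(z) the x-integral can be done first: the eigenvalue equation of
  \<open>e\<close> on the slice replaces the second x-derivative and \<open>V\<close> by
  \<open>b2\<close>, leaving U against the moments of the test function. These moments form a test
  function of z, so the right side has the form treated by \<open>separated_pairing\<close>.\<close>

lemma component_pairing:
 assumes u: "expint u" and w: "L2l w" and wu: "!!x z. w (x, z) = e x * (LBINT xi. u (xi, z) * e xi)"
  and t: "C2c_plane ps D D1 D2"
 shows "(LBINT p. w p * schr V ps D1 D2 p) =
  (LBINT p. u p * (e (fst p) * ((LBINT x. e x * snd (D2 (x, snd p))) + b2 * (LBINT x. e x * ps (x, snd p)))))" proof -
 define g g2 where "g z = (LBINT x. e x * ps (x, z))" and "g2 z = (LBINT x. e x * snd (D2 (x, z)))" for z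
 have t0: "test_function ps D" and t1: "test_function (%p. fst (D p)) D1" and t2: "test_function (%p. snd (D p)) D2" using t by (auto simp: C2c_plane_def)
 note [measurable] = test_measurable[OF t0] test_measurable[OF t1] test_measurable[OF t2]
 have gc: "C2c g (%z. LBINT x. e x * snd (D (x, z))) g2" unfolding g_def g2_def by (rule moment_C2c[OF t])
 note [measurable] = C2c_measurable(1)[OF gc] C2c_measurable(3)[OF gc]
 obtain r0 where r0: "!!p. r0 < norm p ==> ps p = 0" by (rule test_support[OF t0]) blast
 obtain r1 where r1: "!!p. r1 < norm p ==> D1 p = 0" by (rule test_support[OF t1]) blast
 obtain r2 where r2: "!!p. r2 < norm p ==> D2 p = 0" by (rule test_support[OF t2]) blast
 obtain B0 where B0: "B0 >= 0" "!!p. abs (ps p) <= B0" by (rule test_bounded[OF t0]) blast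
 obtain B1 where B1: "!!p. abs (fst (D1 p)) <= B1" by (rule test_bounded[OF t1]) blast
 obtain B2 where B2: "!!p. abs (snd (D2 p)) <= B2" by (rule test_bounded[OF t2]) blast
 define L where "L p = fst (D1 p) + snd (D2 p) + V (fst p) * ps p" for p
 have [measurable]: "L : Borel" unfolding L_def by measurable
 have Lb: "abs (L p) <= B1 + B2 + BV * B0" for p proof -
  have "abs (V (fst p) * ps p) <= BV * B0" unfolding abs_mult by (intro mult_mono V_bound B0 BV_nonneg) simp
  then show ?thesis unfolding L_def using B1[of p] B2[of p] by linarith
 qed
 have Lz: "L p = 0" if "max r0 (max r1 r2) < norm p" for p using r0 r1 r2 that by (simp add: L_def)
 have iw: "integr (%p. w p * L p)" by (rule L2l_integrable[OF w _ Lb]) (measurable, erule Lz)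
 have inner: "(LBINT x. e x * L (x, z)) = g2 z + b2 * g z" for z proof -
  have c0: "continuous_on UNIV ps" "continuous_on UNIV (%p. fst (D1 p))" "continuous_on UNIV (%p. snd (D2 p))"
   by (intro continuous_intros test_continuous[OF t0] test_continuous[OF t1] test_continuous[OF t2])+
  have i0: "integr (%x. e x * ps (x, z))" by (rule slice_integral(2)[OF e_cont c0(1) r0])
  have i1: "integr (%x. e x * fst (D1 (x, z)))" by (rule slice_integral(2)[OF e_cont c0(2), where r=r1]) (simp add: r1)
  have i2: "integr (%x. e x * snd (D2 (x, z)))" by (rule slice_integral(2)[OF e_cont c0(3), where r=r2]) (simp add: r2)
  have i3: "integr (%x. V x * (e x * ps (x, z)))" proof (rule integr_bound[of _ "%x. BV * (e x * ps (x, z))"])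
   show "integr (%x. BV * (e x * ps (x, z)))" using i0 by simp
   show "(%x. V x * (e x * ps (x, z))) : borel_measurable lborel" using borel_measurable_integrable[OF i0] by simp
   show "AE x in lborel. norm (V x * (e x * ps (x, z))) <= norm (BV * (e x * ps (x, z)))"
    using V_bound BV_nonneg by (auto simp: abs_mult[of "V _"] abs_mult[of BV] intro!: AE_I2 mult_right_mono)
  qed
  have z: "(LBINT x. e x * (fst (D1 (x, z)) + (V x - b2) * ps (x, z))) = 0" by (rule e_eq[OF C2c_plane_slice[OF t]])
  have "(LBINT x. e x * (fst (D1 (x, z)) + (V x - b2) * ps (x, z))) = (LBINT x. e x * fst (D1 (x, z)) + V x * (e x * ps (x, z)) - b2 * (e x * ps (x, z)))"
   by (rule lint_cong) (simp_all add: algebra_simps)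
  also have "... = (LBINT x. e x * fst (D1 (x, z))) + (LBINT x. V x * (e x * ps (x, z))) - b2 * g z" unfolding g_def using i0 i1 i3 by simp
  finally have 1: "(LBINT x. e x * fst (D1 (x, z))) + (LBINT x. V x * (e x * ps (x, z))) = b2 * g z" using z by simp
  have "(LBINT x. e x * L (x, z)) = (LBINT x. e x * fst (D1 (x, z)) + V x * (e x * ps (x, z)) + e x * snd (D2 (x, z)))" by (rule lint_cong) (simp_all add: L_def algebra_simps)
  also have "... = (LBINT x. e x * fst (D1 (x, z))) + (LBINT x. V x * (e x * ps (x, z))) + g2 z" unfolding g2_def using i1 i2 i3 by simp
  finally show ?thesis using 1 by simp
 qed
 have iu: "integr (%p. u p * (e (fst p) * (g2 (snd p) + b2 * g (snd p))))" proof -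
  obtain Bg where Bg: "Bg >= 0" "!!x. abs (g x) <= Bg" "!!x. abs (g2 x) <= Bg" by (rule C2c_bounded[OF gc]) blast
  obtain Z where Z: "!!z. Z < abs z ==> g z = 0" "!!z. Z < abs z ==> g2 z = 0" by (rule C2c_supp[OF gc]) blast
  show ?thesis proof (rule expint_integrable[OF u c_pos, where C="C * (Bg + abs b2 * Bg)" and Z=Z])
   fix p :: "plane"
   have "abs (b2 * g (snd p)) <= abs b2 * Bg" unfolding abs_mult by (intro mult_left_mono Bg) simp
   then have "abs (g2 (snd p) + b2 * g (snd p)) <= Bg + abs b2 * Bg" using Bg(3)[of "snd p"] by linarith
   then have "abs (e (fst p)) * abs (g2 (snd p) + b2 * g (snd p)) <= (C * exp (- (c * abs (fst p)))) * (Bg + abs b2 * Bg)" using C_nonneg by (intro mult_mono e_bound) auto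
   then show "abs (e (fst p) * (g2 (snd p) + b2 * g (snd p))) <= C * (Bg + abs b2 * Bg) * exp (- (c * abs (fst p)))" by (simp add: abs_mult mult_ac)
  qed (use Z in \<open>measurable, simp\<close>)
 qed
 have "(LBINT p. w p * L p) = (LBINT z. LBINT x. w (x, z) * L (x, z))" by (rule integral_plane_snd[OF iw])
 also have "... = (LBINT z. LBINT xi. u (xi, z) * (e xi * (g2 z + b2 * g z)))" proof (rule lint_cong[OF refl])
  fix z
  have "(LBINT x. w (x, z) * L (x, z)) = (LBINT x. (LBINT xi. u (xi, z) * e xi) * (e x * L (x, z)))" by (rule lint_cong) (simp_all add: wu mult_ac)
  also have "... = (LBINT xi. u (xi, z) * e xi) * (g2 z + b2 * g z)" by (simp add: inner)
  also have "... = (LBINT xi. (u (xi, z) * e xi) * (g2 z + b2 * g z))" by simp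
  finally show "(LBINT x. w (x, z) * L (x, z)) = (LBINT xi. u (xi, z) * (e xi * (g2 z + b2 * g z)))" by (simp only: mult.assoc)
 qed
 also have "... = (LBINT p. u p * (e (fst p) * (g2 (snd p) + b2 * g (snd p))))" using integral_plane_snd[OF iu] by simp
 finally show ?thesis by (simp add: L_def g_def g2_def)
qed

end

section \<open>The guided modes\<close>

text \<open>The Caratheodory notion of an indefinite integral; \<open>F\<close> need not be
  differentiable at every point, as happens for v' when the potential jumps.\<close>

definition primitive_on :: "real => real => (real => real) => (real => real) => bool" where
 "primitive_on a b f F \<longleftrightarrow> (ALL x y. a <= x & x <= y & y <= b --> (f has_integral (F y - F x)) {x..y})"

lemma primitive_onD: "primitive_on a b f F ==> a <= x ==> x <= y ==> y <= b ==> (f has_integral (F y - F x)) {x..y}" by (simp add: primitive_on_def)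

lemma primitive_on_integral:
 assumes "f integrable_on {a..b}"
 shows "primitive_on a b f (%x. integral {a..x} f + c)" unfolding primitive_on_def
proof (intro allI impI)
 fix x y assume xy: "a <= x & x <= y & y <= b"
 have i: "f integrable_on {x..y}" "f integrable_on {a..y}" using assms xy by (auto intro: integrable_on_subinterval)
 have "integral {a..x} f + integral {x..y} f = integral {a..y} f" by (rule Henstock_Kurzweil_Integration.integral_combine) (use xy i in auto)
 then have "integral {a..y} f + c - (integral {a..x} f + c) = integral {x..y} f" by simp
 then show "(f has_integral (integral {a..y} f + c - (integral {a..x} f + c))) {x..y}" using integrable_integral[OF i(1)] by (simp only:)
qed

lemma primitive_on_deriv:
 assumes "!!x. x : {a..b} ==> (F has_real_derivative f x) (at x within {a..b})"
 shows "primitive_on a b f F" unfolding primitive_on_def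
proof (intro allI impI)
 fix x y assume xy: "a <= x & x <= y & y <= b"
 show "(f has_integral (F y - F x)) {x..y}" proof (rule fundamental_theorem_of_calculus)
  fix t assume "t : {x..y}"
  then have "(F has_real_derivative f t) (at t within {a..b})" using assms xy by auto
  then have "(F has_real_derivative f t) (at t within {x..y})" by (rule DERIV_subset) (use xy in auto)
  then show "(F has_vector_derivative f t) (at t within {x..y})" by (simp add: has_real_derivative_iff_has_vector_derivative)
 qed (use xy in simp)
qed

lemma has_integral_exp_bound:
 fixes f :: "real => real"
 assumes f: "(f has_integral I) {x..y}" and b: "!!t. t : {x..y} ==> abs (f t) <= M * exp (c * t)" and "x <= y" "c ~= 0"
 shows "abs I <= M / c * (exp (c * y) - exp (c * x))"
proof -
 have "((%t. M * exp (c * t)) has_integral (M / c * exp (c * y) - M / c * exp (c * x))) {x..y}" proof (rule fundamental_theorem_of_calculus)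
  fix t show "((%t. M / c * exp (c * t)) has_vector_derivative M * exp (c * t)) (at t within {x..y})" unfolding has_real_derivative_iff_has_vector_derivative[symmetric]
   by (auto intro!: derivative_eq_intros simp: \<open>c ~= 0\<close>)
 qed fact
 note g = this
 have "norm (integral {x..y} f) <= integral {x..y} (%t. M * exp (c * t))" by (rule integral_norm_bound_integral) (use f g b in \<open>auto simp: integrable_on_def\<close>)
 also have "... = M / c * exp (c * y) - M / c * exp (c * x)" using g by (rule integral_unique)
 finally show ?thesis using integral_unique[OF f] by (simp add: right_diff_distrib)
qed

text \<open>Integration from 0 gains a factor 1/L in the sup norm weighted by exp (- L |x|), on
  either side of 0.\<close>

lemma primitive_exp_bound:
 assumes F: "primitive_on (-h) h f F" "F 0 = 0" and b: "!!t. abs t <= h ==> abs (f t) <= M * exp (L * abs t)"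
  and "M >= 0" "L > 0" "abs x <= h"
 shows "abs (F x) <= M / L * exp (L * abs x)"
proof (cases "x >= 0")
 case True
 have "(f has_integral (F x - F 0)) {0..x}" using assms True by (intro primitive_onD[OF F(1)]) auto
 then have "abs (F x - F 0) <= M / L * (exp (L * x) - exp (L * 0))" by (rule has_integral_exp_bound) (use assms True b in \<open>auto\<close>, smt (verit))
 moreover have "0 <= M / L" using assms by simp
 ultimately show ?thesis using True F(2) by (simp add: right_diff_distrib)
next
 case False
 have "(f has_integral (F 0 - F x)) {x..0}" using assms False by (intro primitive_onD[OF F(1)]) auto
 then have "abs (F 0 - F x) <= M / (- L) * (exp ((- L) * 0) - exp ((- L) * x))" proof (rule has_integral_exp_bound)
  fix t assume "t : {x..0}"
  then show "abs (f t) <= M * exp (- L * t)" using b[of t] assms False by auto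
 qed (use assms False in auto)
 moreover have "0 <= M / L" using assms by simp
 ultimately show ?thesis using False F(2) by (simp add: right_diff_distrib)
qed

section \<open>Second order linear equations with a bounded measurable coefficient\<close>

definition linear_ode :: "real => (real => real) => (real => real) => (real => real) => bool" where
 "linear_ode h Q v v1 \<longleftrightarrow> (ALL x:{-h..h}. (v has_real_derivative v1 x) (at x within {-h..h})) &
   primitive_on (-h) h (%t. Q t * v t) v1"

lemma linear_ode_continuous: "linear_ode h Q v v1 ==> continuous_on {-h..h} v" unfolding linear_ode_def by (meson DERIV_continuous_on)

text \<open>Two integrations gain K / L^2, which is at most 1/2: in the weighted norm the integral
  operator is a contraction on the whole interval, so solutions need not be continued step by
  step.\<close>

lemma volterra_bound:
 assumes K: "!!t. abs t <= h ==> abs (Q t) <= K" and L: "L > 0" "2 * K <= L^2"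
  and v1: "primitive_on (-h) h (%t. Q t * y t) v1" "v1 0 = 0" and v: "primitive_on (-h) h v1 v" "v 0 = 0"
  and y: "!!t. abs t <= h ==> abs (y t) <= M * exp (L * abs t)" and "M >= 0" "abs x <= h"
 shows "abs (v x) <= M / 2 * exp (L * abs x)"
proof -
 have K0: "K >= 0" using K[OF \<open>\<bar>x\<bar> <= h\<close>] by linarith
 have 1: "abs (v1 t) <= K * M / L * exp (L * abs t)" if "abs t <= h" for t proof (rule primitive_exp_bound[OF v1 _ _ L(1) that])
  fix t assume "abs t <= h"
  then have "abs (Q t) * abs (y t) <= K * (M * exp (L * abs t))" using K y K0 by (intro mult_mono) auto
  then show "abs (Q t * y t) <= K * M * exp (L * abs t)" by (simp add: abs_mult mult.assoc)
 qed (use K0 \<open>M >= 0\<close> in auto)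
 have "abs (v x) <= K * M / L / L * exp (L * abs x)" by (rule primitive_exp_bound[OF v 1 _ L(1) \<open>\<bar>x\<bar> <= h\<close>]) (use K0 \<open>M >= 0\<close> L in auto)
 also have "... <= M / 2 * exp (L * abs x)" proof (rule mult_right_mono)
  have "2 * K * M <= L^2 * M" using L \<open>M >= 0\<close> by (intro mult_right_mono) auto
  then show "K * M / L / L <= M / 2" using L(1) by (simp add: power2_eq_square field_simps)
 qed simp
 finally show ?thesis .
qed

text \<open>At a maximum point of the weighted difference, the contraction bounds the value there by
  half of itself. The choice L = sqrt (2 K + 1) keeps L positive even for K = 0.\<close>

lemma linear_ode_unique:
 assumes h: "h > 0" and K: "!!t. abs t <= h ==> abs (Q t) <= K"
  and v: "linear_ode h Q v v1" and w: "linear_ode h Q w w1" and "v 0 = w 0" "v1 0 = w1 0" and "abs x <= h"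
 shows "v x = w x" "v1 x = w1 x"
proof -
 define L where "L = sqrt (2 * K + 1)"
 have K0: "K >= 0" using K[of 0] h by linarith
 have L: "L > 0" "2 * K <= L^2" using K0 by (auto simp: L_def)
 define z z1 where "z t = v t - w t" and "z1 t = v1 t - w1 t" for t
 have p1: "primitive_on (-h) h (%t. Q t * z t) z1" unfolding primitive_on_def proof (intro allI impI)
  fix x y assume xy: "-h <= x & x <= y & y <= h"
  have "((%t. Q t * v t - Q t * w t) has_integral ((v1 y - v1 x) - (w1 y - w1 x))) {x..y}"
   by (rule has_integral_diff) (use v w xy in \<open>auto simp: linear_ode_def intro: primitive_onD\<close>)
  then show "((%t. Q t * z t) has_integral (z1 y - z1 x)) {x..y}" by (simp add: z_def z1_def algebra_simps)
 qed
 have p: "primitive_on (-h) h z1 z" proof (rule primitive_on_deriv)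
  fix x assume "x : {-h..h}"
  then show "(z has_real_derivative z1 x) (at x within {-h..h})" unfolding z_def[abs_def] z1_def using v w by (intro DERIV_diff) (auto simp: linear_ode_def)
 qed
 have "continuous_on {-h..h} (%t. abs (z t) * exp (- (L * abs t)))" unfolding z_def by (intro continuous_intros linear_ode_continuous[OF v] linear_ode_continuous[OF w])
 then obtain m where m: "m : {-h..h}" "!!t. t : {-h..h} ==> abs (z t) * exp (- (L * abs t)) <= abs (z m) * exp (- (L * abs m))"
  using continuous_attains_sup[of "{-h..h}" "%t. abs (z t) * exp (- (L * abs t))"] h by auto
 define M where "M = abs (z m) * exp (- (L * abs m))"
 have zb: "abs (z t) <= M * exp (L * abs t)" if "abs t <= h" for t proof -
  have t: "t : {-h..h}" using that by (auto simp: abs_le_iff)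
  have "abs (z t) * exp (- (L * abs t)) * exp (L * abs t) <= M * exp (L * abs t)" using m(2)[OF t] unfolding M_def by (rule mult_right_mono) simp
  then show ?thesis by (simp add: mult.assoc flip: exp_add)
 qed
 have "abs (z m) <= M / 2 * exp (L * abs m)" by (rule volterra_bound[OF K L p1 _ p _ zb]) (use m assms in \<open>auto simp: z_def z1_def M_def\<close>)
 also have "M / 2 * exp (L * abs m) = abs (z m) / 2" by (simp add: M_def flip: exp_add)
 finally have "z m = 0" by simp
 then have M0: "M = 0" by (simp add: M_def)
 then have z0: "z t = 0" if "abs t <= h" for t using zb[OF that] by simp
 then show "v x = w x" using \<open>\<bar>x\<bar> <= h\<close> by (simp add: z_def)
 have "abs (z1 x) <= 0 / L * exp (L * abs x)" by (rule primitive_exp_bound[OF p1 _ _ _ L(1) \<open>\<bar>x\<bar> <= h\<close>]) (use z0 assms in \<open>auto simp: z1_def\<close>)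
 then show "v1 x = w1 x" by (simp add: z1_def)
qed

lemma measurable_bounded_mult_integrable:
 fixes Q v :: "real => real"
 assumes Q: "Q : borel_measurable (lebesgue_on {a..b})" "!!t. t : {a..b} ==> abs (Q t) <= K" and v: "continuous_on {a..b} v"
 shows "(%t. Q t * v t) absolutely_integrable_on {a..b}"
proof -
 have "bounded (v ` {a..b})" using v compact_continuous_image compact_imp_bounded by blast
 then obtain B where B: "!!t. t : {a..b} ==> abs (v t) <= B" unfolding bounded_iff by force
 show ?thesis proof (rule measurable_bounded_by_integrable_imp_absolutely_integrable)
  have "v : borel_measurable (lebesgue_on {a..b})" using v by (rule continuous_imp_measurable_on_sets_lebesgue) simp
  then show "(%t. Q t * v t) : borel_measurable (lebesgue_on {a..b})" using Q(1) by measurable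
  show "(%_. K * B) integrable_on {a..b}" by (rule integrable_const_ivl)
  fix t assume t: "t : {a..b}"
  show "norm (Q t * v t) <= K * B" unfolding real_norm_def abs_mult using Q(2)[OF t] B[OF t] by (intro mult_mono) auto
 qed simp
qed

text \<open>Banach's fixed point theorem in the complete space of bounded continuous functions on
  the line. The additive constants in \<open>T1\<close> and \<open>T\<close> encode the initial
  values at 0, although the integrals start at -h.\<close>

lemma linear_ode_exists:
 assumes h: "h > 0" and Q: "Q : borel_measurable (lebesgue_on {-h..h})" and K: "!!t. abs t <= h ==> abs (Q t) <= K"
 shows "EX v v1. linear_ode h Q v v1 & v 0 = a & v1 0 = b"
proof -
 define L where "L = sqrt (2 * K + 1)"
 have K0: "K >= 0" using K[of 0] h by linarith
 have L: "L > 0" "2 * K <= L^2" using K0 by (auto simp: L_def)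
 \<comment> \<open>The unknown is the solution multiplied by exp (- L |t|), so that the plain sup
   norm plays the role of the weighted one; \<open>W\<close> undoes this.\<close>
 define W where "W y t = exp (L * abs t) * y t" for y :: "real => real" and t
 define T1 where "T1 y x = integral {-h..x} (%t. Q t * W y t) + (b - integral {-h..0} (%t. Q t * W y t))" for y x
 define T where "T y x = integral {-h..x} (T1 y) + (a - integral {-h..0} (T1 y))" for y x
 have iQ: "(%t. Q t * W y t) integrable_on {-h..h}" if "continuous_on UNIV y" for y proof -
  have "continuous_on {-h..h} (W y)" unfolding W_def by (intro continuous_intros continuous_on_subset[OF that]) auto
  moreover have "abs (Q t) <= K" if "t : {-h..h}" for t using that by (intro K) (auto simp: abs_le_iff)
  ultimately have "(%t. Q t * W y t) absolutely_integrable_on {-h..h}" by (intro measurable_bounded_mult_integrable[OF Q]) auto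
  then show ?thesis by (simp add: absolutely_integrable_on_def)
 qed
 have p1: "primitive_on (-h) h (%t. Q t * W y t) (T1 y)" if "continuous_on UNIV y" for y unfolding T1_def by (rule primitive_on_integral[OF iQ[OF that]])
 have c1: "continuous_on {-h..h} (T1 y)" if "continuous_on UNIV y" for y unfolding T1_def by (intro continuous_intros indefinite_integral_continuous_1 iQ that)
 have p: "primitive_on (-h) h (T1 y) (T y)" if "continuous_on UNIV y" for y unfolding T_def by (rule primitive_on_integral) (rule integrable_continuous_real[OF c1[OF that]])
 have dT: "(T y has_real_derivative T1 y x) (at x within {-h..h})" if "continuous_on UNIV y" "x : {-h..h}" for y x proof -
  have "((%x. integral {-h..x} (T1 y)) has_real_derivative T1 y x) (at x within {-h..h})" by (rule integral_has_real_derivative[OF c1[OF that(1)] that(2)])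
  then show ?thesis unfolding T_def[abs_def] using DERIV_add[OF _ DERIV_const] by force
 qed
 have cT: "continuous_on {-h..h} (T y)" if "continuous_on UNIV y" for y using dT[OF that] by (meson DERIV_continuous_on)
 \<comment> \<open>Clamping to the interval extends the iterates to bounded continuous functions on
   the whole line.\<close>
 define cl where "cl x = max (-h) (min h x)" for x :: real
 have cl: "abs (cl x) <= h" "cl x : {-h..h}" for x using h by (auto simp: cl_def)
 define S where "S y x = exp (- (L * abs (cl x))) * T y (cl x)" for y x
 have Sb: "S y : bcontfun" if y: "continuous_on UNIV y" for y proof -
  have "bounded (T y ` {-h..h})" using cT[OF y] compact_continuous_image compact_imp_bounded by blast
  then obtain B where B: "!!t. t : {-h..h} ==> abs (T y t) <= B" unfolding bounded_iff by force
  show ?thesis proof (rule bcontfun_normI)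
   have ccl: "continuous_on UNIV cl" unfolding cl_def[abs_def] by (intro continuous_intros)
   have "continuous_on UNIV (%x. T y (cl x))" by (rule continuous_on_compose2[OF cT[OF y] ccl]) (use cl in blast)
   then show "continuous_on UNIV (S y)" unfolding S_def by (intro continuous_intros ccl)
   show "norm (S y x) <= 1 * B" for x unfolding S_def real_norm_def abs_mult using B[OF cl(2)] L by (intro mult_mono) auto
  qed
 qed
 define Ph where "Ph Y = Bcontfun (S (apply_bcontfun Y))" for Y :: "real \<Rightarrow>\<^sub>C real"
 have ap: "apply_bcontfun (Ph Y) = S (apply_bcontfun Y)" for Y unfolding Ph_def by (rule Bcontfun_inverse[OF Sb]) simp
 have "\<exists>!Y. Ph Y = Y" proof (rule banach_fix_type[of "1/2"])
  show "ALL X Y. dist (Ph X) (Ph Y) <= 1/2 * dist X Y" proof (intro allI dist_bound)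
   fix X Y :: "real \<Rightarrow>\<^sub>C real" and x
   let ?X = "apply_bcontfun X" and ?Y = "apply_bcontfun Y"
   have cX: "continuous_on UNIV ?X" "continuous_on UNIV ?Y" by auto
   define z1 where "z1 t = T1 ?X t - T1 ?Y t" for t
   define z where "z t = T ?X t - T ?Y t" for t
   have q1: "primitive_on (-h) h (%t. Q t * (W ?X t - W ?Y t)) z1" unfolding primitive_on_def proof (intro allI impI)
    fix x y assume xy: "-h <= x & x <= y & y <= h"
    have "((%t. Q t * W ?X t - Q t * W ?Y t) has_integral ((T1 ?X y - T1 ?X x) - (T1 ?Y y - T1 ?Y x))) {x..y}" by (rule has_integral_diff; rule primitive_onD[OF p1]) (use xy in auto)
    then show "((%t. Q t * (W ?X t - W ?Y t)) has_integral (z1 y - z1 x)) {x..y}" by (simp add: z1_def algebra_simps)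
   qed
   have q: "primitive_on (-h) h z1 z" unfolding primitive_on_def proof (intro allI impI)
    fix x y assume xy: "-h <= x & x <= y & y <= h"
    have "((%t. T1 ?X t - T1 ?Y t) has_integral ((T ?X y - T ?X x) - (T ?Y y - T ?Y x))) {x..y}" by (rule has_integral_diff; rule primitive_onD[OF p]) (use xy in auto)
    then show "(z1 has_integral (z y - z x)) {x..y}" by (simp add: z1_def[abs_def] z_def algebra_simps)
   qed
   have b: "abs (W ?X t - W ?Y t) <= dist X Y * exp (L * abs t)" for t proof -
    have "abs (W ?X t - W ?Y t) = exp (L * abs t) * dist (?X t) (?Y t)" by (simp add: W_def dist_real_def abs_mult flip: right_diff_distrib)
    also have "... <= exp (L * abs t) * dist X Y" by (intro mult_left_mono dist_bounded) simp
    finally show ?thesis by (simp add: mult.commute)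
   qed
   have "abs (z (cl x)) <= dist X Y / 2 * exp (L * abs (cl x))" by (rule volterra_bound[OF K L q1 _ q _ b _ cl(1)]) (auto simp: z1_def z_def T1_def T_def)
   then have "exp (- (L * abs (cl x))) * abs (z (cl x)) <= exp (- (L * abs (cl x))) * (dist X Y / 2 * exp (L * abs (cl x)))" by (rule mult_left_mono) simp
   also have "... = (exp (- (L * abs (cl x))) * exp (L * abs (cl x))) * (dist X Y / 2)" by (simp only: mult_ac)
   also have "... = 1/2 * dist X Y" by (simp flip: exp_add)
   finally show "dist (apply_bcontfun (Ph X) x) (apply_bcontfun (Ph Y) x) <= 1/2 * dist X Y" by (simp add: ap S_def z_def dist_real_def abs_mult flip: right_diff_distrib)
  qed
 qed auto
 then obtain Y where Y: "Ph Y = Y" by blast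
 define y where "y = apply_bcontfun Y"
 have cy: "continuous_on UNIV y" by (simp add: y_def)
 have Sy: "S y = y" using ap[of Y] Y by (simp add: y_def)
 have yT: "T y t = W y t" if "t : {-h..h}" for t proof -
  have "cl t = t" using that by (auto simp: cl_def)
  then have "y t = exp (- (L * abs t)) * T y t" using fun_cong[OF Sy, of t] by (simp add: S_def)
  then have "W y t = (exp (L * abs t) * exp (- (L * abs t))) * T y t" by (simp add: W_def)
  then show ?thesis by (simp flip: exp_add)
 qed
 have "linear_ode h Q (T y) (T1 y)" unfolding linear_ode_def proof (intro conjI ballI dT cy)
  show "primitive_on (-h) h (%t. Q t * T y t) (T1 y)" unfolding primitive_on_def proof (intro allI impI)
   fix x z assume xz: "-h <= x & x <= z & z <= h"
   have "((%t. Q t * W y t) has_integral (T1 y z - T1 y x)) {x..z}" by (rule primitive_onD[OF p1[OF cy]]) (use xz in auto)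
   then show "((%t. Q t * T y t) has_integral (T1 y z - T1 y x)) {x..z}" by (rule has_integral_eq[rotated]) (use yT xz in auto)
  qed
 qed
 moreover have "T y 0 = a" "T1 y 0 = b" by (simp_all add: T_def T1_def)
 ultimately show ?thesis by blast
qed

text \<open>With \<open>sg\<close> equal to 1 or -1 and matching initial values, uniqueness turns
  this into evenness or oddness of the solution.\<close>

lemma linear_ode_reflect:
 assumes v: "linear_ode h Q v v1" and even: "!!t. abs t <= h ==> Q (- t) = Q t"
 shows "linear_ode h Q (%x. sg * v (- x)) (%x. - (sg * v1 (- x)))" unfolding linear_ode_def
proof (intro conjI ballI)
 fix x assume x: "x : {-h..h}"
 have "(v has_real_derivative v1 (- x)) (at (- x) within uminus ` {-h..h})" using v x by (auto simp: linear_ode_def)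
 moreover have "(uminus has_real_derivative - 1) (at x within {-h..h})" by (auto intro!: derivative_eq_intros)
 ultimately have "(v \<circ> uminus has_real_derivative v1 (- x) * - 1) (at x within {-h..h})" by (rule DERIV_image_chain)
 from DERIV_cmult[OF this, of sg] show "((%x. sg * v (- x)) has_real_derivative - (sg * v1 (- x))) (at x within {-h..h})" by (simp add: comp_def)
next
 show "primitive_on (-h) h (%t. Q t * (sg * v (- t))) (%x. - (sg * v1 (- x)))" unfolding primitive_on_def proof (intro allI impI)
  fix x y assume xy: "-h <= x & x <= y & y <= h"
  have "((%t. Q t * v t) has_integral (v1 (- x) - v1 (- y))) {-y..-x}" using v xy by (auto simp: linear_ode_def intro!: primitive_onD)
  then have "((%t. Q (- t) * v (- t)) has_integral (v1 (- x) - v1 (- y))) {- (- x)..- (- y)}" by (subst has_integral_reflect_real)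
  then have "((%t. sg * (Q (- t) * v (- t))) has_integral (sg * (v1 (- x) - v1 (- y)))) {x..y}" by (intro has_integral_mult_right) simp
  then have "((%t. Q t * (sg * v (- t))) has_integral (sg * (v1 (- x) - v1 (- y)))) {x..y}" by (rule has_integral_eq[rotated]) (use even xy in \<open>auto simp: mult_ac abs_le_iff\<close>)
  then show "((%t. Q t * (sg * v (- t))) has_integral (- (sg * v1 (- y)) - - (sg * v1 (- x)))) {x..y}" by (simp add: algebra_simps)
 qed
qed

lemma primitive_on_combine:
 assumes "primitive_on a b f F" "primitive_on b c f F"
 shows "primitive_on a c f F" unfolding primitive_on_def
proof (intro allI impI)
 fix x y assume xy: "a <= x & x <= y & y <= c"
 consider "y <= b" | "b <= x" | "x <= b" "b <= y" by linarith
 then show "(f has_integral F y - F x) {x..y}" proof cases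
  case 3
  have "(f has_integral ((F b - F x) + (F y - F b))) {x..y}" by (rule has_integral_combine[of x b y]) (use 3 xy assms in \<open>auto intro: primitive_onD\<close>)
  then show ?thesis by simp
 qed (use xy assms in \<open>auto intro: primitive_onD\<close>)
qed

text \<open>The function \<open>E x = F x al x - \<integral>\<^sub>a\<^sup>x (f al + F al')\<close> satisfies \<open>\<bar>E y - E x\<bar> \<le> C (y - x)\<^sup>2\<close> and is
  therefore constant; this avoids differentiating \<open>F\<close>.\<close>

lemma primitive_integration_by_parts:
 fixes f F al al1 :: "real => real"
 assumes F: "primitive_on a b f F" and f: "f : borel_measurable (lebesgue_on {a..b})" "!!t. t : {a..b} ==> abs (f t) <= M"
  and al: "!!x. (al has_real_derivative al1 x) (at x)" "continuous_on UNIV al1" and "a <= b"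
 shows "((%t. f t * al t + F t * al1 t) has_integral (F b * al b - F a * al a)) {a..b}"
proof -
 have cal: "continuous_on S al" for S by (meson DERIV_continuous_on al(1) has_field_derivative_at_within)
 have cal1: "continuous_on S al1" for S using al(2) by (rule continuous_on_subset) simp
 have M0: "M >= 0" using f(2)[of a] \<open>a <= b\<close> by (auto intro: order_trans[OF abs_ge_zero])
 have "bounded (al1 ` {a..b})" using cal1 compact_continuous_image compact_imp_bounded by blast
 then obtain B where B: "!!t. t : {a..b} ==> abs (al1 t) <= B" unfolding bounded_iff by force
 have B0: "B >= 0" using B[of a] \<open>a <= b\<close> by (auto intro: order_trans[OF abs_ge_zero])
 have lipal: "abs (al y - al x) <= B * (y - x)" if "a <= x" "x <= y" "y <= b" for x y proof (cases "x = y")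
  case False
  have "EX t>x. t < y & al y - al x = (y - x) * al1 t" by (rule MVT2) (use False that al(1) in auto)
  then obtain t where t: "x < t" "t < y" "al y - al x = (y - x) * al1 t" by blast
  have "abs (al1 t) * (y - x) <= B * (y - x)" using B[of t] t that by (intro mult_right_mono) auto
  then show ?thesis using t by (simp add: abs_mult mult.commute)
 qed simp
 have lipF: "abs (F y - F x) <= M * (y - x)" if "a <= x" "x <= y" "y <= b" for x y proof -
  have i: "(f has_integral (F y - F x)) {x..y}" by (rule primitive_onD[OF F that])
  have "norm (integral {x..y} f) <= integral {x..y} (%t. M)" by (rule integral_norm_bound_integral) (use i f(2) that in \<open>auto simp: integrable_on_def\<close>)
  then show ?thesis using integral_unique[OF i] that by (simp add: mult.commute)
 qed
 have cF: "continuous_on {a..b} F" proof (rule lipschitz_on_continuous_on[of M], rule lipschitz_onI[OF _ M0])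
  fix x y assume "x : {a..b}" "y : {a..b}"
  then show "dist (F x) (F y) <= M * dist x y" using lipF[of x y] lipF[of y x] by (cases "x <= y") (auto simp: dist_real_def abs_minus_commute)
 qed
 define g where "g t = f t * al t + F t * al1 t" for t
 have i1: "(%t. f t * al t) integrable_on {a..b}" using measurable_bounded_mult_integrable[OF f cal] by (auto simp: absolutely_integrable_on_def)
 have i2: "(%t. F t * al1 t) integrable_on {a..b}" by (intro integrable_continuous_real continuous_intros cF cal1)
 have ig: "g integrable_on {a..b}" unfolding g_def by (intro integrable_add i1 i2)
 define E where "E x = F x * al x - integral {a..x} g" for x
 have est: "abs (E y - E x) <= (3 * M * B) * (y - x)^2" if xy: "a <= x" "x <= y" "y <= b" for x y proof -
  have sub: "{x..y} \<subseteq> {a..b}" using xy by auto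
  have j1: "(%t. f t * al t) integrable_on {x..y}" and j2: "(%t. F t * al1 t) integrable_on {x..y}" using i1 i2 sub by (auto intro: integrable_on_subinterval)
  have cb: "integral {a..x} g + integral {x..y} g = integral {a..y} g"
   by (rule Henstock_Kurzweil_Integration.integral_combine) (use xy ig in \<open>auto intro: integrable_on_subinterval\<close>)
  have sp: "integral {x..y} g = integral {x..y} (%t. f t * al t) + integral {x..y} (%t. F t * al1 t)" unfolding g_def by (rule Henstock_Kurzweil_Integration.integral_add[OF j1 j2])
  have k1: "((%t. f t * al x) has_integral ((F y - F x) * al x)) {x..y}" by (rule has_integral_mult_left) (rule primitive_onD[OF F xy])
  have k2: "((%t. F x * al1 t) has_integral (F x * (al y - al x))) {x..y}" by (rule has_integral_mult_right, rule fundamental_theorem_of_calculus)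
    (use xy al(1) in \<open>auto simp: has_real_derivative_iff_has_vector_derivative[symmetric] intro: has_field_derivative_at_within\<close>)
  have k1i: "(%t. f t * al x) integrable_on {x..y}" using k1 by (rule has_integral_integrable)
  have k2i: "(%t. F x * al1 t) integrable_on {x..y}" using k2 by (rule has_integral_integrable)
  have b1: "abs (integral {x..y} (%t. f t * al t) - (F y - F x) * al x) <= M * B * (y - x)^2" proof -
   have "integral {x..y} (%t. f t * al t) - (F y - F x) * al x = integral {x..y} (%t. f t * al t - f t * al x)"
    unfolding Henstock_Kurzweil_Integration.integral_diff[OF j1 k1i] integral_unique[OF k1] ..
   also have "norm ... <= integral {x..y} (%t. M * (B * (y - x)))" proof (rule integral_norm_bound_integral)
    show "(%t. f t * al t - f t * al x) integrable_on {x..y}" by (rule Henstock_Kurzweil_Integration.integrable_diff[OF j1 k1i])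
    fix t assume t: "t : {x..y}"
    have "abs (al t - al x) <= B * (t - x)" using lipal[of x t] t xy by auto
    also have "... <= B * (y - x)" using t B0 by (intro mult_left_mono) auto
    finally have "abs (f t) * abs (al t - al x) <= M * (B * (y - x))" using f(2)[of t] t xy M0 by (intro mult_mono) auto
    then show "norm (f t * al t - f t * al x) <= M * (B * (y - x))" by (simp add: abs_mult flip: right_diff_distrib)
   qed auto
   also have "... = M * B * (y - x)^2" using xy by (simp add: power2_eq_square)
   finally show ?thesis by simp
  qed
  have b2: "abs (integral {x..y} (%t. F t * al1 t) - F x * (al y - al x)) <= M * B * (y - x)^2" proof -
   have "integral {x..y} (%t. F t * al1 t) - F x * (al y - al x) = integral {x..y} (%t. F t * al1 t - F x * al1 t)"
    unfolding Henstock_Kurzweil_Integration.integral_diff[OF j2 k2i] integral_unique[OF k2] ..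
   also have "norm ... <= integral {x..y} (%t. (M * (y - x)) * B)" proof (rule integral_norm_bound_integral)
    show "(%t. F t * al1 t - F x * al1 t) integrable_on {x..y}" by (rule Henstock_Kurzweil_Integration.integrable_diff[OF j2 k2i])
    fix t assume t: "t : {x..y}"
    have "abs (F t - F x) <= M * (t - x)" using lipF[of x t] t xy by auto
    also have "... <= M * (y - x)" using t M0 by (intro mult_left_mono) auto
    finally have "abs (F t - F x) * abs (al1 t) <= (M * (y - x)) * B" using B[of t] t xy M0 by (intro mult_mono) auto
    then show "norm (F t * al1 t - F x * al1 t) <= (M * (y - x)) * B" by (simp add: abs_mult flip: left_diff_distrib)
   qed auto
   also have "... = M * B * (y - x)^2" using xy by (simp add: power2_eq_square)
   finally show ?thesis by simp
  qed
  moreover have "abs ((F y - F x) * (al y - al x)) <= M * B * (y - x)^2" proof -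
   have "abs (F y - F x) * abs (al y - al x) <= (M * (y - x)) * (B * (y - x))" using lipF[OF xy] lipal[OF xy] M0 xy by (intro mult_mono) auto
   then show ?thesis by (simp add: abs_mult power2_eq_square mult_ac)
  qed
  moreover have "F y * al y - F x * al x = (F y - F x) * al x + F x * (al y - al x) + (F y - F x) * (al y - al x)" by (simp add: algebra_simps)
  ultimately show ?thesis using cb sp b1 b2 unfolding E_def by linarith
 qed
 have est2: "abs (E y - E x) <= (3 * M * B) * (y - x)^2" if "x : {a..b}" "y : {a..b}" for x y
  using est[of x y] est[of y x] that by (cases "x <= y") (auto simp: abs_minus_commute power2_commute)
 have "EX k. ALL x:{a..b}. E x = k" proof (rule has_field_derivative_zero_constant)
  fix x assume x: "x : {a..b}"
  show "(E has_real_derivative 0) (at x within {a..b})" unfolding has_field_derivative_iff proof (rule Lim_null_comparison)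
   show "eventually (%y. norm ((E y - E x) / (y - x)) <= (3 * M * B) * abs (y - x)) (at x within {a..b})" unfolding eventually_at_filter proof (intro always_eventually allI impI)
    fix y assume "y ~= x" "y : {a..b}"
    then have "abs (E y - E x) <= ((3 * M * B) * abs (y - x)) * abs (y - x)" using est2[OF x, of y] by (simp add: power2_eq_square abs_mult_self_eq mult.assoc)
    then show "norm ((E y - E x) / (y - x)) <= (3 * M * B) * abs (y - x)" using \<open>y ~= x\<close> by (simp add: divide_le_eq)
   qed
   have "((%y. (3 * M * B) * abs (y - x)) \<longlongrightarrow> (3 * M * B) * abs (x - x)) (at x within {a..b})" by (intro tendsto_intros)
   then show "((%y. (3 * M * B) * abs (y - x)) \<longlongrightarrow> 0) (at x within {a..b})" by simp
  qed
 qed simp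
 then have "E b = E a" using \<open>a <= b\<close> by auto
 then have "integral {a..b} g = F b * al b - F a * al a" by (simp add: E_def)
 then show ?thesis using integrable_integral[OF ig] by (simp add: g_def[abs_def])
qed

lemma primitive_on_continuous:
 assumes F: "primitive_on a b f F"
 shows "continuous_on {a..b} F"
proof (cases "a <= b")
 case True
 have i: "f integrable_on {a..b}" using primitive_onD[OF F order_refl True order_refl] by blast
 have "continuous_on {a..b} (%x. F a + integral {a..x} f)" by (intro continuous_intros indefinite_integral_continuous_1[OF i])
 moreover have "F a + integral {a..x} f = F x" if "x : {a..b}" for x using integral_unique[OF primitive_onD[OF F order_refl, of x]] that by simp
 ultimately show ?thesis using continuous_on_eq by blast
qed simp

text \<open>The finite exceptional set absorbs the interface points, where the integrand takes the
  value belonging to the core.\<close>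

lemma primitive_on_cong:
 assumes "primitive_on a b f F" "finite S" "!!x. x : {a..b} - S ==> g x = f x" "!!x. x : {a..b} ==> G x = F x"
 shows "primitive_on a b g G" unfolding primitive_on_def
proof (intro allI impI)
 fix x y assume xy: "a <= x & x <= y & y <= b"
 have "(f has_integral (F y - F x)) {x..y}" by (rule primitive_onD[OF assms(1)]) (use xy in auto)
 then have "(g has_integral (F y - F x)) {x..y}" by (rule has_integral_spike_finite[OF assms(2), rotated]) (use assms(3) xy in auto)
 then show "(g has_integral (G y - G x)) {x..y}" using assms(4)[of x] assms(4)[of y] xy by simp
qed

lemma AE_negligible:
 assumes "AE x in lebesgue. P x" shows "negligible {x. ~ P (x::'a::euclidean_space)}"
proof -
 obtain N where "N : null_sets lebesgue" "{x : space lebesgue. ~ P x} \<subseteq> N" using assms unfolding eventually_ae_filter by blast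
 then show ?thesis by (auto simp: negligible_iff_null_sets intro: null_sets_completion_subset[of _ N])
qed

text \<open>Two integrations by parts turn the Caratheodory equation into its very weak form.\<close>

lemma caratheodory_very_weak:
 fixes w w1 Q :: "real => real"
 assumes w: "!!r. r >= h ==> primitive_on (-r) r w1 w" and w1: "!!r. r >= h ==> primitive_on (-r) r (%t. Q t * w t) w1"
  and Q: "Q : borel_measurable lebesgue" "!!t. abs (Q t) <= K" and al: "C2c al al1 al2"
  and Q0[measurable]: "Q0 : Borel" and Q0b: "!!t. abs (Q0 t) <= K" and AE: "AE t in lborel. Q0 t = Q t"
  and cw: "continuous_on UNIV w"
 shows "(LBINT t. w t * (al2 t - Q0 t * al t)) = 0"
proof -
 obtain r0 where r0: "!!x. r0 < abs x ==> al x = 0" "!!x. r0 < abs x ==> al1 x = 0" "!!x. r0 < abs x ==> al2 x = 0" by (rule C2c_supp[OF al]) blast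
 define r where "r = max h (abs r0) + 1"
 have r: "r >= h" "- r <= r" "r0 < r" by (auto simp: r_def)
 note cal = C2c_cont[OF al]
 have dal: "!!x. (al has_real_derivative al1 x) (at x)" "!!x. (al1 has_real_derivative al2 x) (at x)" using al by (auto simp: C2c_def)
 have z: "al r = 0" "al (- r) = 0" "al1 r = 0" "al1 (- r) = 0" using r0(1,2)[of r] r0(1,2)[of "- r"] r by auto
 have cw1: "continuous_on {-r..r} w1" by (rule primitive_on_continuous[OF w1[OF r(1)]])
 have bdd: "EX B. ALL t:{-r..r}. abs (g t) <= B" if "continuous_on {-r..r} g" for g :: "real => real"
  using compact_imp_bounded[OF compact_continuous_image[OF that]] unfolding bounded_iff by auto
 obtain B1 where B1: "!!t. t : {-r..r} ==> abs (w1 t) <= B1" using bdd[OF cw1] by blast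
 obtain B where B: "!!t. t : {-r..r} ==> abs (w t) <= B" using bdd[OF continuous_on_subset[OF cw]] by blast
 have Ql: "Q : borel_measurable (lebesgue_on {-r..r})" using Q(1) by (rule measurable_restrict_space1)
 have wl: "w : borel_measurable (lebesgue_on {-r..r})" by (rule continuous_imp_measurable_on_sets_lebesgue[OF continuous_on_subset[OF cw]]) auto
 have "((%t. (Q t * w t) * al t + w1 t * al1 t) has_integral (w1 r * al r - w1 (- r) * al (- r))) {-r..r}" proof (rule primitive_integration_by_parts[OF w1[OF r(1)] _ _ dal(1) cal(2) r(2)])
  show "(%t. Q t * w t) : borel_measurable (lebesgue_on {-r..r})" using Ql wl by measurable
  show "abs (Q t * w t) <= K * B" if "t : {-r..r}" for t unfolding abs_mult using Q(2)[of t] B[OF that] by (intro mult_mono) auto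
 qed
 moreover have "((%t. w1 t * al1 t + w t * al2 t) has_integral (w r * al1 r - w (- r) * al1 (- r))) {-r..r}" by (rule primitive_integration_by_parts[OF w[OF r(1)] _ B1 dal(2) cal(3) r(2)])
   (rule continuous_imp_measurable_on_sets_lebesgue[OF cw1], simp)
 ultimately have "((%t. (w1 t * al1 t + w t * al2 t) - ((Q t * w t) * al t + w1 t * al1 t)) has_integral 0 - 0) {-r..r}" using z by (intro has_integral_diff) auto
 then have "((%t. w t * (al2 t - Q t * al t)) has_integral 0 - 0) {-r..r}" proof (rule has_integral_eq[rotated])
  fix t show "(w1 t * al1 t + w t * al2 t) - ((Q t * w t) * al t + w1 t * al1 t) = w t * (al2 t - Q t * al t)" by algebra
 qed
 then have 1: "integral {-r..r} (%t. w t * (al2 t - Q t * al t)) = 0" by (simp add: integral_unique)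
 define g where "g t = w t * (al2 t - Q0 t * al t)" for t
 note [measurable] = borel_measurable_continuous_onI[OF cw] C2c_measurable[OF al]
 obtain Bal where Bal: "Bal >= 0" "!!x. abs (al x) <= Bal" "!!x. abs (al2 x) <= Bal" by (rule C2c_bounded[OF al]) blast
 have K0: "K >= 0" using Q0b[of 0] by linarith
 have gz: "g t = 0" if "r < abs t" for t using r0(1,3)[of t] that r(3) by (simp add: g_def)
 have ig: "integr g" proof (rule integr_compact[of _ "B * (Bal + K * Bal)" r])
  show "g : Borel" unfolding g_def by measurable
  have B0: "B >= 0" using B[of r] r(2) by (auto intro: order_trans[OF abs_ge_zero])
  show "abs (g t) <= B * (Bal + K * Bal)" for t proof (cases "abs t <= r")
   case True
   have "abs (Q0 t * al t) <= K * Bal" unfolding abs_mult by (intro mult_mono Q0b Bal K0) auto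
   then have "abs (al2 t - Q0 t * al t) <= Bal + K * Bal" using Bal(3)[of t] by linarith
   then show ?thesis unfolding g_def abs_mult using B[of t] True B0 by (intro mult_mono) (auto simp: abs_le_iff)
  qed (use gz[of t] B0 Bal(1) K0 in simp)
 qed (use gz in auto)
 have "(LBINT t. g t) = integral UNIV g" by (rule integral_lborel[OF ig, symmetric])
 also have "... = integral UNIV (%t. if t : {-r..r} then g t else 0)" proof (intro arg_cong[where f="integral UNIV"] ext)
  fix t show "g t = (if t : {-r..r} then g t else 0)" using gz[of t] by (cases "r < abs t") (auto simp: abs_le_iff not_less)
 qed
 also have "integral UNIV (%t. if t : {-r..r} then g t else 0) = integral {-r..r} g" by (rule integral_restrict_UNIV)
 also have "... = integral {-r..r} (%t. w t * (al2 t - Q t * al t))" by (rule integral_spike[OF AE_negligible[OF AE_completion[OF AE]]]) (auto simp: g_def)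
 also have "... = 0" by (rule 1)
 finally show ?thesis by (simp add: g_def)
qed

section \<open>The modes of the waveguide as bound states\<close>

context waveguide
begin

lemma n_bounds: obtains N where "!!x. 0 < n x" "!!x. n x <= N"
proof -
 obtain N where *: "ALL y:n_co ` {-h..h}. norm y <= N" using n_co_bounded unfolding bounded_iff by blast
 have N: "abs (n_co x) <= N" if "x : {-h..h}" for x proof -
  have "n_co x : n_co ` {-h..h}" using that by (rule imageI)
  with * have "norm (n_co x) <= N" by blast
  then show ?thesis by simp
 qed
 show ?thesis proof (rule that[of "max N n_cl"])
  fix x
  have "n_co x <= N" if "abs x <= h" using N[of x] that by (auto simp: abs_le_iff)
  then show "0 < n x" "n x <= max N n_cl" using n_co_pos[of x] n_cl_pos by (auto simp: n_def)
 qed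
qed

lemma n_le_n_max: "n x <= n_max"
proof -
 obtain N where "!!x. n x <= N" by (rule n_bounds) blast
 then show ?thesis unfolding n_max_def by (intro cSup_upper bdd_aboveI2) auto
qed

lemma n_measurable: "n : borel_measurable lebesgue"
proof -
 have 1: "(%x. if x : {-h..h} then n_co x else 0) : borel_measurable lebesgue" using n_co_measurable by (subst borel_measurable_if) auto
 have "(%x. n_cl * ind (- {-h..h}) x) : Borel" by measurable
 then have 2: "(%x. n_cl * ind (- {-h..h}) x) : borel_measurable lebesgue" by (intro measurable_completion) simp
 have "n = (%x. (if x : {-h..h} then n_co x else 0) + n_cl * ind (- {-h..h}) x)" by (auto simp: n_def fun_eq_iff indicator_def abs_le_iff)
 then show ?thesis using borel_measurable_add[OF 1 2] by simp
qed

lemma potential_bound: "abs (k^2 * (n x)^2) <= k^2 * n_max^2"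
proof -
 obtain N where "!!x. 0 < n x" by (rule n_bounds) blast
 then have "(n x)^2 <= n_max^2" using n_le_n_max[of x] by (intro power_mono) (auto simp: less_imp_le)
 then show ?thesis by (simp add: abs_mult mult_left_mono)
qed

lemma q_bound: "abs (q x - mu) <= k^2 * n_max^2 + abs mu"
proof -
 have "0 <= k^2 * (n x)^2" by simp
 then show ?thesis using potential_bound[of x] unfolding q_def right_diff_distrib by linarith
qed

lemma q_measurable: "(%x. q x - mu) : borel_measurable lebesgue" unfolding q_def using n_measurable by measurable

lemma q_cladding: "h < abs x ==> q x = d_sq" by (simp add: q_def d_sq_def n_def)

lemma q_even: "q (- x) = q x" using n_co_even[of x] by (simp add: q_def n_def)

lemma cauchy_solution_iff:
 "cauchy_solution mu a b w w1 \<longleftrightarrow> linear_ode h (%t. q t - mu) w w1 & w 0 = a & w1 0 = b" unfolding cauchy_solution_def linear_ode_def primitive_on_def by blast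

lemma cauchy_solution_exists: "EX P. cauchy_solution mu a b (fst P) (snd P)"
proof -
 have m: "(%t. q t - mu) : borel_measurable (lebesgue_on {-h..h})" using q_measurable by (rule measurable_restrict_space1)
 have "EX w w1. linear_ode h (%t. q t - mu) w w1 & w 0 = a & w1 0 = b" by (rule linear_ode_exists[OF h_pos m]) (rule q_bound)
 then obtain w w1 where "cauchy_solution mu a b w w1" unfolding cauchy_solution_iff by blast
 then show ?thesis by (intro exI[of _ "(w, w1)"]) simp
qed

lemma \<phi>_solution:
 "cauchy_solution mu 1 0 (\<phi> Symmetric mu) (\<phi>' Symmetric mu)"
 "cauchy_solution mu 0 (sqrt mu) (\<phi> Antisymmetric mu) (\<phi>' Antisymmetric mu)"
 using someI_ex[OF cauchy_solution_exists[of mu 1 0]] someI_ex[OF cauchy_solution_exists[of mu 0 "sqrt mu"]] by (simp_all add: \<phi>_def[abs_def] \<phi>'_def[abs_def] \<phi>_pair_def)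

lemma \<phi>_ode: "linear_ode h (%t. q t - mu) (\<phi> j mu) (\<phi>' j mu)" using \<phi>_solution[of mu] by (cases j) (simp_all add: cauchy_solution_iff)

text \<open>The dispersion relation is imposed at h alone; parity transfers it to -h, so that the
  mode also matches its left exponential tail.\<close>

lemma \<phi>_parity:
 obtains sg where "\<phi> j mu (- h) = sg * \<phi> j mu h" "\<phi>' j mu (- h) = - (sg * \<phi>' j mu h)"
proof -
 define sg where "sg = (if j = Symmetric then 1 else -1 :: real)"
 have even: "!!t. abs t <= h ==> q (- t) - mu = q t - mu" by (simp add: q_even)
 have r: "linear_ode h (%t. q t - mu) (%x. sg * \<phi> j mu (- x)) (%x. - (sg * \<phi>' j mu (- x)))" by (rule linear_ode_reflect[OF \<phi>_ode even])
 have i: "\<phi> j mu 0 = sg * \<phi> j mu (- 0)" "\<phi>' j mu 0 = - (sg * \<phi>' j mu (- 0))" using \<phi>_solution[of mu] by (cases j; simp add: sg_def cauchy_solution_iff)+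
 have b: "abs (- h) <= h" using h_pos by simp
 note u = linear_ode_unique[OF h_pos q_bound \<phi>_ode r i b]
 show ?thesis by (rule that[of sg]) (use u in simp_all)
qed

lemma \<gamma>_root:
 assumes "l : {1..M}" shows "\<gamma> l : roots (mode_parity l)"
proof -
 let ?L = "sort (sorted_list_of_set (roots Symmetric) @ sorted_list_of_set (roots Antisymmetric))"
 have "length ?L = M" by (simp add: M_def)
 then have "\<gamma> l : set ?L" unfolding \<gamma>_def using assms by (intro nth_mem) auto
 \<comment> \<open>For an infinite set \<open>sorted_list_of_set\<close> is empty, so the inclusion
   holds in both cases; the length agrees with \<open>card\<close> for the same reason.\<close>
 moreover have "set (sorted_list_of_set A) \<subseteq> A" for A :: "real set" by (cases "finite A") auto
 ultimately have "\<gamma> l : roots Symmetric \<union> roots Antisymmetric" by auto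
 then show ?thesis by (auto simp: mode_parity_def)
qed

lemma \<beta>_pos: "l <= M ==> 0 < \<beta> l"
 and \<beta>_square: "l : {1..M} ==> (\<beta> l)^2 = k^2 * n_max^2 - \<gamma> l"
proof -
 have *: "0 < k^2 * n_max^2 - \<gamma> l" if "l : {1..M}" proof -
  have "\<gamma> l < k^2 * n_max^2 - k^2 * n_cl^2" using \<gamma>_root[OF that] by (simp add: roots_def d_sq_def right_diff_distrib)
  moreover have "0 <= k^2 * n_cl^2" by simp
  ultimately show ?thesis by linarith
 qed
 show "l <= M ==> 0 < \<beta> l" using * k_pos n_cl_pos by (auto simp: \<beta>_def)
 show "l : {1..M} ==> (\<beta> l)^2 = k^2 * n_max^2 - \<gamma> l" using * by (auto simp: \<beta>_def)
qed

text \<open>The root condition says that the derivative of the core solution at the interfaces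
  equals that of the exponential tails, so the three pieces glue to one Caratheodory solution on the
  line. \<open>caratheodory_very_weak\<close> then gives the eigenvalue equation with eigenvalue k^2
  n_max^2 - mu, since q - mu equals this number minus the potential. \<open>V0\<close> is a Borel
  version of k^2 n^2.\<close>

lemma mode_bound_state:
 assumes mu: "mu : roots j" and V0: "V0 : Borel" "!!x. abs (V0 x) <= BV"
  and AE: "AE x in lborel. V0 x = k^2 * (n x)^2"
 obtains C where "bound_state V0 (v j mu) BV C (sqrt (d_sq - mu)) (k^2 * n_max^2 - mu)"
proof -
 define ka where "ka = sqrt (d_sq - mu)"
 define w where "w = v j mu"
 define w1 where "w1 x = (if abs x <= h then \<phi>' j mu x else if x > h then - ka * w x else ka * w x)" for x
 have ka: "ka > 0" "ka^2 = d_sq - mu" and root: "\<phi>' j mu h = - ka * \<phi> j mu h" using mu by (auto simp: ka_def roots_def)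
 obtain sg where sg: "\<phi> j mu (- h) = sg * \<phi> j mu h" "\<phi>' j mu (- h) = - (sg * \<phi>' j mu h)" by (rule \<phi>_parity)
 have root': "\<phi>' j mu (- h) = ka * \<phi> j mu (- h)" by (simp add: sg root)
 have win: "w x = \<phi> j mu x" "w1 x = \<phi>' j mu x" if "x : {-h..h}" for x using that by (auto simp: w_def v_def w1_def abs_le_iff)
 \<comment> \<open>At x = h the derivative comes from the core branch of \<open>w1\<close>;
   \<open>root\<close> shows that it agrees with the tail, so both formulas hold from h on,
   including h itself.\<close>
 have wr: "w x = \<phi> j mu h * exp (- ka * (x - h))" "w1 x = - ka * w x" if "h <= x" for x using that h_pos root by (cases "x = h"; simp add: w_def v_def w1_def ka_def[symmetric])+
 have wl: "w x = \<phi> j mu (- h) * exp (ka * (x + h))" "w1 x = ka * w x" if "x <= - h" for x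
  using that h_pos root' by (cases "x = - h"; simp add: w_def v_def w1_def ka_def[symmetric] abs_if)+
 have pr: "primitive_on h r w1 w" "primitive_on h r (%t. (q t - mu) * w t) w1" for r proof -
  let ?f = "%x. \<phi> j mu h * exp (- ka * (x - h))"
  have "primitive_on h r (%x. - ka * ?f x) ?f" by (rule primitive_on_deriv) (auto intro!: derivative_eq_intros)
  then show "primitive_on h r w1 w" by (rule primitive_on_cong[of _ _ _ _ "{}"]) (use wr in auto)
  have "primitive_on h r (%x. ka^2 * ?f x) (%x. - ka * ?f x)" by (rule primitive_on_deriv) (auto intro!: derivative_eq_intros simp: power2_eq_square)
  \<comment> \<open>The point h still carries the core value of \<open>q\<close> and is therefore
    excepted.\<close>
  then show "primitive_on h r (%t. (q t - mu) * w t) w1" by (rule primitive_on_cong[of _ _ _ _ "{h}"]) (use wr h_pos ka(2) in \<open>auto simp: q_cladding\<close>)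
 qed
 have pl: "primitive_on (-r) (-h) w1 w" "primitive_on (-r) (-h) (%t. (q t - mu) * w t) w1" for r proof -
  let ?f = "%x. \<phi> j mu (- h) * exp (ka * (x + h))"
  have "primitive_on (-r) (-h) (%x. ka * ?f x) ?f" by (rule primitive_on_deriv) (auto intro!: derivative_eq_intros)
  then show "primitive_on (-r) (-h) w1 w" by (rule primitive_on_cong[of _ _ _ _ "{}"]) (use wl in auto)
  have "primitive_on (-r) (-h) (%x. ka^2 * ?f x) (%x. ka * ?f x)" by (rule primitive_on_deriv) (auto intro!: derivative_eq_intros simp: power2_eq_square)
  then show "primitive_on (-r) (-h) (%t. (q t - mu) * w t) w1" by (rule primitive_on_cong[of _ _ _ _ "{-h}"]) (use wl h_pos ka(2) in \<open>auto simp: q_cladding\<close>)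
 qed
 have pm: "primitive_on (-h) h w1 w" "primitive_on (-h) h (%t. (q t - mu) * w t) w1" proof -
  have "primitive_on (-h) h (\<phi>' j mu) (\<phi> j mu)" by (rule primitive_on_deriv) (use \<phi>_ode[of mu j] in \<open>simp add: linear_ode_def\<close>)
  then show "primitive_on (-h) h w1 w" by (rule primitive_on_cong[of _ _ _ _ "{}"]) (use win in auto)
  have "primitive_on (-h) h (%t. (q t - mu) * \<phi> j mu t) (\<phi>' j mu)" using \<phi>_ode[of mu j] by (simp add: linear_ode_def)
  then show "primitive_on (-h) h (%t. (q t - mu) * w t) w1" by (rule primitive_on_cong[of _ _ _ _ "{}"]) (use win in auto)
 qed
 have p: "primitive_on (-r) r w1 w" "primitive_on (-r) r (%t. (q t - mu) * w t) w1" for r by (rule primitive_on_combine[OF primitive_on_combine[OF pl(1) pm(1)] pr(1)],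
    rule primitive_on_combine[OF primitive_on_combine[OF pl(2) pm(2)] pr(2)])
 have cw: "continuous_on UNIV w" unfolding continuous_on_eq_continuous_at[OF open_UNIV] proof
  fix x
  have "continuous_on {- (\<bar>x\<bar> + 1)..\<bar>x\<bar> + 1} w" by (rule primitive_on_continuous[OF p(1)])
  moreover have "x : interior {- (\<bar>x\<bar> + 1)..\<bar>x\<bar> + 1}" by (auto simp: interior_atLeastAtMost_real)
  ultimately show "isCont w x" by (rule continuous_on_interior)
 qed
 have "bounded (w ` {-h..h})" by (intro compact_imp_bounded compact_continuous_image continuous_on_subset[OF cw]) auto
 then obtain Bw where *: "ALL y:w ` {-h..h}. norm y <= Bw" unfolding bounded_iff by blast
 have Bw: "abs (w x) <= Bw" if "x : {-h..h}" for x proof -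
  have "w x : w ` {-h..h}" using that by (rule imageI)
  with * have "norm (w x) <= Bw" by blast
  then show ?thesis by simp
 qed
 have Bw0: "Bw >= 0" using Bw[of h] h_pos by (auto intro: order_trans[OF abs_ge_zero])
 have bound: "abs (w x) <= (Bw * exp (ka * h)) * exp (- (ka * abs x))" for x proof -
  consider "x : {-h..h}" | "h < x" | "x < - h" by fastforce
  then show ?thesis proof cases
   case 1
   have "ka * abs x <= ka * h" using 1 ka(1) by (intro mult_left_mono) (auto simp: abs_le_iff)
   then have "1 <= exp (ka * h) * exp (- (ka * abs x))" by (simp flip: exp_add)
   then have "Bw * 1 <= Bw * (exp (ka * h) * exp (- (ka * abs x)))" by (rule mult_left_mono[OF _ Bw0])
   then show ?thesis using Bw[OF 1] by (simp add: mult.assoc)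
  next
   case 2
   have "abs (w x) = abs (w h) * exp (- ka * (x - h))" using wr(1)[of x] wr(1)[of h] 2 by (simp add: abs_mult)
   also have "... <= Bw * exp (- ka * (x - h))" using Bw[of h] h_pos by (intro mult_right_mono) auto
   also have "exp (- ka * (x - h)) = exp (ka * h) * exp (- (ka * abs x))" using 2 h_pos by (simp add: algebra_simps flip: exp_add)
   finally show ?thesis by (simp add: mult.assoc)
  next
   case 3
   have "abs (w x) = abs (w (- h)) * exp (ka * (x + h))" using wl(1)[of x] wl(1)[of "- h"] 3 by (simp add: abs_mult)
   also have "... <= Bw * exp (ka * (x + h))" using Bw[of "- h"] h_pos by (intro mult_right_mono) auto
   also have "exp (ka * (x + h)) = exp (ka * h) * exp (- (ka * abs x))" using 3 h_pos by (simp add: algebra_simps flip: exp_add)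
   finally show ?thesis by (simp add: mult.assoc)
  qed
 qed
 define b2 where "b2 = k^2 * n_max^2 - mu"
 have "bound_state V0 w BV (Bw * exp (ka * h)) ka b2" proof
  fix al al1 al2 assume al: "C2c al al1 al2"
  define K where "K = max (k^2 * n_max^2 + abs mu) (abs b2 + BV)"
  have "(LBINT t. w t * (al2 t - (b2 - V0 t) * al t)) = 0" proof (rule caratheodory_very_weak[OF p(1) p(2) q_measurable _ al _ _ _ cw])
   show "abs (q t - mu) <= K" for t unfolding K_def using q_bound[of t mu] by (rule max.coboundedI1)
   show "(%t. b2 - V0 t) : Borel" using V0(1) by measurable
   show "abs (b2 - V0 t) <= K" for t unfolding K_def using V0(2)[of t] by (intro max.coboundedI2) linarith
   show "AE t in lborel. b2 - V0 t = q t - mu" using AE by eventually_elim (simp add: b2_def q_def right_diff_distrib)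
  qed
  then show "(LBINT x. w x * (al2 x + (V0 x - b2) * al x)) = 0" by (simp add: algebra_simps)
 qed (use V0 cw ka(1) bound in auto)
 then show ?thesis by (rule that[unfolded w_def[symmetric] ka_def[symmetric] b2_def[symmetric]])
qed

lemma bound_state_scale:
 assumes "bound_state V f BV C c b2" shows "bound_state V (%x. f x / s) BV (C / abs s) c b2"
proof -
 interpret bound_state V f BV C c b2 by (rule assms)
 show ?thesis proof
  show "continuous_on UNIV (%x. f x / s)" using e_cont unfolding divide_inverse by (intro continuous_intros)
  show "abs (f x / s) <= C / abs s * exp (- (c * abs x))" for x using divide_right_mono[OF e_bound[of x], of "abs s"] by (simp add: abs_divide)
  show "(LBINT x. f x / s * (al2 x + (V x - b2) * al x)) = 0" if "C2c al al1 al2" for al al1 al2 using e_eq[OF that] by (simp add: times_divide_eq_left)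
 qed (use V_bound c_pos in auto)
qed

lemma guided_mode_bound_state:
 assumes l: "l : {1..M}" and V0: "V0 : Borel" "!!x. abs (V0 x) <= BV"
  and AE: "AE x in lborel. V0 x = k^2 * (n x)^2"
 obtains C c where "bound_state V0 (e l) BV C c ((\<beta> l)^2)"
proof -
 obtain C where "bound_state V0 (v (mode_parity l) (\<gamma> l)) BV C (sqrt (d_sq - \<gamma> l)) (k^2 * n_max^2 - \<gamma> l)" by (rule mode_bound_state[OF \<gamma>_root[OF l] V0 AE])
 from bound_state_scale[OF this] show ?thesis by (intro that) (simp add: \<beta>_square[OF l] e_def[abs_def])
qed

text \<open>A Borel version agrees with the potential only almost everywhere; clamping it makes the
  bound hold at every point, as the lemmas on \<open>V0\<close> require.\<close>

lemma potential_Borel_version: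
 obtains V0 where "V0 : Borel" "!!x. abs (V0 x) <= k^2 * n_max^2" "AE x in lborel. V0 x = k^2 * (n x)^2"
proof -
 let ?B = "k^2 * n_max^2"
 have "(%x. k^2 * (n x)^2) : borel_measurable lebesgue" using n_measurable by measurable
 from completion_ex_borel_measurable_real[OF this] obtain g where
  g: "g : Borel" "AE x in lborel. k^2 * (n x)^2 = g x" by auto
 show ?thesis proof (rule that[of "%x. max (- ?B) (min ?B (g x))"])
  show "(%x. max (- ?B) (min ?B (g x))) : Borel" using g(1) by measurable
  show "abs (max (- ?B) (min ?B (g x))) <= ?B" for x proof -
   have "0 <= ?B" by simp
   then show ?thesis unfolding abs_le_iff by linarith
  qed
  show "AE x in lborel. max (- ?B) (min ?B (g x)) = k^2 * (n x)^2" using g(2) proof eventually_elim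
   case (elim x)
   have "g x <= ?B" "- ?B <= g x" using potential_bound[of x] unfolding elim abs_le_iff by linarith+
   then show ?case unfolding elim by simp
  qed
 qed
qed

end

section \<open>Outgoing solutions are square integrable\<close>

lemma abs_fst_le_norm: "abs (fst h) <= norm h" and abs_snd_le_norm: "abs (snd h) <= norm h" for h :: "plane"
 by (metis norm_fst_le prod.collapse real_norm_def) (metis norm_snd_le prod.collapse real_norm_def)

lemma integral_derivative_compact_support:
 fixes F f :: "real => real"
 assumes F: "!!x. (F has_real_derivative f x) (at x)" and f: "continuous_on UNIV f" and z: "!!x. r < abs x ==> F x = 0"
 shows "(LBINT x. f x) = 0"
proof -
 define s where "s = abs r + 1"
 have fz: "f x = 0" if "r < abs x" for x by (rule DERIV_zero_outside[OF F z that])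
 have "(LBINT x. f x) = (LBINT x. f x * ind {-s..s} x)" proof (rule lint_cong[OF refl])
  fix x show "f x = f x * ind {-s..s} x" using fz[of x] by (cases "r < abs x") (auto simp: s_def indicator_def)
 qed
 also have "... = F s - F (- s)" by (rule integral_FTC_Icc_real) (use F f in \<open>auto simp: s_def continuous_on_eq_continuous_at\<close>)
 also have "... = 0" using z[of s] z[of "-s"] by (simp add: s_def)
 finally show ?thesis .
qed

lemma ker1_moments: "(LBINT x. ker1 n x) = 0" "(LBINT x. x * ker1 n x) = -1"
 "integr (%x. x * ker1 n x)" "integr (%x. x * ker n x)" proof -
 have d: "(ker n has_real_derivative ker1 n x) (at x)" for x using ker_C2c[of n] by (simp add: C2c_def)
 note c = C2c_cont[OF ker_C2c, of n]
 obtain r where r: "!!x. r < abs x ==> ker n x = 0" "!!x. r < abs x ==> ker1 n x = 0" by (rule C2c_supp[OF ker_C2c[of n]]) blast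
 show "(LBINT x. ker1 n x) = 0" by (rule integral_derivative_compact_support[OF d c(2) r(1)])
 have i: "integr (%x. x * g x)" if "continuous_on UNIV g" "!!x. r < abs x ==> g x = 0" for g :: "real => real" proof -
  have c: "continuous_on UNIV (%x. x * g x)" by (intro continuous_intros that)
  have z: "x * g x = 0" if "r < abs x" for x using that \<open>!!x. r < \<bar>x\<bar> ==> g x = 0\<close> by simp
  obtain B where B: "!!x. abs (x * g x) <= B" using bounded_compact[OF c z] by blast
  show ?thesis by (rule integr_compact[OF borel_measurable_continuous_onI[OF c] B, of r]) (use z in auto)
 qed
 show i1: "integr (%x. x * ker1 n x)" by (rule i[OF c(2) r(2)])
 show "integr (%x. x * ker n x)" by (rule i[OF c(1) r(1)])
 have "(LBINT x. ker n x + x * ker1 n x) = 0" proof (rule integral_derivative_compact_support[where F="%x. x * ker n x"])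
  show "((%x. x * ker n x) has_real_derivative ker n x + x * ker1 n x) (at x)" for x using DERIV_mult[OF DERIV_ident d] by (simp add: algebra_simps)
  show "continuous_on UNIV (%x. ker n x + x * ker1 n x)" by (intro continuous_intros c)
  show "x * ker n x = 0" if "r < abs x" for x using r(1)[OF that] by simp
 qed
 then show "(LBINT x. x * ker1 n x) = -1" using C2c_integrable(1)[OF ker_C2c, of n] i1 by (simp add: ker_integral)
qed

lemma ker1_mass: "(LBINT x. abs (ker1 n x)) = real (Suc n) * ((LBINT x. abs (bump1 x)) / (LBINT x. bump x))"
proof -
 let ?N = "real (Suc n)"
 have "(LBINT x. abs (ker1 n x)) = (LBINT x. ?N^2 / (LBINT x. bump x) * abs (bump1 (0 + ?N * x)))" by (rule lint_cong)
   (use bump_integral_pos in \<open>simp_all add: ker1_def abs_mult power2_eq_square add.commute\<close>)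
 also have "... = ?N^2 / (LBINT x. bump x) * (LBINT x. abs (bump1 (0 + ?N * x)))" by simp
 also have "(LBINT x. abs (bump1 (0 + ?N * x))) = (LBINT x. abs (bump1 x)) / ?N" using lborel_integral_real_affine[of ?N "%x. abs (bump1 x)" 0] by (simp add: field_simps)
 finally show ?thesis by (simp add: power2_eq_square)
qed

lemma integral_plane_product:
 fixes f g :: "real => real"
 assumes "integr (%p::plane. f (fst p) * g (snd p))"
 shows "(LBINT p::plane. f (fst p) * g (snd p)) = (LBINT x. f x) * (LBINT z. g z)" by (subst integral_plane[OF assms]) simp

lemma norm_integrable_compact:
 fixes k :: "'a::euclidean_space => real"
 assumes k: "k : Borel" "!!h. abs (k h) <= B" "!!h. r < norm h ==> k h = 0"
  and [measurable]: "f : Borel" and f: "!!h. norm h <= r ==> abs (f h) <= A"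
 shows "integr (%h. f h * k h)"
proof (rule integr_compact[of _ "abs A * B" r])
 show "(%h. f h * k h) : Borel" using k(1) by measurable
 have B: "B >= 0" using k(2)[of 0] by (auto intro: order_trans[OF abs_ge_zero])
 show "abs (f h * k h) <= abs A * B" for h proof (cases "norm h <= r")
  case True
  then have "abs (f h) <= abs A" using f[OF True] by simp
  then show ?thesis unfolding abs_mult using k(2)[of h] by (intro mult_mono) auto
 qed (use k(3)[of h] B in simp)
 show "f h * k h = 0" if "r < norm h" for h using k(3)[OF that] by simp
qed

text \<open>\<open>K n\<close> behaves like a derivative of an approximate identity: its zeroth moment vanishes and its first
  moments are \<open>- ca\<close> and \<open>- cb\<close>, so convolution with it reproduces a directional derivative.\<close>

lemma mollified_derivative:
 fixes K :: "nat => plane => real" and Ps :: "plane => real"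
 assumes K[measurable]: "!!n. K n : Borel" and Kb: "!!n h. abs (K n h) <= B n"
  and Kz: "!!n h. 2 / real (Suc n) < norm h ==> K n h = 0"
  and Km: "!!n. (LBINT h. abs (K n h)) <= c * real (Suc n)" and K0: "!!n. (LBINT h. K n h) = 0"
  and K1: "!!n. (LBINT h. fst h * K n h) = - ca" and K2: "!!n. (LBINT h. snd h * K n h) = - cb"
  and Ps[measurable]: "Ps : Borel" and lip: "!!p h. norm h <= 2 ==> abs (Ps (p - h) - Ps p) <= L * norm h"
 shows "abs (LBINT q. Ps q * K n (p - q)) <= 2 * L * c"
  and "gradient Ps g p ==> (%n. LBINT q. Ps q * K n (p - q)) ----> fst g * ca + snd g * cb"
proof -
 have two: "2 / real (Suc n) <= 2" for n by (simp add: divide_le_eq)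
 have L0: "L >= 0" proof -
  have "0 <= L * norm ((1, 0) :: plane)" using lip[of "(1, 0)" 0] by (auto intro: order_trans[OF abs_ge_zero] simp: norm_prod_def)
  then show ?thesis by (simp add: norm_prod_def)
 qed
 have ik: "integr (%h. f h * K n h)"
  if "f : Borel" "!!h. norm h <= 2 / real (Suc n) ==> abs (f h) <= A" for f A n by (rule norm_integrable_compact[OF K Kb Kz that])
 have iK: "integr (K n)" for n using ik[of "%_. 1" n 1] by simp
 have in1: "integr (%h. norm h * abs (K n h))" for n proof -
  have "integr (%h. abs (norm h * K n h))" by (intro integrable_abs ik[of _ n "2 / real (Suc n)"]) auto
  then show ?thesis by (simp add: abs_mult)
 qed
 have c0: "0 <= c" using order_trans[OF _ Km[of 0]] by simp
 have nm: "(LBINT h. norm h * abs (K n h)) <= 2 * c" for n proof -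
  have "(LBINT h. norm h * abs (K n h)) <= (LBINT h. 2 / real (Suc n) * abs (K n h))" proof (rule integral_mono[OF in1])
   show "integr (%h. 2 / real (Suc n) * abs (K n h))" by (intro integrable_mult_right integrable_abs iK)
   show "norm h * abs (K n h) <= 2 / real (Suc n) * abs (K n h)" for h proof (cases "norm h <= 2 / real (Suc n)")
    case True then show ?thesis by (rule mult_right_mono) simp
   qed (use Kz[of n h] in simp)
  qed
  also have "... = 2 / real (Suc n) * (LBINT h. abs (K n h))" by simp
  also have "... <= 2 / real (Suc n) * (c * real (Suc n))" by (intro mult_left_mono Km) simp
  finally show ?thesis by simp
 qed
 have bd: "abs (LBINT h. f h * K n h) <= 2 * ep * c"
  if [measurable]: "f : Borel" and f: "!!h. norm h <= 2 / real (Suc n) ==> abs (f h) <= ep * norm h" and "ep >= 0" for f n ep proof -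
  have i: "integr (%h. f h * K n h)" proof (rule ik[of _ n "ep * 2"])
   fix h :: "plane" assume h: "norm h <= 2 / real (Suc n)"
   have "ep * norm h <= ep * 2" using h two[of n] \<open>ep >= 0\<close> by (intro mult_left_mono) auto
   then show "abs (f h) <= ep * 2" using f[OF h] by simp
  qed measurable
  have "abs (LBINT h. f h * K n h) <= (LBINT h. abs (f h * K n h))" by (rule integral_abs_bound)
  also have "... <= (LBINT h. ep * (norm h * abs (K n h)))" proof (rule integral_mono)
   show "integr (%h. abs (f h * K n h))" using i by simp
   show "integr (%h. ep * (norm h * abs (K n h)))" using in1 by simp
   show "abs (f h * K n h) <= ep * (norm h * abs (K n h))" for h proof (cases "norm h <= 2 / real (Suc n)")
    case True
    have "abs (f h) * abs (K n h) <= (ep * norm h) * abs (K n h)" by (intro mult_right_mono f True) simp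
    then show ?thesis by (simp add: abs_mult mult.assoc)
   qed (use Kz[of n h] in simp)
  qed
  also have "... = ep * (LBINT h. norm h * abs (K n h))" by simp
  also have "... <= ep * (2 * c)" by (intro mult_left_mono nm \<open>ep >= 0\<close>)
  finally show ?thesis by simp
 qed
 have eq: "(LBINT q. Ps q * K n (p - q)) = (LBINT h. (Ps (p - h) - Ps p) * K n h)" for n proof -
  have i1: "integr (%h. Ps (p - h) * K n h)" proof (rule ik[of _ n "abs (Ps p) + L * 2"])
   fix h :: "plane" assume h: "norm h <= 2 / real (Suc n)"
   have "L * norm h <= L * 2" using h two[of n] L0 by (intro mult_left_mono) auto
   then show "abs (Ps (p - h)) <= abs (Ps p) + L * 2" using lip[of h p] h two[of n] by linarith
  qed measurable
  have "(LBINT q. Ps q * K n (p - q)) = (LBINT h. Ps (p - h) * K n (p - (p - h)))" by (rule lborel_reflect[symmetric, where f="%q. Ps q * K n (p - q)"]) measurable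
  also have "... = (LBINT h. Ps (p - h) * K n h) - (LBINT h. Ps p * K n h)" by (simp add: K0)
  also have "... = (LBINT h. Ps (p - h) * K n h - Ps p * K n h)" by (rule lint_diff[symmetric, OF i1]) (use iK in simp)
  finally show ?thesis by (simp add: left_diff_distrib)
 qed
 show "abs (LBINT q. Ps q * K n (p - q)) <= 2 * L * c" unfolding eq proof (rule bd[OF _ _ L0])
  show "abs (Ps (p - h) - Ps p) <= L * norm h" if "norm h <= 2 / real (Suc n)" for h by (rule lip) (use that two[of n] in linarith)
 qed measurable
 show "(%n. LBINT q. Ps q * K n (p - q)) ----> fst g * ca + snd g * cb" if g: "gradient Ps g p" proof (rule LIMSEQ_I)
  fix r :: real assume r: "r > 0"
  define ep where "ep = r / (2 * (c + 1))"
  have ep: "ep > 0" using r c0 by (simp add: ep_def)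
  have "ep * (2 * (c + 1)) = r" using c0 by (simp add: ep_def)
  then have epr: "2 * ep * c < r" using ep by (simp add: algebra_simps)
  obtain de where de: "de > 0" "!!y. norm (y - p) < de ==> abs (Ps y - Ps p - g \<bullet> (y - p)) <= ep * norm (y - p)" using g ep unfolding has_derivative_at_alt real_norm_def by blast
  obtain n0 where n0: "2 / de < real n0" using reals_Archimedean2 by blast
  have "norm ((LBINT q. Ps q * K n (p - q)) - (fst g * ca + snd g * cb)) < r" if n: "n >= n0" for n proof -
   have "2 / de < real (Suc n)" using n0 n by simp
   then have "2 < real (Suc n) * de" using de(1) by (simp only: pos_divide_less_eq)
   then have small: "2 / real (Suc n) < de" by (subst pos_divide_less_eq) (simp_all only: of_nat_0_less_iff zero_less_Suc mult.commute)
   have if1: "integr (%h. fst h * K n h)" proof (rule ik[of _ n 2])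
    fix h :: "plane" assume "norm h <= 2 / real (Suc n)"
    then show "abs (fst h) <= 2" using abs_fst_le_norm[of h] two[of n] by linarith
   qed measurable
   have if2: "integr (%h. snd h * K n h)" proof (rule ik[of _ n 2])
    fix h :: "plane" assume "norm h <= 2 / real (Suc n)"
    then show "abs (snd h) <= 2" using abs_snd_le_norm[of h] two[of n] by linarith
   qed measurable
   have i1: "integr (%h. (Ps (p - h) - Ps p) * K n h)" proof (rule ik[of _ n "L * 2"])
    fix h :: "plane" assume h: "norm h <= 2 / real (Suc n)"
    have "L * norm h <= L * 2" using h two[of n] L0 by (intro mult_left_mono) auto
    then show "abs (Ps (p - h) - Ps p) <= L * 2" using lip[of h p] h two[of n] by linarith
   qed measurable
   have gi: "integr (%h. fst g * (fst h * K n h) + snd g * (snd h * K n h))" using if1 if2 by simp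
   have "(LBINT h. (Ps (p - h) - Ps p + g \<bullet> h) * K n h) =
     (LBINT h. (Ps (p - h) - Ps p) * K n h + (fst g * (fst h * K n h) + snd g * (snd h * K n h)))" by (rule lint_cong) (simp_all add: inner_prod_def algebra_simps)
   also have "... = (LBINT h. (Ps (p - h) - Ps p) * K n h) + (LBINT h. fst g * (fst h * K n h) + snd g * (snd h * K n h))" by (rule lint_add[OF i1 gi])
   also have "(LBINT h. fst g * (fst h * K n h) + snd g * (snd h * K n h)) = - (fst g * ca + snd g * cb)" using if1 if2 by (simp add: K1 K2)
   finally have "(LBINT q. Ps q * K n (p - q)) - (fst g * ca + snd g * cb) = (LBINT h. (Ps (p - h) - Ps p + g \<bullet> h) * K n h)" by (simp add: eq)
   moreover have "abs (LBINT h. (Ps (p - h) - Ps p + g \<bullet> h) * K n h) <= 2 * ep * c" proof (rule bd)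
    fix h :: "plane" assume "norm h <= 2 / real (Suc n)"
    then have "norm (p - h - p) < de" using small by simp
    from de(2)[OF this] show "abs (Ps (p - h) - Ps p + g \<bullet> h) <= ep * norm h" by simp
   qed (use ep in \<open>measurable, simp\<close>)
   ultimately show ?thesis using epr by simp
  qed
  then show "EX no. ALL n>=no. norm ((LBINT q. Ps q * K n (p - q)) - (fst g * ca + snd g * cb)) < r" by blast
 qed
qed

lemma abs_product_integrable:
 fixes f g :: "'a::euclidean_space => real"
 assumes f: "integr f" and g: "integr g"
  and [measurable]: "(%(p, q). k p q) : Borel2" and k: "!!p q. abs (k p q) <= (B::real)"
 shows "integrable lborel2 (%(p, q). f p * (g q * k p q))"
proof (rule lborel_pair.Fubini_integrable)
 have [measurable]: "f : Borel" "g : Borel" using f g by auto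
 show "(%(p, q). f p * (g q * k p q)) : borel_measurable lborel2" by measurable
 have ig: "integr (%q. g q * k p q)" for p proof (rule integr_bound[of _ "%q. B * g q"])
  show "AE q in lborel. norm (g q * k p q) <= norm (B * g q)" proof (intro AE_I2)
   fix q
   have "abs (g q) * abs (k p q) <= abs (g q) * abs B" by (intro mult_left_mono order_trans[OF k abs_ge_self]) simp
   then show "norm (g q * k p q) <= norm (B * g q)" by (simp add: abs_mult mult.commute)
  qed
 qed (use g in \<open>simp, measurable\<close>)
 then show "AE p in lborel. integr (%q. case (p, q) of (p, q) => f p * (g q * k p q))" by simp
 show "integr (%p. LBINT q. norm (case (p, q) of (p, q) => f p * (g q * k p q)))" proof (rule integr_bound[of _ "%p. (B * (LBINT q. abs (g q))) * f p"])
  show "(%p. LBINT q. norm (case (p, q) of (p, q) => f p * (g q * k p q))) : borel_measurable lborel" unfolding measurable_lborel2 by (rule param_integral_Borel) measurable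
  show "AE p in lborel. norm (LBINT q. norm (case (p, q) of (p, q) => f p * (g q * k p q))) <= norm ((B * (LBINT q. abs (g q))) * f p)" proof (intro AE_I2)
   fix p
   have "(LBINT q. abs (g q * k p q)) <= (LBINT q. B * abs (g q))" proof (rule integral_mono)
    show "abs (g q * k p q) <= B * abs (g q)" for q using mult_left_mono[OF k[of p q], of "abs (g q)"] by (simp add: abs_mult mult.commute)
   qed (use ig g in auto)
   then have 1: "(LBINT q. abs (g q * k p q)) <= B * (LBINT q. abs (g q))" by simp
   have 2: "(LBINT q. norm (case (p, q) of (p, q) => f p * (g q * k p q))) = abs (f p) * (LBINT q. abs (g q * k p q))" by (simp add: abs_mult mult.assoc)
   have "0 <= (LBINT q. abs (g q * k p q))" by simp
   then have "norm (abs (f p) * (LBINT q. abs (g q * k p q))) = (LBINT q. abs (g q * k p q)) * abs (f p)" by (simp add: abs_mult mult.commute)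
   also have "... <= abs (B * (LBINT q. abs (g q))) * abs (f p)" using 1 by (intro mult_right_mono) auto
   finally show "norm (LBINT q. norm (case (p, q) of (p, q) => f p * (g q * k p q))) <= norm ((B * (LBINT q. abs (g q))) * f p)" unfolding 2 by (simp add: abs_mult)
  qed
 qed (use f in \<open>intro integrable_mult_right\<close>)
qed

lemma ker2d_1_moments:
 "(LBINT h. ker2d_1 n h) = 0" "(LBINT h. fst h * ker2d_1 n h) = -1" "(LBINT h. snd h * ker2d_1 n h) = 0"
 "(LBINT h. abs (ker2d_1 n h)) = (LBINT x. abs (bump1 x)) / (LBINT x. bump x) * real (Suc n)"
 and ker2d_2_moments:
 "(LBINT h. ker2d_2 n h) = 0" "(LBINT h. fst h * ker2d_2 n h) = 0" "(LBINT h. snd h * ker2d_2 n h) = -1"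
 "(LBINT h. abs (ker2d_2 n h)) = (LBINT x. abs (bump1 x)) / (LBINT x. bump x) * real (Suc n)" proof -
 obtain B where B: "!!h. abs (ker2d_1 n h) <= B" "!!h. abs (ker2d_2 n h) <= B" by (rule ker2d_bound) blast
 have fs': "norm h <= r ==> abs (fst h) <= r" "norm h <= r ==> abs (snd h) <= r" for h :: "plane" and r by (metis abs_fst_le_norm order_trans, metis abs_snd_le_norm order_trans)
 note i1 = norm_integrable_compact[OF ker2d_measurable(2) B(1), where r="2 / real (Suc n)"]
 note i2 = norm_integrable_compact[OF ker2d_measurable(3) B(2), where r="2 / real (Suc n)"]
 have k: "(LBINT x. abs (ker n x)) = 1" using ker_integral[of n] by (simp add: ker_nonneg)
 have f1: "integr (%h. fst h * ker2d_1 n h)" by (rule i1) (auto intro: ker2d_zero fs'(1))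
 have f2: "integr (%h. snd h * ker2d_1 n h)" by (rule i1) (auto intro: ker2d_zero fs'(2))
 have g1: "integr (%h. fst h * ker2d_2 n h)" by (rule i2) (auto intro: ker2d_zero fs'(1))
 have g2: "integr (%h. snd h * ker2d_2 n h)" by (rule i2) (auto intro: ker2d_zero fs'(2))
 have a1: "integr (%h. abs (ker2d_1 n h))" "integr (%h. abs (ker2d_2 n h))" using ker2d_integrable by (auto intro: integrable_abs)
 note P = integral_plane_product
 show "(LBINT h. ker2d_1 n h) = 0" using P[of "ker1 n" "ker n"] ker2d_integrable(2)[of n] by (simp add: ker2d_1_def[abs_def] ker1_moments)
 show "(LBINT h. ker2d_2 n h) = 0" using P[of "ker n" "ker1 n"] ker2d_integrable(3)[of n] by (simp add: ker2d_2_def[abs_def] ker1_moments)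
 show "(LBINT h. fst h * ker2d_1 n h) = -1" using P[of "%x. x * ker1 n x" "ker n"] f1 by (simp add: ker2d_1_def[abs_def] ker1_moments ker_integral mult.assoc)
 show "(LBINT h. snd h * ker2d_1 n h) = 0" using P[of "ker1 n" "%x. x * ker n x"] f2 by (simp add: ker2d_1_def[abs_def] ker1_moments mult.left_commute)
 show "(LBINT h. fst h * ker2d_2 n h) = 0" using P[of "%x. x * ker n x" "ker1 n"] g1 by (simp add: ker2d_2_def[abs_def] ker1_moments mult.assoc)
 show "(LBINT h. snd h * ker2d_2 n h) = -1" using P[of "ker n" "%x. x * ker1 n x"] g2 by (simp add: ker2d_2_def[abs_def] ker1_moments ker_integral mult.left_commute)
 show "(LBINT h. abs (ker2d_1 n h)) = (LBINT x. abs (bump1 x)) / (LBINT x. bump x) * real (Suc n)"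
  using P[of "%x. abs (ker1 n x)" "%x. abs (ker n x)"] a1(1) by (simp add: ker2d_1_def[abs_def] abs_mult ker1_mass k)
 show "(LBINT h. abs (ker2d_2 n h)) = (LBINT x. abs (bump1 x)) / (LBINT x. bump x) * real (Suc n)"
  using P[of "%x. abs (ker n x)" "%x. abs (ker1 n x)"] a1(2) by (simp add: ker2d_2_def[abs_def] abs_mult ker1_mass k)
qed

text \<open>The mollifications of \<open>Ps\<close> are superpositions of translated kernels, for
  which \<open>div\<close> holds, and Fubini transfers the identity to them. Their gradients are
  bounded uniformly by the Lipschitz constant and converge to the gradient of \<open>Ps\<close>
  wherever it exists, so dominated convergence applies against the locally integrable field.\<close>

lemma divergence_free_Lipschitz:
 fixes W1 W2 Ps :: "plane => real" and g :: "plane => plane"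
 assumes W: "W1 : Borel" "W2 : Borel"
   "!!r. integr (%p. ind (cball 0 r) p * W1 p)" "!!r. integr (%p. ind (cball 0 r) p * W2 p)"
  and div: "!!ps D D1 D2. C2c_plane ps D D1 D2 ==> (LBINT p. fst (D p) * W1 p + snd (D p) * W2 p) = 0"
  and lip: "!!p h. norm h <= 2 ==> abs (Ps (p - h) - Ps p) <= L * norm h" and z: "!!p. r < norm p ==> Ps p = 0"
  and Ps: "Ps : Borel" "!!p. abs (Ps p) <= B" and g: "(%p. fst (g p)) : Borel" "(%p. snd (g p)) : Borel"
  and der: "AE p in lborel. gradient Ps (g p) p" and gz: "!!p. r + 2 < norm p ==> g p = 0"
 shows "(LBINT p. fst (g p) * W1 p + snd (g p) * W2 p) = 0"
proof -
 note [measurable] = W(1,2) Ps(1) g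
 define T where "T W p = ind (cball 0 (r + 2)) p * W p" for W :: "plane => real" and p
 have [measurable]: "T W : Borel" if "W : Borel" for W unfolding T_def by (intro borel_measurable_times borel_measurable_indicator borel_closed closed_cball that)
 have iT: "integr (T W1)" "integr (T W2)" unfolding T_def using W(3,4) by auto
 have iPs: "integr Ps" by (rule integr_compact[OF Ps, of r]) (rule z)
 define k where "k = (LBINT x. abs (bump1 x)) / (LBINT x. bump x)"
 define S1 S2 where "S1 n p = (LBINT q. Ps q * ker2d_1 n (p - q))" and "S2 n p = (LBINT q. Ps q * ker2d_2 n (p - q))" for n p
 have "ALL n. EX B. ALL h. abs (ker2d_1 n h) <= B & abs (ker2d_2 n h) <= B" proof
  fix n
  obtain B where "!!h. abs (ker2d_1 n h) <= B" "!!h. abs (ker2d_2 n h) <= B" by (rule ker2d_bound[of n]) blast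
  then show "EX B. ALL h. abs (ker2d_1 n h) <= B & abs (ker2d_2 n h) <= B" by blast
 qed
 from choice[OF this] obtain Bk where Bk: "!!n h. abs (ker2d_1 n h) <= Bk n" "!!n h. abs (ker2d_2 n h) <= Bk n" by blast
 note m1 = mollified_derivative[where K=ker2d_1 and ca=1 and cb=0 and c=k and B=Bk and L=L and Ps=Ps]
 note m2 = mollified_derivative[where K=ker2d_2 and ca=0 and cb=1 and c=k and B=Bk and L=L and Ps=Ps]
 have b1: "abs (S1 n p) <= 2 * L * k" for n p unfolding S1_def by (rule m1(1)) ((rule ker2d_measurable Bk Ps(1) | erule ker2d_zero | erule lip | simp add: ker2d_1_moments k_def)+)
 have b2: "abs (S2 n p) <= 2 * L * k" for n p unfolding S2_def by (rule m2(1)) ((rule ker2d_measurable Bk Ps(1) | erule ker2d_zero | erule lip | simp add: ker2d_2_moments k_def)+)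
 have l1: "(%n. S1 n p) ----> fst (g p)" if "gradient Ps (g p) p" for p proof -
  have "(%n. S1 n p) ----> fst (g p) * 1 + snd (g p) * 0"
   unfolding S1_def by (rule m1(2)) ((rule ker2d_measurable Bk Ps(1) that | erule ker2d_zero | erule lip | simp add: ker2d_1_moments k_def)+)
  then show ?thesis by simp
 qed
 have l2: "(%n. S2 n p) ----> snd (g p)" if "gradient Ps (g p) p" for p proof -
  have "(%n. S2 n p) ----> fst (g p) * 0 + snd (g p) * 1"
   unfolding S2_def by (rule m2(2)) ((rule ker2d_measurable Bk Ps(1) that | erule ker2d_zero | erule lip | simp add: ker2d_2_moments k_def)+)
  then show ?thesis by simp
 qed
 have sm[measurable]: "S1 n : Borel" "S2 n : Borel" for n unfolding S1_def S2_def by (rule param_integral_Borel; measurable)+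
 have zero: "(LBINT p. T W1 p * S1 n p + T W2 p * S2 n p) = 0" for n proof -
  have j1: "integrable lborel2 (%(p, q). T W1 p * (Ps q * ker2d_1 n (p - q)))" by (rule abs_product_integrable[OF iT(1) iPs _ Bk(1)]) measurable
  have j2: "integrable lborel2 (%(p, q). T W2 p * (Ps q * ker2d_2 n (p - q)))" by (rule abs_product_integrable[OF iT(2) iPs _ Bk(2)]) measurable
  have s1: "integr (%p. T W1 p * S1 n p)" using lborel_pair.integrable_fst[OF j1] by (simp add: S1_def)
  have s2: "integr (%p. T W2 p * S2 n p)" using lborel_pair.integrable_fst[OF j2] by (simp add: S2_def)
  have "(LBINT p. T W1 p * S1 n p + T W2 p * S2 n p) = (LBINT p. LBINT q. T W1 p * (Ps q * ker2d_1 n (p - q))) + (LBINT p. LBINT q. T W2 p * (Ps q * ker2d_2 n (p - q)))"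
   using s1 s2 by (simp add: S1_def S2_def)
  also have "... = (LBINT q. LBINT p. T W1 p * (Ps q * ker2d_1 n (p - q))) + (LBINT q. LBINT p. T W2 p * (Ps q * ker2d_2 n (p - q)))"
   using lborel_pair.Fubini_integral[OF j1] lborel_pair.Fubini_integral[OF j2] by simp
  also have "... = (LBINT q. (LBINT p. T W1 p * (Ps q * ker2d_1 n (p - q))) + (LBINT p. T W2 p * (Ps q * ker2d_2 n (p - q))))"
   using lborel_pair.integrable_snd[OF j1] lborel_pair.integrable_snd[OF j2] by simp
  also have "... = (LBINT q::plane. 0)" proof (rule lint_cong[OF refl])
   fix q
   show "(LBINT p. T W1 p * (Ps q * ker2d_1 n (p - q))) + (LBINT p. T W2 p * (Ps q * ker2d_2 n (p - q))) = 0" proof (cases "norm q <= r")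
    case False then show ?thesis using z[of q] by simp
   next
    case True
    have kz: "ker2d_1 n (p - q) = 0 & ker2d_2 n (p - q) = 0" if "r + 2 < norm p" for p proof -
     have "2 < norm (p - q)" using that True norm_triangle_ineq2[of p q] by linarith
     moreover have "2 / real (Suc n) <= 2" by (simp add: divide_le_eq)
     ultimately show ?thesis using ker2d_zero[of n "p - q"] by simp
    qed
    have k1: "ker2d_1 n (p - q) * T W1 p = ker2d_1 n (p - q) * W1 p" and k2: "ker2d_2 n (p - q) * T W2 p = ker2d_2 n (p - q) * W2 p" for p
     using kz[of p] by (cases "norm p <= r + 2"; simp add: T_def)+
    have ik: "integr (%p. T W p * K (p - q))"
     if "integr (T W)" "!!h. abs (K h) <= Bk n" "K : Borel" for W K proof (rule integr_bound[of _ "%p. Bk n * T W p"])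
     show "integr (%p. Bk n * T W p)" using that by simp
     show "(%p. T W p * K (p - q)) : borel_measurable lborel" using that by measurable
     show "AE p in lborel. norm (T W p * K (p - q)) <= norm (Bk n * T W p)" proof (intro AE_I2)
      fix p
      have "abs (T W p) * abs (K (p - q)) <= abs (T W p) * abs (Bk n)" by (intro mult_left_mono order_trans[OF that(2)]) auto
      then show "norm (T W p * K (p - q)) <= norm (Bk n * T W p)" by (simp add: abs_mult mult.commute)
     qed
    qed
    have i1: "integr (%p. T W1 p * ker2d_1 n (p - q))" by (rule ik[OF iT(1) Bk(1)]) measurable
    have i2: "integr (%p. T W2 p * ker2d_2 n (p - q))" by (rule ik[OF iT(2) Bk(2)]) measurable
    have "0 = (LBINT p. ker2d_1 n (p - q) * W1 p + ker2d_2 n (p - q) * W2 p)" using div[OF ker2d_test[of n q]] by simp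
    also have "... = (LBINT p. T W1 p * ker2d_1 n (p - q) + T W2 p * ker2d_2 n (p - q))" proof (rule lint_cong[OF refl])
     fix p
     show "ker2d_1 n (p - q) * W1 p + ker2d_2 n (p - q) * W2 p = T W1 p * ker2d_1 n (p - q) + T W2 p * ker2d_2 n (p - q)"
      unfolding k1[symmetric] k2[symmetric] by (simp only: mult.commute)
    qed
    also have "... = (LBINT p. T W1 p * ker2d_1 n (p - q)) + (LBINT p. T W2 p * ker2d_2 n (p - q))" using i1 i2 by simp
    finally have e: "(LBINT p. T W1 p * ker2d_1 n (p - q)) + (LBINT p. T W2 p * ker2d_2 n (p - q)) = 0" by simp
    have "(LBINT p. T W1 p * (Ps q * ker2d_1 n (p - q))) + (LBINT p. T W2 p * (Ps q * ker2d_2 n (p - q))) =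
      (LBINT p. Ps q * (T W1 p * ker2d_1 n (p - q))) + (LBINT p. Ps q * (T W2 p * ker2d_2 n (p - q)))" by (simp only: mult.left_commute)
    also have "... = Ps q * ((LBINT p. T W1 p * ker2d_1 n (p - q)) + (LBINT p. T W2 p * ker2d_2 n (p - q)))" by (simp add: distrib_left)
    finally show ?thesis by (simp add: e)
   qed
  qed
  finally show ?thesis by simp
 qed
 have "(%n. LBINT p. T W1 p * S1 n p + T W2 p * S2 n p) ----> (LBINT p. T W1 p * fst (g p) + T W2 p * snd (g p))" proof (rule integral_dominated_convergence)
  show "integr (%p. (2 * L * k) * abs (T W1 p) + (2 * L * k) * abs (T W2 p))" using iT by simp
  show "AE p in lborel. (%n. T W1 p * S1 n p + T W2 p * S2 n p) ----> T W1 p * fst (g p) + T W2 p * snd (g p)" using der by eventually_elim (intro tendsto_intros l1 l2)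
  show "AE p in lborel. norm (T W1 p * S1 n p + T W2 p * S2 n p) <= (2 * L * k) * abs (T W1 p) + (2 * L * k) * abs (T W2 p)" for n proof (intro AE_I2)
   fix p
   have "abs (T W1 p) * abs (S1 n p) <= abs (T W1 p) * (2 * L * k)" "abs (T W2 p) * abs (S2 n p) <= abs (T W2 p) * (2 * L * k)" by (intro mult_left_mono b1 b2; simp)+
   then have "abs (T W1 p * S1 n p) <= (2 * L * k) * abs (T W1 p)" "abs (T W2 p * S2 n p) <= (2 * L * k) * abs (T W2 p)" by (simp_all only: abs_mult mult.commute)
   then show "norm (T W1 p * S1 n p + T W2 p * S2 n p) <= (2 * L * k) * abs (T W1 p) + (2 * L * k) * abs (T W2 p)" unfolding real_norm_def by linarith
  qed
 qed measurable
 then have "(LBINT p. T W1 p * fst (g p) + T W2 p * snd (g p)) = 0" unfolding zero by (simp add: LIMSEQ_const_iff)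
 moreover have "T W1 p * fst (g p) + T W2 p * snd (g p) = fst (g p) * W1 p + snd (g p) * W2 p" for p using gz[of p] by (cases "norm p <= r + 2") (auto simp: T_def mult.commute)
 ultimately show ?thesis by simp
qed

section \<open>Local bounds for convex functions and a cut-off along the levels\<close>

lemma convex_Lipschitz_on_cball:
 fixes d :: "'a::real_normed_vector => real"
 assumes d: "convex_on UNIV d" and B: "!!p. norm p <= r + 1 ==> abs (d p) <= B" and x: "norm x <= r" and y: "norm y <= r"
 shows "abs (d x - d y) <= 2 * B * norm (x - y)"
proof -
 have *: "d y - d x <= 2 * B * norm (y - x)" if x: "norm x <= r" and y: "norm y <= r" for x y proof (cases "x = y")
  case False
  define s where "s = norm (y - x)"
  define t where "t = s / (1 + s)"
  \<comment> \<open>The segment from x to y is prolonged by length 1 beyond y, staying in the larger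
    ball where \<open>d\<close> is bounded; convexity then limits the slope between x and y.\<close>
  define z where "z = y + (1 / s) *R (y - x)"
  have s: "s > 0" using False by (simp add: s_def)
  have t: "0 <= t" "t <= 1" "t <= s" "1 - t = 1 / (1 + s)" using s by (auto simp: t_def field_simps)
  have tz: "t *R z = t *R y + (1 - t) *R (y - x)" unfolding z_def t(4) scaleR_add_right using s by (simp add: t_def)
  have "(1 - t) *R x + t *R z = y" unfolding tz by (simp add: algebra_simps)
  then have "d y <= (1 - t) * d x + t * d z" using convex_onD[OF d t(1,2), of x z] by simp
  then have "d y - d x <= t * (d z - d x)" by (simp add: algebra_simps)
  also have "... <= t * (2 * B)" proof (rule mult_left_mono[OF _ t(1)])
   have "norm z <= norm y + norm ((1 / s) *R (y - x))" unfolding z_def by (rule norm_triangle_ineq)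
   also have "norm ((1 / s) *R (y - x)) = 1" using s by (simp add: s_def[symmetric])
   finally show "d z - d x <= 2 * B" using B[of z] B[of x] x y by linarith
  qed
  also have "... <= s * (2 * B)" using B[of x] x by (intro mult_right_mono t) auto
  finally show ?thesis by (simp add: s_def mult.commute)
 qed simp
 show ?thesis using *[OF x y] *[OF y x] by (simp add: abs_le_iff norm_minus_commute)
qed

lemma convex_gradient_bound:
 fixes d :: "plane => real"
 assumes d: "convex_on UNIV d" and B: "!!p. norm p <= r + 1 ==> abs (d p) <= B" and p: "norm p <= r"
  and g: "gradient d g p"
 shows "norm g <= 2 * B"
proof (cases "g = 0")
 case True then show ?thesis using B[of p] p by simp
next
 case False
 define y where "y = p + (1 / norm g) *R g"
 have "norm y <= norm p + norm ((1 / norm g) *R g)" unfolding y_def by (rule norm_triangle_ineq)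
 also have "norm ((1 / norm g) *R g) = 1" using False by simp
 finally have "d y - d p <= 2 * B" using B[of y] B[of p] p by linarith
 moreover have "g \<bullet> (y - p) = norm g" using False by (simp add: y_def dot_square_norm power2_eq_square)
 ultimately show ?thesis using subgradient[OF d g, of y] by simp
qed

text \<open>A trapezoid: it rises on [R, R+1], equals 1 on [R+1, N], and falls on [N, N+1].\<close>

definition cutoff :: "real => real => real => real" where
 "cutoff R N t = max 0 (t - R) - max 0 (t - (R + 1)) - max 0 (t - N) + max 0 (t - (N + 1))"

text \<open>The primitive of \<open>- cutoff\<close> that vanishes beyond N + 1; the constant N - R
  is the area of the trapezoid. Composed with \<open>d\<close> it has compact support by coercivity,
  and its gradient is \<open>- cutoff\<close> times the gradient of \<open>d\<close>, so testing a
  field with it averages the flux over the levels.\<close>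

definition cutoff_primitive :: "real => real => real => real" where
 "cutoff_primitive R N t = (N - R) - ((max 0 (t - R))^2 - (max 0 (t - (R + 1)))^2 - (max 0 (t - N))^2 + (max 0 (t - (N + 1)))^2) / 2"

lemma cutoff_values:
 assumes "R + 1 <= N"
 shows "0 <= cutoff R N t" "cutoff R N t <= 1" "t <= R ==> cutoff R N t = 0" "N + 1 <= t ==> cutoff R N t = 0"
  "R + 1 <= t ==> t <= N ==> cutoff R N t = 1" using assms by (auto simp: cutoff_def max_def)

lemma cutoff_primitive_zero: "R <= N ==> N + 1 <= t ==> cutoff_primitive R N t = 0"
 by (simp add: cutoff_primitive_def max_def power2_eq_square algebra_simps add_divide_distrib diff_divide_distrib)

lemma cutoff_primitive_deriv: "(cutoff_primitive R N has_real_derivative - cutoff R N t) (at t)"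
proof -
 have *: "((%t. (max 0 (t - c))^2) has_real_derivative 2 * max 0 (t - c)) (at t)" for c t :: real proof -
  have "((%t. (%y. max 0 y ^ 2) (t - c)) has_real_derivative (real 2 * max 0 (t - c) ^ (2 - 1)) * 1) (at t)"
   by (rule DERIV_chain2[OF DERIV_max_0_power]) (auto intro!: derivative_eq_intros)
  then show ?thesis by simp
 qed
 show ?thesis unfolding cutoff_primitive_def[abs_def] by (rule DERIV_cong[OF DERIV_diff[OF DERIV_const DERIV_cdivide[OF DERIV_add[OF DERIV_diff[OF DERIV_diff[OF * *] *] *]]]])
   (simp add: cutoff_def diff_divide_distrib add_divide_distrib)
qed

lemma cutoff_primitive_Lipschitz:
 assumes "R + 1 <= N" shows "abs (cutoff_primitive R N s - cutoff_primitive R N t) <= abs (s - t)"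
proof -
 have "norm (cutoff_primitive R N s - cutoff_primitive R N t) <= 1 * norm (s - t)" by (rule field_differentiable_bound[of UNIV _ "%t. - cutoff R N t"])
   (use cutoff_values[OF assms] cutoff_primitive_deriv in auto)
 then show ?thesis by simp
qed

text \<open>\<open>|\<nu>\<cdot>\<nabla>P - i\<beta>P|\<^sup>2\<close> for \<open>P = a + ib\<close>, \<open>\<nabla>a = (A1, A2)\<close>, \<open>\<nabla>b = (B1, B2)\<close> and \<open>\<nu> = g/|g|\<close>.\<close>

definition radiation_defect :: "plane => real => real => real => real => real => real => real => real" where
 "radiation_defect g \<beta> a A1 A2 b B1 B2 =
   (fst g / norm g * A1 + snd g / norm g * A2 + \<beta> * b)^2 + (fst g / norm g * B1 + snd g / norm g * B2 - \<beta> * a)^2"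

abbreviation (input) "weighted_defect d \<beta> a A1 A2 b B1 B2 p \<equiv>
 norm (grad d p) * radiation_defect (grad d p) \<beta> (a p) (A1 p) (A2 p) (b p) (B1 p) (B2 p)"

lemma radiation_defect_nonneg: "0 <= radiation_defect g \<beta> a A1 A2 b B1 B2" by (simp add: radiation_defect_def)

lemma sum_squares_diff_le: "(x - x')^2 + (y - y')^2 <= 2 * (x^2 + y^2) + 2 * (x'^2 + y'^2)" for x x' y y' :: real
proof -
 have "0 <= (x + x')^2" "0 <= (y + y')^2" by simp_all
 then show ?thesis by (simp add: power2_eq_square algebra_simps)
qed

text \<open>The defect is the square of an expression linear in the function and its gradient, so
  the bounds for the two solutions pass to their difference.\<close>

lemma radiation_defect_diff:
 "radiation_defect g \<beta> (a - a') (A1 - A1') (A2 - A2') (b - b') (B1 - B1') (B2 - B2')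
  <= 2 * radiation_defect g \<beta> a A1 A2 b B1 B2 + 2 * radiation_defect g \<beta> a' A1' A2' b' B1' B2'" proof -
 let ?x = "%A1 A2 b. fst g / norm g * A1 + snd g / norm g * A2 + \<beta> * b"
 let ?y = "%B1 B2 a. fst g / norm g * B1 + snd g / norm g * B2 - \<beta> * a"
 have "?x (A1 - A1') (A2 - A2') (b - b') = ?x A1 A2 b - ?x A1' A2' b'"
  "?y (B1 - B1') (B2 - B2') (a - a') = ?y B1 B2 a - ?y B1' B2' a'" by (simp_all only: right_diff_distrib)
 then show ?thesis unfolding radiation_defect_def by (simp only: sum_squares_diff_le)
qed

text \<open>The cross term of the square is the flux of \<open>b \<nabla>a - a \<nabla>b\<close>.\<close>

lemma radiation_defect_lower:
 assumes "g ~= 0"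
 shows "norm g * (\<beta>^2 * (a^2 + b^2)) <= norm g * radiation_defect g \<beta> a A1 A2 b B1 B2
   - 2 * \<beta> * (fst g * (A1 * b - B1 * a) + snd g * (A2 * b - B2 * a))" proof -
 define X Y where "X = fst g / norm g * A1 + snd g / norm g * A2" and "Y = fst g / norm g * B1 + snd g / norm g * B2"
 have n: "norm g * X = fst g * A1 + snd g * A2" "norm g * Y = fst g * B1 + snd g * B2" using assms by (simp_all add: X_def Y_def distrib_left)
 have "radiation_defect g \<beta> a A1 A2 b B1 B2 = (X + \<beta> * b)^2 + (Y - \<beta> * a)^2" by (simp add: radiation_defect_def X_def Y_def)
 also have "... = X^2 + Y^2 + \<beta>^2 * (a^2 + b^2) + 2 * \<beta> * (X * b - Y * a)" by (simp add: power2_eq_square algebra_simps)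
 finally have rd: "radiation_defect g \<beta> a A1 A2 b B1 B2 = X^2 + Y^2 + \<beta>^2 * (a^2 + b^2) + 2 * \<beta> * (X * b - Y * a)" .
 have "norm g * radiation_defect g \<beta> a A1 A2 b B1 B2 = norm g * (X^2 + Y^2) + norm g * (\<beta>^2 * (a^2 + b^2)) + 2 * \<beta> * ((norm g * X) * b - (norm g * Y) * a)"
  unfolding rd by algebra
 also have "(norm g * X) * b - (norm g * Y) * a = fst g * (A1 * b - B1 * a) + snd g * (A2 * b - B2 * a)" unfolding n by (simp add: algebra_simps)
 finally have "norm g * radiation_defect g \<beta> a A1 A2 b B1 B2 = norm g * (X^2 + Y^2) + norm g * (\<beta>^2 * (a^2 + b^2))
   + 2 * \<beta> * (fst g * (A1 * b - B1 * a) + snd g * (A2 * b - B2 * a))" .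
 moreover have "0 <= norm g * (X^2 + Y^2)" by simp
 ultimately show ?thesis by linarith
qed

lemma nn_integral_L2:
 assumes [measurable]: "a : Borel" and "b : Borel"
  and fin: "(NN p. ennreal ((a p)^2 + (b p)^2)) < \<infinity>"
 shows "L2 a" "L2 b"
proof -
 note [measurable] = assms(2)
 have i: "integr (%p. (a p)^2 + (b p)^2)" by (rule integrableI_nonneg) (use fin in \<open>auto intro: sum_power2_ge_zero\<close>)
 show "L2 a" unfolding L2_def by (auto intro!: integr_bound[OF i])
 show "L2 b" unfolding L2_def using assms(2) by (auto intro!: integr_bound[OF i])
qed

section \<open>Vanishing averaged flux and square integrability of outgoing solutions\<close>

context convex_well
begin

text \<open>At distance \<open>B\<close> from \<open>p0\<close> the function has grown by at least
  1, and convexity prolongs this to growth with slope at least 1/B further out; inside distance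
  \<open>B\<close> the level condition R + 1 gives the same bound. The subgradient inequality
  towards \<open>p0\<close> turns growth into a lower bound for the gradient.\<close>

lemma gradient_lower_bound:
 assumes R: "d p0 <= R"
 obtains c where "c > 0" "!!p g. gradient d g p ==> R + 1 <= d p ==> c <= norm g"
proof -
 obtain B where B: "B > 0" "!!p. B <= norm (p - p0) ==> d p0 + 1 <= d p" by (rule far) blast
 show ?thesis proof (rule that[of "1 / B"])
  fix p g assume g: "gradient d g p" and p: "R + 1 <= d p"
  define s where "s = norm (p - p0)"
  have s0: "s ~= 0" using p R by (auto simp: s_def)
  have s: "s > 0" using s0 by (auto simp: s_def)
  have "s / B <= d p - d p0" proof (cases "s <= B")
   case True
   then have "s / B <= 1" using B(1) by simp
   then show ?thesis using p R by linarith
  next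
   case False
   define t where "t = B / s"
   have t: "0 <= t" "t <= 1" "t > 0" using False B(1) s by (auto simp: t_def)
   have "(1 - t) *R p0 + t *R p - p0 = t *R (p - p0)" by (simp add: algebra_simps)
   then have "norm ((1 - t) *R p0 + t *R p - p0) = B" using t(1) s B(1) by (simp add: t_def s_def)
   then have "d p0 + 1 <= d ((1 - t) *R p0 + t *R p)" by (intro B(2)) simp
   also have "... <= (1 - t) * d p0 + t * d p" by (rule convex_onD[OF convex t(1,2)]) auto
   finally have "1 <= t * (d p - d p0)" by (simp add: algebra_simps)
   then have "1 / t <= d p - d p0" using t(3) by (simp add: divide_le_eq mult.commute)
   then show ?thesis by (simp add: t_def)
  qed
  also have "... <= norm g * s" proof -
   have "g \<bullet> (p0 - p) <= d p0 - d p" by (rule subgradient[OF convex g])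
   moreover have "abs (g \<bullet> (p0 - p)) <= norm g * norm (p0 - p)" by (rule Cauchy_Schwarz_ineq2)
   ultimately show ?thesis unfolding s_def norm_minus_commute[of p p0] by linarith
  qed
  finally have "s * (1 / B) <= s * norm g" by (simp add: mult.commute)
  then show "1 / B <= norm g" using s by (simp only: mult_le_cancel_left_pos)
 qed (use B(1) in simp)
qed

text \<open>The field b grad a - a grad b tested with \<open>cutoff_primitive\<close> of
  \<open>d\<close>. That function is only Lipschitz, with a gradient almost everywhere, so the
  identity for C2 test functions is extended by \<open>divergence_free_Lipschitz\<close>.\<close>

lemma cutoff_flux_zero:
 assumes a: "wgrad a A1 A2" and va: "vweak V a" and b: "wgrad b B1 B2" and vb: "vweak V b"
  and V: "V : Borel" "!!x. abs (V x) <= BV"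
  and E: "E : sets borel" "AE p in lborel. p : E" "!!p. p : E ==> gradient d (grad d p) p"
  and N: "R + 1 <= N"
 defines "g \<equiv> %p. (if p : E then - cutoff R N (d p) else 0) *R grad d p"
 shows "(LBINT p. fst (g p) * (A1 p * b p - B1 p * a p) + snd (g p) * (A2 p * b p - B2 p * a p)) = 0"
  and "integr (%p. fst (g p) * (A1 p * b p - B1 p * a p) + snd (g p) * (A2 p * b p - B2 p * a p))"
proof -
 have La: "L2l a" "L2l A1" "L2l A2" and Lb: "L2l b" "L2l B1" "L2l B2" using a b by (auto simp: wgrad_def)
 note [measurable] = E(1) grad_measurable[OF cont]
 have [measurable]: "a : Borel" "A1 : Borel" "A2 : Borel"
   "b : Borel" "B1 : Borel" "B2 : Borel" using La Lb by (auto simp: L2l_def)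
 obtain B' where B': "!!p. B' <= norm (p - p0) ==> N + 2 <= d p" by (rule far) blast
 define r where "r = abs B' + norm p0"
 have r: "N + 2 <= d p" if "r < norm p" for p using B'[of p] that norm_triangle_ineq2[of p p0] unfolding r_def by linarith
 \<comment> \<open>The margin: shifts up to length 2 of points in the ball of radius r + 2 reach r +
   4, and the local Lipschitz bound needs one unit more.\<close>
 have "compact (d ` cball 0 (r + 5))" by (intro compact_continuous_image continuous_on_subset[OF cont]) auto
 then have "bounded (d ` cball 0 (r + 5))" by (rule compact_imp_bounded)
 then obtain Bd where *: "ALL y:d ` cball 0 (r + 5). norm y <= Bd" unfolding bounded_iff by blast
 have Bd: "abs (d p) <= Bd" if "norm p <= r + 5" for p proof -
  have "d p : d ` cball 0 (r + 5)" using that by (intro imageI) simp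
  with * have "norm (d p) <= Bd" by blast
  then show ?thesis by simp
 qed
 have gm[measurable]: "(%p. fst (g p)) : Borel" "(%p. snd (g p)) : Borel" unfolding g_def cutoff_def by simp_all measurable
 have gz: "g p = 0" if "r < norm p" for p using r[OF that] cutoff_values(4)[OF N, of "d p"] by (simp add: g_def)
 have gb: "norm (g p) <= 2 * abs Bd" for p proof (cases "norm p <= r & p : E")
  case True
  have "norm (grad d p) <= 2 * Bd" proof (rule convex_gradient_bound[OF convex, where r="r + 4" and p=p])
   show "abs (d p) <= Bd" if "norm p <= r + 4 + 1" for p by (rule Bd) (use that in simp)
   show "gradient d (grad d p) p" by (rule E(3)) (use True in simp)
  qed (use True in simp)
  then have "abs (cutoff R N (d p)) * norm (grad d p) <= 1 * (2 * abs Bd)" using cutoff_values(1,2)[OF N, of "d p"] by (intro mult_mono) auto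
  then show ?thesis using True by (simp add: g_def)
 qed (use gz[of p] in \<open>auto simp: g_def not_le\<close>)
 have gb': "abs (fst (g p)) <= 2 * abs Bd" "abs (snd (g p)) <= 2 * abs Bd" for p using order_trans[OF abs_fst_le_norm gb] order_trans[OF abs_snd_le_norm gb] by auto
 have gz': "fst (g p) = 0" "snd (g p) = 0" if "r < norm p" for p using gz[OF that] by auto
 note i1 = L2l_prod_integr[OF _ _ gm(1) gb'(1) gz'(1)] and i2 = L2l_prod_integr[OF _ _ gm(2) gb'(2) gz'(2)]
 have "integr (%p. (fst (g p) * A1 p * b p - fst (g p) * B1 p * a p) + (snd (g p) * A2 p * b p - snd (g p) * B2 p * a p))" by (intro integr_add integr_diff i1 i2 La Lb)
 then show "integr (%p. fst (g p) * (A1 p * b p - B1 p * a p) + snd (g p) * (A2 p * b p - B2 p * a p))" by (simp add: right_diff_distrib mult.assoc)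
 define Ps where "Ps p = cutoff_primitive R N (d p)" for p
 have cPs: "continuous_on UNIV (cutoff_primitive R N)" using cutoff_primitive_deriv by (auto simp: continuous_on_eq_continuous_at intro: DERIV_isCont)
 have i3: "integr (%p. ind (cball 0 s) p * (F p * b' p - G p * a' p))"
  if "L2l F" "L2l b'" "L2l G" "L2l a'" for F b' G a' :: "plane => real" and s proof -
  have m: "ind (cball 0 s) : borel_measurable (borel :: plane measure)" by (intro borel_measurable_indicator borel_closed closed_cball)
  have bz: "abs (ind (cball 0 s) p) <= (1::real)" "s < norm p ==> ind (cball 0 s) p = (0::real)" for p :: "plane" by (auto simp: indicator_def)
  note i = L2l_prod_integr[OF _ _ m bz]
  have "integr (%p. ind (cball 0 s) p * F p * b' p - ind (cball 0 s) p * G p * a' p)" by (intro integr_diff i that)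
  then show ?thesis by (simp add: right_diff_distrib mult.assoc)
 qed
 show "(LBINT p. fst (g p) * (A1 p * b p - B1 p * a p) + snd (g p) * (A2 p * b p - B2 p * a p)) = 0"
 proof (rule divergence_free_Lipschitz[where Ps=Ps and L="2 * Bd" and r=r and B="abs Bd + abs (N + 1)"])
  show "(%p. A1 p * b p - B1 p * a p) : Borel" "(%p. A2 p * b p - B2 p * a p) : Borel" by measurable
  show "integr (%p. ind (cball 0 s) p * (A1 p * b p - B1 p * a p))"
   "integr (%p. ind (cball 0 s) p * (A2 p * b p - B2 p * a p))" for s by (intro i3 La Lb)+
  show "(LBINT p. fst (D p) * (A1 p * b p - B1 p * a p) + snd (D p) * (A2 p * b p - B2 p * a p)) = 0"
   if "C2c_plane ps D D1 D2" for ps D D1 D2 by (rule flux_identity_C2[OF a va b vb V that])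
  show Psz: "Ps p = 0" if "r < norm p" for p unfolding Ps_def by (rule cutoff_primitive_zero) (use r[OF that] N in auto)
  show "abs (Ps (p - h) - Ps p) <= 2 * Bd * norm h" if h: "norm h <= 2" for p h proof (cases "norm p <= r + 2")
   case True
   have ph: "norm (p - h) <= r + 4" using norm_triangle_ineq4[of p h] True h by linarith
   have "abs (Ps (p - h) - Ps p) <= abs (d (p - h) - d p)" unfolding Ps_def by (rule cutoff_primitive_Lipschitz[OF N])
   also have "... <= 2 * Bd * norm (p - h - p)" by (rule convex_Lipschitz_on_cball[OF convex, of "r + 4"]) (use Bd ph True in auto)
   finally show ?thesis by simp
  next
   case False
   then have "r < norm p" "r < norm (p - h)" using norm_triangle_ineq2[of p h] h by linarith+
   moreover have "0 <= Bd" using Bd[of 0] by (auto simp: r_def intro: order_trans[OF abs_ge_zero])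
   ultimately show ?thesis using Psz by simp
  qed
  show "Ps : Borel" unfolding Ps_def by (intro borel_measurable_continuous_onI continuous_on_compose2[OF cPs cont]) auto
  show "abs (Ps p) <= abs Bd + abs (N + 1)" for p proof (cases "norm p <= r")
   case True
   have "abs (Ps p - cutoff_primitive R N (N + 1)) <= abs (d p - (N + 1))" unfolding Ps_def by (rule cutoff_primitive_Lipschitz[OF N])
   moreover have "cutoff_primitive R N (N + 1) = 0" by (rule cutoff_primitive_zero) (use N in auto)
   moreover have "abs (d p) <= Bd" by (rule Bd) (use True in simp)
   ultimately show ?thesis by linarith
  qed (use Psz[of p] in simp)
  show "AE p in lborel. gradient Ps (g p) p" using E(2) proof eventually_elim
   case (elim p)
   have "((%p. cutoff_primitive R N (d p)) has_derivative (%v. (grad d p \<bullet> v) * - cutoff R N (d p))) (at p)"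
    using has_derivative_compose[OF E(3)[OF elim] cutoff_primitive_deriv[of R N "d p", THEN has_field_derivative_imp_has_derivative]] by (simp add: mult.commute)
   then show ?case using elim by (simp add: Ps_def[abs_def] g_def mult.commute)
  qed
  show "g p = 0" if "r + 2 < norm p" for p using gz[of p] that by simp
 qed (rule gm)+
qed

text \<open>Multiplying \<open>radiation_defect_lower\<close> by the cut-off and integrating kills
  the flux, so \<beta>^2 |grad d| (a^2 + b^2) on R + 1 <= d <= N is controlled by the defect with a
  constant independent of N. Here \<open>c\<close> bounds |grad d| from below. N tends to infinity
  by monotone convergence, and a ball contains the rest, where local square integrability
  suffices.\<close>

theorem outgoing_L2:
 assumes a: "wgrad a A1 A2" and va: "vweak V a" and b: "wgrad b B1 B2" and vb: "vweak V b"
  and V: "V : Borel" "!!x. abs (V x) <= BV" and \<beta>: "\<beta> > 0"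
  and E: "E : sets borel" "AE p in lborel. p : E" "!!p. p : E ==> gradient d (grad d p) p"
  and R: "d p0 <= R"
  and fin: "(NN p. ind {p : E. R < d p} p * ennreal (weighted_defect d \<beta> a A1 A2 b B1 B2 p)) < \<infinity>"
 shows "L2 a" "L2 b"
proof -
 have La: "L2l a" "L2l A1" "L2l A2" and Lb: "L2l b" "L2l B1" "L2l B2" using a b by (auto simp: wgrad_def)
 note [measurable] = E(1) grad_measurable[OF cont]
 have [measurable]: "a : Borel" "A1 : Borel" "A2 : Borel"
   "b : Borel" "B1 : Borel" "B2 : Borel" using La Lb by (auto simp: L2l_def)
 have ng: "norm (grad d p) = sqrt ((fst (grad d p))^2 + (snd (grad d p))^2)" for p by (simp add: norm_prod_def)
 have ngm[measurable]: "(%p. norm (grad d p)) : Borel" unfolding ng by measurable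
 define Q where "Q p = ind {p : E. R < d p} p * (weighted_defect d \<beta> a A1 A2 b B1 B2 p)" for p
 have Q0: "0 <= Q p" for p by (simp add: Q_def radiation_defect_nonneg)
 have Qm[measurable]: "Q : Borel" unfolding Q_def radiation_defect_def by measurable
 have Qe: "ennreal (Q p) = ind {p : E. R < d p} p * ennreal (weighted_defect d \<beta> a A1 A2 b B1 B2 p)" for p by (simp add: Q_def indicator_def)
 have iQ: "integr Q" by (rule integrableI_nonneg) (use Q0 fin Qe in auto)
 obtain c where c: "c > 0" "!!p g. gradient d g p ==> R + 1 <= d p ==> c <= norm g" by (rule gradient_lower_bound[OF R]) blast
 define m where "m p = (a p)^2 + (b p)^2" for p
 have m0: "0 <= m p" for p by (simp add: m_def)
 have mm[measurable]: "m : Borel" unfolding m_def by measurable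
 define f where "f n p = ind {p. R + 1 <= d p & d p <= R + 1 + real n} p * ennreal (m p)" for n p
 have fm[measurable]: "f n : Borel" for n unfolding f_def by measurable
 have fb: "(NN p. f n p) <= ennreal ((LBINT p. Q p) / (c * \<beta>^2))" for n proof -
  define N where "N = R + 1 + real n"
  have N: "R + 1 <= N" by (simp add: N_def)
  define g where "g p = (if p : E then - cutoff R N (d p) else 0) *R grad d p" for p
  define w where "w p = fst (g p) * (A1 p * b p - B1 p * a p) + snd (g p) * (A2 p * b p - B2 p * a p)" for p
  have w: "(LBINT p. w p) = 0" "integr w" unfolding w_def g_def using cutoff_flux_zero[OF a va b vb V E N] by auto
  \<comment> \<open>The vector field \<open>g\<close> of the cut-off is minus \<open>cutoff\<close>
    times the gradient of \<open>d\<close>, so the cross term of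
    \<open>radiation_defect_lower\<close> appears as \<open>+ 2 * \<beta> * w p\<close>, and
    \<open>w\<close> integrates to 0.\<close>
  have key: "ind {p : E. R + 1 <= d p & d p <= N} p * ((c * \<beta>^2) * m p) <= Q p + 2 * \<beta> * w p" for p proof (cases "p : E & R < d p")
   case False
   then have "g p = 0" "Q p = 0" using cutoff_values(3)[OF N, of "d p"] by (auto simp: g_def Q_def)
   moreover have "ind {p : E. R + 1 <= d p & d p <= N} p = (0::real)" using False by (auto simp: indicator_def)
   ultimately show ?thesis by (simp add: w_def)
  next
   case True
   define et where "et = cutoff R N (d p)"
   have et: "0 <= et" "et <= 1" using cutoff_values[OF N] by (auto simp: et_def)
   have g0: "grad d p ~= 0" proof
    assume "grad d p = 0"
    then have "0 <= d p0 - d p" using subgradient[OF convex E(3)[of p], of p0] True by simp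
    then show False using True R by linarith
   qed
   have gp: "g p = - et *R grad d p" using True by (simp add: g_def et_def)
   define q where "q = weighted_defect d \<beta> a A1 A2 b B1 B2 p"
   have Qp: "Q p = q" using True by (simp add: Q_def q_def)
   have q0: "0 <= q" using Q0[of p] Qp by simp
   have "et * (norm (grad d p) * (\<beta>^2 * m p)) <= et * (q - 2 * \<beta> * (fst (grad d p) * (A1 p * b p - B1 p * a p) + snd (grad d p) * (A2 p * b p - B2 p * a p)))"
    unfolding m_def q_def by (rule mult_left_mono[OF radiation_defect_lower[OF g0] et(1)])
   also have "... = et * q + 2 * \<beta> * w p" unfolding w_def gp by (simp add: algebra_simps)
   also have "... <= q + 2 * \<beta> * w p" using mult_right_mono[OF et(2) q0] by simp
   finally have 1: "et * (norm (grad d p) * (\<beta>^2 * m p)) <= Q p + 2 * \<beta> * w p" by (simp add: Qp)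
   show ?thesis proof (cases "R + 1 <= d p & d p <= N")
    case True
    then have "et = 1" using cutoff_values(5)[OF N] by (simp add: et_def)
    moreover have "c * (\<beta>^2 * m p) <= norm (grad d p) * (\<beta>^2 * m p)" using c(2)[OF E(3)] True \<open>p : E & R < d p\<close> m0[of p] by (intro mult_right_mono) auto
    ultimately show ?thesis using 1 True \<open>p : E & R < d p\<close> by (simp add: mult.assoc)
   next
    case False
    have "0 <= et * (norm (grad d p) * (\<beta>^2 * m p))" using et m0 by simp
    then have "0 <= Q p + 2 * \<beta> * w p" using 1 by linarith
    then show ?thesis using False by (auto simp: indicator_def)
   qed
  qed
  define P where "P p = ind {p : E. R + 1 <= d p & d p <= N} p * ((c * \<beta>^2) * m p)" for p
  have P0: "0 <= P p" for p unfolding P_def using c(1) m0 by simp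
  have Pm: "P : Borel" unfolding P_def by measurable
  have ih: "integr (%p. Q p + 2 * \<beta> * w p)" using iQ w(2) by simp
  have iP: "integr P" proof (rule integr_bound[OF ih])
   show "P : borel_measurable lborel" using Pm by simp
   show "AE p in lborel. norm (P p) <= norm (Q p + 2 * \<beta> * w p)" proof (intro AE_I2)
    fix p show "norm (P p) <= norm (Q p + 2 * \<beta> * w p)" using key[of p] P0[of p] unfolding P_def real_norm_def by linarith
   qed
  qed
  have cb: "c * \<beta>^2 > 0" using c(1) \<beta> by simp
  have "(LBINT p. P p) <= (LBINT p. Q p + 2 * \<beta> * w p)" by (rule integral_mono[OF iP ih]) (use key in \<open>simp add: P_def\<close>)
  also have "... = (LBINT p. Q p)" using iQ w by simp
  finally have PQ: "(LBINT p. P p / (c * \<beta>^2)) <= (LBINT p. Q p) / (c * \<beta>^2)" using cb by (simp add: divide_right_mono)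
  have "(NN p. f n p) = (NN p. ennreal (P p / (c * \<beta>^2)))"
   by (rule nn_integral_cong_AE, use E(2) in eventually_elim) (use c(1) \<beta> in \<open>auto simp: f_def P_def N_def indicator_def\<close>)
  also have "... = ennreal (LBINT p. P p / (c * \<beta>^2))" by (rule nn_integral_eq_integral) (use iP P0 cb in \<open>auto intro!: AE_I2\<close>)
  also have "... <= ennreal ((LBINT p. Q p) / (c * \<beta>^2))" by (rule ennreal_leI[OF PQ])
  finally show ?thesis .
 qed
 have outer: "(NN p. (SUP n. f n p)) < \<infinity>" proof -
  have "(NN p. (SUP n. f n p)) = (SUP n. \<integral>\<^sup>+p. f n p \<partial>lborel)" proof (rule nn_integral_monotone_convergence_SUP)
   show "incseq f" unfolding incseq_def le_fun_def proof (intro allI impI)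
    fix i j :: nat and p assume "i <= j"
    then show "f i p <= f j p" unfolding f_def by (intro mult_right_mono) (auto simp: indicator_def)
   qed
  qed simp
  also have "... <= ennreal ((LBINT p. Q p) / (c * \<beta>^2))" by (rule SUP_least) (rule fb)
  also have "... < \<infinity>" by simp
  finally show ?thesis .
 qed
 obtain B' where B': "!!p. B' <= norm (p - p0) ==> R + 2 <= d p" by (rule far) blast
 define r where "r = abs B' + norm p0"
 have r: "R + 1 <= d p" if "r < norm p" for p using B'[of p] that norm_triangle_ineq2[of p p0] unfolding r_def by linarith
 have inner: "(NN p. ind (cball 0 r) p * ennreal (m p)) < \<infinity>" proof -
  have "integr (%p. (ind (cball 0 r) p * a p)^2 + (ind (cball 0 r) p * b p)^2)" using L2l_cut[OF La(1), of r] L2l_cut[OF Lb(1), of r] by (auto simp: L2_def)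
  from integrableD(2)[OF this] have "(NN p. ennreal (norm ((ind (cball 0 r) p * a p)^2 + (ind (cball 0 r) p * b p)^2))) < \<infinity>" by (simp add: top.not_eq_extremum)
  also have "(%p. ennreal (norm ((ind (cball 0 r) p * a p)^2 + (ind (cball 0 r) p * b p)^2))) = (%p. ind (cball 0 r) p * ennreal (m p))" by (auto simp: fun_eq_iff indicator_def m_def)
  finally show ?thesis .
 qed
 have "ennreal (m p) <= ind (cball 0 r) p * ennreal (m p) + (SUP n. f n p)" for p proof (cases "norm p <= r")
  case True
  then have "ind (cball 0 r) p = (1::ennreal)" by (simp add: indicator_def)
  then show ?thesis by simp
 next
  case False
  obtain n :: nat where n: "d p - (R + 1) <= real n" using real_arch_simple by blast
  have "f n p = ennreal (m p)" using r[of p] False n by (simp add: f_def indicator_def)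
  then have "ennreal (m p) <= (SUP n. f n p)" by (metis SUP_upper UNIV_I)
  then show ?thesis by (simp add: add_increasing)
 qed
 then have "(NN p. ennreal (m p)) <= (NN p. ind (cball 0 r) p * ennreal (m p) + (SUP n. f n p))" by (intro nn_integral_mono) auto
 also have "... = (NN p. ind (cball 0 r) p * ennreal (m p)) + (NN p. (SUP n. f n p))" proof (rule nn_integral_add)
  have [measurable]: "ind (cball 0 r) : borel_measurable (borel :: plane measure)" by (intro borel_measurable_indicator borel_closed closed_cball)
  show "(%p. ind (cball 0 r) p * ennreal (m p)) : borel_measurable lborel" by measurable
  show "(%p. SUP n. f n p) : borel_measurable lborel" by measurable
 qed
 also have "... < \<infinity>" using inner outer by (simp add: less_top[symmetric])
 finally have ab: "(NN p. ennreal ((a p)^2 + (b p)^2)) < \<infinity>" by (simp add: m_def)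
 show "L2 a" by (rule nn_integral_L2(1)[OF _ _ ab]) measurable
 show "L2 b" by (rule nn_integral_L2(2)[OF _ _ ab]) measurable
qed

end

section \<open>Uniqueness\<close>

lemma lebesgue_measurable_AE:
 fixes f :: "'a::euclidean_space => 'b::topological_space"
 assumes g: "g : Borel" and AE: "AE p in lborel. f p = g p"
 shows "f : borel_measurable lebesgue"
proof (rule measurableI)
 fix S :: "'b set" assume S: "S : sets borel"
 obtain N where N: "N : null_sets lborel" "{p : space lborel. ~ f p = g p} \<subseteq> N" using AE unfolding eventually_ae_filter by blast
 have "f -` S \<inter> N : sets lebesgue" by (rule sets_completionI_sub[OF N(1)]) auto
 moreover have "g -` S - N : sets lborel" using measurable_sets[OF g S] N(1) by auto
 then have "g -` S - N : sets lebesgue" by (rule sets_completionI_sets)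
 moreover have "f -` S \<inter> space lebesgue = (f -` S \<inter> N) \<union> (g -` S - N)" using N(2) by auto
 ultimately show "f -` S \<inter> space lebesgue : sets lebesgue" by (metis sets.Un)
qed simp

lemma complex_Borel_version:
 assumes "f : borel_measurable lebesgue"
 obtains a b where "a : Borel" "b : Borel" "AE p in lborel. f p = Complex (a p) (b p)"
proof -
 have m: "(%p. Re (f p)) : borel_measurable (completion lborel)" "(%p. Im (f p)) : borel_measurable (completion lborel)" using assms by measurable
 obtain a where a: "a : borel_measurable lborel" "AE p in lborel. Re (f p) = a p" using completion_ex_borel_measurable_real[OF m(1)] by blast
 obtain b where b: "b : borel_measurable lborel" "AE p in lborel. Im (f p) = b p" using completion_ex_borel_measurable_real[OF m(2)] by blast
 have "AE p in lborel. f p = Complex (a p) (b p)" using a(2) b(2) by eventually_elim (simp add: complex_eq_iff)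
 then show ?thesis using a(1) b(1) by (intro that) auto
qed

lemma integral_Complex_version:
 fixes f :: "'a::euclidean_space => complex"
 assumes a: "integr a" and b: "integr b" and AE: "AE p in lborel. f p = Complex (a p) (b p)"
 shows "(LINT p|lebesgue. f p) = Complex (LBINT p. a p) (LBINT p. b p)"
proof -
 have [measurable]: "a : Borel" "b : Borel" using a b by auto
 define g where "g p = of_real (a p) + \<i> * of_real (b p)" for p
 have g: "g : Borel" unfolding g_def by measurable
 have AE': "AE p in lborel. f p = g p" using AE by eventually_elim (simp add: g_def Complex_eq)
 have "(LINT p|lebesgue. f p) = (LINT p|lebesgue. g p)"
  by (rule integral_cong_AE) (use lebesgue_measurable_AE[OF g AE'] g AE_completion[OF AE'] in \<open>auto intro: measurable_completion\<close>)
 also have "... = (LBINT p. g p)" by (rule integral_completion) (use g in simp)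
 also have "... = of_real (LBINT p. a p) + \<i> * of_real (LBINT p. b p)" unfolding g_def using a b by (subst lint_add) auto
 finally show ?thesis by (simp add: Complex_eq)
qed

lemma L2_loc_imp_L2l:
 assumes f: "L2_loc f" and g: "g : Borel" and AE: "AE p in lborel. abs (g p) <= norm (f p)"
 shows "L2l g" unfolding L2l_def
proof (intro conjI allI)
 fix r
 have [measurable]: "ind (cball 0 r) : borel_measurable (borel :: plane measure)" by (intro borel_measurable_indicator borel_closed closed_cball)
 note [measurable] = g
 have m: "(%p. ind (cball 0 r) p * g p) : Borel" by measurable
 have m2: "(%p. (ind (cball 0 r) p * g p)^2) : borel_measurable lborel" by measurable
 have "integrable lebesgue (%p. ind (cball 0 r) p *R ((norm (f p))^2))" using f by (auto simp: L2_loc_def set_integrable_def)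
 then have "integrable lebesgue (%p. (ind (cball 0 r) p * g p)^2)" proof (rule integr_bound)
  show "(%p. (ind (cball 0 r) p * g p)^2) : borel_measurable lebesgue" by (rule measurable_completion[OF m2])
  show "AE p in lebesgue. norm ((ind (cball 0 r) p * g p)^2) <= norm (ind (cball 0 r) p *R ((norm (f p))^2))" using AE_completion[OF AE] proof eventually_elim
   case (elim p)
   then have "(abs (g p))^2 <= (norm (f p))^2" by (intro power_mono) auto
   then show ?case by (auto simp: indicator_def)
  qed
 qed
 then show "L2 (%p. ind (cball 0 r) p * g p)" unfolding L2_def using m integrable_completion[OF m2] by simp
qed (rule g)

lemma H1_loc_real_parts:
 assumes H: "H1_loc_gradient c G"
 obtains a A1 A2 b B1 B2 where "wgrad a A1 A2" "wgrad b B1 B2"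
  "AE p in lborel. c p = Complex (a p) (b p) & G p = (Complex (A1 p) (B1 p), Complex (A2 p) (B2 p))" proof -
 have L: "L2_loc c" "L2_loc G" using H by (auto simp: H1_loc_gradient_def)
 then have m: "c : borel_measurable lebesgue" "G : borel_measurable lebesgue" by (auto simp: L2_loc_def)
 note [measurable] = m(2)
 have mG: "(%p. fst (G p)) : borel_measurable lebesgue" "(%p. snd (G p)) : borel_measurable lebesgue" by measurable
 obtain a b where ab: "a : Borel" "b : Borel" "AE p in lborel. c p = Complex (a p) (b p)" by (rule complex_Borel_version[OF m(1)])
 obtain A1 B1 where AB1: "A1 : Borel" "B1 : Borel" "AE p in lborel. fst (G p) = Complex (A1 p) (B1 p)" by (rule complex_Borel_version[OF mG(1)])
 obtain A2 B2 where AB2: "A2 : Borel" "B2 : Borel" "AE p in lborel. snd (G p) = Complex (A2 p) (B2 p)" by (rule complex_Borel_version[OF mG(2)])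
 have cb: "abs x <= cmod (Complex x y)" "abs y <= cmod (Complex x y)" for x y using abs_Re_le_cmod[of "Complex x y"] abs_Im_le_cmod[of "Complex x y"] by simp_all
 have cG: "cmod (fst g) <= norm g" "cmod (snd g) <= norm g" for g :: "complex \<times> complex" by (metis norm_fst_le prod.collapse, metis norm_snd_le prod.collapse)
 have l: "L2l a" "L2l b" by (rule L2_loc_imp_L2l[OF L(1)], use ab in simp, use ab(3) in eventually_elim, simp add: cb)+
 have l1: "L2l A1" "L2l B1" by (rule L2_loc_imp_L2l[OF L(2)], use AB1 in simp, use AB1(3) in eventually_elim, metis cb cG order_trans)+
 have l2: "L2l A2" "L2l B2" by (rule L2_loc_imp_L2l[OF L(2)], use AB2 in simp, use AB2(3) in eventually_elim, metis cb cG order_trans)+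
 have e: "(LINT p|lebesgue. F p * of_real (ps p)) = Complex (LBINT p. x p * ps p) (LBINT p. y p * ps p)"
  if "AE p in lborel. F p = Complex (x p) (y p)" "integr (%p. x p * ps p)" "integr (%p. y p * ps p)" for F x y and ps :: "plane => real"
  by (rule integral_Complex_version[OF that(2,3)], use that(1) in eventually_elim) (simp add: complex_eq_iff)
 have w: "((LBINT p. a p * fst (D p)) = - (LBINT p. A1 p * \<phi> p) & (LBINT p. a p * snd (D p)) = - (LBINT p. A2 p * \<phi> p)) &
   ((LBINT p. b p * fst (D p)) = - (LBINT p. B1 p * \<phi> p) & (LBINT p. b p * snd (D p)) = - (LBINT p. B2 p * \<phi> p))"
  if t: "test_function \<phi> D" for \<phi> D proof -
  note i = L2l_test_integr[OF _ t]
  have "(LINT p|lebesgue. c p * of_real (fst (D p))) = - (LINT p|lebesgue. fst (G p) * of_real (\<phi> p))"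
    "(LINT p|lebesgue. c p * of_real (snd (D p))) = - (LINT p|lebesgue. snd (G p) * of_real (\<phi> p))" using H t by (auto simp: H1_loc_gradient_def)
  then show ?thesis unfolding e[OF ab(3) i(2)[OF l(1)] i(2)[OF l(2)]] e[OF ab(3) i(3)[OF l(1)] i(3)[OF l(2)]]
    e[OF AB1(3) i(1)[OF l1(1)] i(1)[OF l1(2)]] e[OF AB2(3) i(1)[OF l2(1)] i(1)[OF l2(2)]] by (simp add: complex_eq_iff)
 qed
 have "AE p in lborel. c p = Complex (a p) (b p) & G p = (Complex (A1 p) (B1 p), Complex (A2 p) (B2 p))" using ab(3) AB1(3) AB2(3) by eventually_elim (simp add: prod_eq_iff)
 then show ?thesis using l l1 l2 w by (intro that[of a A1 A2 b B1 B2]) (auto simp: wgrad_def)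
qed

lemma L2l_diff: "L2l a ==> L2l b ==> L2l (%p. a p - b p)" unfolding L2l_def right_diff_distrib by (auto intro: L2_diff)

lemma L2l_sum:
 assumes "!!i. i : I ==> L2l (a i)" shows "L2l (%p. \<Sum>i\<in>I. a i p)"
proof (cases "finite I")
 case True
 then show ?thesis using assms proof (induction I)
  case empty show ?case by (simp add: L2l_def L2_def)
 next
  case (insert i I)
  then have "L2l (a i)" "L2l (%p. \<Sum>i\<in>I. a i p)" by auto
  then have "L2l (%p. a i p + (\<Sum>i\<in>I. a i p))" unfolding L2l_def distrib_left by (auto intro: L2_add)
  then show ?case using insert by simp
 qed
qed (simp add: L2l_def L2_def)

lemma L2_sum:
 assumes "!!i. i : I ==> L2 (a i)" shows "L2 (%p. \<Sum>i\<in>I. a i p)"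
proof (cases "finite I")
 case True
 then show ?thesis using assms by (induction I) (auto simp: L2_def[of "%_. 0"] intro: L2_add)
qed (simp add: L2_def)

lemma wgrad_diff:
 assumes a: "wgrad a A1 A2" and b: "wgrad b B1 B2"
 shows "wgrad (%p. a p - b p) (%p. A1 p - B1 p) (%p. A2 p - B2 p)"
proof -
 have La: "L2l a" "L2l A1" "L2l A2" and Lb: "L2l b" "L2l B1" "L2l B2" using a b by (auto simp: wgrad_def)
 have "(LBINT p. (a p - b p) * fst (D p)) = - (LBINT p. (A1 p - B1 p) * \<phi> p) & (LBINT p. (a p - b p) * snd (D p)) = - (LBINT p. (A2 p - B2 p) * \<phi> p)"
  if t: "test_function \<phi> D" for \<phi> D using a b t L2l_test_integr[OF La(1) t] L2l_test_integr[OF Lb(1) t] L2l_test_integr(1)[OF La(2) t] L2l_test_integr(1)[OF Lb(2) t]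
   L2l_test_integr(1)[OF La(3) t] L2l_test_integr(1)[OF Lb(3) t] by (simp add: wgrad_def left_diff_distrib)
 then show ?thesis using La Lb by (auto simp: wgrad_def intro: L2l_diff)
qed

lemma vweak_integrable:
 assumes L: "L2l a" and V: "V : Borel" "!!x. abs (V x) <= BV" and t: "C2c_plane ps D D1 D2"
 shows "integr (%p. a p * schr V ps D1 D2 p)"
proof -
 have t0: "test_function ps D" and t1: "test_function (%p. fst (D p)) D1" and t2: "test_function (%p. snd (D p)) D2" using t by (auto simp: C2c_plane_def)
 note [measurable] = test_measurable[OF t0] V(1)
 obtain r where r: "!!p. r < norm p ==> ps p = 0" by (rule test_support[OF t0]) blast
 obtain B where B: "B >= 0" "!!p. abs (ps p) <= B" by (rule test_bounded[OF t0]) blast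
 have BV: "BV >= 0" using V(2)[of 0] by linarith
 have "integr (%p. a p * (V (fst p) * ps p))" proof (rule L2l_integrable[OF L])
  show "abs (V (fst p) * ps p) <= BV * B" for p unfolding abs_mult by (intro mult_mono V(2) B BV) auto
  show "V (fst p) * ps p = 0" if "r < norm p" for p using r that by simp
 qed measurable
 then show ?thesis using L2l_test_integr(2)[OF L t1] L2l_test_integr(3)[OF L t2] by (simp add: distrib_left)
qed

lemma vweak_diff:
 assumes "L2l a" "vweak V a" "L2l b" "vweak V b" and V: "V : Borel" "!!x. abs (V x) <= BV"
 shows "vweak V (%p. a p - b p)" unfolding vweak_def
proof (intro allI impI)
 fix ps D D1 D2 assume t: "C2c_plane ps D D1 D2"
 show "(LBINT p. (a p - b p) * schr V ps D1 D2 p) = 0" using assms(2,4) t vweak_integrable[OF assms(1) V t] vweak_integrable[OF assms(3) V t]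
  unfolding left_diff_distrib by (simp add: vweak_def)
qed

lemma vweak_sum:
 assumes "!!i. i : I ==> L2l (a i)" "!!i. i : I ==> vweak V (a i)" and V: "V : Borel" "!!x. abs (V x) <= BV"
 shows "vweak V (%p. \<Sum>i\<in>I. a i p)" unfolding vweak_def
proof (intro allI impI)
 fix ps D D1 D2 assume t: "C2c_plane ps D D1 D2"
 have "(LBINT p. (\<Sum>i\<in>I. a i p) * schr V ps D1 D2 p) = (\<Sum>i\<in>I. LBINT p. a i p * schr V ps D1 D2 p)"
  unfolding sum_distrib_right by (rule lint_sum) (rule vweak_integrable[OF assms(1) V t])
 then show "(LBINT p. (\<Sum>i\<in>I. a i p) * schr V ps D1 D2 p) = 0" using assms(2) t by (simp add: vweak_def)
qed

lemma vweak_cong_AE: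
 assumes v: "vweak V a" and a: "a : Borel" and b: "b : Borel"
  and V: "V : Borel" and AE: "AE p in lborel. b p = a p"
 shows "vweak V b" unfolding vweak_def
proof (intro allI impI)
 fix ps D D1 D2 assume t: "C2c_plane ps D D1 D2"
 then have ts: "test_function ps D" "test_function (%p. fst (D p)) D1" "test_function (%p. snd (D p)) D2" by (auto simp: C2c_plane_def)
 note [measurable] = test_measurable[OF ts(1)] test_measurable[OF ts(2)] test_measurable[OF ts(3)] a b V
 have "(LBINT p. b p * schr V ps D1 D2 p) = (LBINT p. a p * schr V ps D1 D2 p)" proof (rule integral_cong_AE)
  show "AE p in lborel. b p * schr V ps D1 D2 p = a p * schr V ps D1 D2 p" using AE by eventually_elim simp
 qed measurable
 then show "(LBINT p. b p * schr V ps D1 D2 p) = 0" using v t by (simp add: vweak_def)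
qed

text \<open>On the strip 1 + x^2 + z^2 <= (1 + Z^2) (1 + |x|)^2, so the weight decays at most like a
  power of 1 + |x|, with exponent m = -2 s; the inequality 1 + t <= exp t, with t = c |x| / m,
  absorbs this power into exp (c |x|).\<close>

lemma exp_weight_bound:
 fixes c s Z :: real
 assumes "c > 0" "s < 0" obtains K where "K >= 0"
  "!!x z. abs z <= Z ==> exp (- (c * abs x)) <= K * (1 + x^2 + z^2) powr s" proof -
 define m where "m = - 2 * s"
 have m: "m > 0" using assms by (simp add: m_def)
 define A where "A = max 1 (m / c)"
 have A: "A >= 1" "m / c <= A" by (auto simp: A_def)
 define K where "K = (1 + Z^2) powr (- s) * (A powr m)"
 show ?thesis proof (rule that[of K])
  show "K >= 0" by (simp add: K_def)
  fix x z :: real assume z: "abs z <= Z"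
  define W where "W = 1 + x^2 + z^2"
  have W: "W >= 1" by (simp add: W_def)
  have "z^2 <= Z^2" using z by (simp add: abs_le_square_iff[symmetric])
  moreover have "0 <= x^2 * Z^2" "0 <= (1 + Z^2) * (2 * abs x)" by simp_all
  ultimately have "W <= (1 + Z^2) * (1 + abs x)^2" unfolding W_def by (simp add: power2_eq_square algebra_simps)
  then have "W powr (- s) <= ((1 + Z^2) * (1 + abs x)^2) powr (- s)" using W assms by (intro powr_mono2) auto
  also have "... = (1 + Z^2) powr (- s) * ((1 + abs x)^2) powr (- s)" by (rule powr_mult)
  also have "((1 + abs x)^2) powr (- s) = (1 + abs x) powr m" proof -
   have "(1 + abs x)^2 = (1 + abs x) powr 2" by simp
   then show ?thesis by (simp only: powr_powr m_def) simp
  qed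
  also have "(1 + abs x) powr m <= (A * exp (c * abs x / m)) powr m" proof (rule powr_mono2)
   have "abs x = (m / c) * (c * abs x / m)" using m assms(1) by simp
   also have "... <= A * (c * abs x / m)" using A(2) m assms(1) by (intro mult_right_mono) auto
   finally have "1 + abs x <= A * (1 + c * abs x / m)" using A(1) by (simp only: distrib_left)
   also have "... <= A * exp (c * abs x / m)" using A(1) by (intro mult_left_mono exp_ge_add_one_self) auto
   finally show "1 + abs x <= A * exp (c * abs x / m)" .
  qed (use m in auto)
  also have "(A * exp (c * abs x / m)) powr m = A powr m * exp (c * abs x)" using m by (simp add: powr_mult exp_powr_real)
  finally have "W powr (- s) <= K * exp (c * abs x)" by (simp add: K_def mult.assoc mult_left_mono)
  then have "exp (- (c * abs x)) * W powr (- s) * W powr s <= exp (- (c * abs x)) * (K * exp (c * abs x)) * W powr s" by (intro mult_right_mono mult_left_mono) auto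
  moreover have "exp (- (c * abs x)) * (K * exp (c * abs x)) = K" by (simp add: exp_minus)
  moreover have "W powr (- s) * W powr s = 1" using W by (simp flip: powr_add)
  ultimately show "exp (- (c * abs x)) <= K * (1 + x^2 + z^2) powr s" by (simp add: W_def[symmetric] mult.assoc)
 qed
qed

text \<open>With f the exponential weight on the strip and W the polynomial one, |a| <= 1 + a^2 and
  f <= K W bound f |a| by f + K a^2 W, and both terms are integrable.\<close>

lemma L2_weighted_imp_expint:
 assumes u: "u : L2_weighted s" and s: "s < 0" and a: "a : Borel" and AE: "AE p in lborel. abs (a p) <= cmod (u p)"
 shows "expint a" unfolding expint_def
proof (intro conjI allI impI)
 fix c Z :: real assume c: "c > 0"
 obtain K where K: "K >= 0" "!!x z. abs z <= Z ==> exp (- (c * abs x)) <= K * (1 + x^2 + z^2) powr s" by (rule exp_weight_bound[OF c s, of Z]) blast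
 note [measurable] = a
 define W where "W p = (1 + (fst p)^2 + (snd p)^2) powr s" for p :: "plane"
 have Wm[measurable]: "W : Borel" unfolding W_def by measurable
 have W0: "0 <= W p" for p by (simp add: W_def)
 have i1: "integr (%p. (a p)^2 * W p)" proof (rule integrableI_nonneg)
  have "(NN p. ennreal ((a p)^2 * W p)) = (\<integral>\<^sup>+p. ennreal ((a p)^2 * W p) \<partial>lebesgue)" by (rule nn_integral_completion[symmetric])
  also have "... <= (\<integral>\<^sup>+p. ennreal ((cmod (u p))^2 * (1 + (fst p)^2 + (snd p)^2) powr s) \<partial>lebesgue)"
  proof (rule nn_integral_mono_AE, use AE_completion[OF AE] in eventually_elim)
   fix p assume "abs (a p) <= cmod (u p)"
   then have "(abs (a p))^2 <= (cmod (u p))^2" by (intro power_mono) auto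
   then show "ennreal ((a p)^2 * W p) <= ennreal ((cmod (u p))^2 * (1 + (fst p)^2 + (snd p)^2) powr s)" unfolding W_def by (intro ennreal_leI mult_right_mono) auto
  qed
  also have "... < \<infinity>" using u by (simp add: L2_weighted_def)
  finally show "(NN p. ennreal ((a p)^2 * W p)) < \<infinity>" .
 qed (use W0 in auto)
 define f where "f p = ind {-Z..Z} (snd p) * exp (- (c * abs (fst p)))" for p :: "plane"
 have fm[measurable]: "f : Borel" unfolding f_def by measurable
 have f0: "0 <= f p" for p by (simp add: f_def)
 have i2: "integr f" proof -
  have iZ: "integr (%z. ind {-Z..Z} z :: real)" by (simp add: integrable_indicator_iff emeasure_lborel_Icc_eq)
  have "integrable lborel2 (%(x, z). exp (- (c * abs x)) * (ind {-Z..Z} z * 1))" by (rule abs_product_integrable[where B=1, OF exp_abs_integrable[OF c] iZ]) auto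
  then show ?thesis by (simp add: lborel_prod f_def[abs_def] case_prod_unfold mult.commute)
 qed
 have fW: "f p <= K * W p" for p using K(2)[of "snd p" "fst p"] K(1) W0[of p] by (auto simp: f_def indicator_def W_def abs_le_iff)
 show "integr (%p. ind {-Z..Z} (snd p) * exp (- (c * abs (fst p))) * a p)" proof (rule integr_bound[of _ "%p. f p + K * ((a p)^2 * W p)"])
  show "integr (%p. f p + K * ((a p)^2 * W p))" using i1 i2 by simp
  show "AE p in lborel. norm (ind {-Z..Z} (snd p) * exp (- (c * abs (fst p))) * a p) <= norm (f p + K * ((a p)^2 * W p))" proof (intro AE_I2)
   fix p
   have "0 <= (abs (a p) - 1)^2" "0 <= (a p)^2" by simp_all
   then have "abs (a p) <= 1 + (a p)^2" by (simp add: power2_eq_square algebra_simps)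
   then have "f p * abs (a p) <= f p * (1 + (a p)^2)" by (rule mult_left_mono[OF _ f0])
   also have "... = f p + f p * (a p)^2" by (simp add: distrib_left)
   also have "f p * (a p)^2 <= (K * W p) * (a p)^2" by (rule mult_right_mono[OF fW]) simp
   finally have "f p * abs (a p) <= f p + K * ((a p)^2 * W p)" by (simp add: mult_ac)
   moreover have "norm (ind {-Z..Z} (snd p) * exp (- (c * abs (fst p))) * a p) = f p * abs (a p)" using f0[of p] by (simp add: f_def abs_mult)
   ultimately show "norm (ind {-Z..Z} (snd p) * exp (- (c * abs (fst p))) * a p) <= norm (f p + K * ((a p)^2 * W p))" unfolding real_norm_def by linarith
  qed
 qed measurable
qed (rule a)

lemma AE_slices:
 assumes "AE p in lborel. P (p :: plane)"
 shows "AE z in lborel. AE x in lborel. P (x, z)"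
proof -
 from AE_E[OF assms] obtain N where N: "{p : space lborel. ~ P p} \<subseteq> N" "emeasure lborel N = 0" "N : sets lborel" by blast
 have N': "N : sets lborel2" using N(3) by (simp only: lborel_prod)
 have "(NN z. emeasure lborel ((%x. (x, z)) -` N)) = 0" using lborel_pair.emeasure_pair_measure_alt2[OF N'] N(2) by (simp add: lborel_prod)
 then have "AE z in lborel. emeasure lborel ((%x. (x, z)) -` N) = 0" using nn_integral_0_iff_AE[OF lborel_pair.measurable_emeasure_Pair2[OF N']] by simp
 then show ?thesis proof eventually_elim
  case (elim z)
  show ?case by (rule AE_I[OF _ elim]) (use N(1) sets_Pair2[OF N', of z] in auto)
 qed
qed

text \<open>Fubini on each strip |z| <= n, and countably many strips cover the plane. It is what
  makes the mode coefficient additive for almost every z, since a Bochner integral of a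
  non-integrable slice would be 0.\<close>

lemma (in bound_state) slice_integrable:
 assumes a: "expint a"
 shows "AE z in lborel. integr (%x. a (x, z) * e x)"
proof -
 have "AE z in lborel. integr (%x. a (x, z) * (ind {- real n..real n} z * e x))" for n proof -
  have "integr (%p. a p * (ind {- real n..real n} (snd p) * e (fst p)))" proof (rule expint_integrable[OF a c_pos, of _ C "real n"])
   show "abs (ind {- real n..real n} (snd p) * e (fst p)) <= C * exp (- (c * abs (fst p)))" for p :: "plane" using e_bound[of "fst p"] C_nonneg by (auto simp: indicator_def)
   show "ind {- real n..real n} (snd p) * e (fst p) = 0" if "real n < abs (snd p)" for p :: "plane" proof -
    have "snd p ~: {- real n..real n}" using that by auto
    then show ?thesis by simp
   qed
  qed measurable
  then have "integrable lborel2 (%(x, z). a (x, z) * (ind {- real n..real n} z * e x))" by (simp add: lborel_prod case_prod_unfold)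
  from lborel_pair.AE_integrable_snd[OF this] show ?thesis by simp
 qed
 then have "AE z in lborel. ALL n. integr (%x. a (x, z) * (ind {- real n..real n} z * e x))" by (simp add: AE_all_countable)
 then show ?thesis proof eventually_elim
  case (elim z)
  obtain n :: nat where "abs z <= real n" using real_arch_simple by blast
  then have "ind {- real n..real n} z = (1::real)" by (auto simp: indicator_def abs_le_iff)
  then show ?case using elim[rule_format, of n] by simp
 qed
qed

lemma arclength_integral_cong:
 assumes "!!p. p : C ==> g p = g' p" shows "arclength_integral C g = arclength_integral C g'" unfolding arclength_integral_def
proof (intro SUP_cong refl nn_integral_cong)
 fix \<gamma> t assume \<gamma>: "\<gamma> : lipschitz_loops C"
 have "\<gamma> t : C" if "t : {0..1}" using \<gamma> that by (auto simp: lipschitz_loops_def path_image_def)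
 then show "g (\<gamma> t) * ennreal (norm (vector_derivative \<gamma> (at t within {0..1}))) * ind {0..1} t =
   g' (\<gamma> t) * ennreal (norm (vector_derivative \<gamma> (at t within {0..1}))) * ind {0..1} t" using assms by (cases "t : {0..1}") auto
qed

lemma cmod_radiation_defect:
 "(cmod (dot (g /\<^sub>R norm g) (Complex A1 B1, Complex A2 B2) - \<i> * of_real \<beta> * Complex a b))^2 = radiation_defect g \<beta> a A1 A2 b B1 B2" proof -
 have "(cmod (dot v (Complex A1 B1, Complex A2 B2) - \<i> * of_real \<beta> * Complex a b))^2 =
   (fst v * A1 + snd v * A2 + \<beta> * b)^2 + (fst v * B1 + snd v * B2 - \<beta> * a)^2" for v by (simp add: cmod_power2 dot_def)
 then show ?thesis by (simp add: radiation_defect_def divide_inverse mult.commute)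
qed

abbreviation (input) "radiation_flux d \<beta> c G \<equiv> (\<integral>\<^sup>+ R\<in>{0<..}. arclength_integral (frontier (sublevel d R))
  (%p. ennreal ((cmod (dot (outward_unit_normal (sublevel d R) p) (G p) - \<i> * of_real \<beta> * c p))^2)) \<partial>lebesgue)"

text \<open>On \<open>E\<close> the normal is the normalised gradient and the complex data equal
  their real Borel versions, so the area integrand is a Borel minorant as
  \<open>coarea_inequality\<close> requires. Above the level R >= d p0 the gradient does not vanish,
  and R >= 0 keeps the levels inside the range of the radiation integral.\<close>

lemma (in convex_well) radiation_defect_finite:
 assumes E: "E : sets borel" "!!p. p : E ==> gradient d (grad d p) p"
  and eq: "!!p. p : E ==> c p = Complex (a p) (b p) & G p = (Complex (A1 p) (B1 p), Complex (A2 p) (B2 p))"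
  and a: "wgrad a A1 A2" and b: "wgrad b B1 B2" and R: "d p0 <= R" "0 <= R"
  and fin: "radiation_flux d \<beta> c G < \<infinity>"
 shows "(NN p. ind {p : E. R < d p} p * ennreal (weighted_defect d \<beta> a A1 A2 b B1 B2 p)) < \<infinity>"
proof -
 have [measurable]: "a : Borel" "A1 : Borel" "A2 : Borel"
   "b : Borel" "B1 : Borel" "B2 : Borel" using a b by (auto simp: wgrad_def L2l_def)
 note [measurable] = E(1) grad_measurable[OF cont]
 have ng: "norm (grad d p) = sqrt ((fst (grad d p))^2 + (snd (grad d p))^2)" for p by (simp add: norm_prod_def)
 define E' where "E' = {p : E. R < d p}"
 define F where "F p = ennreal (radiation_defect (grad d p) \<beta> (a p) (A1 p) (A2 p) (b p) (B1 p) (B2 p))" for p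
 define F' where "F' p = ennreal ((cmod (dot (outward_unit_normal (sublevel d (d p)) p) (G p) - \<i> * of_real \<beta> * c p))^2)" for p
 have "(NN p. ind {p : E'. R < d p} p * (ennreal (norm (grad d p)) * F p))
  <= (NN R'. ind {R<..} R' * arclength_integral (frontier (sublevel d R')) F')" proof (rule coarea_inequality[OF _ _ _ _ R(1)])
  show "E' : sets borel" unfolding E'_def by measurable
  show "F : Borel" unfolding F_def radiation_defect_def ng by measurable
  fix p assume p: "p : E'"
  then show der: "gradient d (grad d p) p" using E(2) by (simp add: E'_def)
  have g0: "grad d p ~= 0" proof
   assume "grad d p = 0"
   then have "0 <= d p0 - d p" using subgradient[OF convex der, of p0] by simp
   then show False using p R by (simp add: E'_def)
  qed
  have "c p = Complex (a p) (b p)" "G p = (Complex (A1 p) (B1 p), Complex (A2 p) (B2 p))" using eq[of p] p by (auto simp: E'_def)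
  then have "F' p = F p" unfolding F'_def F_def normal_unique[OF convex der g0] by (simp only: cmod_radiation_defect)
  then show "F p <= F' p" by simp
 qed
 also have "... <= (\<integral>\<^sup>+ R\<in>{0<..}. arclength_integral (frontier (sublevel d R))
    (%p. ennreal ((cmod (dot (outward_unit_normal (sublevel d R) p) (G p) - \<i> * of_real \<beta> * c p))^2)) \<partial>lborel)" proof (rule nn_integral_mono)
  fix R' :: real
  show "ind {R<..} R' * arclength_integral (frontier (sublevel d R')) F' <=
   arclength_integral (frontier (sublevel d R')) (%p. ennreal ((cmod (dot (outward_unit_normal (sublevel d R') p) (G p) - \<i> * of_real \<beta> * c p))^2)) * ind {0<..} R'" proof (cases "R < R'")
   case True
   have "frontier (sublevel d R') = {p. d p = R'}" by (rule frontier_sublevel) (use True R in simp)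
   then have "arclength_integral (frontier (sublevel d R')) F' =
    arclength_integral (frontier (sublevel d R')) (%p. ennreal ((cmod (dot (outward_unit_normal (sublevel d R') p) (G p) - \<i> * of_real \<beta> * c p))^2))"
    by (intro arclength_integral_cong) (simp add: F'_def)
   then show ?thesis using True R(2) by simp
  qed simp
 qed
 also have "... < \<infinity>" using fin by (simp only: nn_integral_completion)
 finally have "(NN p. ind {p : E'. R < d p} p * (ennreal (norm (grad d p)) * F p)) < \<infinity>" .
 moreover have "ind {p : E'. R < d p} p * (ennreal (norm (grad d p)) * F p) = ind {p : E. R < d p} p * ennreal (weighted_defect d \<beta> a A1 A2 b B1 B2 p)" for p
  by (simp add: F_def E'_def ennreal_mult radiation_defect_nonneg)
 ultimately show ?thesis by simp
qed

definition mode_part :: "(real => real) => (plane => real) => plane => real" where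
 "mode_part e a p = e (fst p) * (LBINT xi. a (xi, snd p) * e xi)"

context bound_state
begin

lemma mode_part_measurable:
 assumes [measurable]: "a : Borel" shows "mode_part e a : Borel"
proof -
 have [measurable]: "(%z. LBINT xi. a (xi, z) * e xi) : Borel" by (rule param_integral_Borel) measurable
 show ?thesis unfolding mode_part_def by measurable
qed

lemma mode_part_diff:
 assumes "expint a" "expint a'"
 shows "AE p in lborel. mode_part e (%p. a p - a' p) p = mode_part e a p - mode_part e a' p"
proof -
 have "AE z in lborel. (LBINT xi. (a (xi, z) - a' (xi, z)) * e xi) = (LBINT xi. a (xi, z) * e xi) - (LBINT xi. a' (xi, z) * e xi)"
  using slice_integrable[OF assms(1)] slice_integrable[OF assms(2)] by eventually_elim (simp add: left_diff_distrib)
 from AE_snd_lborel[OF this] show ?thesis by eventually_elim (simp add: mode_part_def right_diff_distrib)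
qed

text \<open>\<open>component_pairing\<close> moves the test from the mode part to \<open>a\<close>,
  and \<open>separated_pairing\<close> evaluates the result to 0.\<close>

lemma mode_part_vweak:
 assumes a: "expint a" and v: "vweak V a" and L: "L2l (mode_part e a)"
 shows "vweak V (mode_part e a)" unfolding vweak_def
proof (intro allI impI)
 fix ps D D1 D2 assume t: "C2c_plane ps D D1 D2"
 have "(LBINT p. mode_part e a p * schr V ps D1 D2 p) =
  (LBINT p. a p * (e (fst p) * ((LBINT x. e x * snd (D2 (x, snd p))) + b2 * (LBINT x. e x * ps (x, snd p)))))" by (rule component_pairing[OF a L _ t]) (simp add: mode_part_def)
 also have "... = 0" proof (rule separated_pairing[OF a _ moment_C2c[OF t]])
  fix al al1 al2 \<beta> \<beta>1 \<beta>2 assume "C2c al al1 al2" "C2c \<beta> \<beta>1 \<beta>2"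
  from v[unfolded vweak_def, rule_format, OF C2c_plane_prod[OF this]]
  show "(LBINT p. a p * (al2 (fst p) * \<beta> (snd p) + al (fst p) * \<beta>2 (snd p) + V (fst p) * al (fst p) * \<beta> (snd p))) = 0" by (simp add: mult.assoc)
 qed
 finally show "(LBINT p. mode_part e a p * schr V ps D1 D2 p) = 0" .
qed

end

lemma L2l_cong_AE:
 assumes a: "L2l a" and b: "b : Borel" and AE: "AE p in lborel. b p = a p"
 shows "L2l b"
proof -
 have [measurable]: "ind (cball 0 r) : borel_measurable (borel :: plane measure)" for r by (intro borel_measurable_indicator borel_closed closed_cball)
 have [measurable]: "a : Borel" using a by (simp add: L2l_def)
 note [measurable] = b
 have "integr (%p. (ind (cball 0 r) p * b p)^2)" for r proof (rule integrable_cong_AE_imp)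
  show "integr (%p. (ind (cball 0 r) p * a p)^2)" using L2l_cut[OF a, of r] by (simp add: L2_def)
  show "AE p in lborel. (ind (cball 0 r) p * a p)^2 = (ind (cball 0 r) p * b p)^2" using AE by eventually_elim simp
 qed measurable
 then show ?thesis using b unfolding L2l_def L2_def by simp
qed

section \<open>Components of the difference of two radiating solutions\<close>

context waveguide
begin

text \<open>The coefficient \<open>U\<close> is a complex Lebesgue integral over a horizontal line;
  for almost every z the Borel versions agree with \<open>u\<close> almost everywhere on that line
  and are integrable against the mode, so real and imaginary parts separate.\<close>

lemma component_version:
 assumes bs: "bound_state V0 (e l) BV C c b2" and l: "l : {1..M}"
  and u: "AE p in lborel. u p = Complex (a p) (b p)" and ab: "expint a" "expint b"
 shows "AE p in lborel. component u l p = Complex (mode_part (e l) a p) (mode_part (e l) b p)"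
proof -
 interpret mode: bound_state V0 "e l" BV C c b2 by (rule bs)
 have "AE z in lborel. U u l z = Complex (LBINT xi. a (xi, z) * e l xi) (LBINT xi. b (xi, z) * e l xi)" using AE_slices[OF u] mode.slice_integrable[OF ab(1)] mode.slice_integrable[OF ab(2)]
 proof eventually_elim
  case (elim z)
  show ?case unfolding U_def proof (rule integral_Complex_version[OF elim(2,3)])
   show "AE xi in lborel. u (xi, z) * of_real (e l xi) = Complex (a (xi, z) * e l xi) (b (xi, z) * e l xi)" using elim(1) by eventually_elim (simp add: complex_eq_iff)
  qed
 qed
 from AE_snd_lborel[OF this] show ?thesis by eventually_elim (use l in \<open>simp add: component_def mode_part_def complex_eq_iff\<close>)
qed

text \<open>Moving the remaining derivative onto the test function eliminates the gradient. The
  right sides involve \<open>f\<close> alone and are therefore the same for two solutions, so they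
  cancel in the difference.\<close>

lemma weak_solution_real_parts:
 assumes sol: "weak_solution f u" and V0: "V0 : Borel" "!!x. abs (V0 x) <= BV"
  and AE: "AE x in lborel. V0 x = k^2 * (n x)^2"
 obtains a b where "L2l a" "L2l b" "AE p in lborel. u p = Complex (a p) (b p)"
  "!!ps D D1 D2. C2c_plane ps D D1 D2 ==> (LBINT p. a p * schr V0 ps D1 D2 p) = Re (LINT p|lebesgue. f p * of_real (ps p))"
  "!!ps D D1 D2. C2c_plane ps D D1 D2 ==> (LBINT p. b p * schr V0 ps D1 D2 p) = Im (LINT p|lebesgue. f p * of_real (ps p))" proof -
 obtain G where G: "H1_loc_gradient u G" and w: "!!ps D. test_function ps D ==>
     - (LINT p|lebesgue. dot (D p) (G p)) + (LINT p|lebesgue. of_real (k^2 * (n (fst p))^2) * u p * of_real (ps p))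
     = (LINT p|lebesgue. f p * of_real (ps p))" using sol unfolding weak_solution_def by blast
 obtain a A1 A2 b B1 B2 where wg: "wgrad a A1 A2" "wgrad b B1 B2"
  and eq: "AE p in lborel. u p = Complex (a p) (b p) & G p = (Complex (A1 p) (B1 p), Complex (A2 p) (B2 p))" by (rule H1_loc_real_parts[OF G])
 have L: "L2l a" "L2l A1" "L2l A2" "L2l b" "L2l B1" "L2l B2" using wg by (auto simp: wgrad_def)
 have AE': "AE p in (lborel :: plane measure). V0 (fst p) = k^2 * (n (fst p))^2" by (rule AE_fst_lborel[OF AE])
 have main: "(LBINT p. a p * schr V0 ps D1 D2 p) = Re (LINT p|lebesgue. f p * of_real (ps p)) &
   (LBINT p. b p * schr V0 ps D1 D2 p) = Im (LINT p|lebesgue. f p * of_real (ps p))"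
  if t: "C2c_plane ps D D1 D2" for ps D D1 D2 proof -
  have t0: "test_function ps D" and t1: "test_function (%p. fst (D p)) D1" and t2: "test_function (%p. snd (D p)) D2" using t by (auto simp: C2c_plane_def)
  note [measurable] = test_measurable[OF t0] V0(1)
  obtain r where r: "!!p. r < norm p ==> ps p = 0" by (rule test_support[OF t0]) blast
  obtain B where B: "B >= 0" "!!p. abs (ps p) <= B" by (rule test_bounded[OF t0]) blast
  have BV: "BV >= 0" using V0(2)[of 0] by linarith
  have iV: "integr (%p. x p * (V0 (fst p) * ps p))" if "L2l x" for x proof (rule L2l_integrable[OF that])
   show "abs (V0 (fst p) * ps p) <= BV * B" for p unfolding abs_mult by (intro mult_mono V0(2) B BV) auto
   show "V0 (fst p) * ps p = 0" if "r < norm p" for p using r that by simp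
  qed measurable
  have e1: "(LINT p|lebesgue. dot (D p) (G p)) = Complex (LBINT p. A1 p * fst (D p) + A2 p * snd (D p)) (LBINT p. B1 p * fst (D p) + B2 p * snd (D p))" proof (rule integral_Complex_version)
   show "integr (%p. A1 p * fst (D p) + A2 p * snd (D p))" "integr (%p. B1 p * fst (D p) + B2 p * snd (D p))"
    by (intro integr_add L2l_test_integr(1)[OF _ t1] L2l_test_integr(1)[OF _ t2] L)+
   show "AE p in lborel. dot (D p) (G p) = Complex (A1 p * fst (D p) + A2 p * snd (D p)) (B1 p * fst (D p) + B2 p * snd (D p))"
    using eq by eventually_elim (simp add: dot_def complex_eq_iff mult.commute)
  qed
  have e2: "(LINT p|lebesgue. of_real (k^2 * (n (fst p))^2) * u p * of_real (ps p)) = Complex (LBINT p. a p * (V0 (fst p) * ps p)) (LBINT p. b p * (V0 (fst p) * ps p))"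
  proof (rule integral_Complex_version[OF iV iV])
   show "AE p in lborel. of_real (k^2 * (n (fst p))^2) * u p * of_real (ps p) = Complex (a p * (V0 (fst p) * ps p)) (b p * (V0 (fst p) * ps p))" using eq AE' proof eventually_elim
    case (elim p)
    have "u p = Complex (a p) (b p)" using elim(1) by blast
    then show ?case unfolding elim(2)[symmetric] by (simp only:) (simp add: complex_eq_iff mult_ac)
   qed
  qed (use L in auto)
  have s: "(LBINT p. x p * schr V0 ps D1 D2 p) = - (LBINT p. X1 p * fst (D p) + X2 p * snd (D p)) + (LBINT p. x p * (V0 (fst p) * ps p))"
   if x: "wgrad x X1 X2" for x X1 X2 proof -
   have Lx: "L2l x" "L2l X1" "L2l X2" using x by (auto simp: wgrad_def)
   have "(LBINT p. x p * fst (D1 p)) = - (LBINT p. X1 p * fst (D p))" "(LBINT p. x p * snd (D2 p)) = - (LBINT p. X2 p * snd (D p))" using x t1 t2 by (auto simp: wgrad_def)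
   then show ?thesis using L2l_test_integr(2)[OF Lx(1) t1] L2l_test_integr(3)[OF Lx(1) t2] iV[OF Lx(1)]
     L2l_test_integr(1)[OF Lx(2) t1] L2l_test_integr(1)[OF Lx(3) t2] by (simp add: distrib_left)
  qed
  have "(LINT p|lebesgue. f p * of_real (ps p)) = - Complex (LBINT p. A1 p * fst (D p) + A2 p * snd (D p)) (LBINT p. B1 p * fst (D p) + B2 p * snd (D p))
    + Complex (LBINT p. a p * (V0 (fst p) * ps p)) (LBINT p. b p * (V0 (fst p) * ps p))" using w[OF t0] unfolding e1 e2 by (rule sym)
  then show ?thesis unfolding s[OF wg(1)] s[OF wg(2)] by simp
 qed
 have "AE p in lborel. u p = Complex (a p) (b p)" using eq by eventually_elim blast
 then show ?thesis using L main by (intro that[of a b]) auto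
qed

text \<open>Square integrability is stated under the proviso that the component of the difference
  solves the equation: for index 0 this is known only after all guided components have been treated,
  whereas the gradients and the radiation bounds are at hand here.\<close>

lemma component_outgoing:
 assumes well: "convex_well d p0" and u: "radiation_condition d u" and w: "radiation_condition d w" and l: "l <= M"
  and V0: "V0 : Borel" "!!x. abs (V0 x) <= BV"
 obtains a b where "L2l a" "L2l b" "AE p in lborel. component u l p - component w l p = Complex (a p) (b p)"
  "vweak V0 a ==> vweak V0 b ==> L2 a & L2 b" proof -
 interpret convex_well d p0 by (rule well)
 have rad: "EX G. H1_loc_gradient (component y l) G & radiation_flux d (\<beta> l) (component y l) G < \<infinity>"
  if y: "radiation_condition d y" for y proof -
  define I where "I G j = radiation_flux d (\<beta> j) (component y j) (G j)" for G j
  obtain G where G: "ALL l<=M. H1_loc_gradient (component y l) (G l)" "(\<Sum>j = 0..M. I G j) < \<infinity>" using y unfolding radiation_condition_def I_def by blast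
  have "I G l <= (\<Sum>j = 0..M. I G j)" by (rule member_le_sum) (use l in auto)
  then have "I G l < \<infinity>" using G(2) by (rule order.strict_trans1)
  then show ?thesis using G(1) l unfolding I_def by blast
 qed
 obtain Gu where Gu: "H1_loc_gradient (component u l) Gu" "radiation_flux d (\<beta> l) (component u l) Gu < \<infinity>" using rad[OF u] by blast
 obtain Gw where Gw: "H1_loc_gradient (component w l) Gw" "radiation_flux d (\<beta> l) (component w l) Gw < \<infinity>" using rad[OF w] by blast
 obtain a A1 A2 b B1 B2 where wu: "wgrad a A1 A2" "wgrad b B1 B2"
  and eu: "AE p in lborel. component u l p = Complex (a p) (b p) & Gu p = (Complex (A1 p) (B1 p), Complex (A2 p) (B2 p))" by (rule H1_loc_real_parts[OF Gu(1)])
 obtain a' A1' A2' b' B1' B2' where ww: "wgrad a' A1' A2'" "wgrad b' B1' B2'"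
  and ew: "AE p in lborel. component w l p = Complex (a' p) (b' p) & Gw p = (Complex (A1' p) (B1' p), Complex (A2' p) (B2' p))" by (rule H1_loc_real_parts[OF Gw(1)])
 note wd = wgrad_diff[OF wu(1) ww(1)] wgrad_diff[OF wu(2) ww(2)]
 define Q where "Q p \<longleftrightarrow> gradient d (grad d p) p &
   (component u l p = Complex (a p) (b p) & Gu p = (Complex (A1 p) (B1 p), Complex (A2 p) (B2 p))) &
   (component w l p = Complex (a' p) (b' p) & Gw p = (Complex (A1' p) (B1' p), Complex (A2' p) (B2' p)))" for p
 have "AE p in lborel. Q p" using convex_AE_differentiable[OF convex] eu ew unfolding Q_def by eventually_elim blast
 then obtain N where N: "N : null_sets lborel" "{p : space lborel. ~ Q p} \<subseteq> N" unfolding eventually_ae_filter by blast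
 define E where "E = - N"
 have E: "E : sets borel" "AE p in lborel. p : E" using N(1) AE_not_in[OF N(1)] by (auto simp: E_def)
 have EQ: "Q p" if "p : E" for p using N(2) that by (auto simp: E_def)
 have Ed: "gradient d (grad d p) p" if "p : E" for p using EQ[OF that] unfolding Q_def by blast
 have Eu: "component u l p = Complex (a p) (b p) & Gu p = (Complex (A1 p) (B1 p), Complex (A2 p) (B2 p))"
  and Ew: "component w l p = Complex (a' p) (b' p) & Gw p = (Complex (A1' p) (B1' p), Complex (A2' p) (B2' p))" if "p : E" for p using EQ[OF that] unfolding Q_def by blast+
 \<comment> \<open>The radiation integral runs over positive levels, while the minimum of
   \<open>d\<close> may have either sign.\<close>
 define R where "R = max 0 (d p0)"
 have R: "d p0 <= R" "0 <= R" by (auto simp: R_def)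
 have fu: "(NN p. ind {p : E. R < d p} p * ennreal (weighted_defect d (\<beta> l) a A1 A2 b B1 B2 p)) < \<infinity>" by (rule radiation_defect_finite[OF E(1) Ed Eu wu R Gu(2)])
 have fw: "(NN p. ind {p : E. R < d p} p * ennreal (weighted_defect d (\<beta> l) a' A1' A2' b' B1' B2' p)) < \<infinity>" by (rule radiation_defect_finite[OF E(1) Ed Ew ww R Gw(2)])
 define S S' where "S p = weighted_defect d (\<beta> l) a A1 A2 b B1 B2 p"
  and "S' p = weighted_defect d (\<beta> l) a' A1' A2' b' B1' B2' p" for p
 have S0: "0 <= S p" "0 <= S' p" for p by (simp_all add: S_def S'_def radiation_defect_nonneg)
 have [measurable]: "a : Borel" "A1 : Borel" "A2 : Borel"
   "b : Borel" "B1 : Borel" "B2 : Borel"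
   "a' : Borel" "A1' : Borel" "A2' : Borel"
   "b' : Borel" "B1' : Borel" "B2' : Borel" using wu ww by (auto simp: wgrad_def L2l_def)
 note [measurable] = E(1) grad_measurable[OF cont]
 have ng: "norm (grad d p) = sqrt ((fst (grad d p))^2 + (snd (grad d p))^2)" for p by (simp add: norm_prod_def)
 have Sm[measurable]: "S : Borel" "S' : Borel" unfolding S_def S'_def radiation_defect_def ng by measurable
 let ?T = "%p. norm (grad d p) * radiation_defect (grad d p) (\<beta> l) (a p - a' p) (A1 p - A1' p) (A2 p - A2' p) (b p - b' p) (B1 p - B1' p) (B2 p - B2' p)"
 have "(NN p. ind {p : E. R < d p} p * ennreal (?T p))
  <= (NN p. 2 * (ind {p : E. R < d p} p * ennreal (S p)) + 2 * (ind {p : E. R < d p} p * ennreal (S' p)))" proof (rule nn_integral_mono)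
  fix p
  have "?T p
    <= norm (grad d p) * (2 * radiation_defect (grad d p) (\<beta> l) (a p) (A1 p) (A2 p) (b p) (B1 p) (B2 p) + 2 * radiation_defect (grad d p) (\<beta> l) (a' p) (A1' p) (A2' p) (b' p) (B1' p) (B2' p))"
   by (intro mult_left_mono radiation_defect_diff) simp
  also have "... = 2 * S p + 2 * S' p" by (simp add: S_def S'_def distrib_left)
  finally have "ennreal (?T p)
    <= ennreal (2 * S p + 2 * S' p)" by (rule ennreal_leI)
  also have "... = 2 * ennreal (S p) + 2 * ennreal (S' p)" using S0[of p] by (simp add: ennreal_plus ennreal_mult)
  finally show "ind {p : E. R < d p} p * ennreal (?T p)
    <= 2 * (ind {p : E. R < d p} p * ennreal (S p)) + 2 * (ind {p : E. R < d p} p * ennreal (S' p))" by (cases "p : {p : E. R < d p}") auto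
 qed
 also have "... = 2 * (NN p. ind {p : E. R < d p} p * ennreal (S p)) + 2 * (NN p. ind {p : E. R < d p} p * ennreal (S' p))" by (subst nn_integral_add) (auto simp: nn_integral_cmult)
 also have "... < \<infinity>" using fu fw by (simp add: S_def S'_def ennreal_mult_less_top)
 finally have fin: "(NN p. ind {p : E. R < d p} p * ennreal (?T p)) < \<infinity>" .
 show ?thesis proof (rule that)
  show "L2l (%p. a p - a' p)" "L2l (%p. b p - b' p)" using wd by (auto simp: wgrad_def)
  show "AE p in lborel. component u l p - component w l p = Complex (a p - a' p) (b p - b' p)" using eu ew by eventually_elim (simp add: complex_eq_iff)
  show "L2 (%p. a p - a' p) & L2 (%p. b p - b' p)" if "vweak V0 (%p. a p - a' p)" "vweak V0 (%p. b p - b' p)"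
   using outgoing_L2[OF wd(1) that(1) wd(2) that(2) V0 \<beta>_pos[OF l] E Ed R(1) fin] by blast
 qed
qed

text \<open>For l >= 1 the component is a mode part of the difference and
  \<open>mode_part_vweak\<close> applies; the component with index 0 is the difference minus these
  finitely many solutions.\<close>

lemma modes_vweak:
 assumes V0: "V0 : Borel" "!!x. abs (V0 x) <= BV" "AE x in lborel. V0 x = k^2 * (n x)^2"
  and de: "L2l de" "expint de" "vweak V0 de" and a: "!!l. l <= M ==> L2l (a l)"
  and mode: "!!l. l : {1..M} ==> AE p in lborel. a l p = mode_part (e l) de p"
  and sum: "AE p in lborel. de p = (\<Sum>l = 0..M. a l p)" and l: "l <= M"
 shows "vweak V0 (a l)"
proof -
 have am: "a l : Borel" if "l <= M" for l using a[OF that] by (simp add: L2l_def)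
 have dem: "de : Borel" using de(1) by (simp add: L2l_def)
 have pos: "vweak V0 (a l)" if l: "l : {1..M}" for l proof -
  have lM: "l <= M" using l by simp
  obtain C c where bs: "bound_state V0 (e l) BV C c ((\<beta> l)^2)" by (rule guided_mode_bound_state[OF l V0])
  interpret mode: bound_state V0 "e l" BV C c "(\<beta> l)^2" by (rule bs)
  have m: "mode_part (e l) de : Borel" by (rule mode.mode_part_measurable[OF dem])
  have AE: "AE p in lborel. mode_part (e l) de p = a l p" using mode[OF l] by eventually_elim simp
  have "vweak V0 (mode_part (e l) de)" by (rule mode.mode_part_vweak[OF de(2,3) L2l_cong_AE[OF a[OF lM] m AE]])
  then show ?thesis by (rule vweak_cong_AE[OF _ m am[OF lM] V0(1) mode[OF l]])
 qed
 show ?thesis proof (cases "l = 0")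
  case True
  have L: "L2l (%p. \<Sum>l = 1..M. a l p)" by (rule L2l_sum) (use a in auto)
  have v: "vweak V0 (%p. de p - (\<Sum>l = 1..M. a l p))" by (rule vweak_diff[OF de(1,3) L _ V0(1,2)], rule vweak_sum[OF _ _ V0(1,2)]) (use a pos in auto)
  have "AE p in lborel. a 0 p = de p - (\<Sum>l = 1..M. a l p)" using sum by eventually_elim (simp add: sum.atLeast_Suc_atMost)
  then show ?thesis unfolding True by (rule vweak_cong_AE[OF v _ am V0(1), rotated 2]) (use dem L in \<open>auto simp: L2l_def\<close>)
 next
  case False
  then show ?thesis using l by (intro pos) simp
 qed
qed

text \<open>The difference is almost everywhere the finite sum of its square integrable components,
  and the vanishing theorem is applied to that sum.\<close>

lemma vanishing:
 assumes V0: "V0 : Borel" "!!x. abs (V0 x) <= BV"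
  and de: "de : Borel" "vweak V0 de" and a: "!!l. l <= M ==> L2 (a l)"
  and sum: "AE p in lborel. de p = (\<Sum>l = 0..M. a l p)"
 shows "AE p in lborel. de p = 0"
proof -
 define S where "S p = (\<Sum>l = 0..M. a l p)" for p
 have S: "L2 S" unfolding S_def by (rule L2_sum) (use a in auto)
 have Sd: "AE p in lborel. S p = de p" using sum by eventually_elim (simp add: S_def)
 have v: "vweak V0 S" by (rule vweak_cong_AE[OF de(2,1) _ V0(1) Sd]) (use S in \<open>simp add: L2_def\<close>)
 have "AE p in lborel. S p = 0" proof (rule L2_solution_zero[OF S V0])
  fix al al1 al2 \<beta> \<beta>1 \<beta>2 assume "C2c al al1 al2" "C2c \<beta> \<beta>1 \<beta>2"
  from v[unfolded vweak_def, rule_format, OF C2c_plane_prod[OF this]]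
  show "(LBINT p. S p * (al2 (fst p) * \<beta> (snd p) + al (fst p) * \<beta>2 (snd p) + V0 (fst p) * al (fst p) * \<beta> (snd p))) = 0" by (simp add: mult.assoc)
 qed
 with Sd show ?thesis by eventually_elim simp
qed

text \<open>The real and imaginary parts of u - w are treated separately, since the vanishing
  theorem concerns real functions, but they meet in each component: the flux in the radiation
  condition couples them.\<close>

lemma radiating_solution_unique:
 assumes s: "s < 0" and well: "convex_well d p0"
  and u: "u : L2_weighted s" "weak_solution f u" "radiation_condition d u"
  and w: "w : L2_weighted s" "weak_solution f w" "radiation_condition d w"
 shows "AE p in lebesgue. u p = w p"
proof -
 obtain V0 where V0: "V0 : Borel" "!!x. abs (V0 x) <= k^2 * n_max^2" "AE x in lborel. V0 x = k^2 * (n x)^2" by (rule potential_Borel_version) blast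
 obtain ur ui where ur: "L2l ur" and ui: "L2l ui" and eu: "AE p in lborel. u p = Complex (ur p) (ui p)"
  and sur: "!!ps D D1 D2. C2c_plane ps D D1 D2 ==> (LBINT p. ur p * schr V0 ps D1 D2 p) = Re (LINT p|lebesgue. f p * of_real (ps p))"
  and sui: "!!ps D D1 D2. C2c_plane ps D D1 D2 ==> (LBINT p. ui p * schr V0 ps D1 D2 p) = Im (LINT p|lebesgue. f p * of_real (ps p))" by (rule weak_solution_real_parts[OF u(2) V0]) blast
 obtain wr wi where wr: "L2l wr" and wi: "L2l wi" and ew: "AE p in lborel. w p = Complex (wr p) (wi p)"
  and swr: "!!ps D D1 D2. C2c_plane ps D D1 D2 ==> (LBINT p. wr p * schr V0 ps D1 D2 p) = Re (LINT p|lebesgue. f p * of_real (ps p))"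
  and swi: "!!ps D D1 D2. C2c_plane ps D D1 D2 ==> (LBINT p. wi p * schr V0 ps D1 D2 p) = Im (LINT p|lebesgue. f p * of_real (ps p))" by (rule weak_solution_real_parts[OF w(2) V0]) blast
 have cb: "abs x <= cmod (Complex x y)" "abs y <= cmod (Complex x y)" for x y using abs_Re_le_cmod[of "Complex x y"] abs_Im_le_cmod[of "Complex x y"] by simp_all
 have ex: "expint ur" "expint ui" by (rule L2_weighted_imp_expint[OF u(1) s], use ur ui in \<open>simp add: L2l_def\<close>, use eu in eventually_elim, simp add: cb)+
 have ex': "expint wr" "expint wi" by (rule L2_weighted_imp_expint[OF w(1) s], use wr wi in \<open>simp add: L2l_def\<close>, use ew in eventually_elim, simp add: cb)+
 define der dei where "der p = ur p - wr p" and "dei p = ui p - wi p" for p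
 have L: "L2l der" "L2l dei" unfolding der_def[abs_def] dei_def[abs_def] by (intro L2l_diff ur ui wr wi)+
 have X: "expint der" "expint dei" unfolding der_def[abs_def] dei_def[abs_def] by (intro expint_diff ex ex')+
 have v: "vweak V0 der" "vweak V0 dei" proof -
  have "(LBINT p. (x p - y p) * schr V0 ps D1 D2 p) =
    (LBINT p. x p * schr V0 ps D1 D2 p) - (LBINT p. y p * schr V0 ps D1 D2 p)"
   if "C2c_plane ps D D1 D2" "L2l x" "L2l y" for x y ps D D1 D2 unfolding left_diff_distrib
   by (rule lint_diff[OF vweak_integrable[OF that(2) V0(1,2) that(1)] vweak_integrable[OF that(3) V0(1,2) that(1)]])
  then show "vweak V0 der" "vweak V0 dei" unfolding vweak_def der_def dei_def using ur ui wr wi sur sui swr swi by simp_all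
 qed
 \<comment> \<open>Packaged as one predicate so that a choice over l yields families of Borel
   versions that can be summed.\<close>
 define Q where "Q l a b \<longleftrightarrow> L2l a & L2l b & (AE p in lborel. component u l p - component w l p = Complex (a p) (b p)) &
   (vweak V0 a --> vweak V0 b --> L2 a & L2 b)" for l a b
 have "ALL l. EX a b. l <= M --> Q l a b" proof
  fix l
  show "EX a b. l <= M --> Q l a b" proof (cases "l <= M")
   case True
   show ?thesis by (rule component_outgoing[OF well u(3) w(3) True V0(1,2)]) (unfold Q_def, blast)
  qed simp
 qed
 then obtain a b where "ALL l. l <= M --> Q l (a l) (b l)" by metis
 then have ab: "!!l. l <= M ==> L2l (a l)" "!!l. l <= M ==> L2l (b l)"
  "!!l. l <= M ==> AE p in lborel. component u l p - component w l p = Complex (a l p) (b l p)"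
  "!!l. l <= M ==> vweak V0 (a l) ==> vweak V0 (b l) ==> L2 (a l) & L2 (b l)" unfolding Q_def by blast+
 have modes: "AE p in lborel. a l p = mode_part (e l) der p" "AE p in lborel. b l p = mode_part (e l) dei p" if l: "l : {1..M}" for l proof -
  obtain C c where bs: "bound_state V0 (e l) (k^2 * n_max^2) C c ((\<beta> l)^2)" by (rule guided_mode_bound_state[OF l V0])
  interpret mode: bound_state V0 "e l" "k^2 * n_max^2" C c "(\<beta> l)^2" by (rule bs)
  have lM: "l <= M" using l by simp
  note cu = component_version[OF bs l eu ex] and cw = component_version[OF bs l ew ex']
  show "AE p in lborel. a l p = mode_part (e l) der p" using cu cw ab(3)[OF lM] mode.mode_part_diff[OF ex(1) ex'(1)] by eventually_elim (simp add: complex_eq_iff der_def[abs_def])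
  show "AE p in lborel. b l p = mode_part (e l) dei p" using cu cw ab(3)[OF lM] mode.mode_part_diff[OF ex(2) ex'(2)] by eventually_elim (simp add: complex_eq_iff dei_def[abs_def])
 qed
 \<comment> \<open>The component with index 0 is by definition what the guided ones leave
   over.\<close>
 have tot: "(\<Sum>l = 0..M. component y l p) = y p" for y p by (simp add: sum.atLeast_Suc_atMost component_def)
 have "AE p in lborel. ALL l:{0..M}. component u l p - component w l p = Complex (a l p) (b l p)" by (rule AE_finite_allI) (use ab(3) in auto)
 then have sums: "AE p in lborel. der p = (\<Sum>l = 0..M. a l p) & dei p = (\<Sum>l = 0..M. b l p)" using eu ew proof eventually_elim
  case (elim p)
  have "u p - w p = (\<Sum>l = 0..M. component u l p - component w l p)" unfolding sum_subtractf tot ..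
  also have "... = (\<Sum>l = 0..M. Complex (a l p) (b l p))" by (rule sum.cong) (use elim in auto)
  finally show ?case using elim(2,3) by (simp add: complex_eq_iff der_def dei_def)
 qed
 have sr: "AE p in lborel. der p = (\<Sum>l = 0..M. a l p)" and si: "AE p in lborel. dei p = (\<Sum>l = 0..M. b l p)" using sums by (eventually_elim, simp)+
 have va: "vweak V0 (a l)" "vweak V0 (b l)" if "l <= M" for l by (rule modes_vweak[OF V0 L(1) X(1) v(1) ab(1) modes(1) sr that], assumption+)
   (rule modes_vweak[OF V0 L(2) X(2) v(2) ab(2) modes(2) si that], assumption+)
 have "AE p in lborel. der p = 0" "AE p in lborel. dei p = 0" by (rule vanishing[OF V0(1,2) _ v(1) _ sr], use L in \<open>simp add: L2l_def\<close>, use ab(4) va in blast)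
   (rule vanishing[OF V0(1,2) _ v(2) _ si], use L in \<open>simp add: L2l_def\<close>, use ab(4) va in blast)
 with eu ew have "AE p in lborel. u p = w p" by eventually_elim (simp add: der_def dei_def)
 then show ?thesis by (rule AE_completion)
qed

end

theorem theorem2p3:
  fixes k h n_cl s :: real and n_co :: "real \<Rightarrow> real"
    and f u w :: "real \<times> real \<Rightarrow> complex" and d :: "real \<times> real \<Rightarrow> real"
  assumes "waveguide k h n_cl n_co"
    and "s < -1"
    and "convex_on UNIV d"
    and "filterlim d at_top at_infinity"
    and "u \<in> L2_weighted s" and "waveguide.weak_solution k h n_cl n_co f u"
    and "waveguide.radiation_condition k h n_cl n_co d u"
    and "w \<in> L2_weighted s" and "waveguide.weak_solution k h n_cl n_co f w"
    and "waveguide.radiation_condition k h n_cl n_co d w"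
  shows "AE p in lebesgue. u p = w p"
proof -
 obtain p0 where "convex_well d p0" using convex_well_exists[OF assms(3,4)] by blast
 then show ?thesis using waveguide.radiating_solution_unique[OF assms(1), of s d p0 u f w] assms by simp
qed

end
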